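(* Let $k$ be a commutative associative ring with unit, and let $A$ be a dg $k$-algebra such that: a) $H^pA=0$ for $p<0$; b) $H^0A$ is a semi-simple $k$-algebra; and c) each $H^pA$, $p\in\mathbb{Z}$, is a finitely generated $H^0A$-module. Then the perfect derived category $\mathrm{per}\,A$ admits a bounded $t$-structure whose left (resp. right) aisle is the smallest full subcategory containing $A$ and closed under extensions, positive (resp. negative) shifts and direct summands. Its heart is a length category whose simple objects are the indecomposable direct summands of $A$ in $\mathrm{per}\,A$.
   Context: $\mathcal{D}A$ is the unbounded derived category of (right) dg $A$-modules with shift functor $\Sigma$, and $\mathrm{per}\,A$ is the smallest full subcategory of $\mathcal{D}A$ containing $A$ and closed under extensions, shifts and direct summands. Positive (resp. negative) shifts are the functors $\Sigma^n$ with $n>0$ (resp. $n<0$). A $t$-structure on a triangulated category $\mathcal{D}$ is a pair $(\mathcal{D}^{\leq 0},\mathcal{D}^{\geq 0})$ of strictly full additive subcategories such that $\mathcal{D}^{\leq 0}$ is closed under $\Sigma$ and $\mathcal{D}^{\geq 0}$ under $\Sigma^{-1}$; $\mathrm{Hom}(M,\Sigma^{-1}N)=0$ for $M\in\mathcal{D}^{\leq 0}$, $N\in\mathcal{D}^{\geq 0}$; and each $M\in\mathcal{D}$ fits into a triangle $M^{\leq 0}\to M\to M^{\geq 1}\to\Sigma M^{\leq 0}$ with $M^{\leq 0}\in\mathcal{D}^{\leq 0}$ and $\Sigma(M^{\geq 1})\in\mathcal{D}^{\geq 0}$. Its left aisle is $\mathcal{D}^{\leq 0}$, its right aisle is $\mathcal{D}^{\geq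 0}$, and its heart is $\mathcal{D}^{\leq 0}\cap\mathcal{D}^{\geq 0}$ (an abelian category). It is bounded if $\bigcup_{n\in\mathbb{Z}}\Sigma^n\mathcal{D}^{\leq 0}=\mathcal{D}=\bigcup_{n\in\mathbb{Z}}\Sigma^n\mathcal{D}^{\geq 0}$. A length category is an abelian category where each object has finite length. *)

theory Defs
  imports "HOL-Algebra.QuotRing" "HOL-Algebra.Module" "HOL-Algebra.Elementary_Groups"
begin

section \<open>Dg algebras and dg modules\<close>

text \<open>
  Graded objects are families of modules indexed by the integers.  The components are records of
  HOL-Algebra's type \<^typ>\<open>('k, 'm) module\<close>; the multiplicative ring fields that this record type
  inherits play no role.  Values of maps outside the carriers play no role either: all notions
  below only look at carriers.
\<close>

record ('k, 'm) cpx =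
  cgr :: "int \<Rightarrow> ('k, 'm) module"
  cdiff :: "int \<Rightarrow> 'm \<Rightarrow> 'm"

record ('k, 'a) dga = "('k, 'a) cpx" +
  gmul :: "int \<Rightarrow> int \<Rightarrow> 'a \<Rightarrow> 'a \<Rightarrow> 'a"
  gone :: 'a

record ('k, 'a, 'm) dgm = "('k, 'm) cpx" +
  gact :: "int \<Rightarrow> int \<Rightarrow> 'm \<Rightarrow> 'a \<Rightarrow> 'm"

abbreviation cel :: "('k, 'm, 'z) cpx_scheme \<Rightarrow> int \<Rightarrow> 'm set" where
  "cel X p \<equiv> carrier (cgr X p)"

definition linear_map ::
    "'k ring \<Rightarrow> ('k, 'm) module \<Rightarrow> ('k, 'n) module \<Rightarrow> ('m \<Rightarrow> 'n) \<Rightarrow> bool" where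
  "linear_map k M N f \<longleftrightarrow>
     f \<in> carrier M \<rightarrow> carrier N \<and>
     (\<forall>x\<in>carrier M. \<forall>y\<in>carrier M. f (x \<oplus>\<^bsub>M\<^esub> y) = f x \<oplus>\<^bsub>N\<^esub> f y) \<and>
     (\<forall>c\<in>carrier k. \<forall>x\<in>carrier M. f (c \<odot>\<^bsub>M\<^esub> x) = c \<odot>\<^bsub>N\<^esub> f x)"

definition koszul_sign :: "int \<Rightarrow> ('k, 'm) module \<Rightarrow> 'm \<Rightarrow> 'm" where
  "koszul_sign p M x = (if even p then x else \<ominus>\<^bsub>M\<^esub> x)"

definition cochain_complex :: "'k ring \<Rightarrow> ('k, 'm, 'z) cpx_scheme \<Rightarrow> bool" where
  "cochain_complex k X \<longleftrightarrow>
     (\<forall>p. module k (cgr X p)) \<and>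
     (\<forall>p. linear_map k (cgr X p) (cgr X (p + 1)) (cdiff X p)) \<and>
     (\<forall>p. \<forall>x\<in>cel X p. cdiff X (p + 1) (cdiff X p x) = \<zero>\<^bsub>cgr X (p + 2)\<^esub>)"

definition dg_algebra :: "'k ring \<Rightarrow> ('k, 'a) dga \<Rightarrow> bool" where
  "dg_algebra k A \<longleftrightarrow>
     cochain_complex k A \<and>
     (\<forall>p q. \<forall>x\<in>cel A p. linear_map k (cgr A q) (cgr A (p + q)) (gmul A p q x)) \<and>
     (\<forall>p q. \<forall>y\<in>cel A q. linear_map k (cgr A p) (cgr A (p + q)) (\<lambda>x. gmul A p q x y)) \<and>
     (\<forall>p q r. \<forall>x\<in>cel A p. \<forall>y\<in>cel A q. \<forall>z\<in>cel A r.
        gmul A (p + q) r (gmul A p q x y) z = gmul A p (q + r) x (gmul A q r y z)) \<and>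
     gone A \<in> cel A 0 \<and>
     (\<forall>p. \<forall>x\<in>cel A p. gmul A 0 p (gone A) x = x \<and> gmul A p 0 x (gone A) = x) \<and>
     (\<forall>p q. \<forall>x\<in>cel A p. \<forall>y\<in>cel A q.
        cdiff A (p + q) (gmul A p q x y) =
          gmul A (p + 1) q (cdiff A p x) y
          \<oplus>\<^bsub>cgr A (p + q + 1)\<^esub>
          koszul_sign p (cgr A (p + q + 1)) (gmul A p (q + 1) x (cdiff A q y)))"

text \<open>Right dg modules.\<close>

definition dg_module :: "'k ring \<Rightarrow> ('k, 'a) dga \<Rightarrow> ('k, 'a, 'm) dgm \<Rightarrow> bool" where
  "dg_module k A M \<longleftrightarrow>
     cochain_complex k M \<and>
     (\<forall>p q. \<forall>x\<in>cel M p. linear_map k (cgr A q) (cgr M (p + q)) (gact M p q x)) \<and>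
     (\<forall>p q. \<forall>a\<in>cel A q. linear_map k (cgr M p) (cgr M (p + q)) (\<lambda>x. gact M p q x a)) \<and>
     (\<forall>p q r. \<forall>x\<in>cel M p. \<forall>a\<in>cel A q. \<forall>b\<in>cel A r.
        gact M (p + q) r (gact M p q x a) b = gact M p (q + r) x (gmul A q r a b)) \<and>
     (\<forall>p. \<forall>x\<in>cel M p. gact M p 0 x (gone A) = x) \<and>
     (\<forall>p q. \<forall>x\<in>cel M p. \<forall>a\<in>cel A q.
        cdiff M (p + q) (gact M p q x a) =
          gact M (p + 1) q (cdiff M p x) a
          \<oplus>\<^bsub>cgr M (p + q + 1)\<^esub>
          koszul_sign p (cgr M (p + q + 1)) (gact M p (q + 1) x (cdiff A q a)))"

text \<open>
  The free module of rank one, with its elements renamed along an injection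
  \<open>e\<close> into the type in which the elements of dg modules live.
\<close>

definition regular_dgm :: "('a \<Rightarrow> 'm) \<Rightarrow> ('k, 'a) dga \<Rightarrow> ('k, 'a, 'm) dgm" where
  "regular_dgm e A =
     \<lparr>cgr = (\<lambda>p. \<lparr>carrier = e ` cel A p,
                  monoid.mult = undefined, one = undefined,
                  zero = e \<zero>\<^bsub>cgr A p\<^esub>,
                  add = (\<lambda>x y. e (the_inv e x \<oplus>\<^bsub>cgr A p\<^esub> the_inv e y)),
                  smult = (\<lambda>c x. e (c \<odot>\<^bsub>cgr A p\<^esub> the_inv e x))\<rparr>),
      cdiff = (\<lambda>p x. e (cdiff A p (the_inv e x))),
      gact = (\<lambda>p q x a. e (gmul A p q (the_inv e x) a))\<rparr>"

text \<open>
  With \<open>(\<Sigma>\<^sup>n M)\<^sup>p = M\<^sup>p\<^sup>+\<^sup>n\<close> and differential \<open>(-1)\<^sup>n d\<close>, a right action needs no sign.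
\<close>

definition dg_shift :: "int \<Rightarrow> ('k, 'a, 'm) dgm \<Rightarrow> ('k, 'a, 'm) dgm" where
  "dg_shift n M =
     \<lparr>cgr = (\<lambda>p. cgr M (p + n)),
      cdiff = (\<lambda>p x. koszul_sign n (cgr M (p + n + 1)) (cdiff M (p + n) x)),
      gact = (\<lambda>p q. gact M (p + n) q)\<rparr>"


section \<open>Cohomology\<close>

definition cocycles :: "('k, 'm, 'z) cpx_scheme \<Rightarrow> int \<Rightarrow> 'm set" where
  "cocycles X p = {x \<in> cel X p. cdiff X p x = \<zero>\<^bsub>cgr X (p + 1)\<^esub>}"

definition coboundaries :: "('k, 'm, 'z) cpx_scheme \<Rightarrow> int \<Rightarrow> 'm set" where
  "coboundaries X p = cdiff X (p - 1) ` cel X (p - 1)"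

definition cohomology :: "('k, 'm, 'z) cpx_scheme \<Rightarrow> int \<Rightarrow> 'm set monoid" where
  "cohomology X p = ((cgr X p)\<lparr>carrier := cocycles X p\<rparr>) A_Mod (coboundaries X p)"

definition H0_ring :: "('k, 'a) dga \<Rightarrow> 'a set ring" where
  "H0_ring A =
     \<lparr>carrier = cocycles A 0, monoid.mult = gmul A 0 0, one = gone A,
      zero = \<zero>\<^bsub>cgr A 0\<^esub>, add = add (cgr A 0)\<rparr> Quot (coboundaries A 0)"

text \<open>The right action of \<open>H\<^sup>0A\<close> on \<open>H\<^sup>pA\<close>, in the style of \<^const>\<open>rcoset_mult\<close>.\<close>

definition H0_act :: "('k, 'a) dga \<Rightarrow> int \<Rightarrow> 'a set \<Rightarrow> 'a set \<Rightarrow> 'a set" where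
  "H0_act A p X a =
     (\<Union>x\<in>X. \<Union>y\<in>a. coboundaries A p +>\<^bsub>cgr A p\<^esub> (gmul A p 0 x y))"

text \<open>
  Finite generation of an abelian group \<open>G\<close> (written multiplicatively) with a right action of
  a not necessarily commutative ring \<open>R\<close>.
\<close>

definition fin_gen_right_module ::
    "('r, 'y) ring_scheme \<Rightarrow> ('g, 'z) monoid_scheme \<Rightarrow> ('g \<Rightarrow> 'r \<Rightarrow> 'g) \<Rightarrow> bool" where
  "fin_gen_right_module R G act \<longleftrightarrow>
     (\<exists>S. finite S \<and> S \<subseteq> carrier G \<and>
        (\<forall>W. subgroup W G \<and> (\<forall>x\<in>W. \<forall>r\<in>carrier R. act x r \<in> W) \<and> S \<subseteq> W \<longrightarrow> W = carrier G))"

definition right_ideal :: "('r, 'y) ring_scheme \<Rightarrow> 'r set \<Rightarrow> bool" where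
  "right_ideal R I \<longleftrightarrow> additive_subgroup I R \<and> (\<forall>x\<in>I. \<forall>r\<in>carrier R. x \<otimes>\<^bsub>R\<^esub> r \<in> I)"

definition minimal_right_ideal :: "('r, 'y) ring_scheme \<Rightarrow> 'r set \<Rightarrow> bool" where
  "minimal_right_ideal R I \<longleftrightarrow>
     right_ideal R I \<and> I \<noteq> {\<zero>\<^bsub>R\<^esub>} \<and>
     (\<forall>J. right_ideal R J \<and> J \<subseteq> I \<longrightarrow> J = {\<zero>\<^bsub>R\<^esub>} \<or> J = I)"

text \<open>
  The right regular module is a direct sum of simple modules; the sum is necessarily finite as
  \<open>R\<close> has a unit.  The zero ring is semisimple.
\<close>

definition semisimple_ring :: "('r, 'y) ring_scheme \<Rightarrow> bool" where
  "semisimple_ring R \<longleftrightarrow>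
     ring R \<and>
     (\<exists>(n::nat) I. (\<forall>i<n. minimal_right_ideal R (I i)) \<and>
        bij_betw (\<lambda>x. finsum R x {..<n}) (Pi\<^sub>E {..<n} I) (carrier R))"


section \<open>Morphisms of dg modules\<close>

definition graded_hom :: "'k ring \<Rightarrow> ('k, 'a) dga \<Rightarrow> int \<Rightarrow>
    ('k, 'a, 'm) dgm \<Rightarrow> ('k, 'a, 'm) dgm \<Rightarrow> (int \<Rightarrow> 'm \<Rightarrow> 'm) \<Rightarrow> bool" where
  "graded_hom k A n M N f \<longleftrightarrow>
     (\<forall>p. linear_map k (cgr M p) (cgr N (p + n)) (f p)) \<and>
     (\<forall>p q. \<forall>x\<in>cel M p. \<forall>a\<in>cel A q.
        f (p + q) (gact M p q x a) = gact N (p + n) q (f p x) a)"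

definition dg_hom :: "'k ring \<Rightarrow> ('k, 'a) dga \<Rightarrow>
    ('k, 'a, 'm) dgm \<Rightarrow> ('k, 'a, 'm) dgm \<Rightarrow> (int \<Rightarrow> 'm \<Rightarrow> 'm) \<Rightarrow> bool" where
  "dg_hom k A M N f \<longleftrightarrow>
     graded_hom k A 0 M N f \<and>
     (\<forall>p. \<forall>x\<in>cel M p. f (p + 1) (cdiff M p x) = cdiff N p (f p x))"

definition homotopic :: "'k ring \<Rightarrow> ('k, 'a) dga \<Rightarrow> ('k, 'a, 'm) dgm \<Rightarrow> ('k, 'a, 'm) dgm \<Rightarrow>
    (int \<Rightarrow> 'm \<Rightarrow> 'm) \<Rightarrow> (int \<Rightarrow> 'm \<Rightarrow> 'm) \<Rightarrow> bool" where
  "homotopic k A M N f g \<longleftrightarrow>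
     (\<exists>h. graded_hom k A (-1) M N h \<and>
        (\<forall>p. \<forall>x\<in>cel M p.
           f p x \<ominus>\<^bsub>cgr N p\<^esub> g p x =
             cdiff N (p - 1) (h p x) \<oplus>\<^bsub>cgr N p\<^esub> h (p + 1) (cdiff M p x)))"

definition quasi_iso :: "'k ring \<Rightarrow> ('k, 'a) dga \<Rightarrow>
    ('k, 'a, 'm) dgm \<Rightarrow> ('k, 'a, 'm) dgm \<Rightarrow> (int \<Rightarrow> 'm \<Rightarrow> 'm) \<Rightarrow> bool" where
  "quasi_iso k A M N f \<longleftrightarrow>
     dg_hom k A M N f \<and>
     (\<forall>p. bij_betw (\<lambda>X. \<Union>x\<in>X. coboundaries N p +>\<^bsub>cgr N p\<^esub> (f p x))
            (carrier (cohomology M p)) (carrier (cohomology N p)))"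

definition gcomp :: "(int \<Rightarrow> 'm \<Rightarrow> 'm) \<Rightarrow> (int \<Rightarrow> 'm \<Rightarrow> 'm) \<Rightarrow> (int \<Rightarrow> 'm \<Rightarrow> 'm)" where
  "gcomp g f = (\<lambda>p. g p \<circ> f p)"

text \<open>
  \<open>M \<rightarrow> N \<rightarrow> C \<rightarrow> \<Sigma>M\<close> is the strict triangle on the mapping cone of \<open>f\<close>.  As types are not closed
  under pairing, \<open>C\<close> is described up to isomorphism: \<open>j\<close> is the inclusion of the graded summand
  \<open>\<Sigma>M\<close>, the pair \<open>(y, x)\<close> in \<open>N\<^sup>p \<oplus> M\<^sup>p\<^sup>+\<^sup>1\<close> being \<open>i y + j x\<close>, with \<open>d (y, x) = (d y + f x, - d x)\<close>.
\<close>

definition cone_triangle :: "'k ring \<Rightarrow> ('k, 'a) dga \<Rightarrow>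
    ('k, 'a, 'm) dgm \<Rightarrow> ('k, 'a, 'm) dgm \<Rightarrow> ('k, 'a, 'm) dgm \<Rightarrow>
    (int \<Rightarrow> 'm \<Rightarrow> 'm) \<Rightarrow> (int \<Rightarrow> 'm \<Rightarrow> 'm) \<Rightarrow> (int \<Rightarrow> 'm \<Rightarrow> 'm) \<Rightarrow> bool" where
  "cone_triangle k A M N C f i \<pi> \<longleftrightarrow>
     dg_module k A M \<and> dg_module k A N \<and> dg_module k A C \<and>
     dg_hom k A M N f \<and> dg_hom k A N C i \<and> dg_hom k A C (dg_shift 1 M) \<pi> \<and>
     (\<exists>j. graded_hom k A 0 (dg_shift 1 M) C j \<and>
        (\<forall>p. bij_betw (\<lambda>(y, x). i p y \<oplus>\<^bsub>cgr C p\<^esub> j p x) (cel N p \<times> cel M (p + 1)) (cel C p)) \<and>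
        (\<forall>p. \<forall>y\<in>cel N p. \<forall>x\<in>cel M (p + 1). \<pi> p (i p y \<oplus>\<^bsub>cgr C p\<^esub> j p x) = x) \<and>
        (\<forall>p. \<forall>x\<in>cel M (p + 1).
           cdiff C p (j p x) =
             i (p + 1) (f (p + 1) x) \<ominus>\<^bsub>cgr C (p + 1)\<^esub> j (p + 1) (cdiff M (p + 1) x)))"


section \<open>Preadditive categories with shifts and triangles\<close>

record ('o, 'f) precat =
  Obj :: "'o set"
  Hom :: "'o \<Rightarrow> 'o \<Rightarrow> 'f set"
  Cmp :: "'f \<Rightarrow> 'f \<Rightarrow> 'f"  \<comment> \<open>\<open>Cmp C g f\<close> is \<open>g\<close> after \<open>f\<close>\<close>
  Idn :: "'o \<Rightarrow> 'f"
  HAdd :: "'f \<Rightarrow> 'f \<Rightarrow> 'f"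
  HZero :: "'o \<Rightarrow> 'o \<Rightarrow> 'f"

record ('o, 'f) tricat = "('o, 'f) precat" +
  Shift :: "int \<Rightarrow> 'o \<Rightarrow> 'o"
  Tri :: "('o \<times> 'o \<times> 'o \<times> 'f \<times> 'f \<times> 'f) set"

definition full_sub :: "('o, 'f) tricat \<Rightarrow> 'o set \<Rightarrow> ('o, 'f) tricat" where
  "full_sub T S =
     T\<lparr>Obj := S, Tri := {(X, Y, Z, u, v, w) \<in> Tri T. X \<in> S \<and> Y \<in> S \<and> Z \<in> S}\<rparr>"

definition category :: "('o, 'f, 'z) precat_scheme \<Rightarrow> bool" where
  "category C \<longleftrightarrow>
     (\<forall>X\<in>Obj C. Idn C X \<in> Hom C X X) \<and>
     (\<forall>X\<in>Obj C. \<forall>Y\<in>Obj C. \<forall>Z\<in>Obj C. \<forall>f\<in>Hom C X Y. \<forall>g\<in>Hom C Y Z. Cmp C g f \<in> Hom C X Z) \<and>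
     (\<forall>X\<in>Obj C. \<forall>Y\<in>Obj C. \<forall>f\<in>Hom C X Y. Cmp C f (Idn C X) = f \<and> Cmp C (Idn C Y) f = f) \<and>
     (\<forall>W\<in>Obj C. \<forall>X\<in>Obj C. \<forall>Y\<in>Obj C. \<forall>Z\<in>Obj C.
        \<forall>f\<in>Hom C W X. \<forall>g\<in>Hom C X Y. \<forall>h\<in>Hom C Y Z. Cmp C h (Cmp C g f) = Cmp C (Cmp C h g) f)"

definition preadditive :: "('o, 'f, 'z) precat_scheme \<Rightarrow> bool" where
  "preadditive C \<longleftrightarrow>
     category C \<and>
     (\<forall>X\<in>Obj C. \<forall>Y\<in>Obj C.
        comm_group \<lparr>carrier = Hom C X Y, monoid.mult = HAdd C, one = HZero C X Y\<rparr>) \<and>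
     (\<forall>X\<in>Obj C. \<forall>Y\<in>Obj C. \<forall>Z\<in>Obj C. \<forall>f\<in>Hom C X Y. \<forall>f'\<in>Hom C X Y. \<forall>g\<in>Hom C Y Z. \<forall>g'\<in>Hom C Y Z.
        Cmp C g (HAdd C f f') = HAdd C (Cmp C g f) (Cmp C g f') \<and>
        Cmp C (HAdd C g g') f = HAdd C (Cmp C g f) (Cmp C g' f))"

definition is_iso :: "('o, 'f, 'z) precat_scheme \<Rightarrow> 'o \<Rightarrow> 'o \<Rightarrow> 'f \<Rightarrow> bool" where
  "is_iso C X Y f \<longleftrightarrow>
     f \<in> Hom C X Y \<and> (\<exists>g\<in>Hom C Y X. Cmp C g f = Idn C X \<and> Cmp C f g = Idn C Y)"

definition isomorphic :: "('o, 'f, 'z) precat_scheme \<Rightarrow> 'o \<Rightarrow> 'o \<Rightarrow> bool" where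
  "isomorphic C X Y \<longleftrightarrow> X \<in> Obj C \<and> Y \<in> Obj C \<and> (\<exists>f. is_iso C X Y f)"

definition zero_object :: "('o, 'f, 'z) precat_scheme \<Rightarrow> 'o \<Rightarrow> bool" where
  "zero_object C Z \<longleftrightarrow>
     Z \<in> Obj C \<and> (\<forall>X\<in>Obj C. (\<exists>!f. f \<in> Hom C X Z) \<and> (\<exists>!f. f \<in> Hom C Z X))"

definition is_biproduct :: "('o, 'f, 'z) precat_scheme \<Rightarrow> 'o \<Rightarrow> 'o \<Rightarrow> 'o \<Rightarrow> bool" where
  "is_biproduct C X Y P \<longleftrightarrow>
     X \<in> Obj C \<and> Y \<in> Obj C \<and> P \<in> Obj C \<and>
     (\<exists>i1\<in>Hom C X P. \<exists>i2\<in>Hom C Y P. \<exists>p1\<in>Hom C P X. \<exists>p2\<in>Hom C P Y.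
        Cmp C p1 i1 = Idn C X \<and> Cmp C p2 i2 = Idn C Y \<and>
        Cmp C p2 i1 = HZero C X Y \<and> Cmp C p1 i2 = HZero C Y X \<and>
        HAdd C (Cmp C i1 p1) (Cmp C i2 p2) = Idn C P)"

definition direct_summand :: "('o, 'f, 'z) precat_scheme \<Rightarrow> 'o \<Rightarrow> 'o \<Rightarrow> bool" where
  "direct_summand C X Y \<longleftrightarrow> (\<exists>Z. is_biproduct C X Z Y)"

definition indecomposable :: "('o, 'f, 'z) precat_scheme \<Rightarrow> 'o \<Rightarrow> bool" where
  "indecomposable C X \<longleftrightarrow>
     X \<in> Obj C \<and> \<not> zero_object C X \<and>
     (\<forall>Y Z. is_biproduct C Y Z X \<longrightarrow> zero_object C Y \<or> zero_object C Z)"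

definition monic :: "('o, 'f, 'z) precat_scheme \<Rightarrow> 'o \<Rightarrow> 'o \<Rightarrow> 'f \<Rightarrow> bool" where
  "monic C X Y f \<longleftrightarrow>
     f \<in> Hom C X Y \<and>
     (\<forall>W\<in>Obj C. \<forall>g\<in>Hom C W X. \<forall>h\<in>Hom C W X. Cmp C f g = Cmp C f h \<longrightarrow> g = h)"

definition epic :: "('o, 'f, 'z) precat_scheme \<Rightarrow> 'o \<Rightarrow> 'o \<Rightarrow> 'f \<Rightarrow> bool" where
  "epic C X Y f \<longleftrightarrow>
     f \<in> Hom C X Y \<and>
     (\<forall>W\<in>Obj C. \<forall>g\<in>Hom C Y W. \<forall>h\<in>Hom C Y W. Cmp C g f = Cmp C h f \<longrightarrow> g = h)"

text \<open>\<open>i : K \<rightarrow> X\<close> is a kernel, resp. \<open>q : Y \<rightarrow> Q\<close> is a cokernel, of \<open>f : X \<rightarrow> Y\<close>.\<close>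

definition is_kernel ::
    "('o, 'f, 'z) precat_scheme \<Rightarrow> 'o \<Rightarrow> 'o \<Rightarrow> 'f \<Rightarrow> 'o \<Rightarrow> 'f \<Rightarrow> bool" where
  "is_kernel C X Y f K i \<longleftrightarrow>
     K \<in> Obj C \<and> i \<in> Hom C K X \<and> Cmp C f i = HZero C K Y \<and>
     (\<forall>W\<in>Obj C. \<forall>g\<in>Hom C W X. Cmp C f g = HZero C W Y \<longrightarrow>
        (\<exists>!h. h \<in> Hom C W K \<and> Cmp C i h = g))"

definition is_cokernel ::
    "('o, 'f, 'z) precat_scheme \<Rightarrow> 'o \<Rightarrow> 'o \<Rightarrow> 'f \<Rightarrow> 'o \<Rightarrow> 'f \<Rightarrow> bool" where
  "is_cokernel C X Y f Q q \<longleftrightarrow>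
     Q \<in> Obj C \<and> q \<in> Hom C Y Q \<and> Cmp C q f = HZero C X Q \<and>
     (\<forall>W\<in>Obj C. \<forall>g\<in>Hom C Y W. Cmp C g f = HZero C X W \<longrightarrow>
        (\<exists>!h. h \<in> Hom C Q W \<and> Cmp C h q = g))"

definition abelian_category :: "('o, 'f, 'z) precat_scheme \<Rightarrow> bool" where
  "abelian_category C \<longleftrightarrow>
     preadditive C \<and>
     (\<exists>Z. zero_object C Z) \<and>
     (\<forall>X\<in>Obj C. \<forall>Y\<in>Obj C. \<exists>P. is_biproduct C X Y P) \<and>
     (\<forall>X\<in>Obj C. \<forall>Y\<in>Obj C. \<forall>f\<in>Hom C X Y.
        (\<exists>K i. is_kernel C X Y f K i) \<and> (\<exists>Q q. is_cokernel C X Y f Q q)) \<and>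
     (\<forall>X\<in>Obj C. \<forall>Y\<in>Obj C. \<forall>f. monic C X Y f \<longrightarrow>
        (\<exists>Z\<in>Obj C. \<exists>g\<in>Hom C Y Z. is_kernel C Y Z g X f)) \<and>
     (\<forall>X\<in>Obj C. \<forall>Y\<in>Obj C. \<forall>f. epic C X Y f \<longrightarrow>
        (\<exists>W\<in>Obj C. \<exists>g\<in>Hom C W X. is_cokernel C W X g Y f))"

definition simple_object :: "('o, 'f, 'z) precat_scheme \<Rightarrow> 'o \<Rightarrow> bool" where
  "simple_object C S \<longleftrightarrow>
     S \<in> Obj C \<and> \<not> zero_object C S \<and>
     (\<forall>Y\<in>Obj C. \<forall>f. monic C Y S f \<longrightarrow> zero_object C Y \<or> is_iso C Y S f)"

text \<open>Existence of a composition series \<open>0 = Y 0 \<rightarrow> Y 1 \<rightarrow> \<dots> \<rightarrow> Y n = X\<close>.\<close>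

definition finite_length :: "('o, 'f, 'z) precat_scheme \<Rightarrow> 'o \<Rightarrow> bool" where
  "finite_length C X \<longleftrightarrow>
     (\<exists>(n::nat) Y m.
        (\<forall>i\<le>n. Y i \<in> Obj C) \<and> zero_object C (Y 0) \<and> Y n = X \<and>
        (\<forall>i<n. monic C (Y i) (Y (Suc i)) (m i) \<and>
           (\<exists>S q. simple_object C S \<and> is_cokernel C (Y i) (Y (Suc i)) (m i) S q)))"

definition length_category :: "('o, 'f, 'z) precat_scheme \<Rightarrow> bool" where
  "length_category C \<longleftrightarrow> abelian_category C \<and> (\<forall>X\<in>Obj C. finite_length C X)"

text \<open>
  \<open>generated T N G\<close> is the smallest full subcategory containing \<open>G\<close> and closed under
  extensions, the shifts \<open>\<Sigma>\<^sup>n\<close> with \<open>n \<in> N\<close>, and direct summands.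
\<close>

inductive_set generated :: "('o, 'f) tricat \<Rightarrow> int set \<Rightarrow> 'o \<Rightarrow> 'o set"
  for T :: "('o, 'f) tricat" and N :: "int set" and G :: 'o where
  base: "G \<in> generated T N G"
| ext: "\<lbrakk>(X, Y, Z, u, v, w) \<in> Tri T; X \<in> generated T N G; Z \<in> generated T N G\<rbrakk>
    \<Longrightarrow> Y \<in> generated T N G"
| shift: "\<lbrakk>X \<in> generated T N G; n \<in> N\<rbrakk> \<Longrightarrow> Shift T n X \<in> generated T N G"
| summand: "\<lbrakk>Y \<in> generated T N G; direct_summand T X Y\<rbrakk> \<Longrightarrow> X \<in> generated T N G"

definition strictly_full_additive :: "('o, 'f, 'z) precat_scheme \<Rightarrow> 'o set \<Rightarrow> bool" where
  "strictly_full_additive C S \<longleftrightarrow>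
     S \<subseteq> Obj C \<and>
     (\<forall>X\<in>S. \<forall>Y. isomorphic C X Y \<longrightarrow> Y \<in> S) \<and>
     (\<exists>Z\<in>S. zero_object C Z) \<and>
     (\<forall>X\<in>S. \<forall>Y\<in>S. \<exists>P\<in>S. is_biproduct C X Y P)"

definition t_structure :: "('o, 'f) tricat \<Rightarrow> 'o set \<Rightarrow> 'o set \<Rightarrow> bool" where
  "t_structure T U V \<longleftrightarrow>
     strictly_full_additive T U \<and> strictly_full_additive T V \<and>
     (\<forall>X\<in>U. Shift T 1 X \<in> U) \<and> (\<forall>X\<in>V. Shift T (-1) X \<in> V) \<and>
     (\<forall>M\<in>U. \<forall>N\<in>V. Hom T M (Shift T (-1) N) = {HZero T M (Shift T (-1) N)}) \<and>
     (\<forall>M\<in>Obj T. \<exists>L R u v w. (L, M, R, u, v, w) \<in> Tri T \<and> L \<in> U \<and> Shift T 1 R \<in> V)"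

definition shifted :: "('o, 'f) tricat \<Rightarrow> int \<Rightarrow> 'o set \<Rightarrow> 'o set" where
  "shifted T n S = {X. \<exists>Y\<in>S. isomorphic T X (Shift T n Y)}"

definition bounded_t_structure :: "('o, 'f) tricat \<Rightarrow> 'o set \<Rightarrow> 'o set \<Rightarrow> bool" where
  "bounded_t_structure T U V \<longleftrightarrow>
     t_structure T U V \<and> (\<Union>n. shifted T n U) = Obj T \<and> (\<Union>n. shifted T n V) = Obj T"


section \<open>The derived category of a dg algebra\<close>

text \<open>
  Localization of the homotopy category of dg modules at the quasi-isomorphisms by calculus of
  fractions.  A roof is \<open>src \<leftarrow> apex \<rightarrow> tgt\<close> with the quasi-isomorphism \<open>den\<close> pointing left.
\<close>

record ('k, 'a, 'm) roof =
  src :: "('k, 'a, 'm) dgm"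
  apex :: "('k, 'a, 'm) dgm"
  tgt :: "('k, 'a, 'm) dgm"
  den :: "int \<Rightarrow> 'm \<Rightarrow> 'm"
  num :: "int \<Rightarrow> 'm \<Rightarrow> 'm"

definition is_roof :: "'k ring \<Rightarrow> ('k, 'a) dga \<Rightarrow> ('k, 'a, 'm) roof \<Rightarrow> bool" where
  "is_roof k A r \<longleftrightarrow>
     dg_module k A (src r) \<and> dg_module k A (apex r) \<and> dg_module k A (tgt r) \<and>
     quasi_iso k A (apex r) (src r) (den r) \<and> dg_hom k A (apex r) (tgt r) (num r)"

definition roof_rel :: "'k ring \<Rightarrow> ('k, 'a) dga \<Rightarrow> ('k, 'a, 'm) roof rel" where
  "roof_rel k A = {(r, r'). is_roof k A r \<and> is_roof k A r' \<and> src r = src r' \<and> tgt r = tgt r' \<and>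
     (\<exists>Q u v. dg_module k A Q \<and> dg_hom k A Q (apex r) u \<and> dg_hom k A Q (apex r') v \<and>
        quasi_iso k A Q (src r) (gcomp (den r) u) \<and>
        homotopic k A Q (src r) (gcomp (den r) u) (gcomp (den r') v) \<and>
        homotopic k A Q (tgt r) (gcomp (num r) u) (gcomp (num r') v))}"

text \<open>The image of a morphism of dg modules in the derived category.\<close>

definition der_map :: "'k ring \<Rightarrow> ('k, 'a) dga \<Rightarrow> ('k, 'a, 'm) dgm \<Rightarrow> ('k, 'a, 'm) dgm \<Rightarrow>
    (int \<Rightarrow> 'm \<Rightarrow> 'm) \<Rightarrow> ('k, 'a, 'm) roof set" where
  "der_map k A M N f =
     roof_rel k A `` {\<lparr>src = M, apex = M, tgt = N, den = (\<lambda>p x. x), num = f\<rparr>}"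

definition der_hom :: "'k ring \<Rightarrow> ('k, 'a) dga \<Rightarrow>
    ('k, 'a, 'm) dgm \<Rightarrow> ('k, 'a, 'm) dgm \<Rightarrow> ('k, 'a, 'm) roof set set" where
  "der_hom k A M N = {r. is_roof k A r \<and> src r = M \<and> tgt r = N} // roof_rel k A"

text \<open>
  The operations on classes are unions over representatives; each of these unions is a single
  class.  Roofs are composed by completing \<open>apex F \<rightarrow> Y \<leftarrow> apex G\<close> to a square that commutes up to
  homotopy, and added after passing to a common denominator.
\<close>

definition der_cmp :: "'k ring \<Rightarrow> ('k, 'a) dga \<Rightarrow>
    ('k, 'a, 'm) roof set \<Rightarrow> ('k, 'a, 'm) roof set \<Rightarrow> ('k, 'a, 'm) roof set" where
  "der_cmp k A G F =
     roof_rel k A `` {\<lparr>src = src f, apex = Q, tgt = tgt g,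
                       den = gcomp (den f) u, num = gcomp (num g) v\<rparr> | f g Q u v.
       f \<in> F \<and> g \<in> G \<and> tgt f = src g \<and> dg_module k A Q \<and>
       quasi_iso k A Q (apex f) u \<and> dg_hom k A Q (apex g) v \<and>
       homotopic k A Q (tgt f) (gcomp (num f) u) (gcomp (den g) v)}"

definition der_add :: "'k ring \<Rightarrow> ('k, 'a) dga \<Rightarrow>
    ('k, 'a, 'm) roof set \<Rightarrow> ('k, 'a, 'm) roof set \<Rightarrow> ('k, 'a, 'm) roof set" where
  "der_add k A F G =
     roof_rel k A `` {f\<lparr>num := (\<lambda>p x. num f p x \<oplus>\<^bsub>cgr (tgt f) p\<^esub> num g p x)\<rparr> | f g.
       f \<in> F \<and> g \<in> G \<and> src f = src g \<and> tgt f = tgt g \<and> apex f = apex g \<and> den f = den g}"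

text \<open>The functor \<open>\<Sigma>\<close> on morphisms.\<close>

definition der_susp :: "'k ring \<Rightarrow> ('k, 'a) dga \<Rightarrow>
    ('k, 'a, 'm) roof set \<Rightarrow> ('k, 'a, 'm) roof set" where
  "der_susp k A F =
     roof_rel k A `` {\<lparr>src = dg_shift 1 (src f), apex = dg_shift 1 (apex f),
                       tgt = dg_shift 1 (tgt f),
                       den = (\<lambda>p. den f (p + 1)), num = (\<lambda>p. num f (p + 1))\<rparr> | f. f \<in> F}"

definition der_cat :: "'k ring \<Rightarrow> ('k, 'a) dga \<Rightarrow>
    (('k, 'a, 'm) dgm, ('k, 'a, 'm) roof set) precat" where
  "der_cat k A =
     \<lparr>Obj = {M. dg_module k A M},
      Hom = der_hom k A,
      Cmp = der_cmp k A,
      Idn = (\<lambda>M. der_map k A M M (\<lambda>p x. x)),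
      HAdd = der_add k A,
      HZero = (\<lambda>M N. der_map k A M N (\<lambda>p x. \<zero>\<^bsub>cgr N p\<^esub>))\<rparr>"

text \<open>The triangles isomorphic to the triangle of some mapping cone.\<close>

definition der_triangles :: "'k ring \<Rightarrow> ('k, 'a) dga \<Rightarrow>
    (('k, 'a, 'm) dgm \<times> ('k, 'a, 'm) dgm \<times> ('k, 'a, 'm) dgm \<times>
     ('k, 'a, 'm) roof set \<times> ('k, 'a, 'm) roof set \<times> ('k, 'a, 'm) roof set) set" where
  "der_triangles k A = {(X, Y, Z, u, v, w).
     dg_module k A X \<and> dg_module k A Y \<and> dg_module k A Z \<and>
     u \<in> der_hom k A X Y \<and> v \<in> der_hom k A Y Z \<and> w \<in> der_hom k A Z (dg_shift 1 X) \<and>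
     (\<exists>M N C f i \<pi> a b c. cone_triangle k A M N C f i \<pi> \<and>
        is_iso (der_cat k A) X M a \<and> is_iso (der_cat k A) Y N b \<and> is_iso (der_cat k A) Z C c \<and>
        der_cmp k A b u = der_cmp k A (der_map k A M N f) a \<and>
        der_cmp k A c v = der_cmp k A (der_map k A N C i) b \<and>
        der_cmp k A (der_susp k A a) w = der_cmp k A (der_map k A C (dg_shift 1 M) \<pi>) c)}"

definition derived :: "'k ring \<Rightarrow> ('k, 'a) dga \<Rightarrow>
    (('k, 'a, 'm) dgm, ('k, 'a, 'm) roof set) tricat" where
  "derived k A =
     precat.extend (der_cat k A) (tricat.fields dg_shift (der_triangles k A))"

text \<open>
  HOL has no type of all dg modules.  The type \<open>'m\<close> plays the part of the universe:
  the derived category consists of the dg modules with elements in \<open>'m\<close>.  It has to be infinite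
  and receive an injection \<open>e\<close> from the type of \<open>A\<close>; then it has room for mapping cones,
  semi-free resolutions and countable direct sums.
\<close>

definition per :: "'k ring \<Rightarrow> ('k, 'a) dga \<Rightarrow> ('a \<Rightarrow> 'm) \<Rightarrow>
    (('k, 'a, 'm) dgm, ('k, 'a, 'm) roof set) tricat" where
  "per k A e = full_sub (derived k A) (generated (derived k A) UNIV (regular_dgm e A))"

definition left_aisle :: "'k ring \<Rightarrow> ('k, 'a) dga \<Rightarrow> ('a \<Rightarrow> 'm) \<Rightarrow> ('k, 'a, 'm) dgm set" where
  "left_aisle k A e = generated (per k A e) {n. n > 0} (regular_dgm e A)"

definition right_aisle :: "'k ring \<Rightarrow> ('k, 'a) dga \<Rightarrow> ('a \<Rightarrow> 'm) \<Rightarrow> ('k, 'a, 'm) dgm set" where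
  "right_aisle k A e = generated (per k A e) {n. n < 0} (regular_dgm e A)"

definition per_heart :: "'k ring \<Rightarrow> ('k, 'a) dga \<Rightarrow> ('a \<Rightarrow> 'm) \<Rightarrow>
    (('k, 'a, 'm) dgm, ('k, 'a, 'm) roof set) tricat" where
  "per_heart k A e = full_sub (per k A e) (left_aisle k A e \<inter> right_aisle k A e)"

end

theory Submission imports Defs begin

text \<open>
  Split \<open>1 \<in> H\<^sup>0A\<close> into orthogonal idempotents whose corners are division rings. Idempotents split in
  \<open>DA\<close> (as the colimit of the iterates), so \<open>A\<close> becomes a sum of objects \<open>s\<close> with
  \<open>Hom(s, \<Sigma>\<^sup>n s') = 0\<close> for \<open>n < 0\<close> and with every nonzero \<open>s \<rightarrow> s'\<close> an isomorphism. Objects of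
  \<open>per A\<close> are summands of objects filtered by shifts of the \<open>s\<close>; the vanishing lets the filtration be
  sorted by degree, and truncating it gives the t-structure, whose heart consists of the iterated
  extensions of the \<open>s\<close>. The cone of a nonzero map out of a shifted \<open>s\<close> in the extreme degree has a
  shorter filtration, so filtered objects are closed under summands and the \<open>s\<close> are the simple objects.
\<close>

text \<open>Two independent halves meet in the locale \<open>smc\<close>. The abstract half needs
  only the axioms of \<open>tricat0\<close>; the concrete half proves these axioms for dg modules
  and produces the objects s. The obstacle on the concrete side is that all objects must have their
  elements in the one type \<open>'m\<close>. Direct sums, cones and homotopy fibres are therefore
  coded by an injection \<open>pr\<close> of pairs, and an element of a colimit by a chosen stage
  together with a chosen representative. The homotopy category is localised directly by fractions:
  both Ore conditions come from explicit twisted sums with an acyclic part, so no resolutions occur.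
  Maps out of A stay computable, since A is free on the cocycle 1 and Hom(A, N) is therefore H^0 N.
  On the abstract side the obstacle is closure of filtered objects under direct summands without a
  decomposition theorem.\<close>

lemma (in abelian_group) group_simps:
 "\<zero> : carrier G" "x : carrier G ==> \<ominus> x : carrier G" "x : carrier G ==> y : carrier G ==> x \<oplus> y : carrier G"
 "x : carrier G ==> \<zero> \<oplus> x = x" "x : carrier G ==> x \<oplus> \<zero> = x"
 "x : carrier G ==> x \<oplus> \<ominus> x = \<zero>" "x : carrier G ==> \<ominus> x \<oplus> x = \<zero>"
 "x : carrier G ==> y : carrier G ==> x \<oplus> (\<ominus> x \<oplus> y) = y"
 "x : carrier G ==> y : carrier G ==> \<ominus> x \<oplus> (x \<oplus> y) = y"
 "x : carrier G ==> \<ominus> (\<ominus> x) = x" "\<ominus> \<zero> = \<zero>"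
 "x : carrier G ==> y : carrier G ==> \<ominus> (x \<oplus> y) = \<ominus> x \<oplus> \<ominus> y"
 by (simp_all add: l_neg r_neg r_neg1 r_neg2 minus_add)

lemma (in abelian_group) neg_unique:
 assumes "x : carrier G" "y : carrier G" "x \<oplus> y = \<zero>" shows "y = \<ominus> x" "x = \<ominus> y"
 using assms minus_equality a_comm by metis+

lemma (in abelian_group) add_cancel:
 assumes "x : carrier G" "y : carrier G" "z : carrier G"
 shows "(x \<oplus> y = x \<oplus> z) = (y = z)" "(y \<oplus> x = z \<oplus> x) = (y = z)"
 using assms by simp_all

text \<open>\<open>pr\<close> codes a pair of elements of \<open>'m\<close> by one element. It is
  the only means by which new dg modules with elements in \<open>'m\<close> can be formed from two
  given ones.\<close>

locale dgc =
 fixes k :: "'k ring" and A :: "('k, 'a) dga" and pr :: "'m \<times> 'm => 'm"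
 assumes k_cring: "cring k" and A_dga: "dg_algebra k A" and inj_pr: "inj pr"
begin

abbreviation DG :: "('k, 'a, 'm) dgm => bool" where "DG M \<equiv> dg_module k A M"
abbreviation gh where "gh n M N f \<equiv> graded_hom k A n (M :: ('k, 'a, 'm) dgm) N f"
abbreviation hom where "hom M N f \<equiv> dg_hom k A (M :: ('k, 'a, 'm) dgm) N f"
abbreviation heq where "heq M N f g \<equiv> homotopic k A (M :: ('k, 'a, 'm) dgm) N f g"
abbreviation qis where "qis M N f \<equiv> quasi_iso k A (M :: ('k, 'a, 'm) dgm) N f"
abbreviation dhom where "dhom \<equiv> der_hom k A"
abbreviation dcmp where "dcmp \<equiv> der_cmp k A"
abbreviation dadd where "dadd \<equiv> der_add k A"
abbreviation pls where "pls M p x y \<equiv> x \<oplus>\<^bsub>cgr (M :: ('k, 'a, 'm) dgm) p\<^esub> y"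
abbreviation ngt where "ngt M p x \<equiv> \<ominus>\<^bsub>cgr (M :: ('k, 'a, 'm) dgm) p\<^esub> x"
abbreviation sml where "sml M p c x \<equiv> c \<odot>\<^bsub>cgr M p\<^esub> x"
abbreviation apl where "apl p a b \<equiv> a \<oplus>\<^bsub>cgr A p\<^esub> b"
abbreviation zr where "zr M p \<equiv> \<zero>\<^bsub>cgr (M :: ('k, 'a, 'm) dgm) p\<^esub>"

lemma DG_module: "DG M ==> module k (cgr M p)"
 by (simp add: dg_module_def cochain_complex_def)

lemma DG_ab: "DG M ==> abelian_group (cgr M p)"
 by (rule module.axioms(2)[OF DG_module])

lemmas DG_group_simps [simp] = abelian_group.group_simps[OF DG_ab]
lemmas DG_ac = abelian_monoid.a_comm[OF abelian_group.axioms(1)[OF DG_ab]]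
 abelian_monoid.a_assoc[OF abelian_group.axioms(1)[OF DG_ab]] abelian_monoid.a_lcomm[OF abelian_group.axioms(1)[OF DG_ab]]
lemmas DG_neg_unique = abelian_group.neg_unique[OF DG_ab]
lemmas DG_cancel = abelian_group.add_cancel[OF DG_ab]

lemma DG_smult [simp]: "DG M ==> c : carrier k ==> x : cel M p ==> sml M p c x : cel M p"
 by (rule module.smult_closed[OF DG_module])

lemma linear_mapD:
 assumes "linear_map k M N f"
 shows "x : carrier M ==> f x : carrier N"
  and "x : carrier M ==> y : carrier M ==> f (x \<oplus>\<^bsub>M\<^esub> y) = f x \<oplus>\<^bsub>N\<^esub> f y"
  and "c : carrier k ==> x : carrier M ==> f (c \<odot>\<^bsub>M\<^esub> x) = c \<odot>\<^bsub>N\<^esub> f x"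
 using assms by (auto simp: linear_map_def)

lemma DG_linear:
 assumes "DG M"
 shows "linear_map k (cgr M p) (cgr M (p+1)) (cdiff M p)"
  and "x : cel M p ==> linear_map k (cgr A q) (cgr M (p + q)) (gact M p q x)"
  and "a : cel A q ==> linear_map k (cgr M p) (cgr M (p + q)) (%x. gact M p q x a)"
 using assms by (simp_all add: dg_module_def cochain_complex_def)

lemma DG_d [simp]: "DG M ==> x : cel M p ==> q = p+1 ==> cdiff M p x : cel M q"
 using linear_mapD(1)[OF DG_linear(1)] by simp

lemma DG_d_add: "DG M ==> x : cel M p ==> y : cel M p ==>
  cdiff M p (pls M p x y) = pls M (p+1) (cdiff M p x) (cdiff M p y)"
 using linear_mapD(2)[OF DG_linear(1)] by simp

lemma DG_d_smult: "DG M ==> c : carrier k ==> x : cel M p ==>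
  cdiff M p (sml M p c x) = sml M (p+1) c (cdiff M p x)"
 using linear_mapD(3)[OF DG_linear(1)] by simp

lemma DG_dd [simp]: "DG M ==> x : cel M p ==> q = p+1 ==> cdiff M q (cdiff M p x) = zr M (p+2)"
 by (simp add: dg_module_def cochain_complex_def)

lemma DG_act [simp]: "DG M ==> x : cel M p ==> a : cel A q ==> r = p + q ==> gact M p q x a : cel M r"
 using linear_mapD(1)[OF DG_linear(2)] by simp

lemma DG_act_add: "DG M ==> x : cel M p ==> y : cel M p ==> a : cel A q ==>
  gact M p q (pls M p x y) a = pls M (p + q) (gact M p q x a) (gact M p q y a)"
 using linear_mapD(2)[OF DG_linear(3)] by simp

lemma DG_act_add2: "DG M ==> x : cel M p ==> a : cel A q ==> b : cel A q ==>
  gact M p q x (apl q a b) = pls M (p + q) (gact M p q x a) (gact M p q x b)"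
 using linear_mapD(2)[OF DG_linear(2)] by simp

lemma DG_act_smult: "DG M ==> c : carrier k ==> x : cel M p ==> a : cel A q ==>
  gact M p q (sml M p c x) a = sml M (p + q) c (gact M p q x a)"
 using linear_mapD(3)[OF DG_linear(3)] by simp

lemma DG_act_smult2: "DG M ==> c : carrier k ==> x : cel M p ==> a : cel A q ==>
  gact M p q x (sml A q c a) = sml M (p + q) c (gact M p q x a)"
 using linear_mapD(3)[OF DG_linear(2)] by simp

lemma DG_act_assoc: "DG M ==> x : cel M p ==> a : cel A q ==> b : cel A r ==>
  gact M (p + q) r (gact M p q x a) b = gact M p (q + r) x (gmul A q r a b)"
 by (simp add: dg_module_def)

lemma DG_act_one: "DG M ==> x : cel M p ==> gact M p 0 x (gone A) = x"
 by (simp add: dg_module_def)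

lemma DG_leibniz: "DG M ==> x : cel M p ==> a : cel A q ==>
  cdiff M (p + q) (gact M p q x a) =
   pls M (p + q+1) (gact M (p+1) q (cdiff M p x) a)
    (koszul_sign p (cgr M (p + q+1)) (gact M p (q+1) x (cdiff A q a)))"
 by (simp add: dg_module_def)

lemma A_module: "module k (cgr A p)"
 using A_dga by (simp add: dg_algebra_def cochain_complex_def)

lemma A_facts [simp]:
 "gone A : cel A 0"
 "a : cel A p ==> b : cel A q ==> r = p + q ==> gmul A p q a b : cel A r"
 "a : cel A p ==> q = p+1 ==> cdiff A p a : cel A q"
 "c : carrier k ==> a : cel A p ==> sml A p c a : cel A p"
proof -
 show "gone A : cel A 0" using A_dga by (simp add: dg_algebra_def)
 have "a : cel A p ==> linear_map k (cgr A q) (cgr A (p + q)) (gmul A p q a)"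
  using A_dga by (simp add: dg_algebra_def)
 thus "a : cel A p ==> b : cel A q ==> r = p + q ==> gmul A p q a b : cel A r"
  by (simp add: linear_mapD(1)[of "cgr A q"])
 have "linear_map k (cgr A p) (cgr A (p+1)) (cdiff A p)"
  using A_dga by (simp add: dg_algebra_def cochain_complex_def)
 thus "a : cel A p ==> q = p+1 ==> cdiff A p a : cel A q"
  by (simp add: linear_mapD(1)[of "cgr A p"])
 show "c : carrier k ==> a : cel A p ==> sml A p c a : cel A p"
  by (rule module.smult_closed[OF A_module])
qed

lemma additive_zero_neg:
 assumes "abelian_group G" "abelian_group H" "!!x. x : carrier G ==> f x : carrier H"
  "!!x y. x : carrier G ==> y : carrier G ==> f (x \<oplus>\<^bsub>G\<^esub> y) = f x \<oplus>\<^bsub>H\<^esub> f y"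
 shows "f \<zero>\<^bsub>G\<^esub> = \<zero>\<^bsub>H\<^esub>" "x : carrier G ==> f (\<ominus>\<^bsub>G\<^esub> x) = \<ominus>\<^bsub>H\<^esub> f x"
proof -
 interpret G: abelian_group G by fact
 interpret H: abelian_group H by fact
 have "f \<zero>\<^bsub>G\<^esub> \<oplus>\<^bsub>H\<^esub> f \<zero>\<^bsub>G\<^esub> = f \<zero>\<^bsub>G\<^esub>"
  using assms(4)[of "\<zero>\<^bsub>G\<^esub>" "\<zero>\<^bsub>G\<^esub>"] by simp
 thus z: "f \<zero>\<^bsub>G\<^esub> = \<zero>\<^bsub>H\<^esub>" using assms(3)[of "\<zero>\<^bsub>G\<^esub>"] by simp
 show "f (\<ominus>\<^bsub>G\<^esub> x) = \<ominus>\<^bsub>H\<^esub> f x" if x: "x : carrier G"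
 proof -
  have "f (\<ominus>\<^bsub>G\<^esub> x) \<oplus>\<^bsub>H\<^esub> f x = \<zero>\<^bsub>H\<^esub>"
   using assms(4)[of "\<ominus>\<^bsub>G\<^esub> x" x] x z by (simp add: G.l_neg)
  thus ?thesis using x assms(3) H.minus_equality by simp
 qed
qed

lemma DG_d_zero [simp]: "DG M ==> cdiff M p (zr M p) = zr M (p+1)"
 by (rule additive_zero_neg(1)[of "cgr M p" "cgr M (p+1)"]) (auto simp: DG_ab DG_d_add)

lemma DG_d_neg: "DG M ==> x : cel M p ==> cdiff M p (ngt M p x) = ngt M (p+1) (cdiff M p x)"
 by (rule additive_zero_neg(2)[of "cgr M p" "cgr M (p+1)"]) (auto simp: DG_ab DG_d_add)

lemma DG_act_zero: "DG M ==> a : cel A q ==> gact M p q (zr M p) a = zr M (p + q)"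
 by (rule additive_zero_neg(1)[of "cgr M p" "cgr M (p + q)" "%x. gact M p q x a"])
  (auto simp: DG_ab DG_act_add)

lemma DG_act_neg: "DG M ==> x : cel M p ==> a : cel A q ==>
  gact M p q (ngt M p x) a = ngt M (p + q) (gact M p q x a)"
 by (rule additive_zero_neg(2)[of "cgr M p" "cgr M (p + q)" "%x. gact M p q x a"])
  (auto simp: DG_ab DG_act_add)

lemma DG_smult_via_act:
 assumes "DG M" "x : cel M p" "c : carrier k"
 shows "sml M p c x = gact M p 0 x (sml A 0 c (gone A))"
 using assms DG_act_smult2[of M c x p "gone A" 0] DG_act_one by simp

subsection \<open>Graded homomorphisms and homotopies\<close>

text \<open>Linearity over k does not appear among the premises because a scalar c acts as right
  multiplication by c times the unit of A (\<open>DG_smult_via_act\<close>), so it is an instance of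
  compatibility with the action.\<close>

lemma ghI:
 assumes M: "DG M" and N: "DG N"
  and cl: "!!p x. x : cel M p ==> f p x : cel N (p + n)"
  and ad: "!!p x y. x : cel M p ==> y : cel M p ==>
     f p (pls M p x y) = pls N (p + n) (f p x) (f p y)"
  and ac: "!!p q x a. x : cel M p ==> a : cel A q ==>
     f (p + q) (gact M p q x a) = gact N (p + n) q (f p x) a"
 shows "gh n M N f"
proof -
 have "f p (sml M p c x) = sml N (p + n) c (f p x)"
  if "c : carrier k" "x : cel M p" for p c x
  using that ac[of x p "sml A 0 c (gone A)" 0] cl
  by (simp add: DG_smult_via_act[OF M] DG_smult_via_act[OF N])
 thus ?thesis
  unfolding graded_hom_def linear_map_def using cl ad ac by auto
qed

lemma ghD:
 assumes "gh n M N f"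
 shows "x : cel M p ==> q = p + n ==> f p x : cel N q"
  and "x : cel M p ==> y : cel M p ==> f p (pls M p x y) = pls N (p + n) (f p x) (f p y)"
  and "x : cel M p ==> a : cel A q ==> f (p + q) (gact M p q x a) = gact N (p + n) q (f p x) a"
  and "c : carrier k ==> x : cel M p ==> f p (sml M p c x) = sml N (p + n) c (f p x)"
  and "DG M ==> DG N ==> f p (zr M p) = zr N (p + n)"
  and "DG M ==> DG N ==> x : cel M p ==> f p (ngt M p x) = ngt N (p + n) (f p x)"
 using assms additive_zero_neg[of "cgr M p" "cgr N (p + n)" "f p"] DG_ab[of M p] DG_ab[of N "p + n"]
 by (auto simp: graded_hom_def linear_map_def Pi_iff)

lemma gh_zero: "DG M ==> DG N ==> gh n M N (%p x. zr N (p + n))"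
 by (rule ghI) (simp_all add: DG_act_zero add_ac)

lemma gh_add:
 assumes "DG M" "DG N" "gh n M N f" "gh n M N g"
 shows "gh n M N (%p x. pls N (p + n) (f p x) (g p x))"
proof (rule ghI)
 note f = ghD[OF assms(3)] and g = ghD[OF assms(4)]
 show "pls N (p + n) (f p (pls M p x y)) (g p (pls M p x y)) =
   pls N (p + n) (pls N (p + n) (f p x) (g p x)) (pls N (p + n) (f p y) (g p y))"
  if "x : cel M p" "y : cel M p" for p x y
  using that assms by (simp add: f(1,2) g(1,2) DG_ac)
 show "pls N (p + q + n) (f (p + q) (gact M p q x a)) (g (p + q) (gact M p q x a)) =
   gact N (p + n) q (pls N (p + n) (f p x) (g p x)) a"
  if "x : cel M p" "a : cel A q" for p q x a
  using that assms by (simp add: f(1,3) g(1,3) DG_act_add add_ac)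
qed (use assms in "simp_all add: ghD(1)[OF assms(3)] ghD(1)[OF assms(4)]")

lemma gh_neg:
 assumes "DG M" "DG N" "gh n M N f"
 shows "gh n M N (%p x. ngt N (p + n) (f p x))"
proof (rule ghI)
 note f = ghD[OF assms(3)]
 show "ngt N (p + n) (f p (pls M p x y)) = pls N (p + n) (ngt N (p + n) (f p x)) (ngt N (p + n) (f p y))"
  if "x : cel M p" "y : cel M p" for p x y
  using that assms by (simp add: f(1,2))
 show "ngt N (p + q + n) (f (p + q) (gact M p q x a)) = gact N (p + n) q (ngt N (p + n) (f p x)) a"
  if "x : cel M p" "a : cel A q" for p q x a
  using that assms by (simp add: f(1,3) DG_act_neg add_ac)
qed (use assms in "simp_all add: ghD(1)[OF assms(3)]")

lemma gh_comp:
 assumes "DG M" "DG N" "DG L" "gh n M N f" "gh m N L g" "l = n + m"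
 shows "gh l M L (%p x. g (p + n) (f p x))"
proof (rule ghI)
 note f = ghD[OF assms(4)] and g = ghD[OF assms(5)]
 show "g (p + n) (f p x) : cel L (p + l)" if "x : cel M p" for p x
  using that by (simp add: f(1) g(1) assms(6))
 show "g (p + n) (f p (pls M p x y)) = pls L (p + l) (g (p + n) (f p x)) (g (p + n) (f p y))"
  if "x : cel M p" "y : cel M p" for p x y
  using that by (simp add: f(1,2) g(2) assms(6) add.assoc)
 show "g (p + q + n) (f (p + q) (gact M p q x a)) = gact L (p + l) q (g (p + n) (f p x)) a"
  if "x : cel M p" "a : cel A q" for p q x a
  using that g(3)[of "f p x" "p + n" a q] by (simp add: f(1,3) assms(6) add_ac)
qed (use assms in simp_all)

end

section \<open>Dg morphisms and the homotopy relation on them\<close>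

context dgc begin

definition mor :: "('k, 'a, 'm) dgm => ('k, 'a, 'm) dgm => (int => 'm => 'm) => bool" where
 "mor M N f = (DG M & DG N & hom M N f)"

definition hq :: "('k, 'a, 'm) dgm => ('k, 'a, 'm) dgm => (int => 'm => 'm) => (int => 'm => 'm) => bool" where
 "hq M N f g = (mor M N f & mor M N g & heq M N f g)"

definition qs :: "('k, 'a, 'm) dgm => ('k, 'a, 'm) dgm => (int => 'm => 'm) => bool" where
 "qs M N f = (DG M & DG N & qis M N f)"

abbreviation bnd where
 "bnd M N g h p x \<equiv> pls N p (g p x) (pls N p (cdiff N (p - 1) (h p x)) (h (p+1) (cdiff (M :: ('k, 'a, 'm) dgm) p x)))"
abbreviation hadd where "hadd N f g \<equiv> (%p x. pls N p (f p x) (g p x))"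
abbreviation hneg where "hneg N f \<equiv> (%p x. ngt N p (f p x))"
abbreviation hzero where "hzero N \<equiv> (%p x. zr N p)"
abbreviation hid :: "int => 'm => 'm" where "hid \<equiv> (%p x. x)"

lemma gcomp_hid [simp]: "gcomp f hid = f" "gcomp hid f = f"
 by (simp_all add: gcomp_def fun_eq_iff)

lemma gcomp_apply [simp]: "gcomp g f p x = g p (f p x)"
 by (simp add: gcomp_def)

lemma gcomp_assoc: "gcomp (gcomp h g) f = gcomp h (gcomp g f)"
 by (simp add: gcomp_def comp_assoc)

lemma morD:
 assumes "mor M N f"
 shows "DG M" "DG N" "hom M N f" "gh 0 M N f"
  and "x : cel M p ==> f p x : cel N p"
  and "x : cel M p ==> y : cel M p ==> f p (pls M p x y) = pls N p (f p x) (f p y)"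
  and "x : cel M p ==> q = p+1 ==> f q (cdiff M p x) = cdiff N p (f p x)"
  and "f p (zr M p) = zr N p"
  and "x : cel M p ==> f p (ngt M p x) = ngt N p (f p x)"
  and "x : cel M p ==> a : cel A q ==> f (p + q) (gact M p q x a) = gact N p q (f p x) a"
 using assms ghD[of 0 M N f] by (auto simp: mor_def dg_hom_def)

lemma morI:
 assumes "DG M" "DG N"
  and "!!p x. x : cel M p ==> f p x : cel N p"
  and "!!p x y. x : cel M p ==> y : cel M p ==> f p (pls M p x y) = pls N p (f p x) (f p y)"
  and "!!p q x a. x : cel M p ==> a : cel A q ==> f (p + q) (gact M p q x a) = gact N p q (f p x) a"
  and "!!p x. x : cel M p ==> f (p+1) (cdiff M p x) = cdiff N p (f p x)"
 shows "mor M N f"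
 unfolding mor_def dg_hom_def using assms ghI[of M N f 0] by simp

lemma mor_id: "DG M ==> mor M M hid"
 by (rule morI) simp_all

lemma mor_zero: "DG M ==> DG N ==> mor M N (hzero N)"
 by (rule morI) (simp_all add: DG_act_zero)

lemma mor_comp: "mor M N f ==> mor N L g ==> mor M L (gcomp g f)"
 by (rule morI) (simp_all add: morD[of M N f] morD[of N L g])

lemma mor_add: "mor M N f ==> mor M N g ==> mor M N (hadd N f g)"
 by (rule morI) (simp_all add: morD[of M N f] morD[of M N g] DG_ac DG_act_add DG_d_add)

lemma mor_neg: "mor M N f ==> mor M N (hneg N f)"
 by (rule morI) (simp_all add: morD[of M N f] DG_act_neg DG_d_neg)

text \<open>The relation is restated without subtraction, as f = g + (d h + h d). All later
  homotopies are then checked by normalising sums.\<close>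

lemma hqI:
 assumes "mor M N f" "mor M N g" "gh (-1) M N h"
  "!!p x. x : cel M p ==>
   f p x = bnd M N g h p x"
 shows "hq M N f g"
proof -
 have "f p x \<ominus>\<^bsub>cgr N p\<^esub> g p x = pls N p (cdiff N (p - 1) (h p x)) (h (p+1) (cdiff M p x))"
  if "x : cel M p" for p x
 proof -
  have "pls N p (cdiff N (p - 1) (h p x)) (h (p+1) (cdiff M p x)) : cel N p"
   using that by (simp add: morD[OF assms(1)] ghD(1)[OF assms(3)])
  thus ?thesis
   using that by (simp add: assms(4)[OF that] a_minus_def DG_ac morD[OF assms(2)])
 qed
 thus ?thesis using assms unfolding hq_def homotopic_def by blast
qed

lemma hqD:
 assumes "hq M N f g"
 shows "mor M N f" "mor M N g" "DG M" "DG N"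
 using assms by (auto simp: hq_def mor_def)

lemma hqE:
 assumes "hq M N f g"
 obtains h where "gh (-1) M N h" "!!p x. x : cel M p ==>
   f p x = bnd M N g h p x"
proof -
 obtain h where h: "gh (-1) M N h" and e: "!!p x. x : cel M p ==> f p x \<ominus>\<^bsub>cgr N p\<^esub> g p x =
    pls N p (cdiff N (p - 1) (h p x)) (h (p+1) (cdiff M p x))"
  using assms unfolding hq_def homotopic_def by blast
 note f = morD[OF hqD(1)[OF assms]] and g = morD[OF hqD(2)[OF assms]]
 show ?thesis
 proof (rule that[OF h])
  fix p x assume x: "x : cel M p"
  have "pls N p (g p x) (pls N p (f p x) (ngt N p (g p x))) = f p x"
   using x by (simp add: DG_ac f g)
  thus "f p x = bnd M N g h p x"
   using e[OF x] by (simp add: a_minus_def)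
 qed
qed

text \<open>Values off the carriers are arbitrary, so two descriptions of the same morphism need not
  be equal functions. The zero homotopy is what identifies them.\<close>

lemma hq_ext:
 assumes "mor M N f" "mor M N g" "!!p x. x : cel M p ==> f p x = g p x"
 shows "hq M N f g"
proof (rule hqI[OF assms(1,2)])
 note f = morD[OF assms(1)] and g = morD[OF assms(2)]
 show "gh (-1) M N (%p x. zr N (p + -1))" by (rule gh_zero) fact+
 show "f p x = pls N p (g p x) (pls N p (cdiff N (p - 1) (zr N (p + -1))) (zr N (p+1 + -1)))"
  if "x : cel M p" for p x
  using that by (simp add: assms(3) f(2) g(5))
qed

lemma hq_refl: "mor M N f ==> hq M N f f"
 by (rule hq_ext) simp_all

lemma hq_sym:
 assumes "hq M N f g" shows "hq M N g f"
proof (rule hqE[OF assms])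
 fix h assume h: "gh (-1) M N h" and e: "!!p x. x : cel M p ==>
   f p x = bnd M N g h p x"
 note f = morD[OF hqD(1)[OF assms]] and g = morD[OF hqD(2)[OF assms]]
 have k: "gh (-1) M N (%p x. ngt N (p + -1) (h p x))" by (rule gh_neg) fact+
 show ?thesis
 proof (rule hqI[OF hqD(2,1)[OF assms] k])
  fix p x assume x: "x : cel M p"
  have a: "cdiff N (p - 1) (h p x) : cel N p" "h (p+1) (cdiff M p x) : cel N p" "h p x : cel N (p - 1)"
   using x by (simp_all add: f ghD(1)[OF h])
  show "g p x = pls N p (f p x) (pls N p (cdiff N (p - 1) (ngt N (p + - 1) (h p x)))
      (ngt N (p+1 + - 1) (h (p+1) (cdiff M p x))))"
   using x a DG_d_neg[of N "h p x" "p - 1"] by (simp add: e DG_ac f(2) g(5))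
 qed
qed

lemma hq_trans:
 assumes "hq M N f g" "hq M N g l" shows "hq M N f l"
proof (rule hqE[OF assms(1)], rule hqE[OF assms(2)])
 fix h h' assume h: "gh (-1) M N h" and e: "!!p x. x : cel M p ==>
   f p x = bnd M N g h p x"
 and h': "gh (-1) M N h'" and e': "!!p x. x : cel M p ==>
   g p x = bnd M N l h' p x"
 note f = morD[OF hqD(1)[OF assms(1)]] and l = morD[OF hqD(2)[OF assms(2)]]
 have k: "gh (-1) M N (%p x. pls N (p + -1) (h p x) (h' p x))" by (rule gh_add) fact+
 show ?thesis
 proof (rule hqI[OF hqD(1)[OF assms(1)] hqD(2)[OF assms(2)] k])
  fix p x assume x: "x : cel M p"
  have a: "cdiff N (p - 1) (h p x) : cel N p" "h (p+1) (cdiff M p x) : cel N p" "h p x : cel N (p - 1)"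
   "cdiff N (p - 1) (h' p x) : cel N p" "h' (p+1) (cdiff M p x) : cel N p" "h' p x : cel N (p - 1)"
   using x by (simp_all add: f ghD(1)[OF h] ghD(1)[OF h'])
  show "f p x = pls N p (l p x) (pls N p (cdiff N (p - 1) (pls N (p + -1) (h p x) (h' p x)))
      (pls N (p+1 + - 1) (h (p+1) (cdiff M p x)) (h' (p+1) (cdiff M p x))))"
   using x a DG_d_add[of N "h p x" "p - 1" "h' p x"] by (simp add: e e' DG_ac f(2) l(5))
 qed
qed

lemma hq_comp_left:
 assumes "hq M N f g" "mor N L l" shows "hq M L (gcomp l f) (gcomp l g)"
proof (rule hqE[OF assms(1)])
 fix h assume h: "gh (-1) M N h" and e: "!!p x. x : cel M p ==>
   f p x = bnd M N g h p x"
 note f = morD[OF hqD(1)[OF assms(1)]] and g = morD[OF hqD(2)[OF assms(1)]] and l = morD[OF assms(2)]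
 have k: "gh (-1) M L (%p x. l (p + -1) (h p x))"
  using l(2) by (intro gh_comp[OF f(1,2) _ h l(4)]) simp_all
 show ?thesis
 proof (rule hqI[OF mor_comp[OF hqD(1)[OF assms(1)] assms(2)] mor_comp[OF hqD(2)[OF assms(1)] assms(2)] k])
  fix p x assume x: "x : cel M p"
  have a: "cdiff N (p - 1) (h p x) : cel N p" "h (p+1) (cdiff M p x) : cel N p" "h p x : cel N (p - 1)"
   using x by (simp_all add: f ghD(1)[OF h])
  show "gcomp l f p x = pls L p (gcomp l g p x) (pls L p (cdiff L (p - 1) (l (p + - 1) (h p x)))
      (l (p+1 + - 1) (h (p+1) (cdiff M p x))))"
   using x a l(7)[of "h p x" "p - 1" p] by (simp add: e l(6) f(2) g(5))
 qed
qed

lemma hq_comp_right: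
 assumes "mor L M l" "hq M N f g" shows "hq L N (gcomp f l) (gcomp g l)"
proof (rule hqE[OF assms(2)])
 fix h assume h: "gh (-1) M N h" and e: "!!p x. x : cel M p ==>
   f p x = bnd M N g h p x"
 note f = morD[OF hqD(1)[OF assms(2)]] and l = morD[OF assms(1)]
 have k: "gh (-1) L N (%p x. h (p+0) (l p x))"
  using l(1) f(1,2) by (intro gh_comp[OF _ _ _ l(4) h]) simp_all
 show ?thesis
 proof (rule hqI[OF mor_comp[OF assms(1) hqD(1)[OF assms(2)]] mor_comp[OF assms(1) hqD(2)[OF assms(2)]] k])
  fix p x assume x: "x : cel L p"
  show "gcomp f l p x = pls N p (gcomp g l p x) (pls N p (cdiff N (p - 1) (h (p+0) (l p x)))
      (h (p+1+0) (l (p+1) (cdiff L p x))))"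
   using x by (simp add: e l(5,7))
 qed
qed

lemma hq_add:
 assumes "hq M N f g" "hq M N f' g'" shows "hq M N (hadd N f f') (hadd N g g')"
proof (rule hqE[OF assms(1)], rule hqE[OF assms(2)])
 fix h h' assume h: "gh (-1) M N h" and e: "!!p x. x : cel M p ==>
   f p x = bnd M N g h p x"
 and h': "gh (-1) M N h'" and e': "!!p x. x : cel M p ==>
   f' p x = bnd M N g' h' p x"
 note f = morD[OF hqD(1)[OF assms(1)]] and g = morD[OF hqD(2)[OF assms(1)]]
  and g' = morD[OF hqD(2)[OF assms(2)]]
 have k: "gh (-1) M N (%p x. pls N (p + -1) (h p x) (h' p x))" by (rule gh_add) fact+
 show ?thesis
 proof (rule hqI[OF mor_add[OF hqD(1)[OF assms(1)] hqD(1)[OF assms(2)]]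
    mor_add[OF hqD(2)[OF assms(1)] hqD(2)[OF assms(2)]] k])
  fix p x assume x: "x : cel M p"
  have a: "cdiff N (p - 1) (h p x) : cel N p" "h (p+1) (cdiff M p x) : cel N p" "h p x : cel N (p - 1)"
   "cdiff N (p - 1) (h' p x) : cel N p" "h' (p+1) (cdiff M p x) : cel N p" "h' p x : cel N (p - 1)"
   using x by (simp_all add: f ghD(1)[OF h] ghD(1)[OF h'])
  show "pls N p (f p x) (f' p x) = pls N p (pls N p (g p x) (g' p x))
   (pls N p (cdiff N (p - 1) (pls N (p + -1) (h p x) (h' p x)))
      (pls N (p+1 + - 1) (h (p+1) (cdiff M p x)) (h' (p+1) (cdiff M p x))))"
   using x a DG_d_add[of N "h p x" "p - 1" "h' p x"] by (simp add: e e' DG_ac f(2) g(5) g'(5))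
 qed
qed

lemma hq_neg: "hq M N f g ==> hq M N (hneg N f) (hneg N g)"
proof -
 assume a: "hq M N f g"
 note f = hqD[OF a]
 have n: "mor N N (hneg N hid)" by (rule mor_neg[OF mor_id[OF f(4)]])
 show ?thesis
  using hq_comp_left[OF a n] by (simp add: gcomp_def comp_def)
qed

end

context dgc begin

subsection \<open>Quasi-isomorphisms\<close>

lemma qs_mor: "qs M N f ==> mor M N f"
 by (simp add: qs_def quasi_iso_def mor_def)

abbreviation "hc X p x \<equiv> coboundaries X p +>\<^bsub>cgr X p\<^esub> x"

text \<open>The coboundaries form a subgroup because d is additive. This is the bridge from
  cohomology as a set of cosets to statements about single elements.\<close>

lemma coset_eq_iff:
 assumes "DG M" "x : cel M p" "y : cel M p"
 shows "(hc M p x = hc M p y) = (EX b:cel M (p - 1). x = pls M p y (cdiff M (p - 1) b))"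
proof -
 interpret abelian_group "cgr M p" by (rule DG_ab[OF assms(1)])
 let ?B = "coboundaries M p"
 have d: "cdiff M (p - 1) b : cel M p" if "b : cel M (p - 1)" for b using assms(1) that by simp
 have sub: "subgroup ?B (add_monoid (cgr M p))"
 proof (rule group.subgroupI[OF a_group])
  show "?B \<subseteq> carrier (add_monoid (cgr M p))" using d by (auto simp: coboundaries_def)
  show "?B ~= {}" using DG_group_simps(1)[OF assms(1)] by (auto simp: coboundaries_def)
  show "inv\<^bsub>add_monoid (cgr M p)\<^esub> a : ?B" if a: "a : ?B" for a
  proof -
   obtain b where b: "b : cel M (p - 1)" "a = cdiff M (p - 1) b"
    using a by (auto simp: coboundaries_def)
   have "inv\<^bsub>add_monoid (cgr M p)\<^esub> a = cdiff M (p - 1) (ngt M (p - 1) b)"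
    using b DG_d_neg[OF assms(1) b(1)] by (simp add: a_inv_def)
   thus ?thesis using b assms(1) by (auto simp: coboundaries_def)
  qed
  show "a \<otimes>\<^bsub>add_monoid (cgr M p)\<^esub> b : ?B" if ab: "a : ?B" "b : ?B" for a b
  proof -
   obtain a' b' where b: "a' : cel M (p - 1)" "a = cdiff M (p - 1) a'" "b' : cel M (p - 1)" "b = cdiff M (p - 1) b'"
    using ab unfolding coboundaries_def by blast
   have "a \<otimes>\<^bsub>add_monoid (cgr M p)\<^esub> b = cdiff M (p - 1) (pls M (p - 1) a' b')"
    using b DG_d_add[OF assms(1) b(1,3)] by simp
   thus ?thesis using b assms(1) by (auto simp: coboundaries_def)
  qed
 qed
 have "(?B +>\<^bsub>cgr M p\<^esub> x = ?B +>\<^bsub>cgr M p\<^esub> y) = (x : ?B +>\<^bsub>cgr M p\<^esub> y)"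
  using a_repr_independence[OF _ assms(3) sub] a_rcosI
   add.rcos_self[OF _ sub, of x] assms(2) unfolding a_r_coset_def by auto
 also have "... = (EX b:cel M (p - 1). x = pls M p y (cdiff M (p - 1) b))"
  using assms d by (auto simp: a_r_coset_def' coboundaries_def a_comm)
 finally show ?thesis .
qed

abbreviation hits where
 "hits M N f p y \<equiv> EX x:cel M (p+1). cdiff M (p+1) x = zr M (p+2) & (EX b:cel N p. y = pls N (p+1) (f (p+1) x) (cdiff N p b))"

definition coho_inj where
 "coho_inj M N f = (ALL p x b. x : cel (M :: ('k, 'a, 'm) dgm) (p+1) & cdiff M (p+1) x = zr M (p+2) &
  b : cel (N :: ('k, 'a, 'm) dgm) p & f (p+1) x = cdiff N p b --> (EX c:cel M p. x = cdiff M p c))"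

definition coho_surj where
 "coho_surj M N f = (ALL p y. y : cel (N :: ('k, 'a, 'm) dgm) (p+1) & cdiff N (p+1) y = zr N (p+2) -->
  (EX x:cel (M :: ('k, 'a, 'm) dgm) (p+1). cdiff M (p+1) x = zr M (p+2) &
   (EX b:cel N p. y = pls N (p+1) (f (p+1) x) (cdiff N p b))))"

lemma carrier_cohomology:
 "carrier (cohomology X p) = (%x. hc X p x) ` cocycles X p"
 by (auto simp: cohomology_def A_FactGroup_def' A_RCOSETS_def' a_r_coset_def')

lemma coset_map:
 assumes f: "mor M N f" and x: "x : cel M p"
 shows "(\<Union>z\<in>hc M p x. hc N p (f p z)) =
  hc N p (f p x)"
proof -
 note D = morD[OF f]
 have c: "hc N p (f p z) = hc N p (f p x)"
  if z: "z : hc M p x" for z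
 proof -
  obtain b where b: "b : cel M (p - 1)" "z = pls M p (cdiff M (p - 1) b) x"
   using z by (auto simp: a_r_coset_def' coboundaries_def)
  have "f p z = pls N p (f p x) (cdiff N (p - 1) (f (p - 1) b))" "f p z : cel N p"
   using b x D(1,2) D(5)[of x p] D(5)[OF b(1)] D(7)[of b "p - 1" p] by (simp_all add: D(6) DG_ac)
  thus ?thesis using coset_eq_iff[OF D(2) _ D(5)[OF x]] D(5)[OF b(1)] by blast
 qed
 have "x : hc M p x"
 proof -
  have "pls M p (cdiff M (p - 1) (zr M (p - 1))) x = x" using D(1) x by simp
  moreover have "zr M (p - 1) : cel M (p - 1)" using D(1) by simp
  ultimately show ?thesis unfolding a_r_coset_def' coboundaries_def by force
 qed
 thus ?thesis using c by blast
qed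

lemma image_comp_eq_iff:
 assumes "!!x. x : Z ==> f x : W"
 shows "((%x. h (f x)) ` Z = h ` W) = (ALL y:W. EX x:Z. h y = h (f x))"
proof
 assume "ALL y:W. EX x:Z. h y = h (f x)"
 thus "(%x. h (f x)) ` Z = h ` W" using assms by (auto simp: image_iff)
qed (metis (no_types, lifting) imageE imageI)

text \<open>Bijectivity on cosets is split into injectivity and surjectivity on representatives.
  Degrees are written p+1 so that coboundaries come from degree p and no subtraction of indices is
  needed.\<close>

lemma qs_iff: "qs M N f = (mor M N f & coho_inj M N f & coho_surj M N f)"
proof (cases "mor M N f")
 case True
 note D = morD[OF True]
 let ?F = "%X p. \<Union>z\<in>X. hc N p (f p z)"
 have cyc: "f p x : cocycles N p" if "x : cocycles M p" for x p
  using that D(5)[of x p] D(7)[of x p "p+1"] D(8)[of "p+1"] by (auto simp: cocycles_def)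
 have inj: "inj_on (%X. ?F X (p+1)) (carrier (cohomology M (p+1))) = (ALL x b. x : cel M (p+1) & cdiff M (p+1) x = zr M (p+2) &
  b : cel N p & f (p+1) x = cdiff N p b --> (EX c:cel M p. x = cdiff M p c))"
  (is "?I = ?J") for p
 proof
  assume I: ?I
  show ?J
  proof (intro allI impI, elim conjE)
   fix x b assume a: "x : cel M (p+1)" "cdiff M (p+1) x = zr M (p+2)" "b : cel N p" "f (p+1) x = cdiff N p b"
   have c: "x : cocycles M (p+1)" "zr M (p+1) : cocycles M (p+1)"
    using a D(1) by (simp_all add: cocycles_def add_ac)
   have "hc N (p+1) (f (p+1) x) = hc N (p+1) (f (p+1) (zr M (p+1)))"
    using a D(2,8) by (subst coset_eq_iff) (auto intro!: bexI[of _ b])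
   hence F: "?F (hc M (p+1) x) (p+1) =
     ?F (hc M (p+1) (zr M (p+1))) (p+1)"
    by (simp only: coset_map[OF True a(1)] coset_map[OF True DG_group_simps(1)[OF D(1)]])
   have "hc M (p+1) x = hc M (p+1) (zr M (p+1))"
    by (rule inj_onD[OF I F]) (simp_all only: carrier_cohomology imageI c)
   thus "EX c:cel M p. x = cdiff M p c"
    using a(1) D(1) by (subst (asm) coset_eq_iff) auto
  qed
 next
  assume J: ?J
  show ?I
  proof (rule inj_onI, unfold carrier_cohomology, elim imageE)
   fix X Y x y assume a: "?F X (p+1) = ?F Y (p+1)" "X = hc M (p+1) x"
    "Y = hc M (p+1) y" "x : cocycles M (p+1)" "y : cocycles M (p+1)"
   have x: "x : cel M (p+1)" "y : cel M (p+1)"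
     "cdiff M (p+1) x = zr M (p+2)" "cdiff M (p+1) y = zr M (p+2)"
    using a by (simp_all add: cocycles_def add_ac)
   have "hc N (p+1) (f (p+1) x) = hc N (p+1) (f (p+1) y)"
    using a(1) by (simp only: a(2,3) coset_map[OF True x(1)] coset_map[OF True x(2)])
   then obtain b where b: "b : cel N p" "f (p+1) x = pls N (p+1) (f (p+1) y) (cdiff N p b)"
    using x D(2,5) by (subst (asm) coset_eq_iff) auto
   have "f (p+1) (pls M (p+1) x (ngt M (p+1) y)) = cdiff N p b"
    using b x D(1,2) D(5)[of y "p+1"] by (simp add: D(6) D(9) DG_ac)
   moreover have "cdiff M (p+1) (pls M (p+1) x (ngt M (p+1) y)) = zr M (p+2)"
    using D(1) x by (simp add: DG_d_add DG_d_neg add_ac)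
   ultimately obtain c where c: "c : cel M p" "pls M (p+1) x (ngt M (p+1) y) = cdiff M p c"
    using J b(1) DG_group_simps(3)[OF D(1) x(1) DG_group_simps(2)[OF D(1) x(2)]] by blast
   have "x = pls M (p+1) y (pls M (p+1) x (ngt M (p+1) y))"
    using x D(1) by (simp add: DG_ac)
   hence "x = pls M (p+1) y (cdiff M p c)" using c by simp
   thus "X = Y" using c(1) a(2,3) x D(1) by (simp, subst coset_eq_iff) auto
  qed
 qed
 have im: "(%X. ?F X p) ` carrier (cohomology M p) = (%x. hc N p (f p x)) ` cocycles M p" for p
  unfolding carrier_cohomology image_image
  by (rule image_cong[OF refl]) (simp add: coset_map[OF True] cocycles_def)
 have surj: "((%X. ?F X (p+1)) ` carrier (cohomology M (p+1)) = carrier (cohomology N (p+1))) = (ALL y. y : cel N (p+1) & cdiff N (p+1) y = zr N (p+2) -->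
  (hits M N f p y))" (is "?I = ?J") for p
 proof -
  have "?I = (ALL y:cocycles N (p+1). EX x:cocycles M (p+1).
    hc N (p+1) y = hc N (p+1) (f (p+1) x))"
   unfolding im unfolding carrier_cohomology by (rule image_comp_eq_iff[OF cyc])
  also have "... = (ALL y:cocycles N (p+1). EX x:cocycles M (p+1).
    EX b:cel N p. y = pls N (p+1) (f (p+1) x) (cdiff N p b))"
  proof (intro ball_cong bex_cong refl)
   fix y x assume "y : cocycles N (p+1)" "x : cocycles M (p+1)"
   thus "(hc N (p+1) y = hc N (p+1) (f (p+1) x)) = (EX b:cel N p. y = pls N (p+1) (f (p+1) x) (cdiff N p b))"
    using coset_eq_iff[OF D(2), of y "p+1" "f (p+1) x"] D(5)[of x "p+1"]
    by (simp add: cocycles_def)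
  qed
  also have "... = ?J" by (simp add: cocycles_def Ball_def Bex_def add_ac)
  finally show ?thesis .
 qed
 have "qs M N f = (ALL p. inj_on (%X. ?F X (p+1)) (carrier (cohomology M (p+1))) &
   (%X. ?F X (p+1)) ` carrier (cohomology M (p+1)) = carrier (cohomology N (p+1)))"
 proof -
  have sh: "(\<forall>p::int. P p) = (ALL p. P (p+1))" for P by (metis diff_add_cancel)
  have "qs M N f = (ALL p. bij_betw (%X. ?F X p) (carrier (cohomology M p)) (carrier (cohomology N p)))"
   unfolding qs_def quasi_iso_def using D(1-3) by simp
  thus ?thesis unfolding bij_betw_def by (subst (asm) sh)
 qed
 thus ?thesis unfolding inj surj coho_inj_def coho_surj_def by (simp add: True all_conj_distrib)
qed (auto dest: qs_mor)

end

context dgc begin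

lemma qsI:
 assumes "mor M N f"
  and "!!p x b. x : cel M (p+1) ==> cdiff M (p+1) x = zr M (p+2) ==> b : cel N p ==>
    f (p+1) x = cdiff N p b ==> EX c:cel M p. x = cdiff M p c"
  and "!!p y. y : cel N (p+1) ==> cdiff N (p+1) y = zr N (p+2) ==>
    hits M N f p y"
 shows "qs M N f"
 unfolding qs_iff coho_inj_def coho_surj_def using assms by blast

lemma qs_injE:
 assumes "qs M N f" "x : cel M (p+1)" "cdiff M (p+1) x = zr M (p+2)" "b : cel N p"
  "f (p+1) x = cdiff N p b"
 obtains c where "c : cel M p" "x = cdiff M p c"
 using assms unfolding qs_iff coho_inj_def by blast

lemma qs_surjE:
 assumes "qs M N f" "y : cel N (p+1)" "cdiff N (p+1) y = zr N (p+2)"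
 obtains x b where "x : cel M (p+1)" "cdiff M (p+1) x = zr M (p+2)" "b : cel N p"
  "y = pls N (p+1) (f (p+1) x) (cdiff N p b)"
 using assms unfolding qs_iff coho_surj_def by blast

lemma qs_id: "DG M ==> qs M M hid"
proof (rule qsI)
 fix p y assume "DG M" "y : cel M (p+1)" "cdiff M (p+1) y = zr M (p+2)"
 thus "EX x:cel M (p+1). cdiff M (p+1) x = zr M (p+2) &
   (EX b:cel M p. y = pls M (p+1) x (cdiff M p b))"
  by (intro bexI[of _ y] conjI bexI[of _ "zr M p"]) simp_all
qed (auto simp: mor_id)

text \<open>On a cocycle the term h (d x) vanishes, so homotopic maps differ there by the coboundary
  of h x and induce the same map on cohomology.\<close>

lemma qs_hq:
 assumes "hq M N f g" "qs M N f" shows "qs M N g"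
proof (rule hqE[OF assms(1)])
 fix h assume h: "gh (-1) M N h" and e: "!!p x. x : cel M p ==>
   f p x = bnd M N g h p x"
 note f = morD[OF hqD(1)[OF assms(1)]] and g = morD[OF hqD(2)[OF assms(1)]]
 note h1 = ghD(1)[OF h]
 have e': "f (p+1) x = pls N (p+1) (g (p+1) x) (cdiff N p (h (p+1) x))"
  "h (p+1) x : cel N p"
  if "x : cel M (p+1)" "cdiff M (p+1) x = zr M (p+2)" for p x
 proof -
  have "h (p+2) (zr M (p+2)) = zr N (p+1)"
   using ghD(5)[OF h f(1,2), of "p+2"] by (simp add: add.commute[of 1])
  thus "f (p+1) x = pls N (p+1) (g (p+1) x) (cdiff N p (h (p+1) x))"
   "h (p+1) x : cel N p"
   using that h1[of x "p+1" p] by (simp_all add: e f(2) g(5) add.commute[of 2])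
 qed
 show ?thesis
 proof (rule qsI[OF hqD(2)[OF assms(1)]])
  fix p x b assume a: "x : cel M (p+1)" "cdiff M (p+1) x = zr M (p+2)" "b : cel N p"
    "g (p+1) x = cdiff N p b"
  have "f (p+1) x = cdiff N p (pls N p b (h (p+1) x))"
   using a e'[OF a(1,2)] f(2) by (simp add: DG_d_add)
  thus "EX c:cel M p. x = cdiff M p c"
   using qs_injE[OF assms(2) a(1,2)] a(3) e'(2)[OF a(1,2)] f(2) DG_group_simps(3) by metis
 next
  fix p y assume a: "y : cel N (p+1)" "cdiff N (p+1) y = zr N (p+2)"
  obtain x b where x: "x : cel M (p+1)" "cdiff M (p+1) x = zr M (p+2)" "b : cel N p"
   "y = pls N (p+1) (f (p+1) x) (cdiff N p b)" by (rule qs_surjE[OF assms(2) a])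
  have "y = pls N (p+1) (g (p+1) x) (cdiff N p (pls N p (h (p+1) x) b))"
   using x e'[OF x(1,2)] f(2) g(5)[OF x(1)] by (simp add: DG_d_add DG_ac)
  moreover have "pls N p (h (p+1) x) b : cel N p" using x e'[OF x(1,2)] f(2) by simp
  ultimately show "hits M N g p y" using x(1,2) by blast
 qed
qed

lemma qs_comp:
 assumes t: "qs M N t" and s: "qs N L s" shows "qs M L (gcomp s t)"
proof (rule qsI)
 note T = morD[OF qs_mor[OF t]] and S = morD[OF qs_mor[OF s]]
 show "mor M L (gcomp s t)" using mor_comp qs_mor s t by blast
 fix p x b assume a: "x : cel M (p+1)" "cdiff M (p+1) x = zr M (p+2)" "b : cel L p"
    "gcomp s t (p+1) x = cdiff L p b"
 have c: "t (p+1) x : cel N (p+1)" "cdiff N (p+1) (t (p+1) x) = zr N (p+2)"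
  using a T(5)[OF a(1)] T(7)[OF a(1), of "p+2"] T(8) by simp_all
 obtain d where d: "d : cel N p" "t (p+1) x = cdiff N p d"
  using qs_injE[OF s c a(3)] a(4) by auto
 show "EX c:cel M p. x = cdiff M p c" using qs_injE[OF t a(1,2) d] by blast
next
 note T = morD[OF qs_mor[OF t]] and S = morD[OF qs_mor[OF s]]
 fix p y assume a: "y : cel L (p+1)" "cdiff L (p+1) y = zr L (p+2)"
 obtain x b where x: "x : cel N (p+1)" "cdiff N (p+1) x = zr N (p+2)" "b : cel L p"
   "y = pls L (p+1) (s (p+1) x) (cdiff L p b)" by (rule qs_surjE[OF s a])
 obtain w c where w: "w : cel M (p+1)" "cdiff M (p+1) w = zr M (p+2)" "c : cel N p"
   "x = pls N (p+1) (t (p+1) w) (cdiff N p c)" by (rule qs_surjE[OF t x(1,2)])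
 have "y = pls L (p+1) (gcomp s t (p+1) w) (cdiff L p (pls L p (s p c) b))" "pls L p (s p c) b : cel L p"
  using x(3,4) w T(2) S(2) T(5)[OF w(1)] S(5)[OF w(3)] S(5)[of "t (p+1) w" "p+1"]
  by (simp_all add: S(6) S(7) DG_d_add DG_ac)
 thus "EX x:cel M (p+1). cdiff M (p+1) x = zr M (p+2) &
   (EX b:cel L p. y = pls L (p+1) (gcomp s t (p+1) x) (cdiff L p b))" using w(1,2) by blast
qed

lemma qs_cancel:
 assumes t: "mor M N t" and s: "qs N L s" and st: "qs M L (gcomp s t)" shows "qs M N t"
proof (rule qsI[OF t])
 note T = morD[OF t] and S = morD[OF qs_mor[OF s]]
 fix p x b assume a: "x : cel M (p+1)" "cdiff M (p+1) x = zr M (p+2)" "b : cel N p"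
    "t (p+1) x = cdiff N p b"
 have "gcomp s t (p+1) x = cdiff L p (s p b)" using a by (simp add: S(7))
 thus "EX c:cel M p. x = cdiff M p c" using qs_injE[OF st a(1,2) S(5)[OF a(3)]] by blast
next
 note T = morD[OF t] and S = morD[OF qs_mor[OF s]]
 fix p y assume a: "y : cel N (p+1)" "cdiff N (p+1) y = zr N (p+2)"
 have c: "s (p+1) y : cel L (p+1)" "cdiff L (p+1) (s (p+1) y) = zr L (p+2)"
  using a S(5)[OF a(1)] S(7)[OF a(1), of "p+2"] S(8) by simp_all
 obtain x b where x: "x : cel M (p+1)" "cdiff M (p+1) x = zr M (p+2)" "b : cel L p"
   "s (p+1) y = pls L (p+1) (gcomp s t (p+1) x) (cdiff L p b)" by (rule qs_surjE[OF st c])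
 have tx: "t (p+1) x : cel N (p+1)" "cdiff N (p+1) (t (p+1) x) = zr N (p+2)"
  using x T(5)[OF x(1)] T(7)[OF x(1), of "p+2"] T(8) by simp_all
 \<comment> \<open>The preimage x of the class of s y under s t is taken back out of y; what remains
   is a cocycle with trivial image under s, hence a coboundary.\<close>
 define z where "z = pls N (p+1) y (ngt N (p+1) (t (p+1) x))"
 have z: "z : cel N (p+1)" "cdiff N (p+1) z = zr N (p+2)"
  using a tx T(2) by (simp_all add: z_def DG_d_add DG_d_neg add.commute[of 2])
 have "s (p+1) z = cdiff L p b"
  using x a tx S(1,2) S(5)[OF tx(1)] by (simp add: z_def S(6) S(9) DG_ac)
 then obtain c where c: "c : cel N p" "z = cdiff N p c" by (rule qs_injE[OF s z x(3)])
 have "y = pls N (p+1) (t (p+1) x) z" using a tx T(2) by (simp add: z_def DG_ac)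
 thus "hits M N t p y" using x(1,2) c by blast
qed

lemma qs_hequiv:
 assumes f: "mor M N f" and g: "mor N M g" and gf: "hq M M (gcomp g f) hid" and fg: "hq N N (gcomp f g) hid"
 shows "qs M N f"
proof (rule qsI[OF f])
 note F = morD[OF f] and G = morD[OF g]
 have gf': "qs M M (gcomp g f)" using qs_hq[OF hq_sym[OF gf]] qs_id F(1) by blast
 have fg': "qs N N (gcomp f g)" using qs_hq[OF hq_sym[OF fg]] qs_id F(2) by blast
 show "EX c:cel M p. x = cdiff M p c" if a: "x : cel M (p+1)" "cdiff M (p+1) x = zr M (p+2)" "b : cel N p"
    "f (p+1) x = cdiff N p b" for p x b
 proof -
  have "gcomp g f (p+1) x = cdiff M p (g p b)" using a by (simp add: G(7))
  thus ?thesis using qs_injE[OF gf' a(1,2) G(5)[OF a(3)]] by blast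
 qed
 show "hits M N f p y"
  if a: "y : cel N (p+1)" "cdiff N (p+1) y = zr N (p+2)" for p y
 proof -
  obtain x b where x: "x : cel N (p+1)" "cdiff N (p+1) x = zr N (p+2)" "b : cel N p"
   "y = pls N (p+1) (gcomp f g (p+1) x) (cdiff N p b)" by (rule qs_surjE[OF fg' a])
  have "g (p+1) x : cel M (p+1)" "cdiff M (p+1) (g (p+1) x) = zr M (p+2)"
   using x G(5)[OF x(1)] G(7)[OF x(1), of "p+2"] G(8) by simp_all
  thus ?thesis using x by (intro bexI[of _ "g (p+1) x"] conjI bexI[of _ b]) simp_all
 qed
qed

lemma DGI:
 assumes "!!p. module k (cgr M p)"
  and "!!p x. x : cel M p ==> cdiff M p x : cel M (p+1)"
  and "!!p x y. x : cel M p ==> y : cel M p ==>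
    cdiff M p (pls M p x y) = pls M (p+1) (cdiff M p x) (cdiff M p y)"
  and "!!p c x. c : carrier k ==> x : cel M p ==>
    cdiff M p (sml M p c x) = sml M (p+1) c (cdiff M p x)"
  and "!!p x. x : cel M p ==> cdiff M (p+1) (cdiff M p x) = zr M (p+2)"
  and "!!p q x a. x : cel M p ==> a : cel A q ==> gact M p q x a : cel M (p + q)"
  and "!!p q x y a. x : cel M p ==> y : cel M p ==> a : cel A q ==>
    gact M p q (pls M p x y) a = pls M (p + q) (gact M p q x a) (gact M p q y a)"
  and "!!p q x a b. x : cel M p ==> a : cel A q ==> b : cel A q ==>
    gact M p q x (apl q a b) = pls M (p + q) (gact M p q x a) (gact M p q x b)"
  and "!!p q c x a. c : carrier k ==> x : cel M p ==> a : cel A q ==>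
    gact M p q (sml M p c x) a = sml M (p + q) c (gact M p q x a)"
  and "!!p q c x a. c : carrier k ==> x : cel M p ==> a : cel A q ==>
    gact M p q x (sml A q c a) = sml M (p + q) c (gact M p q x a)"
  and "!!p q r x a b. x : cel M p ==> a : cel A q ==> b : cel A r ==>
    gact M (p + q) r (gact M p q x a) b = gact M p (q + r) x (gmul A q r a b)"
  and "!!p x. x : cel M p ==> gact M p 0 x (gone A) = x"
  and "!!p q x a. x : cel M p ==> a : cel A q ==>
    cdiff M (p + q) (gact M p q x a) =
     pls M (p + q+1) (gact M (p+1) q (cdiff M p x) a)
      (koszul_sign p (cgr M (p + q+1)) (gact M p (q+1) x (cdiff A q a)))"
 shows "DG M"
 unfolding dg_module_def cochain_complex_def linear_map_def using assms by (simp add: Pi_iff)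

text \<open>Iterated shifts need not be equal as records to a single shift: the signs of the
  differentials cancel only on the carriers. \<open>same\<close> is the agreement that does hold,
  and it makes the identity function a quasi-isomorphism.\<close>

definition same :: "('k, 'a, 'm) dgm => ('k, 'a, 'm) dgm => bool" where
 "same M N = (cgr M = cgr N & gact M = gact N & (ALL p. ALL x:cel M p. cdiff M p x = cdiff N p x))"

lemma same_sym: "same M N ==> same N M"
 by (simp add: same_def)

lemma same_DG:
 assumes M: "DG M" and s: "same M N"
 shows "DG N"
proof -
 have c: "cgr N = cgr M" "gact N = gact M" and d: "!!p x. x : cel M p ==> cdiff N p x = cdiff M p x"
  using s by (simp_all add: same_def)
 show ?thesis
  by (rule DGI; simp only: c)
   (simp_all add: d M DG_module DG_d_add DG_d_smult DG_act_add DG_act_add2 DG_act_smult DG_act_smult2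
    DG_act_assoc DG_act_one DG_leibniz)
qed

lemma same_qs:
 assumes "DG M" "same M N" shows "qs M N hid"
proof -
 have c: "cgr N = cgr M" "gact N = gact M" and d: "!!p x. x : cel M p ==> cdiff N p x = cdiff M p x"
  using assms(2) by (simp_all add: same_def)
 have N: "DG N" by (rule same_DG[OF assms])
 have m: "mor M N hid" by (rule morI[OF assms(1) N]) (simp_all add: c d)
 have n: "mor N M hid" by (rule morI[OF N assms(1)]) (simp_all add: c d)
 show ?thesis by (rule qs_hequiv[OF m n]) (simp_all add: hq_refl mor_id assms N)
qed

lemma same_mor:
 assumes "same M M'" "same N N'" "mor M N f" shows "mor M' N' f"
proof -
 have "qs M' M hid" "qs N N' hid"
  using same_qs[OF same_DG same_sym] same_qs morD(1,2)[OF assms(3)] assms(1,2) by blast+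
 from mor_comp[OF mor_comp[OF qs_mor[OF this(1)] assms(3)] qs_mor[OF this(2)]] show ?thesis by simp
qed

lemma same_qs':
 assumes "same M M'" "same N N'" "qs M N f" shows "qs M' N' f"
proof -
 have "qs M' M hid" "qs N N' hid"
  using same_qs[OF same_DG same_sym] same_qs morD(1,2)[OF qs_mor[OF assms(3)]] assms(1,2) by blast+
 from qs_comp[OF qs_comp[OF this(1) assms(3)] this(2)] show ?thesis by simp
qed

lemma same_hq:
 assumes "same M M'" "same N N'" "hq M N f g" shows "hq M' N' f g"
proof -
 have "mor M' M hid" "mor N N' hid"
  using qs_mor[OF same_qs[OF same_DG same_sym]] qs_mor[OF same_qs] hqD(3,4)[OF assms(3)] assms(1,2) by blast+
 from hq_comp_left[OF hq_comp_right[OF this(1) assms(3)] this(2)] show ?thesis by simp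
qed

subsection \<open>Shifts\<close>

lemma shift_sel [simp]:
 "cgr (dg_shift n M) p = cgr M (p + n)"
 "gact (dg_shift n M) p q = gact M (p + n) q"
 "cdiff (dg_shift n M) p x = koszul_sign n (cgr M (p + n+1)) (cdiff M (p + n) x)"
 by (simp_all add: dg_shift_def)

lemma koszul_cases: "koszul_sign n G x = (if even n then x else \<ominus>\<^bsub>G\<^esub> x)"
 by (simp add: koszul_sign_def)

lemma koszul_in [simp]: "DG M ==> x : cel M p ==> koszul_sign n (cgr M p) x : cel M p"
 by (simp add: koszul_sign_def)

lemma DG_smult_neg: "DG M ==> c : carrier k ==> x : cel M p ==>
  sml M p c (ngt M p x) = ngt M p (sml M p c x)"
 by (rule module.smult_r_minus[OF DG_module])

lemma DG_shift [simp]: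
 assumes M: "DG M" shows "DG (dg_shift n M)"
proof (rule DGI)
 fix p q r :: int
 define m where "m = p + n"
 have i: "p + n = m" "p+1 + n = m+1" "p+2 + n = m+2" "p + q + n = m + q" "p + q+1 + n = m + q+1"
  by (simp_all add: m_def)
 let ?S = "dg_shift n M"
 show "module k (cgr ?S p)" by (simp add: DG_module M)
 show "cdiff ?S p x : cel ?S (p+1)" if "x : cel ?S p" for x
  using that M by (simp add: i)
 show "cdiff ?S p (pls ?S p x y) = pls ?S (p+1) (cdiff ?S p x) (cdiff ?S p y)"
  if "x : cel ?S p" "y : cel ?S p" for x y
  using that M by (simp add: i koszul_cases DG_d_add)
 show "cdiff ?S p (sml ?S p c x) = sml ?S (p+1) c (cdiff ?S p x)"
  if "c : carrier k" "x : cel ?S p" for c x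
  using that M by (simp add: i koszul_cases DG_d_smult DG_smult_neg)
 show "cdiff ?S (p+1) (cdiff ?S p x) = zr ?S (p+2)" if "x : cel ?S p" for x
  using that M by (simp add: i koszul_cases DG_d_neg add.commute[of 2])
 show "gact ?S p q x a : cel ?S (p + q)" if "x : cel ?S p" "a : cel A q" for x a
  using that M by (simp add: i)
 show "gact ?S p q (pls ?S p x y) a = pls ?S (p + q) (gact ?S p q x a) (gact ?S p q y a)"
  if "x : cel ?S p" "y : cel ?S p" "a : cel A q" for x y a
  using that M by (simp add: i DG_act_add)
 show "gact ?S p q x (apl q a b) = pls ?S (p + q) (gact ?S p q x a) (gact ?S p q x b)"
  if "x : cel ?S p" "a : cel A q" "b : cel A q" for x a b
  using that M by (simp add: i DG_act_add2)
 show "gact ?S p q (sml ?S p c x) a = sml ?S (p + q) c (gact ?S p q x a)"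
  "gact ?S p q x (sml A q c a) = sml ?S (p + q) c (gact ?S p q x a)"
  if "c : carrier k" "x : cel ?S p" "a : cel A q" for c x a
  using that M by (simp_all add: i DG_act_smult DG_act_smult2)
 show "gact ?S (p + q) r (gact ?S p q x a) b = gact ?S p (q + r) x (gmul A q r a b)"
  if "x : cel ?S p" "a : cel A q" "b : cel A r" for x a b
  using that M by (simp add: i DG_act_assoc)
 show "gact ?S p 0 x (gone A) = x" if "x : cel ?S p" for x
  using that M by (simp add: i DG_act_one)
 show "cdiff ?S (p + q) (gact ?S p q x a) =
     pls ?S (p + q+1) (gact ?S (p+1) q (cdiff ?S p x) a)
      (koszul_sign p (cgr ?S (p + q+1)) (gact ?S p (q+1) x (cdiff A q a)))"
  if "x : cel ?S p" "a : cel A q" for x a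
 proof -
  have j: "m+1 + q = m + q+1" "even m \<longleftrightarrow> (even p \<longleftrightarrow> even n)" by (auto simp: m_def)
  have x: "x : cel M m" using that by (simp add: i)
  have z: "gact M m (q+1) x (cdiff A q a) : cel M (m + q+1)"
   "gact M (m+1) q (cdiff M m x) a : cel M (m + q+1)"
   using x that(2) M by simp_all
  have w: "gact M (m+1) q (ngt M (m+1) (cdiff M m x)) a = ngt M (m + q+1) (gact M (m+1) q (cdiff M m x) a)"
   using DG_act_neg[OF M, of "cdiff M m x" "m+1" a q] x that(2) M by (simp add: j)
  show ?thesis using x z that(2) M by (simp add: i koszul_cases DG_leibniz w j)
 qed
qed

lemma same_shift_shift:
 assumes M: "DG M" shows "same (dg_shift n (dg_shift m M)) (dg_shift (n + m) M)"
 using M by (auto simp: same_def fun_eq_iff koszul_cases add_ac)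

lemma same_shift_0: "same (dg_shift 0 M) M"
 by (auto simp: same_def fun_eq_iff koszul_cases)

lemma mor_shift:
 assumes "mor M N f" shows "mor (dg_shift n M) (dg_shift n N) (%p. f (p + n))"
proof -
 note F = morD[OF assms]
 have i: "p+1 + n = p + n+1" "p + q + n = p + n + q" for p q by simp_all
 show ?thesis
  by (rule morI, simp_all only: shift_sel i DG_shift F(1,2))
   (auto simp: F koszul_cases)
qed

lemma hq_shift:
 assumes "hq M N f g" shows "hq (dg_shift n M) (dg_shift n N) (%p. f (p + n)) (%p. g (p + n))"
proof (rule hqE[OF assms])
 fix h assume h: "gh (-1) M N h" and e: "!!p x. x : cel M p ==>
   f p x = bnd M N g h p x"
 note F = morD[OF hqD(1)[OF assms]] and G = morD[OF hqD(2)[OF assms]]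
 note H = ghD[OF h]
 \<comment> \<open>The shifted differentials carry the sign (-1)^n, so the homotopy has to carry it
   too for d h + h d to be unchanged.\<close>
 let ?h = "%p x. koszul_sign n (cgr N (p + n - 1)) (h (p + n) x)"
 have "gh (-1) (dg_shift n M) (dg_shift n N) ?h"
 proof (rule ghI)
  fix p q :: int
  define m where "m = p + n"
  have i: "p + n = m" "p+1 + n = m+1" "p - 1 + n = m - 1" "p + q + n = m + q" "p + q+1 + n = m + q+1"
   by (simp_all add: m_def)
  show "?h p x : cel (dg_shift n N) (p + -1)" if "x : cel (dg_shift n M) p" for x
   using that F(2) by (simp add: i H(1) koszul_cases)
  show "?h p (pls (dg_shift n M) p x y) = pls (dg_shift n N) (p + -1) (?h p x) (?h p y)"
   if "x : cel (dg_shift n M) p" "y : cel (dg_shift n M) p" for x y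
   using that F(2) by (simp add: i H(1,2) koszul_cases)
  fix x a assume "x : cel (dg_shift n M) p" "a : cel A q"
  hence x: "x : cel M m" "a : cel A q" by (simp_all add: i)
  have j: "m - 1 + q = m + q - 1" by simp
  have "h (m + q) (gact M m q x a) = gact N (m - 1) q (h m x) a"
   using H(3)[OF x] by simp
  moreover have "gact N (m - 1) q (ngt N (m - 1) (h m x)) a = ngt N (m + q - 1) (gact N (m - 1) q (h m x) a)"
   using DG_act_neg[OF F(2) H(1)[OF x(1)] x(2), of "m - 1"] by (simp add: j)
  ultimately show "?h (p + q) (gact (dg_shift n M) p q x a) = gact (dg_shift n N) (p + -1) q (?h p x) a"
   by (simp add: koszul_cases i)
 qed (use F(1,2) in simp_all)
 thus ?thesis
 proof (rule hqI[OF hqD(1)[OF assms, THEN mor_shift] hqD(2)[OF assms, THEN mor_shift]])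
  fix p x
  define m where "m = p + n"
  have i: "p + n = m" "p+1 + n = m+1" "p - 1 + n = m - 1" "p - 1 + n+1 = m"
   by (simp_all add: m_def)
  assume "x : cel (dg_shift n M) p"
  hence x: "x : cel M m" by (simp add: i)
  have a: "cdiff M m x : cel M (m+1)" "h m x : cel N (m - 1)"
   using x F(1) H(1) by simp_all
  have b: "cdiff N (m - 1) (h m x) : cel N m" "h (m+1) (cdiff M m x) : cel N m"
   using H(1)[OF a(1), of m] a F(2) by simp_all
  have c: "h (m+1) (ngt M (m+1) (cdiff M m x)) = ngt N m (h (m+1) (cdiff M m x))"
   using H(6)[OF F(1,2) a(1)] by simp
  have d: "cdiff N (m - 1) (ngt N (m - 1) (h m x)) = ngt N m (cdiff N (m - 1) (h m x))"
   using DG_d_neg[OF F(2) a(2)] by simp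
  show "f (p + n) x = pls (dg_shift n N) p (g (p + n) x)
      (pls (dg_shift n N) p (cdiff (dg_shift n N) (p - 1) (?h p x)) (?h (p+1) (cdiff (dg_shift n M) p x)))"
   unfolding shift_sel i e[OF x] using b F(2) by (simp add: koszul_cases c d)
 qed
qed

lemma shift_down_same: "DG M ==> same (dg_shift (-n) (dg_shift n M)) M"
 using same_shift_shift[of M "-n" n] same_shift_0[of M] by (simp add: same_def)

lemma mor_shift_iff:
 assumes "DG M" "DG N"
 shows "mor (dg_shift n M) (dg_shift n N) f = mor M N (%p. f (p - n))"
proof
 assume "mor (dg_shift n M) (dg_shift n N) f"
 from mor_shift[OF this, of "-n"] show "mor M N (%p. f (p - n))"
  using same_mor[OF shift_down_same shift_down_same, OF assms] by simp
next
 assume "mor M N (%p. f (p - n))"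
 from mor_shift[OF this, of n] show "mor (dg_shift n M) (dg_shift n N) f" by simp
qed

lemma hq_shift_iff:
 assumes "DG M" "DG N"
 shows "hq (dg_shift n M) (dg_shift n N) f g = hq M N (%p. f (p - n)) (%p. g (p - n))"
proof
 assume "hq (dg_shift n M) (dg_shift n N) f g"
 from hq_shift[OF this, of "-n"] show "hq M N (%p. f (p - n)) (%p. g (p - n))"
  using same_hq[OF shift_down_same shift_down_same, OF assms] by simp
next
 assume "hq M N (%p. f (p - n)) (%p. g (p - n))"
 from hq_shift[OF this, of n] show "hq (dg_shift n M) (dg_shift n N) f g" by simp
qed

lemma qs_shift:
 assumes "qs M N f" shows "qs (dg_shift n M) (dg_shift n N) (%p. f (p + n))"
proof (rule qsI[OF mor_shift[OF qs_mor[OF assms]]])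
 note F = morD[OF qs_mor[OF assms]]
 have kz: "(koszul_sign n (cgr L q) y = zr L q) = (y = zr L q)" if "DG L" "y : cel L q" for L q y
  using that by (metis DG_group_simps(10,11) koszul_sign_def)
 have kk: "koszul_sign n (cgr L (q+1)) (cdiff L q y) = cdiff L q (koszul_sign n (cgr L q) y)"
  if "DG L" "y : cel L q" for L q y
  using that by (simp add: koszul_cases DG_d_neg)
 have i: "p+1 + n = p + n+1" "p+2 + n = p + n+2" "p + n+1+1 = p + n+2" for p by simp_all
 fix p x b assume "x : cel (dg_shift n M) (p+1)" "cdiff (dg_shift n M) (p+1) x = zr (dg_shift n M) (p+2)"
  "b : cel (dg_shift n N) p" "f (p+1 + n) x = cdiff (dg_shift n N) p b"
 hence a: "x : cel M (p + n+1)" "cdiff M (p + n+1) x = zr M (p + n+2)" "b : cel N (p + n)"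
   "f (p + n+1) x = cdiff N (p + n) (koszul_sign n (cgr N (p + n)) b)"
  using F(1,2) by (simp_all add: i kz kk)
 obtain c where c: "c : cel M (p + n)" "x = cdiff M (p + n) c"
  by (rule qs_injE[OF assms a(1,2) koszul_in[OF F(2) a(3)] a(4)])
 have "x = cdiff (dg_shift n M) p (koszul_sign n (cgr M (p + n)) c)"
  using c F(1) by (simp add: koszul_cases DG_d_neg)
 thus "EX c:cel (dg_shift n M) p. x = cdiff (dg_shift n M) p c"
  using koszul_in[OF F(1) c(1)] by (metis shift_sel(1))
next
 note F = morD[OF qs_mor[OF assms]]
 have kz: "(koszul_sign n (cgr L q) y = zr L q) = (y = zr L q)" if "DG L" "y : cel L q" for L q y
  using that by (metis DG_group_simps(10,11) koszul_sign_def)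
 have i: "p+1 + n = p + n+1" "p+2 + n = p + n+2" "p + n+1+1 = p + n+2" for p by simp_all
 fix p y assume "y : cel (dg_shift n N) (p+1)" "cdiff (dg_shift n N) (p+1) y = zr (dg_shift n N) (p+2)"
 hence a: "y : cel N (p + n+1)" "cdiff N (p + n+1) y = zr N (p + n+2)"
  using F(1,2) by (simp_all add: i kz)
 obtain x b where x: "x : cel M (p + n+1)" "cdiff M (p + n+1) x = zr M (p + n+2)" "b : cel N (p + n)"
   "y = pls N (p + n+1) (f (p + n+1) x) (cdiff N (p + n) b)" by (rule qs_surjE[OF assms a])
 have "cdiff (dg_shift n N) p (koszul_sign n (cgr N (p + n)) b) = cdiff N (p + n) b"
  using x F(2) by (simp add: koszul_cases DG_d_neg)
 thus "EX x:cel (dg_shift n M) (p+1). cdiff (dg_shift n M) (p+1) x = zr (dg_shift n M) (p+2) &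
   (EX b:cel (dg_shift n N) p. y = pls (dg_shift n N) (p+1) (f (p+1 + n) x) (cdiff (dg_shift n N) p b))"
  using x F(1,2) koszul_in[OF F(2) x(3), of n]
  by (intro bexI[of _ x] conjI bexI[of _ "koszul_sign n (cgr N (p + n)) b"]) (simp_all add: i kz)
qed

lemma qs_shift_iff:
 assumes "DG M" "DG N"
 shows "qs (dg_shift n M) (dg_shift n N) f = qs M N (%p. f (p - n))"
proof
 assume "qs (dg_shift n M) (dg_shift n N) f"
 from qs_shift[OF this, of "-n"] show "qs M N (%p. f (p - n))"
  using same_qs'[OF shift_down_same shift_down_same, OF assms] by simp
next
 assume "qs M N (%p. f (p - n))"
 from qs_shift[OF this, of n] show "qs (dg_shift n M) (dg_shift n N) f" by simp
qed

end

context dgc begin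

lemma DG_cancel_mid [simp]:
 assumes "DG M" "x : cel M p" "y : cel M p"
 shows "pls M p x (pls M p y (ngt M p x)) = y" "pls M p (ngt M p x) (pls M p y x) = y"
  and "z : cel M p ==> pls M p x (pls M p y (pls M p (ngt M p x) z)) = pls M p y z"
  and "z : cel M p ==> pls M p (ngt M p x) (pls M p y (pls M p x z)) = pls M p y z"
 using assms DG_ac(3)[OF assms] DG_ac(3)[OF assms(1) DG_group_simps(2)[OF assms(1,2)] assms(3)] by simp_all

lemma idx: "1 + p = p + (1 :: int)" "2 + p = p + (2 :: int)"
 by simp_all

subsection \<open>Twisted direct sums\<close>

definition un :: "'m => 'm \<times> 'm" where "un = the_inv pr"

lemma un_pr [simp]: "un (pr z) = z"
 unfolding un_def by (rule the_inv_f_f[OF inj_pr])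

lemma pr_eq [simp]: "(pr z = pr z') = (z = z')"
 using inj_pr by (rule inj_eq)

definition tw :: "('k, 'a, 'm) dgm => ('k, 'a, 'm) dgm => (int => 'm => 'm) => ('k, 'a, 'm) dgm" where
 "tw M N ph =
  \<lparr>cgr = (%p. \<lparr>carrier = pr ` (cel N p \<times> cel M p), monoid.mult = undefined, one = undefined,
    zero = pr (zr N p, zr M p),
    add = (%u v. pr (pls N p (fst (un u)) (fst (un v)), pls M p (snd (un u)) (snd (un v)))),
    smult = (%c u. pr (sml N p c (fst (un u)), sml M p c (snd (un u))))\<rparr>),
  cdiff = (%p u. pr (pls N (p+1) (cdiff N p (fst (un u))) (ph p (snd (un u))), cdiff M p (snd (un u)))),
  gact = (%p q u a. pr (gact N p q (fst (un u)) a, gact M p q (snd (un u)) a))\<rparr>"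

lemma tw_sel [simp]:
 "carrier (cgr (tw M N ph) p) = pr ` (cel N p \<times> cel M p)"
 "zr (tw M N ph) p = pr (zr N p, zr M p)"
 "pls (tw M N ph) p u v = pr (pls N p (fst (un u)) (fst (un v)), pls M p (snd (un u)) (snd (un v)))"
 "sml (tw M N ph) p c u = pr (sml N p c (fst (un u)), sml M p c (snd (un u)))"
 "cdiff (tw M N ph) p u = pr (pls N (p+1) (cdiff N p (fst (un u))) (ph p (snd (un u))), cdiff M p (snd (un u)))"
 "gact (tw M N ph) p q u a = pr (gact N p q (fst (un u)) a, gact M p q (snd (un u)) a)"
 by (simp_all add: tw_def)

lemma pr_in_image [simp]: "(pr (y, x) : pr ` (Y \<times> X)) = (y : Y & x : X)"
 by auto

text \<open>The last clause, d ph + ph d = 0, is exactly what makes the twisted differential square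
  to zero.\<close>

definition tws :: "('k, 'a, 'm) dgm => ('k, 'a, 'm) dgm => (int => 'm => 'm) => bool" where
 "tws M N ph = (DG M & DG N & gh 1 M N ph &
  (ALL p. ALL x:cel M p. pls N (p+2) (cdiff N (p+1) (ph p x)) (ph (p+1) (cdiff M p x)) = zr N (p+2)))"

lemma twsD:
 assumes "tws M N ph"
 shows "DG M" "DG N" "gh 1 M N ph"
  "x : cel M p ==> pls N (p+2) (cdiff N (p+1) (ph p x)) (ph (p+1) (cdiff M p x)) = zr N (p+2)"
 using assms by (auto simp: tws_def)

lemma tw_module:
 assumes M: "DG M" and N: "DG N"
 shows "module k (cgr (tw M N ph) p)"
proof (rule moduleI)
 show "cring k" by (rule k_cring)
 show "abelian_group (cgr (tw M N ph) p)"
 proof (rule abelian_groupI)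
  fix u assume "u : cel (tw M N ph) p"
  then obtain y x where u: "u = pr (y, x)" "y : cel N p" "x : cel M p" by auto
  thus "EX v:cel (tw M N ph) p. pls (tw M N ph) p v u = zr (tw M N ph) p"
   using M N by (intro bexI[of _ "pr (ngt N p y, ngt M p x)"]) simp_all
 qed (use M N in "auto simp: DG_ac")
qed (use M N in \<open>auto simp: module.smult_l_distr[OF DG_module] module.smult_r_distr[OF DG_module]
  module.smult_assoc1[OF DG_module] module.smult_one[OF DG_module]\<close>)

lemma DG_tw:
 assumes "tws M N ph" shows "DG (tw M N ph)"
proof -
 let ?T = "tw M N ph"
 note T = twsD[OF assms]
 note M = T(1) and N = T(2) and P = ghD[OF T(3)]
 show ?thesis
 proof (rule DGI)
  fix p q r :: int and u assume u0: "u : cel ?T p"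
  then obtain y x where u: "u = pr (y, x)" and y: "y : cel N p" and x: "x : cel M p" by auto
  note Px = P(1)[OF x, of "p+1", OF refl]
  show "cdiff ?T p u : cel ?T (p+1)" using M N x y Px by (simp add: u)
  show "cdiff ?T (p+1) (cdiff ?T p u) = zr ?T (p+2)"
  proof -
   have "cdiff N (p+1) (pls N (p+1) (cdiff N p y) (ph p x)) = cdiff N (p+1) (ph p x)"
    using N y Px DG_d_add[OF N, of "cdiff N p y" "p+1" "ph p x"] by (simp add: add.commute[of 2])
   thus ?thesis using M x T(4)[OF x] by (simp add: u add.commute[of 2])
  qed
  fix a assume a: "a : cel A q"
  show "gact ?T p q u a : cel ?T (p + q)" using M N x y a by (simp add: u)
  show "gact ?T (p + q) r (gact ?T p q u a) b = gact ?T p (q + r) u (gmul A q r a b)"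
   if "b : cel A r" for b
   using M N x y a that by (simp add: u DG_act_assoc)
  show "gact ?T p q u (apl q a b) =
    pls ?T (p + q) (gact ?T p q u a) (gact ?T p q u b)" if "b : cel A q" for b
   using M N x y a that by (simp add: u DG_act_add2)
  show "gact ?T p q u (sml A q c a) = sml ?T (p + q) c (gact ?T p q u a)"
   "gact ?T p q (sml ?T p c u) a = sml ?T (p + q) c (gact ?T p q u a)"
   if "c : carrier k" for c
   using M N x y a that by (simp_all add: u DG_act_smult2 DG_act_smult)
  show "cdiff ?T (p + q) (gact ?T p q u a) =
     pls ?T (p + q+1) (gact ?T (p+1) q (cdiff ?T p u) a)
      (koszul_sign p (cgr ?T (p + q+1)) (gact ?T p (q+1) u (cdiff A q a)))"
  proof -
   interpret E: module k "cgr ?T (p + q+1)" by (rule tw_module[OF M N])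
   have ng: "ngt ?T (p + q+1) (pr (y', x')) = pr (ngt N (p + q+1) y', ngt M (p + q+1) x')"
    if "y' : cel N (p + q+1)" "x' : cel M (p + q+1)" for y' x'
    by (rule E.minus_equality) (use that M N in simp_all)
   have i: "p+1 + q = p + q+1" by simp
   have c: "gact N p (q+1) y (cdiff A q a) : cel N (p + q+1)"
    "gact M p (q+1) x (cdiff A q a) : cel M (p + q+1)"
    "gact N (p+1) q (cdiff N p y) a : cel N (p + q+1)"
    "gact M (p+1) q (cdiff M p x) a : cel M (p + q+1)"
    "gact N (p+1) q (ph p x) a : cel N (p + q+1)"
    using M N x y a Px by simp_all
   have d: "gact N (p+1) q (pls N (p+1) (cdiff N p y) (ph p x)) a =
     pls N (p + q+1) (gact N (p+1) q (cdiff N p y) a) (gact N (p+1) q (ph p x) a)"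
    using DG_act_add[OF N, of "cdiff N p y" "p+1" "ph p x" a q] y Px a N by (simp only: i) simp
   show ?thesis
    using M N x y a c by (simp add: u d ng DG_leibniz P(3)[OF x a] koszul_cases DG_ac)
  qed
 next
  fix p q :: int and u v assume "u : cel ?T p" "v : cel ?T p"
  then obtain y x y' x' where u: "u = pr (y, x)" "v = pr (y', x')"
   and y: "y : cel N p" "y' : cel N p" and x: "x : cel M p" "x' : cel M p" by auto
  show "cdiff ?T p (pls ?T p u v) =
    pls ?T (p+1) (cdiff ?T p u) (cdiff ?T p v)"
   using M N x y P(1)[OF x(1), of "p+1"] P(1)[OF x(2), of "p+1"]
   by (simp add: u DG_d_add P(2) DG_ac)
  show "gact ?T p q (pls ?T p u v) a =
    pls ?T (p + q) (gact ?T p q u a) (gact ?T p q v a)" if "a : cel A q" for a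
   using M N x y that by (simp add: u DG_act_add)
 next
  fix p c and u assume c: "c : carrier k" and "u : cel ?T p"
  then obtain y x where u: "u = pr (y, x)" and y: "y : cel N p" and x: "x : cel M p" by auto
  show "cdiff ?T p (sml ?T p c u) = sml ?T (p+1) c (cdiff ?T p u)"
   using M N x y c P(1)[OF x, of "p+1"]
   by (simp add: u DG_d_smult P(4) module.smult_r_distr[OF DG_module])
 next
  fix p and u assume "u : cel ?T p"
  thus "gact ?T p 0 u (gone A) = u" using M N by (auto simp: DG_act_one)
 qed (rule tw_module[OF M N])
qed

lemma tw_ngt:
 assumes "tws M N ph" "y : cel N p" "x : cel M p"
 shows "ngt (tw M N ph) p (pr (y, x)) = pr (ngt N p y, ngt M p x)"
 using DG_neg_unique(1)[OF DG_tw[OF assms(1)], of "pr (y, x)" p "pr (ngt N p y, ngt M p x)"]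
  twsD(1,2)[OF assms(1)] assms(2,3) by simp

lemma mor_tw_in:
 assumes "tws M N ph" shows "mor N (tw M N ph) (%p y. pr (y, zr M p))"
 by (rule morI)
  (use twsD(1,2)[OF assms] ghD(5)[OF twsD(3,1,2)[OF assms]] in "auto simp: DG_tw assms DG_act_zero")

lemma mor_tw_proj:
 assumes "tws M N ph" shows "mor (tw M N ph) M (%p u. snd (un u))"
 by (rule morI) (use twsD(1,2)[OF assms] in "auto simp: DG_tw assms")

lemma gh_tw_incl:
 assumes "tws M N ph" shows "gh 0 M (tw M N ph) (%p x. pr (zr N p, x))"
 by (rule ghI) (use twsD(1,2)[OF assms] in "auto simp: DG_tw assms DG_act_zero")

definition acyc :: "('k, 'a, 'm) dgm => bool" where
 "acyc M = (ALL p. ALL x:cel M (p+1). cdiff M (p+1) x = zr M (p+2) --> (EX c:cel M p. x = cdiff M p c))"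

lemma acycE:
 assumes "acyc M" "x : cel M (p+1)" "cdiff M (p+1) x = zr M (p+2)"
 obtains c where "c : cel M p" "x = cdiff M p c"
 using assms unfolding acyc_def by blast

text \<open>The kernel of the projection is N, which is acyclic; the long exact sequence is replaced
  by an argument on elements.\<close>

lemma qs_tw_proj:
 assumes tw: "tws M N ph" and ac: "acyc N"
 shows "qs (tw M N ph) M (%p u. snd (un u))"
proof (rule qsI[OF mor_tw_proj[OF tw]])
 note T = twsD[OF tw]
 note M = T(1) and N = T(2) and P = ghD[OF T(3)]
 fix p u b assume a: "u : cel (tw M N ph) (p+1)" "cdiff (tw M N ph) (p+1) u = zr (tw M N ph) (p+2)"
   "b : cel M p" "snd (un u) = cdiff M p b"
 from a obtain y where u: "u = pr (y, cdiff M p b)" and y: "y : cel N (p+1)" by auto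
 have Pb: "ph p b : cel N (p+1)" using P(1)[OF a(3)] by simp
 have Pdb: "ph (p+1) (cdiff M p b) : cel N (p+2)" using P(1)[of "cdiff M p b" "p+1"] a(3) M by (simp add: idx)
 have "pls N (p+2) (cdiff N (p+1) y) (ph (p+1) (cdiff M p b)) = zr N (p+2)"
  using a(2) by (simp add: u add.commute[of 2])
 moreover have "pls N (p+2) (cdiff N (p+1) (ph p b)) (ph (p+1) (cdiff M p b)) = zr N (p+2)"
  by (rule T(4)[OF a(3)])
 \<comment> \<open>Thus y - ph b is a cocycle of the acyclic N, and its primitive c completes b to a
   primitive of u.\<close>
 ultimately have "cdiff N (p+1) y = cdiff N (p+1) (ph p b)"
  using DG_cancel(2)[OF N Pdb, of "cdiff N (p+1) y" "cdiff N (p+1) (ph p b)"] y Pb N by (simp add: idx)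
 hence z: "pls N (p+1) y (ngt N (p+1) (ph p b)) : cel N (p+1)"
  "cdiff N (p+1) (pls N (p+1) y (ngt N (p+1) (ph p b))) = zr N (p+2)"
  using y Pb N by (simp_all add: DG_d_add DG_d_neg add.commute[of 2])
 obtain c where c: "c : cel N p" "pls N (p+1) y (ngt N (p+1) (ph p b)) = cdiff N p c"
  by (rule acycE[OF ac z])
 have "y = pls N (p+1) (cdiff N p c) (ph p b)"
  unfolding c(2)[symmetric] using y Pb N by (simp add: DG_ac)
 thus "EX c:cel (tw M N ph) p. u = cdiff (tw M N ph) p c"
  using c(1) a(3) by (intro bexI[of _ "pr (c, b)"]) (simp_all add: u)
next
 note T = twsD[OF tw]
 note M = T(1) and N = T(2) and P = ghD[OF T(3)]
 fix p x assume x: "x : cel M (p+1)" "cdiff M (p+1) x = zr M (p+2)"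
 have Px: "ph (p+1) x : cel N (p+1+1)" using P(1)[OF x(1)] by simp
 have "cdiff N (p+1+1) (ph (p+1) x) = zr N (p+1+2)"
  using T(4)[OF x(1)] x(2) P(5)[OF M N, of "p+2"] Px N DG_d[OF N Px refl] by (simp add: add_ac)
 then obtain c where c: "c : cel N (p+1)" "ph (p+1) x = cdiff N (p+1) c" by (rule acycE[OF ac Px])
 show "EX u:cel (tw M N ph) (p+1). cdiff (tw M N ph) (p+1) u = zr (tw M N ph) (p+2) &
   (EX b:cel M p. x = pls M (p+1) (snd (un u)) (cdiff M p b))"
  using x c M N
  by (intro bexI[of _ "pr (ngt N (p+1) c, x)"] conjI bexI[of _ "zr M p"])
   (simp_all add: DG_d_neg add.commute[of 2])
qed

subsection \<open>Homotopy fibres and the calculus of fractions\<close>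

abbreviation fib where "fib Y Z s \<equiv> tw Y (dg_shift (-1) Z) s"

lemma tws_fib:
 assumes "mor Y Z s" shows "tws Y (dg_shift (-1) Z) s"
proof -
 note S = morD[OF assms]
 have "gh 1 Y (dg_shift (-1) Z) s"
  by (rule ghI) (use S(1,2) in "simp_all add: S")
 thus ?thesis using S(1,2) by (simp add: tws_def S koszul_cases idx)
qed

text \<open>Injectivity of s on cohomology gives a primitive of the Y-component, and surjectivity
  corrects it so that the Z-component fits as well.\<close>

lemma acyc_fib:
 assumes s: "qs Y Z s" shows "acyc (fib Y Z s)"
 unfolding acyc_def
proof (intro allI ballI impI)
 note S = morD[OF qs_mor[OF s]]
 fix p u assume a: "u : cel (fib Y Z s) (p+1)" "cdiff (fib Y Z s) (p+1) u = zr (fib Y Z s) (p+2)"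
 then obtain z y where u: "u = pr (z, y)" and z: "z : cel Z p" and y: "y : cel Y (p+1)" by auto
 have dz: "cdiff Z p z : cel Z (p+1)" using z S(2) by simp
 have e: "pls Z (p+1) (ngt Z (p+1) (cdiff Z p z)) (s (p+1) y) = zr Z (p+1)" "cdiff Y (p+1) y = zr Y (p+2)"
  using a(2) by (simp_all add: u koszul_cases idx)
 from e(1) have sy: "s (p+1) y = cdiff Z p z"
  using DG_neg_unique(1)[OF S(2) _ S(5)[OF y] e(1)] dz S(2) by simp
 obtain c where c: "c : cel Y p" "y = cdiff Y p c" by (rule qs_injE[OF s y e(2) z sy])
 \<comment> \<open>The primitive c of y need not match z. The defect w is a cocycle, so it is s x up
   to a coboundary for some cocycle x; replacing c by c - x repairs the mismatch without changing
   the differential of c.\<close>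
 define w where "w = pls Z p (s p c) (ngt Z p z)"
 have sc: "s p c : cel Z p" "cdiff Z p (s p c) = cdiff Z p z" using c S(5) sy by (simp_all add: S(7))
 have w: "w : cel Z p" "cdiff Z p w = zr Z (p+1)"
  using sc z dz S(2) by (simp_all add: w_def DG_d_add DG_d_neg)
 have w': "w : cel Z (p - 1+1)" "cdiff Z (p - 1+1) w = zr Z (p - 1+2)" using w by (simp_all add: add_ac)
 obtain x b where x: "x : cel Y (p - 1+1)" "cdiff Y (p - 1+1) x = zr Y (p - 1+2)" "b : cel Z (p - 1)"
   "w = pls Z (p - 1+1) (s (p - 1+1) x) (cdiff Z (p - 1) b)" by (rule qs_surjE[OF s w'])
 have x': "x : cel Y p" "cdiff Y p x = zr Y (p+1)" "w = pls Z p (s p x) (cdiff Z (p - 1) b)"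
  using x by (simp_all add: add_ac)
 have db: "cdiff Z (p - 1) b : cel Z p" using x(3) S(2) by simp
 let ?c = "pls Y p c (ngt Y p x)"
 have "cdiff Y p ?c = y" using c x' S(1) y by (simp add: DG_d_add DG_d_neg)
 moreover have "pls Z p (ngt Z p (cdiff Z (p - 1) b)) (s p ?c) = z"
 proof -
  have "pls Z p w z = s p c" using sc z S(2) by (simp add: w_def DG_ac)
  hence "s p ?c = pls Z p (pls Z p w z) (ngt Z p (s p x))"
   using c(1) x'(1) S(1) by (simp add: S(6) S(9))
  also have "... = pls Z p (cdiff Z (p - 1) b) z"
   unfolding x'(3) using S(5)[OF x'(1)] db z S(2) by (simp add: DG_ac)
  finally show ?thesis using db z S(2) by simp
 qed
 ultimately show "EX c:cel (fib Y Z s) p. u = cdiff (fib Y Z s) p c"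
  using c(1) x'(1) x(3) S(1,2) by (intro bexI[of _ "pr (b, ?c)"]) (simp_all add: u koszul_cases)
qed

lemma acyc_shift:
 assumes "DG M" "acyc M" shows "acyc (dg_shift n M)"
 unfolding acyc_def
proof (intro allI ballI impI)
 have i: "p+1 + n = p + n+1" "p+2 + n = p + n+2" "p + n+1+1 = p + n+2" for p by simp_all
 fix p x assume "x : cel (dg_shift n M) (p+1)" "cdiff (dg_shift n M) (p+1) x = zr (dg_shift n M) (p+2)"
 hence x: "x : cel M (p + n+1)" and "koszul_sign n (cgr M (p + n+2)) (cdiff M (p + n+1) x) = zr M (p + n+2)"
  by (simp_all add: i)
 hence "cdiff M (p + n+1) x = zr M (p + n+2)"
  using DG_d[OF assms(1) x, of "p + n+2"] DG_group_simps(10)[OF assms(1), of "cdiff M (p + n+1) x" "p + n+2"]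
   DG_group_simps(11)[OF assms(1), of "p + n+2"] by (auto simp: koszul_cases split: if_splits)
 then obtain c where c: "c : cel M (p + n)" "x = cdiff M (p + n) c" by (rule acycE[OF assms(2) x])
 have "x = cdiff (dg_shift n M) p (koszul_sign n (cgr M (p + n)) c)"
  using c assms(1) by (simp add: koszul_cases DG_d_neg)
 thus "EX c:cel (dg_shift n M) p. x = cdiff (dg_shift n M) p c"
  using koszul_in[OF assms(1) c(1)] by (metis shift_sel(1))
qed

text \<open>The apex is the homotopy pullback: \<open>fib s\<close> is acyclic, so its extension by \<open>X\<close> is quasi-isomorphic to \<open>X\<close>.\<close>

lemma ore:
 assumes f: "mor X Z f" and s: "qs Y Z s"
 obtains Q u v where "DG Q" "qs Q X u" "mor Q Y v" "hq Q Z (gcomp f u) (gcomp s v)"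
proof -
 note F = morD[OF f] and S = morD[OF qs_mor[OF s]]
 let ?F = "fib Y Z s" and ?g = "%p x. pr (f p x, zr Y (p+1))"
 have twF: "tws Y (dg_shift (-1) Z) s" by (rule tws_fib[OF qs_mor[OF s]])
 have gg: "gh 1 X ?F ?g"
  by (rule ghI)
   (use F(1,2) S(1,2) in "auto simp: DG_tw twF F DG_act_zero add_ac")
 have tw: "tws X ?F ?g"
  using gg F(1,2) S(1,2) by (simp add: tws_def DG_tw[OF twF] F S(8) koszul_cases idx)
 let ?Q = "tw X ?F ?g"
 \<comment> \<open>The differential of ((z, y), x) has Z-component - d z + s y + f x. The function z
   is therefore a homotopy between f x and - s y, which forces the sign in
   \<open>?v\<close>.\<close>
 let ?u = "%p c. snd (un c)" and ?v = "%p c. ngt Y p (snd (un (fst (un c))))"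
 have u: "qs ?Q X ?u" by (rule qs_tw_proj[OF tw acyc_fib[OF s]])
 have v: "mor ?Q Y ?v"
  by (rule morI) (use F(1,2) S(1,2) in "auto simp: DG_tw tw DG_act_neg DG_d_neg")
 have h: "gh (-1) ?Q Z (%p c. fst (un (fst (un c))))"
  by (rule ghI) (use F(1,2) S(1,2) in "auto simp: DG_tw tw")
 have "hq ?Q Z (gcomp f ?u) (gcomp s ?v)"
 proof (rule hqI[OF mor_comp[OF qs_mor[OF u] f] mor_comp[OF v qs_mor[OF s]] h])
  fix p c assume "c : cel ?Q p"
  then obtain z y x where c: "c = pr (pr (z, y), x)" and z: "z : cel Z (p - 1)" and y: "y : cel Y p"
   and x: "x : cel X p" by auto
  have dz: "cdiff Z (p - 1) z : cel Z p" using z S(2) by simp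
  show "gcomp f ?u p c = pls Z p (gcomp s ?v p c) (pls Z p (cdiff Z (p - 1) (fst (un (fst (un c)))))
     (fst (un (fst (un (cdiff ?Q p c))))))"
   using dz z y S(1,2) S(5)[OF y] F(5)[OF x] by (simp add: c koszul_cases S(9) DG_ac)
 qed
 thus ?thesis using that[of ?Q ?u ?v] u v DG_tw[OF tw] by blast
qed

text \<open>A null homotopy h of s f is the same as a lift (h, f) of f to the fibre of s. That fibre
  is acyclic, so the fibre of the lift is still quasi-isomorphic to X, and on it the lift, hence f,
  is tautologically null homotopic.\<close>

lemma ore_cancel:
 assumes f: "mor X Y f" and s: "qs Y Z s" and z: "hq X Z (gcomp s f) (hzero Z)"
 obtains T t where "DG T" "qs T X t" "hq T Y (gcomp f t) (hzero Y)"
proof (rule hqE[OF z])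
 note F = morD[OF f] and S = morD[OF qs_mor[OF s]]
 fix h assume h: "gh (-1) X Z h" and e: "!!p x. x : cel X p ==>
   gcomp s f p x = pls Z p (zr Z p) (pls Z p (cdiff Z (p - 1) (h p x)) (h (p+1) (cdiff X p x)))"
 note H = ghD[OF h]
 let ?F = "fib Y Z s" and ?g = "%p x. pr (h p x, f p x)"
 have twF: "tws Y (dg_shift (-1) Z) s" by (rule tws_fib[OF qs_mor[OF s]])
 have g: "mor X ?F ?g"
 proof (rule morI)
  fix p x assume x: "x : cel X p"
  have a: "cdiff Z (p - 1) (h p x) : cel Z p" "h (p+1) (cdiff X p x) : cel Z p"
   using H(1)[OF x, of "p - 1"] H(1)[of "cdiff X p x" "p+1" p] S(2) F(1) x by simp_all
  show "?g (p+1) (cdiff X p x) = cdiff ?F p (?g p x)"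
   using x e[OF x] a S(2) by (simp add: F(7) koszul_cases)
 qed (use F(1,2) S(1,2) in "simp_all add: DG_tw twF F H")
 note T = tws_fib[OF g]
 have t: "qs (fib X ?F ?g) X (%p c. snd (un c))"
  by (rule qs_tw_proj[OF T acyc_shift[OF DG_tw[OF twF] acyc_fib[OF s]]])
 have h': "gh (-1) (fib X ?F ?g) Y (%p c. snd (un (fst (un c))))"
  by (rule ghI) (use F(1,2) in "auto simp: DG_tw[OF T]")
 have "hq (fib X ?F ?g) Y (gcomp f (%p c. snd (un c))) (hzero Y)"
 proof (rule hqI[OF mor_comp[OF qs_mor[OF t] f] mor_zero[OF DG_tw[OF T] F(2)] h'])
  fix p c assume "c : cel (fib X ?F ?g) p"
  then obtain z y x where c: "c = pr (pr (z, y), x)" and z: "z : cel Z (p - 2)" and y: "y : cel Y (p - 1)"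
   and x: "x : cel X p" by auto
  have a: "pls Z (p - 1) (cdiff (dg_shift (- 1) Z) (p - 1) z) (s (p - 1) y) : cel Z (p - 1)"
   using z y S(2) S(5)[OF y] by (simp add: koszul_cases)
  have b: "cdiff Y (p - 1) y : cel Y p" using y S(1) by simp
  have n: "ngt ?F p (cdiff ?F (p - 1) (pr (z, y))) =
    pr (ngt Z (p - 1) (pls Z (p - 1) (cdiff (dg_shift (- 1) Z) (p - 1) z) (s (p - 1) y)), ngt Y p (cdiff Y (p - 1) y))"
   using tw_ngt[OF twF, of _ p] a b by simp
  show "gcomp f (%p c. snd (un c)) p c = pls Y p (zr Y p) (pls Y p (cdiff Y (p - 1) (snd (un (fst (un c)))))
     (snd (un (fst (un (cdiff (fib X ?F ?g) p c))))))"
   using n b F(5)[OF x] S(1) by (simp add: c koszul_cases)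
 qed
 thus ?thesis using that t DG_tw[OF T] by blast
qed

end

subsection \<open>Preadditive categories\<close>

text \<open>Disjointness of the hom sets lets each arrow determine its ends \<open>dm\<close> and
  \<open>cd\<close>. Composability then becomes an equation between objects, which the simplifier
  can discharge.\<close>

locale pcat =
 fixes C :: "('o, 'f, 'z) precat_scheme"
 assumes preadd: "preadditive C"
  and hom_disj: "[|f : Hom C X Y; f : Hom C X' Y'; X : Obj C; Y : Obj C; X' : Obj C; Y' : Obj C|]
   ==> X = X' & Y = Y'"
begin

abbreviation cmp (infixr "**" 70) where "g ** f \<equiv> Cmp C g f"
abbreviation pl (infixl "\<boxplus>" 65) where "f \<boxplus> g \<equiv> HAdd C f g"
abbreviation "idn \<equiv> Idn C"
abbreviation "zz \<equiv> HZero C"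
abbreviation "ob X \<equiv> X : Obj C"

definition "ar f X Y = (ob X & ob Y & f : Hom C X Y)"
definition "arr f = (EX X Y. ar f X Y)"
definition "dm f = (THE X. EX Y. ar f X Y)"
definition "cd f = (THE Y. EX X. ar f X Y)"

lemma ar_iff: "ar f X Y = (arr f & dm f = X & cd f = Y)"
proof
 assume f: "ar f X Y"
 have "ar f X' Y' ==> X' = X & Y' = Y" for X' Y'
  using f hom_disj unfolding ar_def by blast
 thus "arr f & dm f = X & cd f = Y"
  unfolding arr_def dm_def cd_def using f by (blast intro!: the_equality)
next
 assume a: "arr f & dm f = X & cd f = Y"
 then obtain X' Y' where f: "ar f X' Y'" unfolding arr_def by blast
 have "ar f X'' Y'' ==> X'' = X' & Y'' = Y'" for X'' Y''
  using f hom_disj unfolding ar_def by blast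
 hence "dm f = X'" "cd f = Y'"
  unfolding dm_def cd_def using f by (blast intro!: the_equality)+
 thus "ar f X Y" using f a by blast
qed

lemma arr_obj [simp]: "arr f ==> ob (dm f)" "arr f ==> ob (cd f)"
 using ar_iff[of f "dm f" "cd f"] unfolding ar_def by auto

lemma arr_hom [simp]: "arr f ==> dm f = X ==> cd f = Y ==> f : Hom C X Y"
 using ar_iff[of f X Y] unfolding ar_def by auto

lemma homD:
 assumes "f : Hom C X Y" "ob X" "ob Y"
 shows "arr f" "dm f = X" "cd f = Y"
 using assms ar_iff[of f X Y] unfolding ar_def by auto

lemma cat: "category C"
 using preadd by (simp add: preadditive_def)

lemma grp: "ob X ==> ob Y ==> comm_group \<lparr>carrier = Hom C X Y, monoid.mult = HAdd C, one = HZero C X Y\<rparr>"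
 using preadd by (simp add: preadditive_def)

lemma cmp_simps [simp]:
 assumes "arr f" "arr g" "dm g = cd f"
 shows "arr (g ** f)" "dm (g ** f) = dm f" "cd (g ** f) = cd g"
proof -
 have "ALL X:Obj C. ALL Y:Obj C. ALL Z:Obj C. ALL f:Hom C X Y. ALL g:Hom C Y Z. g ** f : Hom C X Z"
  using cat unfolding category_def by blast
 from this[rule_format, of "dm f" "cd f" "cd g" f g] have "g ** f : Hom C (dm f) (cd g)" using assms by simp
 from homD[OF this arr_obj(1)[OF assms(1)] arr_obj(2)[OF assms(2)]]
 show "arr (g ** f)" "dm (g ** f) = dm f" "cd (g ** f) = cd g" .
qed

lemma assoc [simp]:
 assumes "arr f" "arr g" "arr h" "dm g = cd f" "dm h = cd g"
 shows "(h ** g) ** f = h ** (g ** f)"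
proof -
 have "ALL W:Obj C. ALL X:Obj C. ALL Y:Obj C. ALL Z:Obj C.
    ALL f:Hom C W X. ALL g:Hom C X Y. ALL h:Hom C Y Z. Cmp C h (Cmp C g f) = Cmp C (Cmp C h g) f"
  using cat unfolding category_def by blast
 from this[rule_format, of "dm f" "cd f" "cd g" "cd h" f g h] show ?thesis using assms by simp
qed

lemma idn_simps [simp]:
 assumes "ob X" shows "arr (idn X)" "dm (idn X) = X" "cd (idn X) = X"
proof -
 have "idn X : Hom C X X" using cat assms unfolding category_def by blast
 from homD[OF this assms assms] show "arr (idn X)" "dm (idn X) = X" "cd (idn X) = X" .
qed

lemma cmp_idn [simp]:
 assumes "arr f"
 shows "dm f = X ==> f ** idn X = f" "cd f = Y ==> idn Y ** f = f"
proof -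
 have "ALL X:Obj C. ALL Y:Obj C. ALL f:Hom C X Y. Cmp C f (Idn C X) = f & Cmp C (Idn C Y) f = f"
  using cat unfolding category_def by blast
 from this[rule_format, of "dm f" "cd f" f]
 show "dm f = X ==> f ** idn X = f" "cd f = Y ==> idn Y ** f = f"
  using assms by auto
qed

lemma pl_simps [simp]:
 assumes "arr f" "arr g" "dm f = dm g" "cd f = cd g"
 shows "arr (f \<boxplus> g)" "dm (f \<boxplus> g) = dm g" "cd (f \<boxplus> g) = cd g"
proof -
 interpret G: comm_group "\<lparr>carrier = Hom C (dm g) (cd g), monoid.mult = HAdd C, one = zz (dm g) (cd g)\<rparr>"
  by (rule grp) (use assms in simp_all)
 have "f \<boxplus> g : Hom C (dm g) (cd g)" using G.m_closed[of f g] assms by simp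
 from homD[OF this arr_obj[OF assms(2)]]
 show "arr (f \<boxplus> g)" "dm (f \<boxplus> g) = dm g" "cd (f \<boxplus> g) = cd g" .
qed

lemma pl_ac:
 assumes "arr f" "arr g" "dm f = dm g" "cd f = cd g"
 shows "f \<boxplus> g = g \<boxplus> f"
  and "arr h ==> dm h = dm g ==> cd h = cd g ==> (f \<boxplus> g) \<boxplus> h = f \<boxplus> (g \<boxplus> h)"
  and "arr h ==> dm h = dm g ==> cd h = cd g ==> f \<boxplus> (g \<boxplus> h) = g \<boxplus> (f \<boxplus> h)"
proof -
 interpret G: comm_group "\<lparr>carrier = Hom C (dm g) (cd g), monoid.mult = HAdd C, one = zz (dm g) (cd g)\<rparr>"
  by (rule grp) (use assms in simp_all)
 show "f \<boxplus> g = g \<boxplus> f" using G.m_comm[of f g] assms by simp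
 show "arr h ==> dm h = dm g ==> cd h = cd g ==> (f \<boxplus> g) \<boxplus> h = f \<boxplus> (g \<boxplus> h)"
  using G.m_assoc[of f g h] assms by simp
 show "arr h ==> dm h = dm g ==> cd h = cd g ==> f \<boxplus> (g \<boxplus> h) = g \<boxplus> (f \<boxplus> h)"
  using G.m_lcomm[of f g h] assms by simp
qed

lemma zz_simps [simp]:
 assumes "ob X" "ob Y" shows "arr (zz X Y)" "dm (zz X Y) = X" "cd (zz X Y) = Y"
proof -
 interpret G: comm_group "\<lparr>carrier = Hom C X Y, monoid.mult = HAdd C, one = zz X Y\<rparr>" by (rule grp) fact+
 have "zz X Y : Hom C X Y" using G.one_closed by simp
 from homD[OF this assms] show "arr (zz X Y)" "dm (zz X Y) = X" "cd (zz X Y) = Y" .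
qed

lemma pl_zz [simp]:
 assumes "arr f" "dm f = X" "cd f = Y"
 shows "f \<boxplus> zz X Y = f" "zz X Y \<boxplus> f = f"
proof -
 interpret G: comm_group "\<lparr>carrier = Hom C X Y, monoid.mult = HAdd C, one = zz X Y\<rparr>"
  by (rule grp) (use assms in auto)
 show "f \<boxplus> zz X Y = f" "zz X Y \<boxplus> f = f" using G.l_one[of f] G.r_one[of f] assms by simp_all
qed

lemma pl_cancel:
 assumes "arr f" "arr g" "arr h" "dm g = dm f" "dm h = dm f" "cd g = cd f" "cd h = cd f"
 shows "(f \<boxplus> g = f \<boxplus> h) = (g = h)" "(g \<boxplus> f = h \<boxplus> f) = (g = h)"
proof -
 interpret G: comm_group "\<lparr>carrier = Hom C (dm f) (cd f), monoid.mult = HAdd C, one = zz (dm f) (cd f)\<rparr>"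
  by (rule grp) (use assms in auto)
 show "(g \<boxplus> f = h \<boxplus> f) = (g = h)" using G.right_cancel[of f g h] assms by simp
 thus "(f \<boxplus> g = f \<boxplus> h) = (g = h)" using pl_ac(1)[of g f] pl_ac(1)[of h f] assms by simp
qed

definition ng where "ng f = (SOME g. arr g & dm g = dm f & cd g = cd f & g \<boxplus> f = zz (dm f) (cd f))"

lemma ng_all:
 assumes "arr f" shows "arr (ng f) & dm (ng f) = dm f & cd (ng f) = cd f & ng f \<boxplus> f = zz (dm f) (cd f)"
proof -
 interpret G: comm_group "\<lparr>carrier = Hom C (dm f) (cd f), monoid.mult = HAdd C, one = zz (dm f) (cd f)\<rparr>"
  by (rule grp) (use assms in auto)
 obtain g where g: "g : Hom C (dm f) (cd f)" "g \<boxplus> f = zz (dm f) (cd f)"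
  using G.l_inv_ex[of f] assms by auto
 from homD[OF g(1) arr_obj[OF assms]] g(2)
 have "EX g. arr g & dm g = dm f & cd g = cd f & g \<boxplus> f = zz (dm f) (cd f)" by blast
 thus ?thesis unfolding ng_def by (rule someI_ex)
qed

lemma ng_simps [simp]:
 assumes "arr f" shows "arr (ng f)" "dm (ng f) = dm f" "cd (ng f) = cd f"
  "dm f = X ==> cd f = Y ==> ng f \<boxplus> f = zz X Y" "f \<boxplus> ng f = zz (dm f) (cd f)"
 using ng_all[OF assms] pl_ac(1)[of f "ng f"] assms by auto

lemma ng_unique: "arr f ==> arr g ==> dm g = dm f ==> cd g = cd f ==> g \<boxplus> f = zz (dm f) (cd f) ==> g = ng f"
 using pl_cancel(2)[of f g "ng f"] by simp

lemma ng_ng [simp]: "arr f ==> ng (ng f) = f"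
 using ng_unique[of "ng f" f] by simp

lemma dist [simp]:
 assumes "arr f" "arr f'" "dm f' = dm f" "cd f' = cd f" "arr g" "dm g = cd f"
 shows "g ** (f \<boxplus> f') = g ** f \<boxplus> g ** f'"
proof -
 have "ALL X:Obj C. ALL Y:Obj C. ALL Z:Obj C. ALL f:Hom C X Y. ALL f':Hom C X Y. ALL g:Hom C Y Z. ALL g':Hom C Y Z.
    Cmp C g (HAdd C f f') = HAdd C (Cmp C g f) (Cmp C g f')"
  using preadd unfolding preadditive_def by blast
 from this[rule_format, of "dm f" "cd f" "cd g" f f' g g] show ?thesis using assms by simp
qed

lemma dist2 [simp]:
 assumes "arr g" "arr g'" "dm g' = dm g" "cd g' = cd g" "arr f" "dm g = cd f"
 shows "(g \<boxplus> g') ** f = g ** f \<boxplus> g' ** f"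
proof -
 have "ALL X:Obj C. ALL Y:Obj C. ALL Z:Obj C. ALL f:Hom C X Y. ALL f':Hom C X Y. ALL g:Hom C Y Z. ALL g':Hom C Y Z.
    Cmp C (HAdd C g g') f = HAdd C (Cmp C g f) (Cmp C g' f)"
  using preadd unfolding preadditive_def by blast
 from this[rule_format, of "dm f" "cd f" "cd g" f f g g'] show ?thesis using assms by simp
qed

lemma cmp_zz [simp]:
 assumes "arr f"
 shows "ob X ==> dm f = Y ==> f ** zz X Y = zz X (cd f)"
  and "ob Z ==> cd f = Y ==> zz Y Z ** f = zz (dm f) Z"
proof -
 show "f ** zz X Y = zz X (cd f)" if "ob X" "dm f = Y"
 proof -
  have Y: "ob Y" using assms that by auto
  have "f ** zz X Y \<boxplus> f ** zz X Y = f ** (zz X Y \<boxplus> zz X Y)" using assms that Y by (subst dist) simp_all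
  also have "... = f ** zz X Y \<boxplus> zz X (cd f)" using assms that Y by simp
  finally show ?thesis using assms that Y by (subst (asm) pl_cancel) simp_all
 qed
 show "zz Y Z ** f = zz (dm f) Z" if "ob Z" "cd f = Y"
 proof -
  have Y: "ob Y" using assms that by auto
  have "zz Y Z ** f \<boxplus> zz Y Z ** f = (zz Y Z \<boxplus> zz Y Z) ** f" using assms that Y by (subst dist2) simp_all
  also have "... = zz Y Z ** f \<boxplus> zz (dm f) Z" using assms that Y by simp
  finally show ?thesis using assms that Y by (subst (asm) pl_cancel) simp_all
 qed
qed

lemma cmp_ng [simp]:
 assumes "arr f" "arr g" "dm g = cd f"
 shows "g ** ng f = ng (g ** f)" "ng g ** f = ng (g ** f)"
proof -
 have "g ** ng f \<boxplus> g ** f = zz (dm f) (cd g)" using dist[of "ng f" f g] assms by (simp del: dist)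
 thus "g ** ng f = ng (g ** f)" using assms by (intro ng_unique) simp_all
 have "ng g ** f \<boxplus> g ** f = zz (dm f) (cd g)" using dist2[of "ng g" g f] assms by (simp del: dist2)
 thus "ng g ** f = ng (g ** f)" using assms by (intro ng_unique) simp_all
qed

lemma ng_zz [simp]: "ob X ==> ob Y ==> ng (zz X Y) = zz X Y"
 by (rule ng_unique[symmetric]) simp_all

lemma ng_eq_zz: "arr f ==> ob X ==> ob Y ==> (ng f = zz X Y) = (f = zz X Y)"
 by (metis ng_ng ng_zz)

lemma diff_zero:
 assumes "arr f" "arr g" "dm f = dm g" "cd f = cd g" "f \<boxplus> ng g = zz (dm g) (cd g)"
 shows "f = g"
proof (rule pl_cancel(2)[THEN iffD1])
 show "f \<boxplus> ng g = g \<boxplus> ng g" using assms(5) ng_simps(5)[OF assms(2)] by (rule trans[OF _ sym])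
qed (simp_all add: assms(1-4))

definition iso where
 "iso f = (arr f & (EX g. arr g & dm g = cd f & cd g = dm f & g ** f = idn (dm f) & f ** g = idn (cd f)))"

definition iv where
 "iv f = (SOME g. arr g & dm g = cd f & cd g = dm f & g ** f = idn (dm f) & f ** g = idn (cd f))"

lemma iso_arr [simp]: "iso f ==> arr f"
 by (simp add: iso_def)

lemma iv_simps [simp]:
 assumes "iso f"
 shows "arr (iv f)" "dm (iv f) = cd f" "cd (iv f) = dm f" "iv f ** f = idn (dm f)" "f ** iv f = idn (cd f)"
 using someI_ex[of "%g. arr g & dm g = cd f & cd g = dm f & g ** f = idn (dm f) & f ** g = idn (cd f)"] assms
 unfolding iv_def[symmetric] iso_def by auto

lemma iv_cancel [simp]:
 assumes "iso f" "arr h"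
 shows "cd h = dm f ==> iv f ** (f ** h) = h" "cd h = cd f ==> f ** (iv f ** h) = h"
proof -
 show "iv f ** (f ** h) = h" if "cd h = dm f"
  using that assms assoc[of h f "iv f"] by (simp del: assoc)
 show "f ** (iv f ** h) = h" if "cd h = cd f"
  using that assms assoc[of h "iv f" f] by (simp del: assoc)
qed

lemma isoI: "arr f ==> arr g ==> dm g = cd f ==> cd g = dm f ==> g ** f = idn (dm f) ==> f ** g = idn (cd f) ==> iso f"
 unfolding iso_def by blast

lemma iso_iv [simp]: "iso f ==> iso (iv f)"
 by (rule isoI[of _ f]) simp_all

lemma iso_idn [simp]: "ob X ==> iso (idn X)"
 by (rule isoI[of _ "idn X"]) simp_all

lemma iso_cmp [simp]: "iso f ==> iso g ==> dm g = cd f ==> iso (g ** f)"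
 by (rule isoI[of _ "iv f ** iv g"]) simp_all

lemma iso_ng [simp]: "iso f ==> iso (ng f)"
 by (rule isoI[of _ "ng (iv f)"]) simp_all

lemma is_iso_iff: "ob X ==> ob Y ==> is_iso C X Y f = (iso f & dm f = X & cd f = Y)"
proof
 assume X: "ob X" "ob Y" and "is_iso C X Y f"
 then obtain g where g: "f : Hom C X Y" "g : Hom C Y X" "g ** f = idn X" "f ** g = idn Y"
  unfolding is_iso_def by blast
 from homD[OF g(1) X] homD[OF g(2) X(2,1)] g(3,4) show "iso f & dm f = X & cd f = Y"
  unfolding iso_def by blast
next
 assume "iso f & dm f = X & cd f = Y"
 thus "is_iso C X Y f" unfolding is_iso_def by (auto intro!: bexI[of _ "iv f"])
qed

lemma iso_mono:
 assumes "iso f" "arr g" "arr h" "cd g = dm f" "cd h = dm f" "f ** g = f ** h" shows "g = h"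
proof -
 have "iv f ** (f ** g) = iv f ** (f ** h)" by (simp only: assms(6))
 thus ?thesis by (simp only: iv_cancel(1)[OF assms(1,2,4)] iv_cancel(1)[OF assms(1,3,5)])
qed

lemma iso_epi:
 assumes "iso f" "arr g" "arr h" "dm g = cd f" "dm h = cd f" "g ** f = h ** f" shows "g = h"
proof -
 have "(g ** f) ** iv f = (h ** f) ** iv f" using assms(6) by simp
 thus ?thesis using assms(1-5) by simp
qed

definition isom where "isom X Y = (EX f. iso f & dm f = X & cd f = Y)"

lemma isomI: "iso f ==> dm f = X ==> cd f = Y ==> isom X Y"
 unfolding isom_def by blast

lemma isomE:
 assumes "isom X Y" obtains f where "iso f" "dm f = X" "cd f = Y"
 using assms unfolding isom_def by blast

lemma isom_ob: "isom X Y ==> ob X" "isom X Y ==> ob Y"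
 unfolding isom_def by auto

lemma isom_sym: "isom X Y ==> isom Y X"
 by (erule isomE, rule isomI[OF iso_iv]) auto

lemma isom_trans: "isom X Y ==> isom Y Z ==> isom X Z"
proof (elim isomE)
 fix f g assume "iso f" "dm f = X" "cd f = Y" "iso g" "dm g = Y" "cd g = Z"
 thus "isom X Z" by (intro isomI[of "g ** f"]) simp_all
qed

lemma isom_refl: "ob X ==> isom X X"
 by (rule isomI[OF iso_idn]) auto

definition null where "null X = (ob X & idn X = zz X X)"

lemma null_arr:
 assumes "null X" "arr f"
 shows "dm f = X ==> f = zz X (cd f)" "cd f = X ==> f = zz (dm f) X"
proof -
 have X: "ob X" "idn X = zz X X" using assms(1) by (simp_all add: null_def)
 show "f = zz X (cd f)" if "dm f = X"
  using cmp_idn(1)[OF assms(2) that] cmp_zz(1)[OF assms(2) X(1) that] X(2) by simp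
 show "f = zz (dm f) X" if "cd f = X"
  using cmp_idn(2)[OF assms(2) that] cmp_zz(2)[OF assms(2) X(1) that] X(2) by simp
qed

lemma zero_object_iff: "zero_object C X = null X"
proof
 assume z: "zero_object C X"
 hence X: "ob X" and u: "EX! f. f : Hom C X X" unfolding zero_object_def by auto
 have "idn X : Hom C X X" "zz X X : Hom C X X" using X by simp_all
 hence "idn X = zz X X" using u by blast
 thus "null X" unfolding null_def using X by blast
next
 assume n: "null X"
 hence X: "ob X" unfolding null_def by blast
 have "(EX! f. f : Hom C Y X) & (EX! f. f : Hom C X Y)" if "ob Y" for Y
 proof (intro conjI ex1I)
  show "zz Y X : Hom C Y X" "zz X Y : Hom C X Y" using X that by simp_all
  show "f = zz Y X" if f: "f : Hom C Y X" for f
   using null_arr(2)[OF n, of f] homD[OF f \<open>ob Y\<close> X] by simp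
  show "f = zz X Y" if f: "f : Hom C X Y" for f
   using null_arr(1)[OF n, of f] homD[OF f X \<open>ob Y\<close>] by simp
 qed
 thus "zero_object C X" unfolding zero_object_def using X by blast
qed

lemma null_isom:
 assumes "null X" "isom X Y" shows "null Y"
proof (rule isomE[OF assms(2)])
 fix f assume f: "iso f" "dm f = X" "cd f = Y"
 have X: "ob X" and Y: "ob Y" using isom_ob[OF assms(2)] by auto
 have "f = zz X Y" using null_arr(1)[OF assms(1) iso_arr[OF f(1)] f(2)] f(3) by simp
 hence "f ** iv f = zz Y Y" using cmp_zz(2)[OF iv_simps(1)[OF f(1)], of Y X] f X Y by simp
 thus "null Y" using f Y by (simp add: null_def)
qed

lemma biprod_iff: "is_biproduct C X Y P = (ob X & ob Y & ob P &
 (EX i1 i2 p1 p2. ar i1 X P & ar i2 Y P & ar p1 P X & ar p2 P Y &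
   p1 ** i1 = idn X & p2 ** i2 = idn Y & p2 ** i1 = zz X Y & p1 ** i2 = zz Y X &
   i1 ** p1 \<boxplus> i2 ** p2 = idn P))"
proof
 assume "is_biproduct C X Y P"
 then obtain i1 i2 p1 p2 where "ob X" "ob Y" "ob P" "i1 : Hom C X P" "i2 : Hom C Y P" "p1 : Hom C P X" "p2 : Hom C P Y"
  "p1 ** i1 = idn X" "p2 ** i2 = idn Y" "p2 ** i1 = zz X Y" "p1 ** i2 = zz Y X" "i1 ** p1 \<boxplus> i2 ** p2 = idn P"
  unfolding is_biproduct_def by (elim conjE bexE) rule
 thus "ob X & ob Y & ob P & (EX i1 i2 p1 p2. ar i1 X P & ar i2 Y P & ar p1 P X & ar p2 P Y &
   p1 ** i1 = idn X & p2 ** i2 = idn Y & p2 ** i1 = zz X Y & p1 ** i2 = zz Y X &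
   i1 ** p1 \<boxplus> i2 ** p2 = idn P)"
  by (intro conjI exI[of _ i1] exI[of _ i2] exI[of _ p1] exI[of _ p2]) (simp_all only: ar_def)
next
 assume "ob X & ob Y & ob P & (EX i1 i2 p1 p2. ar i1 X P & ar i2 Y P & ar p1 P X & ar p2 P Y &
   p1 ** i1 = idn X & p2 ** i2 = idn Y & p2 ** i1 = zz X Y & p1 ** i2 = zz Y X &
   i1 ** p1 \<boxplus> i2 ** p2 = idn P)"
 then obtain i1 i2 p1 p2 where "ob X" "ob Y" "ob P" "i1 : Hom C X P" "i2 : Hom C Y P" "p1 : Hom C P X" "p2 : Hom C P Y"
  "p1 ** i1 = idn X" "p2 ** i2 = idn Y" "p2 ** i1 = zz X Y" "p1 ** i2 = zz Y X" "i1 ** p1 \<boxplus> i2 ** p2 = idn P"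
  unfolding ar_def by (elim conjE exE) rule
 thus "is_biproduct C X Y P"
  unfolding is_biproduct_def
  by (intro conjI bexI[of _ i1] bexI[of _ i2] bexI[of _ p1] bexI[of _ p2])
qed

end

context dgc begin

notation gcomp (infixr "oo" 70)

subsection \<open>Roofs\<close>

abbreviation "rr \<equiv> (roof_rel k A :: ('k, 'a, 'm) roof rel)"

text \<open>When both legs of the cospan are quasi-isomorphisms, two-out-of-three upgrades the
  second projection of the homotopy pullback.\<close>

lemma ore_qs:
 assumes "qs X Z f" "qs Y Z s"
 obtains Q u v where "DG Q" "qs Q X u" "qs Q Y v" "hq Q Z (f oo u) (s oo v)"
proof -
 obtain Q u v where Q: "DG Q" "qs Q X u" "mor Q Y v" "hq Q Z (f oo u) (s oo v)"
  by (rule ore[OF qs_mor[OF assms(1)] assms(2)])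
 thus ?thesis using that qs_cancel[OF Q(3) assms(2) qs_hq[OF Q(4) qs_comp[OF Q(2) assms(1)]]] by blast
qed

text \<open>\<open>ore_cancel\<close> is applied to the difference f - g.\<close>

lemma ore_cancel2:
 assumes f: "mor X Y f" and g: "mor X Y g" and s: "qs Y Z s" and z: "hq X Z (s oo f) (s oo g)"
 obtains T t where "DG T" "qs T X t" "hq T Y (f oo t) (g oo t)"
proof -
 note F = morD[OF f] and G = morD[OF g] and S = morD[OF qs_mor[OF s]]
 let ?d = "hadd Y f (hneg Y g)"
 have d: "mor X Y ?d" by (rule mor_add[OF f mor_neg[OF g]])
 have sg: "mor X Z (s oo g)" by (rule mor_comp[OF g qs_mor[OF s]])
 have "hq X Z (hadd Z (s oo f) (hneg Z (s oo g))) (hadd Z (s oo g) (hneg Z (s oo g)))"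
  by (rule hq_add[OF z hq_refl[OF mor_neg[OF sg]]])
 moreover have "hq X Z (s oo ?d) (hadd Z (s oo f) (hneg Z (s oo g)))"
  by (rule hq_ext) (use mor_comp[OF d qs_mor[OF s]] mor_add[OF hqD(1)[OF z] mor_neg[OF sg]] F(5) G(5) G(2)
   in "simp_all add: S(6) S(9)")
 moreover have "hq X Z (hadd Z (s oo g) (hneg Z (s oo g))) (hzero Z)"
  by (rule hq_ext) (use mor_add[OF sg mor_neg[OF sg]] mor_zero[OF F(1) S(2)] morD(5)[OF sg] S(2) in simp_all)
 ultimately have "hq X Z (s oo ?d) (hzero Z)" using hq_trans by blast
 from ore_cancel[OF d s this] obtain T t where t: "DG T" "qs T X t" "hq T Y (?d oo t) (hzero Y)" by blast
 note T = morD[OF qs_mor[OF t(2)]]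
 have gt: "mor T Y (g oo t)" and ft: "mor T Y (f oo t)" using mor_comp qs_mor[OF t(2)] f g by blast+
 have "hq T Y (hadd Y (?d oo t) (g oo t)) (hadd Y (hzero Y) (g oo t))"
  by (rule hq_add[OF t(3) hq_refl[OF gt]])
 moreover have "hq T Y (f oo t) (hadd Y (?d oo t) (g oo t))"
  by (rule hq_ext[OF ft mor_add[OF hqD(1)[OF t(3)] gt]])
   (use F(2) F(5)[OF T(5)] G(5)[OF T(5)] in "simp add: DG_ac")
 moreover have "hq T Y (hadd Y (hzero Y) (g oo t)) (g oo t)"
  by (rule hq_ext[OF mor_add[OF mor_zero[OF t(1) F(2)] gt] gt]) (use F(2) G(5)[OF T(5)] in simp)
 ultimately show ?thesis using that t(1,2) hq_trans by blast
qed

definition mk :: "('k, 'a, 'm) dgm => ('k, 'a, 'm) dgm => ('k, 'a, 'm) dgm => (int => 'm => 'm) =>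
  (int => 'm => 'm) => ('k, 'a, 'm) roof" where
 "mk X P Y s f = \<lparr>src = X, apex = P, tgt = Y, den = s, num = f\<rparr>"

lemma mk_sel [simp]: "src (mk X P Y s f) = X" "apex (mk X P Y s f) = P" "tgt (mk X P Y s f) = Y"
 "den (mk X P Y s f) = s" "num (mk X P Y s f) = f"
 by (simp_all add: mk_def)

lemma mk_cases: "r = mk (src r) (apex r) (tgt r) (den r) (num r)"
 by (simp add: mk_def)

lemma is_roof_iff: "is_roof k A (r :: ('k, 'a, 'm) roof) = (qs (apex r) (src r) (den r) & mor (apex r) (tgt r) (num r))"
 by (auto simp: is_roof_def qs_def mor_def)

text \<open>\<open>roof_rel\<close> only demands that the composite denominator be a
  quasi-isomorphism. Two-out-of-three turns this into a condition on u and v themselves, which is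
  symmetric in the two roofs.\<close>

lemma rr_iff: "((r, r') : rr) = (is_roof k A r & is_roof k A r' & src r = src r' & tgt r = tgt r' &
  (EX Q u v. qs Q (apex r) u & qs Q (apex r') v &
    hq Q (src r) (den r oo u) (den r' oo v) & hq Q (tgt r) (num r oo u) (num r' oo v)))" (is "?L = ?R")
proof
 assume ?L
 then obtain Q u v where Q: "is_roof k A r" "is_roof k A r'" "src r = src r'" "tgt r = tgt r'" "DG Q"
   "hom Q (apex r) u" "hom Q (apex r') v" "qis Q (src r) (den r oo u)"
   "heq Q (src r) (den r oo u) (den r' oo v)" "heq Q (tgt r) (num r oo u) (num r' oo v)"
  unfolding roof_rel_def by auto
 have r: "qs (apex r) (src r) (den r)" "mor (apex r) (tgt r) (num r)"
  "qs (apex r') (src r) (den r')" "mor (apex r') (tgt r) (num r')"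
  using Q(1-4) is_roof_iff[of r] is_roof_iff[of r'] by simp_all
 have u: "mor Q (apex r) u" and v: "mor Q (apex r') v"
  using Q(5-7) r by (auto simp: qs_def mor_def)
 have 1: "hq Q (src r) (den r oo u) (den r' oo v)" "hq Q (tgt r) (num r oo u) (num r' oo v)"
  using Q(9,10) mor_comp u v r qs_mor unfolding hq_def by blast+
 have 2: "qs Q (src r) (den r oo u)" using Q(5,8) r(1) by (auto simp: qs_def)
 have "qs Q (apex r) u" "qs Q (apex r') v"
  using qs_cancel[OF u r(1) 2] qs_cancel[OF v r(3) qs_hq[OF 1(1) 2]] by blast+
 thus ?R using Q(1-4) 1 by blast
next
 assume ?R
 then obtain Q u v where Q: "is_roof k A r" "is_roof k A r'" "src r = src r'" "tgt r = tgt r'"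
   "qs Q (apex r) u" "qs Q (apex r') v"
   "hq Q (src r) (den r oo u) (den r' oo v)" "hq Q (tgt r) (num r oo u) (num r' oo v)" by blast
 have "qs Q (src r) (den r oo u)" using qs_comp[OF Q(5)] Q(1) is_roof_iff by blast
 thus ?L
  unfolding roof_rel_def using Q qs_mor[OF Q(5)] qs_mor[OF Q(6)] by (auto simp: hq_def qs_def mor_def)
qed

lemma rr_refl: "is_roof k A r ==> (r, r) : rr"
 unfolding rr_iff is_roof_iff
 by (auto intro!: exI[of _ "apex r"] exI[of _ hid] qs_id hq_refl intro: qs_mor dest: morD(1))

lemma rr_sym: "(r, r') : rr ==> (r', r) : rr"
 unfolding rr_iff by (metis hq_sym)

text \<open>The two comparison apexes are joined by an Ore square over the apex of the middle
  roof.\<close>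

lemma rr_trans:
 assumes "(r1, r2) : rr" "(r2, r3) : rr" shows "(r1, r3) : rr"
proof -
 obtain Q u v where Q: "qs Q (apex r1) u" "qs Q (apex r2) v"
    "hq Q (src r1) (den r1 oo u) (den r2 oo v)" "hq Q (tgt r1) (num r1 oo u) (num r2 oo v)"
  using assms(1) unfolding rr_iff by blast
 obtain Q' u' v' where Q': "qs Q' (apex r2) u'" "qs Q' (apex r3) v'"
    "hq Q' (src r2) (den r2 oo u') (den r3 oo v')" "hq Q' (tgt r2) (num r2 oo u') (num r3 oo v')"
  using assms(2) unfolding rr_iff by blast
 obtain W a b where W: "qs W Q a" "qs W Q' b" "hq W (apex r2) (v oo a) (u' oo b)"
  by (rule ore_qs[OF Q(2) Q'(1)])
 have e: "src r2 = src r1" "tgt r2 = tgt r1" using assms unfolding rr_iff by auto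
 have m: "mor (apex r2) (src r1) (den r2)" "mor (apex r2) (tgt r1) (num r2)"
  using assms(1) unfolding rr_iff is_roof_iff using qs_mor by auto
 have "hq W (src r1) ((den r1 oo u) oo a) ((den r3 oo v') oo b)"
  using hq_trans[OF hq_trans[OF hq_comp_right[OF qs_mor[OF W(1)] Q(3)] hq_comp_left[OF W(3) m(1), folded gcomp_assoc]]
   hq_comp_right[OF qs_mor[OF W(2)] Q'(3)[unfolded e]]] .
 moreover have "hq W (tgt r1) ((num r1 oo u) oo a) ((num r3 oo v') oo b)"
  using hq_trans[OF hq_trans[OF hq_comp_right[OF qs_mor[OF W(1)] Q(4)] hq_comp_left[OF W(3) m(2), folded gcomp_assoc]]
   hq_comp_right[OF qs_mor[OF W(2)] Q'(4)[unfolded e]]] .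
 ultimately show ?thesis
  unfolding rr_iff using assms qs_comp[OF W(1) Q(1)] qs_comp[OF W(2) Q'(2)]
  by (auto simp: rr_iff gcomp_assoc)
qed

definition cl :: "('k, 'a, 'm) dgm => ('k, 'a, 'm) dgm => ('k, 'a, 'm) dgm => (int => 'm => 'm) =>
  (int => 'm => 'm) => ('k, 'a, 'm) roof set" where
 "cl X P Y s f = rr `` {mk X P Y s f}"

definition rf where "rf X P Y s f = (qs P X s & mor P Y f)"

lemma rfD: "rf X P Y s f ==> qs P X s" "rf X P Y s f ==> mor P Y f" "rf X P Y s f ==> mor P X s"
 "rf X P Y s f ==> DG X" "rf X P Y s f ==> DG P" "rf X P Y s f ==> DG Y"
 by (auto simp: rf_def dest: qs_mor morD(1,2))

lemma rfI: "qs P X s ==> mor P Y f ==> rf X P Y s f"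
 by (simp add: rf_def)

lemma rf_is_roof: "is_roof k A (mk X P Y s f) = rf X P Y s f"
 by (simp add: is_roof_iff rf_def)

lemma class_eq: "is_roof k A r ==> (rr `` {r} = rr `` {r'}) = ((r, r') : rr)"
 using rr_refl rr_sym rr_trans by blast

lemma class_Union:
 assumes "r : S" "!!r'. r' : S ==> (r, r') : rr" shows "rr `` S = rr `` {r}"
 using assms rr_trans by blast

lemma cl_eqI:
 assumes "rf X P Y s f" "rf X P' Y s' f'" "qs Q P u" "mor Q P' v"
  "hq Q X (s oo u) (s' oo v)" "hq Q Y (f oo u) (f' oo v)"
 shows "cl X P Y s f = cl X P' Y s' f'"
proof -
 have "qs Q P' v"
  using qs_cancel[OF assms(4) rfD(1)[OF assms(2)] qs_hq[OF assms(5) qs_comp[OF assms(3) rfD(1)[OF assms(1)]]]] .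
 hence "(mk X P Y s f, mk X P' Y s' f') : rr"
  unfolding rr_iff rf_is_roof using assms by auto
 thus ?thesis unfolding cl_def using class_eq rf_is_roof assms(1) by blast
qed

lemma cl_eqD:
 assumes "rf X P Y s f" "cl X P Y s f = cl X P' Y s' f'"
 obtains Q u v where "qs Q P u" "qs Q P' v" "hq Q X (s oo u) (s' oo v)" "hq Q Y (f oo u) (f' oo v)"
proof -
 have "(mk X P Y s f, mk X P' Y s' f') : rr"
  using assms class_eq rf_is_roof unfolding cl_def by blast
 thus ?thesis unfolding rr_iff using that by auto
qed

lemma in_cl:
 assumes "r : cl X P Y s f" "rf X P Y s f"
 shows "src r = X" "tgt r = Y" "rf X (apex r) Y (den r) (num r)" "cl X (apex r) Y (den r) (num r) = cl X P Y s f"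
proof -
 have r: "(mk X P Y s f, r) : rr" using assms by (simp add: cl_def)
 thus e: "src r = X" "tgt r = Y" unfolding rr_iff by auto
 have r2: "r = mk X (apex r) Y (den r) (num r)" using mk_cases[of r] e by simp
 thus "rf X (apex r) Y (den r) (num r)" using r unfolding rr_iff by (metis rf_is_roof)
 show "cl X (apex r) Y (den r) (num r) = cl X P Y s f"
  unfolding cl_def r2[symmetric] using class_eq[of "mk X P Y s f" r] r rr_iff by blast
qed

lemma cl_self: "rf X P Y s f ==> mk X P Y s f : cl X P Y s f"
 using rr_refl rf_is_roof by (simp add: cl_def)

lemma cl_hq:
 assumes "rf X P Y s f" "hq P X s s'" "hq P Y f f'" shows "cl X P Y s f = cl X P Y s' f'"
proof (rule cl_eqI[OF assms(1) rfI])
 show "qs P X s'" using qs_hq assms(1,2) rfD(1) by blast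
 show "qs P P hid" "mor P P hid" using qs_id mor_id rfD(5)[OF assms(1)] by blast+
qed (use assms hqD in auto)

lemma cl_refine:
 assumes "rf X P Y s f" "qs Q P u" shows "cl X P Y s f = cl X Q Y (s oo u) (f oo u)" "rf X Q Y (s oo u) (f oo u)"
proof -
 show r: "rf X Q Y (s oo u) (f oo u)"
  using assms qs_comp mor_comp qs_mor unfolding rf_def by blast
 show "cl X P Y s f = cl X Q Y (s oo u) (f oo u)"
  by (rule cl_eqI[OF assms(1) r assms(2) mor_id])
   (use rfD[OF r] in "simp_all add: hq_refl")
qed

lemma der_hom_iff: "(F : dhom X Y) = (EX P s f. rf X P Y s f & F = cl X P Y s f)"
proof
 assume "F : dhom X Y"
 then obtain r where r: "is_roof k A r" "src r = X" "tgt r = Y" "F = rr `` {r}"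
  unfolding der_hom_def quotient_def by auto
 hence "r = mk X (apex r) Y (den r) (num r)" using mk_cases[of r] by simp
 thus "EX P s f. rf X P Y s f & F = cl X P Y s f"
  using r rf_is_roof unfolding cl_def by metis
next
 assume "EX P s f. rf X P Y s f & F = cl X P Y s f"
 then obtain P s f where F: "rf X P Y s f" "F = cl X P Y s f" by blast
 hence "is_roof k A (mk X P Y s f)" using rf_is_roof by blast
 thus "F : dhom X Y"
  unfolding F(2) cl_def der_hom_def by (intro quotientI) simp
qed

lemma cl_hom: "rf X P Y s f ==> cl X P Y s f : dhom X Y"
 using der_hom_iff by blast

lemma der_homE:
 assumes "F : dhom X Y"
 obtains P s f where "rf X P Y s f" "F = cl X P Y s f"
 using assms der_hom_iff by blast

text \<open>Two fractions with the same source get a common denominator from the Ore square of their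
  two denominators.\<close>

lemma der_homE2:
 assumes "F : dhom X Y" "G : dhom X Z"
 obtains P s f g where "rf X P Y s f" "F = cl X P Y s f" "rf X P Z s g" "G = cl X P Z s g"
proof -
 obtain P s f where F: "rf X P Y s f" "F = cl X P Y s f" using assms(1) der_homE by blast
 obtain R t g where G: "rf X R Z t g" "G = cl X R Z t g" using assms(2) der_homE by blast
 obtain Q u v where Q: "qs Q P u" "qs Q R v" "hq Q X (s oo u) (t oo v)"
  by (rule ore_qs[OF rfD(1)[OF F(1)] rfD(1)[OF G(1)]])
 note F' = cl_refine[OF F(1) Q(1)] and G' = cl_refine[OF G(1) Q(2)]
 have gv: "mor Q Z (g oo v)" by (rule rfD(2)[OF G'(2)])
 show ?thesis
  by (rule that[OF F'(2) _ rfI[OF rfD(1)[OF F'(2)] gv]])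
   (use F(2) F'(1) G(2) G'(1) cl_hq[OF G'(2) hq_sym[OF Q(3)] hq_refl[OF gv]] in simp_all)
qed

text \<open>Composition depends neither on the representatives nor on the Ore square. Everything is
  pulled back to one apex: \<open>W\<close> and \<open>V\<close> align both squares over the
  comparison of the first factors, \<open>V'\<close> brings in the comparison of the second factors,
  and \<open>V''\<close> makes the two resulting maps homotopic.\<close>

lemma comp_indep:
 assumes r1: "rf X P1 Y s1 f1" and r2: "rf X P2 Y s2 f2" and r: "cl X P1 Y s1 f1 = cl X P2 Y s2 f2"
  and g1: "rf Y R1 Z t1 g1" and g2: "rf Y R2 Z t2 g2" and g: "cl Y R1 Z t1 g1 = cl Y R2 Z t2 g2"
  and Q1: "qs Q1 P1 u1" "mor Q1 R1 v1" "hq Q1 Y (f1 oo u1) (t1 oo v1)"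
  and Q2: "qs Q2 P2 u2" "mor Q2 R2 v2" "hq Q2 Y (f2 oo u2) (t2 oo v2)"
 shows "cl X Q1 Z (s1 oo u1) (g1 oo v1) = cl X Q2 Z (s2 oo u2) (g2 oo v2)"
proof -
 obtain R a1 a2 where R: "qs R P1 a1" "qs R P2 a2" "hq R X (s1 oo a1) (s2 oo a2)" "hq R Y (f1 oo a1) (f2 oo a2)"
  by (rule cl_eqD[OF r1 r])
 obtain S b1 b2 where S: "qs S R1 b1" "qs S R2 b2" "hq S Y (t1 oo b1) (t2 oo b2)" "hq S Z (g1 oo b1) (g2 oo b2)"
  by (rule cl_eqD[OF g1 g])
 obtain W w c where W: "qs W Q1 w" "qs W R c" "hq W P1 (u1 oo w) (a1 oo c)"
  by (rule ore_qs[OF Q1(1) R(1)])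
 obtain V v d where V: "qs V W v" "qs V Q2 d" "hq V P2 ((a2 oo c) oo v) (u2 oo d)"
  by (rule ore_qs[OF qs_comp[OF W(2) R(2)] Q2(1)])
 have wv: "qs V Q1 (w oo v)" by (rule qs_comp[OF V(1) W(1)])
 have m1: "mor V R1 (v1 oo w oo v)" by (rule mor_comp[OF qs_mor[OF wv] Q1(2)])
 obtain V' ta e where V': "qs V' V ta" "mor V' S e" "hq V' R1 ((v1 oo w oo v) oo ta) (b1 oo e)"
  by (rule ore[OF m1 S(1)])
 have Wv: "hq V P1 (u1 oo w oo v) (a1 oo c oo v)"
  using hq_comp_right[OF qs_mor[OF V(1)] W(3)] by (simp add: gcomp_assoc)
 have cv: "mor V R (c oo v)" by (rule mor_comp[OF qs_mor[OF V(1)] qs_mor[OF W(2)]])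
 have A: "hq V X (s1 oo u1 oo w oo v) (s2 oo u2 oo d)"
  using hq_trans[OF hq_trans[OF hq_comp_left[OF Wv rfD(3)[OF r1]]
     hq_comp_right[OF cv R(3), unfolded gcomp_assoc]]
    hq_comp_left[OF V(3) rfD(3)[OF r2], unfolded gcomp_assoc]] .
 have B: "hq V Y (f1 oo u1 oo w oo v) (f2 oo u2 oo d)"
  using hq_trans[OF hq_trans[OF hq_comp_left[OF Wv rfD(2)[OF r1]]
     hq_comp_right[OF cv R(4), unfolded gcomp_assoc]]
    hq_comp_left[OF V(3) rfD(2)[OF r2], unfolded gcomp_assoc]] .
 have C: "hq V Y (t2 oo v2 oo d) (t1 oo v1 oo w oo v)"
  using hq_trans[OF hq_trans[OF hq_sym[OF hq_comp_right[OF qs_mor[OF V(2)] Q2(3), unfolded gcomp_assoc]]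
     hq_sym[OF B]] hq_comp_right[OF qs_mor[OF wv] Q1(3), unfolded gcomp_assoc]] .
 have D: "hq V' Y (t2 oo v2 oo d oo ta) (t2 oo b2 oo e)"
  using hq_trans[OF hq_trans[OF hq_comp_right[OF qs_mor[OF V'(1)] C, unfolded gcomp_assoc]
    hq_comp_left[OF V'(3) rfD(3)[OF g1], unfolded gcomp_assoc]]
    hq_comp_right[OF V'(2) S(3), unfolded gcomp_assoc]] .
 have m2: "mor V' R2 (v2 oo d oo ta)" "mor V' R2 (b2 oo e)"
  using mor_comp[OF mor_comp[OF qs_mor[OF V'(1)] qs_mor[OF V(2)]] Q2(2)] mor_comp[OF V'(2) qs_mor[OF S(2)]]
  by (simp_all add: gcomp_assoc)
 \<comment> \<open>The two maps into \<open>R2\<close> are so far known to be homotopic only after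
   composition with the denominator \<open>t2\<close>; a further refinement cancels it.\<close>
 obtain V'' sg where V'': "qs V'' V' sg" "hq V'' R2 ((v2 oo d oo ta) oo sg) ((b2 oo e) oo sg)"
  by (rule ore_cancel2[OF m2 rfD(1)[OF g2] D])
 have tasg: "qs V'' V (ta oo sg)" by (rule qs_comp[OF V''(1) V'(1)])
 have esg: "mor V'' S (e oo sg)" by (rule mor_comp[OF qs_mor[OF V''(1)] V'(2)])
 have E: "hq V'' Z (g1 oo v1 oo w oo v oo ta oo sg) (g2 oo v2 oo d oo ta oo sg)"
  using hq_trans[OF hq_trans[OF
   hq_comp_left[OF hq_comp_right[OF qs_mor[OF V''(1)] V'(3)] rfD(2)[OF g1], unfolded gcomp_assoc]
   hq_comp_right[OF esg S(4), unfolded gcomp_assoc]]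
   hq_sym[OF hq_comp_left[OF V''(2) rfD(2)[OF g2], unfolded gcomp_assoc]]] .
 show ?thesis
 proof (rule cl_eqI)
  show "rf X Q1 Z (s1 oo u1) (g1 oo v1)" "rf X Q2 Z (s2 oo u2) (g2 oo v2)"
   using r1 r2 g1 g2 Q1(1,2) Q2(1,2) qs_comp mor_comp unfolding rf_def by blast+
  show "qs V'' Q1 ((w oo v) oo ta oo sg)" by (rule qs_comp[OF tasg wv])
  show "mor V'' Q2 (d oo ta oo sg)" by (rule qs_mor[OF qs_comp[OF tasg V(2)]])
  show "hq V'' X ((s1 oo u1) oo (w oo v) oo ta oo sg) ((s2 oo u2) oo d oo ta oo sg)"
   using hq_comp_right[OF qs_mor[OF tasg] A] by (simp add: gcomp_assoc)
  show "hq V'' Z ((g1 oo v1) oo (w oo v) oo ta oo sg) ((g2 oo v2) oo d oo ta oo sg)"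
   using E by (simp add: gcomp_assoc)
 qed
qed

text \<open>The union defining \<open>der_cmp\<close> collapses to one class by
  \<open>comp_indep\<close>, so a composite may be computed from any single Ore square.\<close>

lemma cmp_cl:
 assumes f: "rf X P Y s f" and g: "rf Y R Z t g"
  and Q: "qs Q P u" "mor Q R v" "hq Q Y (f oo u) (t oo v)"
 shows "dcmp (cl Y R Z t g) (cl X P Y s f) = cl X Q Z (s oo u) (g oo v)"
  "rf X Q Z (s oo u) (g oo v)"
proof -
 show rf: "rf X Q Z (s oo u) (g oo v)" using assms qs_comp mor_comp unfolding rf_def by blast
 let ?S = "{\<lparr>src = src f', apex = Q, tgt = tgt g', den = gcomp (den f') u, num = gcomp (num g') v\<rparr> | f' g' Q u v.
   f' : cl X P Y s f & g' : cl Y R Z t g & tgt f' = src g' & dg_module k A Q &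
   quasi_iso k A Q (apex f') u & dg_hom k A Q (apex g') v &
   homotopic k A Q (tgt f') (gcomp (num f') u) (gcomp (den g') v)}"
 have "rr `` ?S = rr `` {mk X Q Z (s oo u) (g oo v)}"
 proof (rule class_Union)
  show "mk X Q Z (s oo u) (g oo v) : ?S"
   using cl_self[OF f] cl_self[OF g] Q unfolding mem_Collect_eq
   by (intro exI[of _ "mk X P Y s f"] exI[of _ "mk Y R Z t g"] exI[of _ Q] exI[of _ u] exI[of _ v])
    (auto simp: mk_def qs_def mor_def hq_def)
  fix r' assume "r' : ?S"
  then obtain f' g' Q' u' v' where r': "r' = mk (src f') Q' (tgt g') (den f' oo u') (num g' oo v')"
   "f' : cl X P Y s f" "g' : cl Y R Z t g" "tgt f' = src g'" "dg_module k A Q'"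
   "quasi_iso k A Q' (apex f') u'" "dg_hom k A Q' (apex g') v'"
   "homotopic k A Q' (tgt f') (gcomp (num f') u') (gcomp (den g') v')"
   unfolding mk_def by blast
  note F = in_cl[OF r'(2) f] and G = in_cl[OF r'(3) g]
  have Q': "qs Q' (apex f') u'" "mor Q' (apex g') v'" "hq Q' Y (num f' oo u') (den g' oo v')"
  proof -
   show 1: "qs Q' (apex f') u'" "mor Q' (apex g') v'"
    using r' rfD(5)[OF F(3)] rfD(5)[OF G(3)] by (auto simp: qs_def mor_def)
   show "hq Q' Y (num f' oo u') (den g' oo v')"
    using r'(8) F(2) mor_comp[OF qs_mor[OF 1(1)] rfD(2)[OF F(3)]] mor_comp[OF 1(2) rfD(3)[OF G(3)]]
    by (simp add: hq_def)
  qed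
  have "cl X Q Z (s oo u) (g oo v) = cl X Q' Z (den f' oo u') (num g' oo v')"
   by (rule comp_indep[OF f F(3) F(4)[symmetric] g G(3) G(4)[symmetric] Q Q'])
  thus "(mk X Q Z (s oo u) (g oo v), r') : rr"
   unfolding r'(1) F(1) G(2) using class_eq rf rf_is_roof unfolding cl_def by blast
 qed
 thus "dcmp (cl Y R Z t g) (cl X P Y s f) = cl X Q Z (s oo u) (g oo v)"
  unfolding der_cmp_def cl_def[of X Q] .
qed


subsection \<open>The derived category is preadditive\<close>

abbreviation "Der \<equiv> (der_cat k A :: (('k, 'a, 'm) dgm, ('k, 'a, 'm) roof set) precat)"

lemma Der_sel [simp]:
 "Obj Der = {M. DG M}" "Hom Der = dhom" "Cmp Der = dcmp" "HAdd Der = dadd"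
 by (simp_all add: der_cat_def)

text \<open>This is the localisation functor on morphisms. Every arrow is \<open>q f\<close>
  followed backwards by the inverse of some \<open>q s\<close> (\<open>factor\<close>), which is how
  later proofs reduce to honest dg maps.\<close>

definition q :: "('k, 'a, 'm) dgm => ('k, 'a, 'm) dgm => (int => 'm => 'm) => ('k, 'a, 'm) roof set" where
 "q M N f = cl M M N hid f"

lemma der_map_q: "der_map k A M N f = q M N f"
 by (simp add: der_map_def q_def cl_def mk_def)

lemma Der_sel2 [simp]: "Idn Der M = q M M hid" "HZero Der M N = q M N (hzero N)"
 by (simp_all add: der_cat_def der_map_q)

lemma rf_q: "mor M N f ==> rf M M N hid f"
 by (simp add: rfI qs_id morD(1))

lemma q_hom: "mor M N f ==> q M N f : dhom M N"
 unfolding q_def by (rule cl_hom[OF rf_q])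

lemma q_eq: "hq M N f g ==> q M N f = q M N g"
 unfolding q_def using cl_hq[OF rf_q hq_refl[OF mor_id]] hqD by blast

lemma q_eqD:
 assumes "mor M N f" "q M N f = q M N g"
 obtains Q t where "qs Q M t" "hq Q N (f oo t) (g oo t)"
proof -
 obtain Q u v where Q: "qs Q M u" "qs Q M v" "hq Q M (hid oo u) (hid oo v)" "hq Q N (f oo u) (g oo v)"
  using cl_eqD[OF rf_q[OF assms(1)] assms(2)[unfolded q_def]] by blast
 have "mor M N g"
 proof -
  have "q M N g : dhom M N" using q_hom[OF assms(1)] assms(2) by simp
  have "(mk M M N hid f, mk M M N hid g) : rr"
   using assms(2) class_eq[of "mk M M N hid f" "mk M M N hid g"] rf_is_roof rf_q[OF assms(1)] by (auto simp: q_def cl_def)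
  thus ?thesis unfolding rr_iff rf_is_roof by (simp add: rf_def)
 qed
 hence "hq Q N (f oo u) (g oo u)"
  using hq_trans[OF Q(4) hq_sym[OF hq_comp_left]] Q(3) by simp
 thus ?thesis using that Q(1) by blast
qed

lemma cmp_q_cl:
 assumes "rf X P Y s f" "mor Y Z g"
 shows "dcmp (q Y Z g) (cl X P Y s f) = cl X P Z s (g oo f)"
 using cmp_cl(1)[OF assms(1) rf_q[OF assms(2)], of P hid f] rfD[OF assms(1)]
 by (simp add: q_def qs_id hq_refl)

lemma q_comp: "mor X Y f ==> mor Y Z g ==> dcmp (q Y Z g) (q X Y f) = q X Z (g oo f)"
 using cmp_q_cl[OF rf_q] by (simp add: q_def)

lemma cmp_cl_q:
 assumes "qs Y X s" "mor Y Z f"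
 shows "dcmp (cl X Y Z s f) (q Y X s) = q Y Z f"
 using cmp_cl(1)[OF rf_q[OF qs_mor[OF assms(1)]] rfI[OF assms], of Y hid hid] assms
 by (simp add: q_def qs_id mor_id hq_refl qs_mor morD(1)[OF assms(2)])

lemma cl_factor:
 assumes "rf X P Y s f"
 shows "cl X P Y s f = dcmp (q P Y f) (cl X P P s hid)" "rf X P P s hid"
proof -
 show r: "rf X P P s hid" using assms rfD(5)[OF assms] by (simp add: rf_def mor_id)
 show "cl X P Y s f = dcmp (q P Y f) (cl X P P s hid)"
  using cmp_q_cl[OF r rfD(2)[OF assms]] by simp
qed

lemma q_iso:
 assumes "qs M N s"
 shows "dcmp (cl N M M s hid) (q M N s) = q M M hid"
  "dcmp (q M N s) (cl N M M s hid) = q N N hid" "cl N M M s hid : dhom N M"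
proof -
 have m: "DG M" "DG N" using morD[OF qs_mor[OF assms]] by auto
 have r: "rf N M M s hid" by (rule rfI[OF assms mor_id[OF m(1)]])
 show "cl N M M s hid : dhom N M" by (rule cl_hom[OF r])
 show "dcmp (cl N M M s hid) (q M N s) = q M M hid"
  by (rule cmp_cl_q[OF assms mor_id[OF m(1)]])
 have "dcmp (q M N s) (cl N M M s hid) = cl N M N s s"
  using cmp_q_cl[OF r qs_mor[OF assms]] by simp
 also have "... = q N N hid"
  unfolding q_def using cl_refine(1)[OF rf_q[OF mor_id[OF m(2)]] assms] by simp
 finally show "dcmp (q M N s) (cl N M M s hid) = q N N hid" .
qed

lemma Der_category: "category Der"
 unfolding category_def
proof (intro conjI ballI; (simp only: Der_sel Der_sel2 mem_Collect_eq)?)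
 fix X assume "DG X" thus "q X X hid : dhom X X" by (intro q_hom mor_id)
next
 fix X Y Z :: "('k, 'a, 'm) dgm" and F G assume F: "F : dhom X Y" and G: "G : dhom Y Z"
 obtain P s f where f: "rf X P Y s f" "F = cl X P Y s f" using F der_homE by blast
 obtain R t g where g: "rf Y R Z t g" "G = cl Y R Z t g" using G der_homE by blast
 obtain Q u v where Q: "qs Q P u" "mor Q R v" "hq Q Y (f oo u) (t oo v)"
  by (rule ore[OF rfD(2)[OF f(1)] rfD(1)[OF g(1)]])
 show "dcmp G F : dhom X Z"
  unfolding f(2) g(2) cmp_cl(1)[OF f(1) g(1) Q] by (rule cl_hom[OF cmp_cl(2)[OF f(1) g(1) Q]])
next
 fix X Y :: "('k, 'a, 'm) dgm" and F assume F: "F : dhom X Y"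
 then obtain P s f where f: "rf X P Y s f" "F = cl X P Y s f" using der_homE by blast
 note D = rfD[OF f(1)]
 show "dcmp F (q X X hid) = F"
  using cmp_cl(1)[OF rf_q[OF mor_id[OF D(4)]] f(1) D(1) mor_id[OF D(5)]] D(3)
  unfolding f(2) q_def by (simp add: hq_refl)
 show "dcmp (q Y Y hid) F = F"
  using cmp_q_cl[OF f(1) mor_id[OF D(6)]] unfolding f(2) by simp
next
 fix X0 X Y Z :: "('k, 'a, 'm) dgm" and F G H assume F: "F : dhom X0 X" and G: "G : dhom X Y" and H: "H : dhom Y Z"
 obtain P s f where f: "rf X0 P X s f" "F = cl X0 P X s f" using F der_homE by blast
 obtain R t g where g: "rf X R Y t g" "G = cl X R Y t g" using G der_homE by blast
 obtain T r h where h: "rf Y T Z r h" "H = cl Y T Z r h" using H der_homE by blast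
 obtain Q u v where Q: "qs Q R u" "mor Q T v" "hq Q Y (g oo u) (r oo v)"
  by (rule ore[OF rfD(2)[OF g(1)] rfD(1)[OF h(1)]])
 note HG = cmp_cl[OF g(1) h(1) Q]
 obtain Q' u' v' where Q': "DG Q'" "qs Q' P u'" "mor Q' Q v'" "hq Q' X (f oo u') ((t oo u) oo v')"
  by (rule ore[OF rfD(2)[OF f(1)] rfD(1)[OF HG(2)]])
 have "mor Q' R (u oo v')" by (rule mor_comp[OF Q'(3) qs_mor[OF Q(1)]])
 note GF = cmp_cl[OF f(1) g(1) Q'(2) this Q'(4)[unfolded gcomp_assoc]]
 have "hq Q' Y ((g oo u oo v') oo hid) (r oo v oo v')"
  using hq_comp_right[OF Q'(3) Q(3)] by (simp add: gcomp_assoc)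
 from cmp_cl(1)[OF GF(2) h(1) qs_id[OF Q'(1)] mor_comp[OF Q'(3) Q(2)] this]
 show "dcmp H (dcmp G F) = dcmp (dcmp H G) F"
  unfolding f(2) g(2) h(2) HG(1) GF(1) cmp_cl(1)[OF f(1) HG(2) Q'(2,3,4)] by (simp add: gcomp_assoc)
qed

lemma hadd_comp: "hadd Y f g oo u = hadd Y (f oo u) (g oo u)"
 by (simp add: gcomp_def comp_def)

lemma rf_add: "rf X P Y s f ==> rf X P Y s g ==> rf X P Y s (hadd Y f g)"
 by (simp add: rf_def mor_add)

text \<open>The equivalences of the f-roofs and of the g-roofs come with different apexes
  \<open>R\<close> and \<open>S\<close>. They are merged over \<open>P\<close> at \<open>W\<close>;
  over \<open>P'\<close> the two legs then agree only after s', which is cancelled at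
  \<open>V\<close>.\<close>

lemma add_indep:
 assumes f: "rf X P Y s f" and f': "rf X P' Y s' f'" and ff: "cl X P Y s f = cl X P' Y s' f'"
  and g: "rf X P Y s g" and g': "rf X P' Y s' g'" and gg: "cl X P Y s g = cl X P' Y s' g'"
 shows "cl X P Y s (hadd Y f g) = cl X P' Y s' (hadd Y f' g')"
proof -
 obtain R a a' where R: "qs R P a" "qs R P' a'" "hq R X (s oo a) (s' oo a')" "hq R Y (f oo a) (f' oo a')"
  by (rule cl_eqD[OF f ff])
 obtain S b b' where S: "qs S P b" "qs S P' b'" "hq S X (s oo b) (s' oo b')" "hq S Y (g oo b) (g' oo b')"
  by (rule cl_eqD[OF g gg])
 obtain W w c where W: "qs W R w" "qs W S c" "hq W P (a oo w) (b oo c)"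
  by (rule ore_qs[OF R(1) S(1)])
 have A: "hq W X (s' oo a' oo w) (s' oo b' oo c)"
  using hq_trans[OF hq_trans[OF hq_sym[OF hq_comp_right[OF qs_mor[OF W(1)] R(3), unfolded gcomp_assoc]]
    hq_comp_left[OF W(3) rfD(3)[OF f]]] hq_comp_right[OF qs_mor[OF W(2)] S(3), unfolded gcomp_assoc]] .
 have m: "mor W P' (a' oo w)" "mor W P' (b' oo c)" using mor_comp qs_mor R S W by blast+
 obtain V v where V: "qs V W v" "hq V P' ((a' oo w) oo v) ((b' oo c) oo v)"
  by (rule ore_cancel2[OF m rfD(1)[OF f'] A])
 have wv: "qs V R (w oo v)" by (rule qs_comp[OF V(1) W(1)])
 have cv: "qs V S (c oo v)" by (rule qs_comp[OF V(1) W(2)])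
 have 1: "hq V Y (f oo a oo w oo v) (f' oo a' oo w oo v)"
  using hq_comp_right[OF qs_mor[OF wv] R(4)] by (simp add: gcomp_assoc)
 have 2: "hq V Y (g oo a oo w oo v) (g' oo a' oo w oo v)"
  using hq_trans[OF hq_trans[OF hq_comp_left[OF hq_comp_right[OF qs_mor[OF V(1)] W(3)] rfD(2)[OF g], unfolded gcomp_assoc]
   hq_comp_right[OF qs_mor[OF cv] S(4), unfolded gcomp_assoc]]
   hq_sym[OF hq_comp_left[OF V(2) rfD(2)[OF g'], unfolded gcomp_assoc]]] .
 show ?thesis
 proof (rule cl_eqI[OF rf_add[OF f g] rf_add[OF f' g']])
  show "qs V P (a oo w oo v)" by (rule qs_comp[OF wv R(1)])
  show "mor V P' (a' oo w oo v)" by (rule qs_mor[OF qs_comp[OF wv R(2)]])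
  show "hq V X (s oo a oo w oo v) (s' oo a' oo w oo v)"
   using hq_comp_right[OF qs_mor[OF wv] R(3)] by (simp add: gcomp_assoc)
  show "hq V Y (hadd Y f g oo a oo w oo v) (hadd Y f' g' oo a' oo w oo v)"
   unfolding hadd_comp by (rule hq_add[OF 1 2])
 qed
qed

lemma add_cl:
 assumes f: "rf X P Y s f" and g: "rf X P Y s g"
 shows "dadd (cl X P Y s f) (cl X P Y s g) = cl X P Y s (hadd Y f g)"
proof -
 let ?S = "{f'\<lparr>num := (%p x. num f' p x \<oplus>\<^bsub>cgr (tgt f') p\<^esub> num g' p x)\<rparr> | f' g'.
   f' : cl X P Y s f & g' : cl X P Y s g & src f' = src g' & tgt f' = tgt g' & apex f' = apex g' & den f' = den g'}"
 have "rr `` ?S = rr `` {mk X P Y s (hadd Y f g)}"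
 proof (rule class_Union)
  show "mk X P Y s (hadd Y f g) : ?S"
   using cl_self[OF f] cl_self[OF g] unfolding mem_Collect_eq
   by (intro exI[of _ "mk X P Y s f"] exI[of _ "mk X P Y s g"]) (simp add: mk_def)
  fix r' assume "r' : ?S"
  then obtain f' g' where r': "r' = f'\<lparr>num := hadd (tgt f') (num f') (num g')\<rparr>"
   "f' : cl X P Y s f" "g' : cl X P Y s g" "apex f' = apex g'" "den f' = den g'"
   by blast
  note F = in_cl[OF r'(2) f] and G = in_cl[OF r'(3) g]
  have "r' = mk X (apex f') Y (den f') (hadd Y (num f') (num g'))"
   unfolding r'(1) using mk_cases[of f'] F(1,2) by (simp add: mk_def)
  moreover have "cl X P Y s (hadd Y f g) = cl X (apex f') Y (den f') (hadd Y (num f') (num g'))"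
   by (rule add_indep[OF f F(3) F(4)[symmetric] g]) (use G r'(4,5) in simp_all)
  ultimately show "(mk X P Y s (hadd Y f g), r') : rr"
   using class_eq rf_is_roof rf_add[OF f g] unfolding cl_def by blast
 qed
 thus ?thesis unfolding der_add_def cl_def[of X P Y s "hadd Y f g"] .
qed

lemma q_add: "mor M N f ==> mor M N g ==> dadd (q M N f) (q M N g) = q M N (hadd N f g)"
 unfolding q_def by (intro add_cl rf_q)

lemma zero_cl: "rf X P Y s f ==> q X Y (hzero Y) = cl X P Y s (hzero Y)"
 using cl_refine(1)[OF rf_q[OF mor_zero] rfD(1), of X Y P Y s f] rfD[of X P Y s f]
 by (simp add: q_def gcomp_def comp_def)

lemma cl_ext:
 assumes "rf X P Y s f" "mor P Y g" "!!p x. x : cel P p ==> f p x = g p x"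
 shows "cl X P Y s f = cl X P Y s g"
 by (rule cl_hq[OF assms(1) hq_refl[OF rfD(3)[OF assms(1)]] hq_ext[OF rfD(2)[OF assms(1)] assms(2,3)]])

lemma Der_group:
 assumes X: "DG X" and Y: "DG Y"
 shows "comm_group \<lparr>carrier = dhom X Y, monoid.mult = dadd, one = q X Y (hzero Y)\<rparr>"
proof (rule comm_groupI, simp_all only: partial_object.simps monoid.simps)
 show "q X Y (hzero Y) : dhom X Y" by (rule q_hom[OF mor_zero[OF X Y]])
 fix F assume F: "F : dhom X Y"
 then obtain P s f where f: "rf X P Y s f" "F = cl X P Y s f" using der_homE by blast
 note D = rfD[OF f(1)] and f5 = morD(5)[OF rfD(2)[OF f(1)]]
 have z: "rf X P Y s (hzero Y)" "rf X P Y s (hneg Y f)" using D by (simp_all add: rf_def mor_zero mor_neg)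
 show "dadd (q X Y (hzero Y)) F = F"
  unfolding f(2) zero_cl[OF f(1)] add_cl[OF z(1) f(1)]
  by (rule cl_ext[OF rf_add[OF z(1) f(1)] D(2)]) (use f5 Y in simp)
 have "dadd (cl X P Y s (hneg Y f)) F = q X Y (hzero Y)"
  unfolding f(2) zero_cl[OF f(1)] add_cl[OF z(2) f(1)]
  by (rule cl_ext[OF rf_add[OF z(2) f(1)] rfD(2)[OF z(1)]]) (use f5 Y in simp)
 thus "EX G:dhom X Y. dadd G F = q X Y (hzero Y)" using cl_hom[OF z(2)] by blast
 fix G assume G: "G : dhom X Y"
 show "dadd F G : dhom X Y" "dadd F G = dadd G F"
 proof -
  obtain P s f g where f: "rf X P Y s f" "F = cl X P Y s f" and g: "rf X P Y s g" "G = cl X P Y s g"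
   by (rule der_homE2[OF F G])
  show "dadd F G : dhom X Y"
   unfolding f(2) g(2) add_cl[OF f(1) g(1)] by (rule cl_hom[OF rf_add[OF f(1) g(1)]])
  show "dadd F G = dadd G F"
   unfolding f(2) g(2) add_cl[OF f(1) g(1)] add_cl[OF g(1) f(1)]
   by (rule cl_ext[OF rf_add[OF f(1) g(1)] rfD(2)[OF rf_add[OF g(1) f(1)]]])
    (use DG_ac(1)[OF Y] morD(5)[OF rfD(2)[OF f(1)]] morD(5)[OF rfD(2)[OF g(1)]] in blast)
 qed
 fix H assume H: "H : dhom X Y"
 obtain P s f g where f: "rf X P Y s f" "F = cl X P Y s f" and g: "rf X P Y s g" "G = cl X P Y s g"
  by (rule der_homE2[OF F G])
 obtain R t h where h: "rf X R Y t h" "H = cl X R Y t h" using H der_homE by blast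
 obtain Q u v where Q: "qs Q P u" "qs Q R v" "hq Q X (s oo u) (t oo v)"
  by (rule ore_qs[OF rfD(1)[OF f(1)] rfD(1)[OF h(1)]])
 note f' = cl_refine[OF f(1) Q(1)] and g' = cl_refine[OF g(1) Q(1)] and h' = cl_refine[OF h(1) Q(2)]
 have h'': "rf X Q Y (s oo u) (h oo v)" "H = cl X Q Y (s oo u) (h oo v)"
  using rfI[OF rfD(1)[OF f'(2)] rfD(2)[OF h'(2)]] h(2) h'(1)
   cl_hq[OF h'(2) hq_sym[OF Q(3)] hq_refl[OF rfD(2)[OF h'(2)]]] by simp_all
 show "dadd (dadd F G) H = dadd F (dadd G H)"
  unfolding f(2) g(2) h''(2) f'(1) g'(1) add_cl[OF f'(2) g'(2)] add_cl[OF g'(2) h''(1)]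
   add_cl[OF rf_add[OF f'(2) g'(2)] h''(1)] add_cl[OF f'(2) rf_add[OF g'(2) h''(1)]]
  by (rule cl_ext[OF rf_add[OF rf_add[OF f'(2) g'(2)] h''(1)] rfD(2)[OF rf_add[OF f'(2) rf_add[OF g'(2) h''(1)]]]])
   (use DG_ac(2)[OF Y] morD(5)[OF rfD(2)[OF f'(2)]] morD(5)[OF rfD(2)[OF g'(2)]] morD(5)[OF rfD(2)[OF h''(1)]]
   in blast)
qed

lemma Der_preadditive: "preadditive Der"
 unfolding preadditive_def
proof (intro conjI ballI; (simp only: Der_sel Der_sel2 mem_Collect_eq)?)
 show "category Der" by (rule Der_category)
 fix X Y :: "('k, 'a, 'm) dgm" assume "DG X" "DG Y"
 thus "comm_group \<lparr>carrier = dhom X Y, monoid.mult = dadd, one = q X Y (hzero Y)\<rparr>"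
  by (rule Der_group)
next
 fix X Y Z :: "('k, 'a, 'm) dgm" and F F' G G' assume F: "F : dhom X Y" "F' : dhom X Y"
  and G: "G : dhom Y Z" "G' : dhom Y Z"
 obtain P s f f' where f: "rf X P Y s f" "F = cl X P Y s f" and f': "rf X P Y s f'" "F' = cl X P Y s f'"
  by (rule der_homE2[OF F])
 obtain R t g g' where g: "rf Y R Z t g" "G = cl Y R Z t g" and g': "rf Y R Z t g'" "G' = cl Y R Z t g'"
  by (rule der_homE2[OF G])
 obtain Q u v where Q: "qs Q P u" "mor Q R v" "hq Q Y (f oo u) (t oo v)"
  by (rule ore[OF rfD(2)[OF f(1)] rfD(1)[OF g(1)]])
 have m: "mor Q Y (f' oo u)" using mor_comp[OF qs_mor[OF Q(1)] rfD(2)[OF f'(1)]] .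
 \<comment> \<open>A second Ore square over the first yields one apex on which both f and f' lift
   through the denominator t, so the lifts can be added.\<close>
 obtain Q' u' v' where Q': "qs Q' Q u'" "mor Q' R v'" "hq Q' Y ((f' oo u) oo u') (t oo v')"
  by (rule ore[OF m rfD(1)[OF g(1)]])
 have U: "qs Q' P (u oo u')" "mor Q' R (v oo u')" "hq Q' Y (f oo u oo u') (t oo v oo u')"
  "hq Q' Y (f' oo u oo u') (t oo v')"
  using qs_comp[OF Q'(1) Q(1)] mor_comp[OF qs_mor[OF Q'(1)] Q(2)] hq_comp_right[OF qs_mor[OF Q'(1)] Q(3)] Q'(3)
  by (simp_all add: gcomp_assoc)
 have T: "hq Q' Y (hadd Y f f' oo u oo u') (t oo hadd R (v oo u') v')"
 proof -
  have "hq Q' Y (hadd Y (t oo v oo u') (t oo v')) (t oo hadd R (v oo u') v')"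
   by (rule hq_ext[OF mor_add[OF hqD(2)[OF U(3)] hqD(2)[OF U(4)]] mor_comp[OF mor_add[OF U(2) Q'(2)] rfD(3)[OF g(1)]]])
    (use morD(5)[OF U(2)] morD(5)[OF Q'(2)] in "simp add: morD(6)[OF rfD(3)[OF g(1)]]")
  thus ?thesis unfolding hadd_comp[of Y f] using hq_trans[OF hq_add[OF U(3,4)]] by blast
 qed
  note c1 = cmp_cl[OF f(1) g(1) U(1-3)] and c2 = cmp_cl[OF f'(1) g(1) U(1) Q'(2) U(4)]
  note c3 = cmp_cl[OF rf_add[OF f(1) f'(1)] g(1) U(1) mor_add[OF U(2) Q'(2)] T]
  show "dcmp G (dadd F F') = dadd (dcmp G F) (dcmp G F')"
   unfolding f(2) f'(2) g(2) add_cl[OF f(1) f'(1)] c1(1) c2(1) c3(1) add_cl[OF c1(2) c2(2)]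
   by (rule cl_ext[OF c3(2) mor_add[OF rfD(2)[OF c1(2)] rfD(2)[OF c2(2)]]])
    (use morD(5)[OF U(2)] morD(5)[OF Q'(2)] in "simp add: morD(6)[OF rfD(2)[OF g(1)]]")
  note d1 = cmp_cl[OF f(1) g(1) Q] and d2 = cmp_cl[OF f(1) g'(1) Q] and d3 = cmp_cl[OF f(1) rf_add[OF g(1) g'(1)] Q]
  show "dcmp (dadd G G') F = dadd (dcmp G F) (dcmp G' F)"
   unfolding f(2) g(2) g'(2) add_cl[OF g(1) g'(1)] d1(1) d2(1) d3(1) add_cl[OF d1(2) d2(2)] hadd_comp ..
qed

end

lemma (in pcat) biprodI:
 assumes "ar i1 X P" "ar i2 Y P" "ar p1 P X" "ar p2 P Y" "p1 ** i1 = idn X" "p2 ** i2 = idn Y"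
  "p2 ** i1 = zz X Y" "p1 ** i2 = zz Y X" "i1 ** p1 \<boxplus> i2 ** p2 = idn P"
 shows "is_biproduct C X Y P"
proof -
 have o: "ob X" "ob Y" "ob P" using assms(1,2) by (simp_all add: ar_def)
 show ?thesis
  unfolding biprod_iff
  by (rule conjI, rule o, rule conjI, rule o, rule conjI, rule o,
    rule exI[of _ i1], rule exI[of _ i2], rule exI[of _ p1], rule exI[of _ p2]) (intro conjI assms)
qed

context dgc begin

declare Der_sel [simp del] Der_sel2 [simp del]

text \<open>Roofs store their source and target, and equivalent roofs share them.\<close>

lemma der_hom_disj:
 fixes X Y X' Y' :: "('k, 'a, 'm) dgm"
 assumes "F : dhom X Y" "F : dhom X' Y'"
 shows "X = X' & Y = Y'"
proof -
 obtain P s f where f: "rf X P Y s f" "F = cl X P Y s f" using der_homE[OF assms(1)] by blast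
 obtain P' s' f' where f': "rf X' P' Y' s' f'" "F = cl X' P' Y' s' f'" using der_homE[OF assms(2)] by blast
 have "mk X P Y s f : cl X' P' Y' s' f'" using cl_self[OF f(1)] f(2) f'(2) by simp
 from in_cl(1,2)[OF this f'(1)] show ?thesis by simp
qed

sublocale D: pcat "der_cat k A :: (('k, 'a, 'm) dgm, ('k, 'a, 'm) roof set) precat"
proof
 show "preadditive Der" by (rule Der_preadditive)
qed (use der_hom_disj in "simp add: Der_sel")

lemma Der_ob [simp]: "(X : Obj Der) = DG X"
 by (simp add: Der_sel)

lemma Der_idn: "Idn Der X = q X X hid"
 by (simp add: Der_sel2)

lemma q_arr [simp]:
 assumes "mor M N f" shows "D.arr (q M N f)" "D.dm (q M N f) = M" "D.cd (q M N f) = N"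
proof -
 have "q M N f : Hom Der M N" using q_hom[OF assms] by (simp add: Der_sel)
 from D.homD[OF this] show "D.arr (q M N f)" "D.dm (q M N f) = M" "D.cd (q M N f) = N"
  using morD(1,2)[OF assms] by simp_all
qed

lemma cl_arr [simp]:
 assumes "rf X P Y s f" shows "D.arr (cl X P Y s f)" "D.dm (cl X P Y s f) = X" "D.cd (cl X P Y s f) = Y"
proof -
 have "cl X P Y s f : Hom Der X Y" using cl_hom[OF assms] by (simp add: Der_sel)
 from D.homD[OF this] show "D.arr (cl X P Y s f)" "D.dm (cl X P Y s f) = X" "D.cd (cl X P Y s f) = Y"
  using rfD(4,6)[OF assms] by simp_all
qed

lemma q_cmp: "mor X Y f ==> mor Y Z g ==> Cmp Der (q Y Z g) (q X Y f) = q X Z (g oo f)"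
 using q_comp by (simp add: Der_sel)

lemma q_iso':
 assumes "qs M N s" shows "D.iso (q M N s)" "D.iv (q M N s) = cl N M M s hid"
proof -
 note m = qs_mor[OF assms] and i = q_iso[OF assms]
 have r: "rf N M M s hid" by (rule rfI[OF assms mor_id[OF morD(1)[OF m]]])
 show iso: "D.iso (q M N s)"
  by (rule D.isoI[of _ "cl N M M s hid"]) (use m r i in "simp_all add: Der_idn", simp_all add: Der_sel)
 show "D.iv (q M N s) = cl N M M s hid"
  by (rule D.iso_epi[OF iso]) (use m r i iso in "simp_all add: Der_idn", simp_all add: Der_sel)
qed

declare q_iso'(1) [simp]

lemma factor:
 assumes "D.arr F"
 obtains P s f where "qs P (D.dm F) s" "mor P (D.cd F) f"
  "F = Cmp Der (q P (D.cd F) f) (D.iv (q P (D.dm F) s))"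
proof -
 have "F : dhom (D.dm F) (D.cd F)" using D.arr_hom[OF assms refl refl] by (simp add: Der_sel)
 then obtain P s f where f: "rf (D.dm F) P (D.cd F) s f" "F = cl (D.dm F) P (D.cd F) s f" using der_homE by blast
 show ?thesis
 proof (rule that[OF rfD(1,2)[OF f(1)]])
  show "F = Cmp Der (q P (D.cd F) f) (D.iv (q P (D.dm F) s))"
   using cl_factor(1)[OF f(1)] f(2) q_iso'(2)[OF rfD(1)[OF f(1)]] by (simp add: Der_sel)
 qed
qed

lemma arr_cl:
 assumes "D.arr F" "D.dm F = X" "D.cd F = Y"
 obtains P s f where "rf X P Y s f" "F = cl X P Y s f"
proof -
 have "F : dhom X Y" using D.arr_hom[OF assms] by (simp add: Der_sel)
 from der_homE[OF this] that show ?thesis by blast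
qed

subsection \<open>The suspension functor\<close>

abbreviation "\<Sigma> \<equiv> dg_shift 1"
abbreviation sh where "sh f \<equiv> (%p. f (p+1))"
abbreviation sus :: "('k, 'a, 'm) roof set => ('k, 'a, 'm) roof set" where "sus \<equiv> der_susp k A"

lemma rf_shift: "rf X P Y s f ==> rf (dg_shift n X) (dg_shift n P) (dg_shift n Y) (%p. s (p + n)) (%p. f (p + n))"
 by (simp add: rf_def qs_shift mor_shift)

lemma sh_comp: "sh (f oo g) = sh f oo sh g"
 by (simp add: gcomp_def)

lemma cl_shift:
 assumes "rf X P Y s f" "cl X P Y s f = cl X P' Y s' f'" "rf X P' Y s' f'"
 shows "cl (\<Sigma> X) (\<Sigma> P) (\<Sigma> Y) (sh s) (sh f) = cl (\<Sigma> X) (\<Sigma> P') (\<Sigma> Y) (sh s') (sh f')"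
proof -
 obtain Q u v where Q: "qs Q P u" "qs Q P' v" "hq Q X (s oo u) (s' oo v)" "hq Q Y (f oo u) (f' oo v)"
  by (rule cl_eqD[OF assms(1,2)])
 show ?thesis
  by (rule cl_eqI[OF rf_shift[OF assms(1)] rf_shift[OF assms(3)] qs_shift[OF Q(1)] qs_mor[OF qs_shift[OF Q(2)]]])
   (use hq_shift[OF Q(3), of 1] hq_shift[OF Q(4), of 1] in "simp_all only: sh_comp")
qed

lemma sus_cl:
 assumes "rf X P Y s f" shows "sus (cl X P Y s f) = cl (\<Sigma> X) (\<Sigma> P) (\<Sigma> Y) (sh s) (sh f)"
proof -
 let ?h = "%r. mk (\<Sigma> (src r)) (\<Sigma> (apex r)) (\<Sigma> (tgt r)) (sh (den r)) (sh (num r))"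
 let ?S = "{\<lparr>src = \<Sigma> (src r), apex = \<Sigma> (apex r), tgt = \<Sigma> (tgt r), den = sh (den r), num = sh (num r)\<rparr> | r. r : cl X P Y s f}"
 have e: "?S = ?h ` cl X P Y s f"
  by (auto simp: mk_def)
 have "rr `` ?S = rr `` {mk (\<Sigma> X) (\<Sigma> P) (\<Sigma> Y) (sh s) (sh f)}"
  unfolding e
 proof (rule class_Union)
  show "mk (\<Sigma> X) (\<Sigma> P) (\<Sigma> Y) (sh s) (sh f) :
    ?h ` cl X P Y s f"
   using cl_self[OF assms] by (rule image_eqI[rotated]) simp
  fix r' assume "r' : ?h ` cl X P Y s f"
  then obtain r where r: "r : cl X P Y s f" "r' = ?h r"
   by blast
  note R = in_cl[OF r(1) assms]
  show "(mk (\<Sigma> X) (\<Sigma> P) (\<Sigma> Y) (sh s) (sh f), r') : rr"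
   using cl_shift[OF assms R(4)[symmetric] R(3)] class_eq rf_is_roof rf_shift[OF assms, of 1]
   unfolding r(2) R(1,2) cl_def by blast
 qed
 thus ?thesis unfolding der_susp_def cl_def[of "\<Sigma> X"] .
qed

lemma sus_q: "mor M N f ==> sus (q M N f) = q (\<Sigma> M) (\<Sigma> N) (sh f)"
 unfolding q_def using sus_cl[OF rf_q] by simp

lemma sus_arr [simp]:
 assumes "D.arr F" shows "D.arr (sus F)" "D.dm (sus F) = \<Sigma> (D.dm F)" "D.cd (sus F) = \<Sigma> (D.cd F)"
proof -
 obtain P s f where f: "rf (D.dm F) P (D.cd F) s f" "F = cl (D.dm F) P (D.cd F) s f"
  by (rule arr_cl[OF assms refl refl])
 have e: "sus F = cl (\<Sigma> (D.dm F)) (\<Sigma> P) (\<Sigma> (D.cd F)) (sh s) (sh f)"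
  using sus_cl[OF f(1)] f(2) by simp
 show "D.arr (sus F)" "D.dm (sus F) = \<Sigma> (D.dm F)" "D.cd (sus F) = \<Sigma> (D.cd F)"
  unfolding e using cl_arr[OF rf_shift[OF f(1), of 1]] by simp_all
qed

lemma sus_idn: "DG X ==> sus (Idn Der X) = Idn Der (\<Sigma> X)"
 using sus_q[OF mor_id] by (simp add: Der_idn)

lemma sus_cmp:
 assumes "D.arr F" "D.arr G" "D.dm G = D.cd F"
 shows "sus (Cmp Der G F) = Cmp Der (sus G) (sus F)"
proof -
 obtain P s f where f: "rf (D.dm F) P (D.cd F) s f" "F = cl (D.dm F) P (D.cd F) s f"
  by (rule arr_cl[OF assms(1) refl refl])
 obtain R t g where g: "rf (D.cd F) R (D.cd G) t g" "G = cl (D.cd F) R (D.cd G) t g"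
  by (rule arr_cl[OF assms(2,3) refl])
 obtain Q u v where Q: "qs Q P u" "mor Q R v" "hq Q (D.cd F) (f oo u) (t oo v)"
  by (rule ore[OF rfD(2)[OF f(1)] rfD(1)[OF g(1)]])
 note c = cmp_cl[OF f(1) g(1) Q]
 note c' = cmp_cl(1)[OF rf_shift[OF f(1), of 1] rf_shift[OF g(1), of 1] qs_shift[OF Q(1)] mor_shift[OF Q(2)]
  hq_shift[OF Q(3), of 1, unfolded sh_comp]]
 have "Cmp Der G F = cl (D.dm F) Q (D.cd G) (s oo u) (g oo v)"
  using c(1) f(2) g(2) by (simp add: Der_sel)
 hence "sus (Cmp Der G F) = cl (\<Sigma> (D.dm F)) (\<Sigma> Q) (\<Sigma> (D.cd G)) (sh s oo sh u) (sh g oo sh v)"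
  using sus_cl[OF c(2)] by (simp add: sh_comp)
 also have "... = Cmp Der (sus G) (sus F)"
  unfolding c'[symmetric] using sus_cl[OF f(1)] sus_cl[OF g(1)] f(2) g(2) by (simp add: Der_sel)
 finally show ?thesis .
qed

lemma arr_cl2:
 assumes "D.arr F" "D.arr G" "D.dm F = D.dm G"
 obtains P s f g where "rf (D.dm G) P (D.cd F) s f" "F = cl (D.dm G) P (D.cd F) s f"
  "rf (D.dm G) P (D.cd G) s g" "G = cl (D.dm G) P (D.cd G) s g"
proof -
 have "F : dhom (D.dm G) (D.cd F)" "G : dhom (D.dm G) (D.cd G)"
  using D.arr_hom[OF assms(1,3) refl] D.arr_hom[OF assms(2) refl refl] by (simp_all add: Der_sel)
 from der_homE2[OF this] that show ?thesis by metis
qed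

lemma sus_add:
 assumes "D.arr F" "D.arr G" "D.dm F = D.dm G" "D.cd F = D.cd G"
 shows "sus (HAdd Der F G) = HAdd Der (sus F) (sus G)"
proof -
 obtain P s f g where f: "rf (D.dm G) P (D.cd F) s f" "F = cl (D.dm G) P (D.cd F) s f"
  and g: "rf (D.dm G) P (D.cd G) s g" "G = cl (D.dm G) P (D.cd G) s g"
  by (rule arr_cl2[OF assms(1-3)])
 note f' = f[unfolded assms(4)]
 have "HAdd Der F G = cl (D.dm G) P (D.cd G) s (hadd (D.cd G) f g)"
  using add_cl[OF f'(1) g(1)] f'(2) g(2) by (simp add: Der_sel)
 hence "sus (HAdd Der F G) = cl (\<Sigma> (D.dm G)) (\<Sigma> P) (\<Sigma> (D.cd G)) (sh s) (sh (hadd (D.cd G) f g))"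
  using sus_cl[OF rf_add[OF f'(1) g(1)]] by simp
 also have "... = HAdd Der (sus F) (sus G)"
  using add_cl[OF rf_shift[OF f'(1), of 1] rf_shift[OF g(1), of 1]] sus_cl[OF f'(1)] sus_cl[OF g(1)] f'(2) g(2)
  by (simp add: Der_sel)
 finally show ?thesis .
qed

lemma same_up: "DG Q ==> same (\<Sigma> (dg_shift (-1) Q)) Q"
 using shift_down_same[of Q "-1"] by simp

text \<open>A comparison apex for the suspended roofs need not be a suspension itself; it is
  replaced by the suspension of its own desuspension, which is the \<open>same\<close> module, and
  then everything is shifted down.\<close>

lemma sus_inj:
 assumes "D.arr F" "D.arr G" "D.dm F = D.dm G" "D.cd F = D.cd G" "sus F = sus G"
 shows "F = G"
proof -
 obtain P s f g where f: "rf (D.dm G) P (D.cd F) s f" "F = cl (D.dm G) P (D.cd F) s f"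
  and g: "rf (D.dm G) P (D.cd G) s g" "G = cl (D.dm G) P (D.cd G) s g"
  by (rule arr_cl2[OF assms(1-3)])
 note f' = f[unfolded assms(4)]
 let ?X = "D.dm G" and ?Y = "D.cd G"
 note DGs = rfD(4-6)[OF g(1)]
 have "cl (\<Sigma> ?X) (\<Sigma> P) (\<Sigma> ?Y) (sh s) (sh f) = cl (\<Sigma> ?X) (\<Sigma> P) (\<Sigma> ?Y) (sh s) (sh g)"
  using sus_cl[OF f'(1)] sus_cl[OF g(1)] f'(2) g(2) assms(5) by simp
 then obtain Q u v where Q: "qs Q (\<Sigma> P) u" "qs Q (\<Sigma> P) v"
  "hq Q (\<Sigma> ?X) (sh s oo u) (sh s oo v)" "hq Q (\<Sigma> ?Y) (sh f oo u) (sh g oo v)"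
  by (rule cl_eqD[OF rf_shift[OF f'(1)]])
 have DQ: "DG Q" using morD(1)[OF qs_mor[OF Q(1)]] .
 let ?Q = "dg_shift (-1) Q"
 have refl_same: "same M M" for M by (simp add: same_def)
 note sm = same_sym[OF same_up[OF DQ]]
 have a: "(%p. (sh s oo u) (p - 1)) = s oo (%p. u (p - 1))" "(%p. (sh s oo v) (p - 1)) = s oo (%p. v (p - 1))"
  "(%p. (sh f oo u) (p - 1)) = f oo (%p. u (p - 1))" "(%p. (sh g oo v) (p - 1)) = g oo (%p. v (p - 1))"
  by (simp_all add: gcomp_def)
 have "cl ?X P ?Y s f = cl ?X P ?Y s g"
 proof (rule cl_eqI[OF f'(1) g(1)])
  show "qs ?Q P (%p. u (p - 1))"
   using same_qs'[OF sm refl_same Q(1)] qs_shift_iff[of ?Q P 1 u] DQ DGs by simp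
  show "mor ?Q P (%p. v (p - 1))"
   using same_mor[OF sm refl_same qs_mor[OF Q(2)]] mor_shift_iff[of ?Q P 1 v] DQ DGs by simp
  show "hq ?Q ?X (s oo (%p. u (p - 1))) (s oo (%p. v (p - 1)))"
   using same_hq[OF sm refl_same Q(3)] hq_shift_iff[of ?Q ?X 1] DQ DGs by (simp add: a)
  show "hq ?Q ?Y (f oo (%p. u (p - 1))) (g oo (%p. v (p - 1)))"
   using same_hq[OF sm refl_same Q(4)] hq_shift_iff[of ?Q ?Y 1] DQ DGs by (simp add: a)
 qed
 thus ?thesis using f'(2) g(2) by simp
qed

text \<open>As for injectivity, the apex is replaced by the \<open>same\<close> module that is a
  suspension; the identity function is a quasi-isomorphism between the two, so the class does not
  change.\<close>

lemma sus_surj: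
 assumes "D.arr F" "D.dm F = \<Sigma> X" "D.cd F = \<Sigma> Y" "DG X" "DG Y"
 obtains G where "D.arr G" "D.dm G = X" "D.cd G = Y" "sus G = F"
proof -
 obtain P s f where f: "rf (\<Sigma> X) P (\<Sigma> Y) s f" "F = cl (\<Sigma> X) P (\<Sigma> Y) s f"
  by (rule arr_cl[OF assms(1-3)])
 note DP = rfD(5)[OF f(1)]
 have refl_same: "same M M" for M by (simp add: same_def)
 let ?P = "dg_shift (-1) P"
 note sm = same_sym[OF same_up[OF DP]]
 have s1: "qs (\<Sigma> ?P) (\<Sigma> X) s" by (rule same_qs'[OF sm refl_same rfD(1)[OF f(1)]])
 have f1: "mor (\<Sigma> ?P) (\<Sigma> Y) f" by (rule same_mor[OF sm refl_same rfD(2)[OF f(1)]])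
 have r: "rf X ?P Y (%p. s (p - 1)) (%p. f (p - 1))"
  using s1 f1 qs_shift_iff[of ?P X 1 s] mor_shift_iff[of ?P Y 1 f] DP assms(4,5) by (simp add: rf_def)
 have "sus (cl X ?P Y (%p. s (p - 1)) (%p. f (p - 1))) = cl (\<Sigma> X) (\<Sigma> ?P) (\<Sigma> Y) s f"
  using sus_cl[OF r] by simp
 also have "... = F"
  unfolding f(2) using cl_refine(1)[OF f(1) same_qs[OF _ same_up[OF DP]]] DP by simp
 finally show ?thesis using that[OF cl_arr[OF r]] by blast
qed

lemma sus_iso [simp]:
 assumes "D.iso F" shows "D.iso (sus F)"
proof (rule D.isoI[of _ "sus (D.iv F)"])
 show "Cmp Der (sus (D.iv F)) (sus F) = Idn Der (D.dm (sus F))"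
  "Cmp Der (sus F) (sus (D.iv F)) = Idn Der (D.cd (sus F))"
  using assms D.arr_obj[of F] by (simp_all add: sus_cmp[symmetric] sus_idn)
qed (use assms in simp_all)

lemma shift_shift_isom: "DG X ==> D.isom (dg_shift n (dg_shift m X)) (dg_shift (n + m) X)"
 using same_qs[OF _ same_shift_shift] qs_mor by (intro D.isomI[of "q (dg_shift n (dg_shift m X)) (dg_shift (n + m) X) hid"]) auto

lemma shift_0_isom: "DG X ==> D.isom (dg_shift 0 X) X"
 using same_qs[OF _ same_shift_0] qs_mor by (intro D.isomI[of "q (dg_shift 0 X) X hid"]) auto

subsection \<open>Biproducts and contractible modules\<close>

lemma q_zero: "DG M ==> DG N ==> HZero Der M N = q M N (hzero N)"
 by (simp add: Der_sel2)

lemma q_add': "mor M N f ==> mor M N g ==> HAdd Der (q M N f) (q M N g) = q M N (hadd N f g)"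
 using q_add by (simp add: Der_sel)

lemma contractible_null:
 assumes "hq C C hid (hzero C)" shows "D.null C"
 unfolding D.null_def using assms hqD(3)[OF assms] q_eq[OF assms] by (simp add: Der_idn q_zero)

lemma tws_zero: "DG M ==> DG N ==> tws M N (%p x. zr N (p+1))"
 by (simp add: tws_def gh_zero idx)

lemma Der_biprod:
 assumes X: "DG X" and Y: "DG Y"
 shows "is_biproduct Der X Y (tw Y X (%p x. zr X (p+1)))"
proof -
 note T = tws_zero[OF Y X]
 let ?P = "tw Y X (%p x. zr X (p+1))"
 note P = DG_tw[OF T]
 have i1: "mor X ?P (%p y. pr (y, zr Y p))" and p2: "mor ?P Y (%p u. snd (un u))"
  by (rule mor_tw_in[OF T], rule mor_tw_proj[OF T])
 have i2: "mor Y ?P (%p x. pr (zr X p, x))"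
  by (rule morI) (use X Y P in "auto simp: DG_act_zero")
 have p1: "mor ?P X (%p u. fst (un u))"
  by (rule morI) (use X Y P in "auto")
 show ?thesis
 proof (rule D.biprodI)
  show "HAdd Der (Cmp Der (q X ?P (%p y. pr (y, zr Y p))) (q ?P X (%p u. fst (un u))))
    (Cmp Der (q Y ?P (%p x. pr (zr X p, x))) (q ?P Y (%p u. snd (un u)))) = Idn Der ?P"
   unfolding q_cmp[OF p1 i1] q_cmp[OF p2 i2] q_add'[OF mor_comp[OF p1 i1] mor_comp[OF p2 i2]] Der_idn
   by (rule q_eq[OF hq_ext[OF mor_add[OF mor_comp[OF p1 i1] mor_comp[OF p2 i2]] mor_id[OF P]]]) (use X Y in auto)
 qed (use X Y P in \<open>simp_all add: D.ar_iff i1 i2 p1 p2 q_cmp[OF i1 p1] q_cmp[OF i2 p1] q_cmp[OF i1 p2] q_cmp[OF i2 p2]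
   Der_idn q_zero gcomp_def comp_def\<close>)
qed

subsection \<open>Mapping cones\<close>

abbreviation cn where "cn M N f \<equiv> tw (\<Sigma> M) N (sh f)"
abbreviation cin where "cin M N f \<equiv> (%p y. pr (y, zr (\<Sigma> M) p))"
abbreviation cpr :: "int => 'm => 'm" where "cpr \<equiv> (%p u. snd (un u))"
abbreviation "ci M N f \<equiv> q N (cn M N f) (cin M N f)"
abbreviation "cp M N f \<equiv> q (cn M N f) (\<Sigma> M) cpr"

lemma tws_cn:
 assumes "mor M N f" shows "tws (\<Sigma> M) N (sh f)"
proof -
 note F = morD[OF assms]
 have "gh 1 (\<Sigma> M) N (sh f)"
  by (rule ghI) (use F(1,2) F(10)[of _ "_+1"] in "simp_all add: F add_ac")
 moreover have "pls N (p+2) (cdiff N (p+1) (f (p+1) x)) (f (p+1+1) (cdiff (\<Sigma> M) p x)) = zr N (p+2)"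
  if "x : cel (\<Sigma> M) p" for p x
  using that F(1,2) F(9)[of "cdiff M (p+1) x" "p+2"] F(5)[of x "p+1"] F(7)[of x "p+1" "p+2"]
  by (simp add: koszul_cases idx)
 ultimately show ?thesis using F(1,2) by (simp add: tws_def)
qed

lemma DG_cn [simp]: "mor M N f ==> DG (cn M N f)"
 by (rule DG_tw[OF tws_cn])

lemma mor_cin: "mor M N f ==> mor N (cn M N f) (cin M N f)"
 using mor_tw_in[OF tws_cn] .

lemma mor_cpr: "mor M N f ==> mor (cn M N f) (\<Sigma> M) cpr"
 using mor_tw_proj[OF tws_cn] .

lemma cone_triangle_cn:
 assumes f: "mor M N f"
 shows "cone_triangle k A M N (cn M N f) f (cin M N f) cpr"
proof -
 note F = morD[OF f] and T = tws_cn[OF f]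
 let ?j = "%p x. pr (zr N p, x)"
 have "graded_hom k A 0 (\<Sigma> M) (cn M N f) ?j" by (rule gh_tw_incl[OF T])
 moreover have "bij_betw (%(y, x). cin M N f p y \<oplus>\<^bsub>cgr (cn M N f) p\<^esub> ?j p x) (cel N p \<times> cel M (p+1)) (cel (cn M N f) p)" for p
 proof -
  have "bij_betw pr (cel N p \<times> cel M (p+1)) (cel (cn M N f) p)"
   by (simp add: bij_betw_def inj_on_def)
  moreover have "pr z = (%(y, x). cin M N f p y \<oplus>\<^bsub>cgr (cn M N f) p\<^esub> ?j p x) z" if "z : cel N p \<times> cel M (p+1)" for z
   using that F(1,2) by auto
  ultimately show ?thesis using bij_betw_cong by blast
 qed
 moreover have "cdiff (cn M N f) p (?j p x) =
   cin M N f (p+1) (f (p+1) x) \<ominus>\<^bsub>cgr (cn M N f) (p+1)\<^esub> ?j (p+1) (cdiff M (p+1) x)"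
  if "x : cel M (p+1)" for p x
  using that F(1,2) F(5)[of x "p+1"] tw_ngt[OF T, of "zr N (p+1)" "p+1" "cdiff M (p+1) x"]
  by (simp add: a_minus_def koszul_cases)
 ultimately show ?thesis
  unfolding cone_triangle_def using F(1-3) DG_cn[OF f] morD(3)[OF mor_cin[OF f]] morD(3)[OF mor_cpr[OF f]]
  by (auto intro!: exI[of _ ?j])
qed

lemma qs_bij:
 assumes f: "mor M N f" and b: "!!p. bij_betw (f p) (cel M p) (cel N p)"
 shows "qs M N f"
proof (rule qsI[OF f])
 note F = morD[OF f]
 have inj: "f p x = f p y ==> x : cel M p ==> y : cel M p ==> x = y" for p x y
  using b[of p] by (auto simp: bij_betw_def dest: inj_onD)
 fix p x c assume a: "x : cel M (p+1)" "c : cel N p" "f (p+1) x = cdiff N p c"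
 obtain c' where c: "c' : cel M p" "c = f p c'" using b[of p] a(2) by (auto simp: bij_betw_def)
 have "f (p+1) x = f (p+1) (cdiff M p c')" using a(3) c by (simp add: F(7))
 thus "EX c:cel M p. x = cdiff M p c" using inj a(1) c(1) F(1) by (intro bexI[of _ c']) auto
next
 note F = morD[OF f]
 have inj: "f p x = f p y ==> x : cel M p ==> y : cel M p ==> x = y" for p x y
  using b[of p] by (auto simp: bij_betw_def dest: inj_onD)
 fix p y assume a: "y : cel N (p+1)" "cdiff N (p+1) y = zr N (p+2)"
 obtain x where x: "x : cel M (p+1)" "y = f (p+1) x" using b[of "p+1"] a(1) by (auto simp: bij_betw_def)
 have "f (p+2) (cdiff M (p+1) x) = f (p+2) (zr M (p+2))"
  using a(2) x F(7)[of x "p+1" "p+2"] F(8) by simp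
 hence "cdiff M (p+1) x = zr M (p+2)" by (rule inj) (use x(1) F(1) in simp_all)
 thus "hits M N f p y"
  using x a(1) F(2) by (intro bexI[of _ x] conjI bexI[of _ "zr N p"]) simp_all
qed

text \<open>\<open>cone_triangle\<close> fixes the cone only up to isomorphism; \<open>th\<close>,
  sending (y, x) to i y + j x, identifies the model \<open>cn\<close> with it.\<close>

lemma cone_triangle_iso:
 assumes "cone_triangle k A M N C f i pi"
 obtains th where "mor M N f" "mor N C i" "mor C (\<Sigma> M) pi" "qs (cn M N f) C th"
  "hq N C (th oo cin M N f) i" "hq (cn M N f) (\<Sigma> M) (pi oo th) cpr"
proof -
 have c: "DG M" "DG N" "DG C" "hom M N f" "hom N C i" "hom C (\<Sigma> M) pi"
  using assms unfolding cone_triangle_def by auto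
 obtain j where j: "gh 0 (\<Sigma> M) C j"
  and bij: "!!p. bij_betw (%(y, x). i p y \<oplus>\<^bsub>cgr C p\<^esub> j p x) (cel N p \<times> cel M (p+1)) (cel C p)"
  and pj: "!!p y x. y : cel N p ==> x : cel M (p+1) ==> pi p (i p y \<oplus>\<^bsub>cgr C p\<^esub> j p x) = x"
  and dj: "!!p x. x : cel M (p+1) ==> cdiff C p (j p x) =
      i (p+1) (f (p+1) x) \<ominus>\<^bsub>cgr C (p+1)\<^esub> j (p+1) (cdiff M (p+1) x)"
  using assms unfolding cone_triangle_def by auto
 have f: "mor M N f" and i: "mor N C i" and p: "mor C (\<Sigma> M) pi" using c by (simp_all add: mor_def)
 note F = morD[OF f] and I = morD[OF i] and P = morD[OF p]
 have J: "x : cel M (p+1) ==> j p x : cel C p"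
  "x : cel M (p+1) ==> y : cel M (p+1) ==> j p (pls M (p+1) x y) = pls C p (j p x) (j p y)"
  "j p (zr M (p+1)) = zr C p"
  "x : cel M (p+1) ==> j p (ngt M (p+1) x) = ngt C p (j p x)"
  "x : cel M (p+1) ==> a : cel A r ==> j (p + r) (gact M (p+1) r x a) = gact C p r (j p x) a" for p :: int and x y a r
  using ghD(1)[OF j, of x p p] ghD(2)[OF j, of x p y] ghD(3)[OF j, of x p a r] ghD(5)[OF j, of p]
   ghD(6)[OF j, of x p] c(1,3) by simp_all
 let ?C = "cn M N f"
 let ?th = "%p u. pls C p (i p (fst (un u))) (j p (snd (un u)))"
 note DC = DG_cn[OF f]
 have th: "mor ?C C ?th"
 proof (rule morI[OF DC c(3)])
  fix p u assume "u : cel ?C p"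
  then obtain y x where u: "u = pr (y, x)" and y: "y : cel N p" and x: "x : cel M (p+1)" by auto
  have fx: "f (p+1) x : cel N (p+1)" using F(5) x by simp
  have dx: "cdiff M (p+1) x : cel M (p+1+1)" using c(1) x by simp
  have jn: "j (p+1) (ngt M (p+2) (cdiff M (p+1) x)) = ngt C (p+1) (j (p+1) (cdiff M (p+1) x))"
   using J(4)[OF dx] by (simp add: idx)
  show "?th p u : cel C p" using u y x I(5) J(1) c(3) by simp
  show "?th (p+1) (cdiff ?C p u) = cdiff C p (?th p u)"
   using y x fx dx c(2,3) I(5)[OF y] I(5)[OF fx] J(1)[OF x] J(1)[OF dx]
   by (simp add: u koszul_cases DG_d_add dj a_minus_def I(6) I(7) jn idx DG_ac)
  show "?th (p + r) (gact ?C p r u a) = gact C p r (?th p u) a" if "a : cel A r" for r a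
   using y x that c(3) I(5)[OF y] J(1)[OF x] by (simp add: u I(10) J(5) DG_act_add)
  fix v assume "v : cel ?C p"
  then obtain y' x' where v: "v = pr (y', x')" and y': "y' : cel N p" and x': "x' : cel M (p+1)" by auto
  show "?th p (pls ?C p u v) = pls C p (?th p u) (?th p v)"
   using y x y' x' c(3) I(5)[OF y] I(5)[OF y'] J(1)[OF x] J(1)[OF x'] by (simp add: u v I(6) J(2) DG_ac)
 qed
 have "bij_betw (?th p) (cel ?C p) (cel C p)" for p
 proof -
  have "bij_betw (?th p \<circ> pr) (cel N p \<times> cel M (p+1)) (cel C p)"
   by (rule bij_betw_cong[THEN iffD1, OF _ bij]) auto
  moreover have "bij_betw pr (cel N p \<times> cel M (p+1)) (cel ?C p)"
   by (simp add: bij_betw_def inj_on_def)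
  ultimately show ?thesis using bij_betw_comp_iff by blast
 qed
 hence "qs ?C C ?th" by (rule qs_bij[OF th])
 moreover have "hq N C (?th oo cin M N f) i"
  by (rule hq_ext[OF mor_comp[OF mor_cin[OF f] th] i]) (use I(5) c(3) in "simp add: J(3)")
 moreover have "hq ?C (\<Sigma> M) (pi oo ?th) cpr"
  by (rule hq_ext[OF mor_comp[OF th p] mor_cpr[OF f]]) (use pj in auto)
 ultimately show ?thesis using that f i p by blast
qed

end

context dgc begin

abbreviation cmpD (infixr "**" 70) where "G ** F \<equiv> Cmp Der G F"

lemma q_neg: "mor M N f ==> q M N (hneg N f) = D.ng (q M N f)"
proof (rule D.ng_unique)
 assume f: "mor M N f"
 note F = morD[OF f]
 show "HAdd Der (q M N (hneg N f)) (q M N f) = HZero Der (D.dm (q M N f)) (D.cd (q M N f))"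
  unfolding q_add'[OF mor_neg[OF f] f] q_arr[OF f] q_zero[OF F(1,2)]
  by (rule q_eq[OF hq_ext[OF mor_add[OF mor_neg[OF f] f] mor_zero[OF F(1,2)]]]) (use F(2,5) in simp)
qed (simp_all add: mor_neg)

lemma sus_ng: "D.arr F ==> sus (D.ng F) = D.ng (sus F)"
proof (rule D.ng_unique)
 assume F: "D.arr F"
 have DGs: "DG (D.dm F)" "DG (D.cd F)" using D.arr_obj[OF F] by simp_all
 have "HAdd Der (sus (D.ng F)) (sus F) = sus (HZero Der (D.dm F) (D.cd F))"
  using F by (simp add: sus_add[symmetric])
 also have "... = HZero Der (\<Sigma> (D.dm F)) (\<Sigma> (D.cd F))"
  using DGs sus_q[OF mor_zero[OF DGs]] by (simp add: q_zero)
 finally show "HAdd Der (sus (D.ng F)) (sus F) = HZero Der (D.dm (sus F)) (D.cd (sus F))" using F by simp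
qed simp_all

abbreviation "tri X Y Z u v w \<equiv> (X, Y, Z, u, v, w) : der_triangles k A"

lemma triI:
 assumes f: "mor M N f" and u: "D.arr u" "D.arr v" "D.arr w" "D.dm v = D.cd u" "D.dm w = D.cd v" "D.cd w = \<Sigma> (D.dm u)"
  and i: "D.iso a" "D.iso b" "D.iso c" "D.dm a = D.dm u" "D.dm b = D.cd u" "D.dm c = D.cd v"
   "D.cd a = M" "D.cd b = N" "D.cd c = cn M N f"
  and e: "b ** u = q M N f ** a" "c ** v = ci M N f ** b" "sus a ** w = cp M N f ** c"
 shows "tri (D.dm u) (D.cd u) (D.cd v) u v w"
proof -
 have DGs: "DG (D.dm u)" "DG (D.cd u)" "DG (D.cd v)" "DG M" "DG N" "DG (cn M N f)"
  using D.arr_obj[OF u(1)] D.arr_obj[OF u(2)] f morD[OF f] by simp_all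
 have homs: "u : dhom (D.dm u) (D.cd u)" "v : dhom (D.cd u) (D.cd v)"
  "w : dhom (D.cd v) (\<Sigma> (D.dm u))"
  using D.arr_hom[OF u(1) refl refl] D.arr_hom[OF u(2,4) refl] D.arr_hom[OF u(3,5,6)] by (simp_all add: Der_sel)
 have isos: "is_iso Der (D.dm u) M a" "is_iso Der (D.cd u) N b" "is_iso Der (D.cd v) (cn M N f) c"
  using D.is_iso_iff[of "D.dm u" M a] D.is_iso_iff[of "D.cd u" N b] D.is_iso_iff[of "D.cd v" "cn M N f" c] DGs i
  by simp_all
 have eqs: "dcmp b u = dcmp (der_map k A M N f) a"
  "dcmp c v = dcmp (der_map k A N (cn M N f) (cin M N f)) b"
  "dcmp (der_susp k A a) w = dcmp (der_map k A (cn M N f) (\<Sigma> M) cpr) c"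
  using e by (simp_all add: Der_sel der_map_q)
 show ?thesis
  unfolding der_triangles_def mem_Collect_eq case_prod_conv
  using cone_triangle_cn[OF f] DGs homs isos eqs by blast
qed

text \<open>By \<open>cone_triangle_iso\<close> every triangle is isomorphic to the one on the
  explicit model \<open>cn\<close>, so no later argument has to deal with an unspecified
  cone.\<close>

lemma triE:
 assumes "tri X Y Z u v w"
 obtains M N f a b c where "mor M N f" "D.arr u" "D.arr v" "D.arr w" "D.dm u = X" "D.cd u = Y" "D.dm v = Y"
   "D.cd v = Z" "D.dm w = Z" "D.cd w = \<Sigma> X"
   "D.iso a" "D.iso b" "D.iso c" "D.dm a = X" "D.dm b = Y" "D.dm c = Z"
   "D.cd a = M" "D.cd b = N" "D.cd c = cn M N f"
   "b ** u = q M N f ** a" "c ** v = ci M N f ** b" "sus a ** w = cp M N f ** c"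
proof -
 obtain M N C f i pi a b c where DGs: "DG X" "DG Y" "DG Z"
  and homs: "u : dhom X Y" "v : dhom Y Z" "w : dhom Z (\<Sigma> X)"
  and cone: "cone_triangle k A M N C f i pi"
  and isos: "is_iso Der X M a" "is_iso Der Y N b" "is_iso Der Z C c"
  and eqs: "dcmp b u = dcmp (der_map k A M N f) a"
  "dcmp c v = dcmp (der_map k A N C i) b"
  "dcmp (der_susp k A a) w = dcmp (der_map k A C (\<Sigma> M) pi) c"
  using assms unfolding der_triangles_def mem_Collect_eq case_prod_conv by blast
 obtain th where f: "mor M N f" and im: "mor N C i" and pm: "mor C (\<Sigma> M) pi" and th: "qs (cn M N f) C th"
  "hq N C (th oo cin M N f) i" "hq (cn M N f) (\<Sigma> M) (pi oo th) cpr"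
  by (rule cone_triangle_iso[OF cone])
 have DG2: "DG M" "DG N" "DG C" using morD[OF f] morD[OF im] by auto
 have u: "D.arr u" "D.arr v" "D.arr w" "D.dm u = X" "D.cd u = Y" "D.dm v = Y" "D.cd v = Z" "D.dm w = Z" "D.cd w = \<Sigma> X"
  using D.homD[of u X Y] D.homD[of v Y Z] D.homD[of w Z "\<Sigma> X"] homs DGs by (simp_all add: Der_sel)
 have i: "D.iso a" "D.iso b" "D.iso c" "D.dm a = X" "D.dm b = Y" "D.dm c = Z" "D.cd a = M" "D.cd b = N" "D.cd c = C"
  using D.is_iso_iff[of X M a] D.is_iso_iff[of Y N b] D.is_iso_iff[of Z C c] isos DGs DG2 by simp_all
 have e: "b ** u = q M N f ** a" "c ** v = q N C i ** b" "sus a ** w = q C (\<Sigma> M) pi ** c"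
  using eqs by (simp_all add: Der_sel der_map_q)
 let ?t = "q (cn M N f) C th"
 have t: "D.iso ?t" "D.arr ?t" "D.dm ?t = cn M N f" "D.cd ?t = C"
  using th(1) q_iso'(1) q_arr[OF qs_mor[OF th(1)]] by auto
 have ti: "?t ** ci M N f = q N C i"
  unfolding q_cmp[OF mor_cin[OF f] qs_mor[OF th(1)]] by (rule q_eq[OF th(2)])
 have tp: "q C (\<Sigma> M) pi ** ?t = cp M N f"
  unfolding q_cmp[OF qs_mor[OF th(1)] pm] by (rule q_eq[OF th(3)])
 show ?thesis
 proof (rule that[OF f u i(1,2) _ i(4,5) _ i(7,8) _ e(1)])
  show "D.iso (D.iv ?t ** c)" "D.dm (D.iv ?t ** c) = Z" "D.cd (D.iv ?t ** c) = cn M N f"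
   using t i by simp_all
  show "(D.iv ?t ** c) ** v = ci M N f ** b"
   using e(2)[folded ti] t i u mor_cin[OF f] by simp
  show "sus a ** w = cp M N f ** D.iv ?t ** c"
   using e(3) t i u mor_cpr[OF f] pm unfolding tp[symmetric] by simp
 qed
qed

lemma tri_wf:
 assumes "tri X Y Z u v w"
 shows "D.arr u" "D.arr v" "D.arr w" "D.dm u = X" "D.cd u = Y" "D.dm v = Y" "D.cd v = Z" "D.dm w = Z" "D.cd w = \<Sigma> X"
 by (rule triE[OF assms], assumption)+

lemma tri_iso:
 assumes t: "tri X Y Z u v w" and i: "D.iso al" "D.iso be" "D.iso gm" "D.dm al = X" "D.dm be = Y" "D.dm gm = Z"
  and u': "D.arr u'" "D.arr v'" "D.arr w'" "D.dm u' = D.cd al" "D.cd u' = D.cd be" "D.dm v' = D.cd be" "D.cd v' = D.cd gm"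
   "D.dm w' = D.cd gm" "D.cd w' = \<Sigma> (D.cd al)"
  and e': "u' ** al = be ** u" "v' ** be = gm ** v" "w' ** gm = sus al ** w"
 shows "tri (D.cd al) (D.cd be) (D.cd gm) u' v' w'"
proof (rule triE[OF t])
 fix M N f a b c assume f: "mor M N f"
  and u: "D.arr u" "D.arr v" "D.arr w" "D.dm u = X" "D.cd u = Y" "D.dm v = Y" "D.cd v = Z" "D.dm w = Z" "D.cd w = \<Sigma> X"
  and j: "D.iso a" "D.iso b" "D.iso c" "D.dm a = X" "D.dm b = Y" "D.dm c = Z" "D.cd a = M" "D.cd b = N" "D.cd c = cn M N f"
  and e: "b ** u = q M N f ** a" "c ** v = ci M N f ** b" "sus a ** w = cp M N f ** c"
 note m = f mor_cin[OF f] mor_cpr[OF f]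
 have 1: "(b ** D.iv be) ** u' = q M N f ** a ** D.iv al"
  by (rule D.iso_epi[OF i(1)]) (use i u' u j m e(1) e'(1) in simp_all)
 have 2: "(c ** D.iv gm) ** v' = ci M N f ** b ** D.iv be"
  by (rule D.iso_epi[OF i(2)]) (use i u' u j m e(2) e'(2) in simp_all)
 have sa: "sus (D.iv al) ** sus al = Idn Der (\<Sigma> X)"
  using i D.arr_obj[of al] by (simp add: sus_cmp[symmetric] sus_idn)
 have sa': "sus (D.iv al) ** (sus al ** w) = w"
  using D.assoc[of w "sus al" "sus (D.iv al)"] sa i u by (simp del: D.assoc)
 have 3: "sus (a ** D.iv al) ** w' = cp M N f ** c ** D.iv gm"
  by (rule D.iso_epi[OF i(3)]) (use i u' u j m e(3) e'(3) sa' in "simp_all add: sus_cmp")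
 show ?thesis
  using triI[OF f u'(1-3), of "a ** D.iv al" "b ** D.iv be" "c ** D.iv gm"] 1 2 3 i u' j by simp
qed

lemma tri_cn:
 assumes "mor M N f" shows "tri M N (cn M N f) (q M N f) (ci M N f) (cp M N f)"
proof -
 have a: "DG M" "DG N" using morD[OF assms] by auto
 note m = mor_cin[OF assms] mor_cpr[OF assms]
 show ?thesis
  using triI[OF assms, of "q M N f" "ci M N f" "cp M N f" "Idn Der M" "Idn Der N" "Idn Der (cn M N f)"] a m assms
  by (simp add: sus_idn)
qed

text \<open>For F = f s^-1 the invertible arrow s identifies F with f, and the cone of the numerator
  f completes the triangle.\<close>

lemma tri_complete:
 assumes "D.arr F" shows "EX Z v w. tri (D.dm F) (D.cd F) Z F v w"
proof (rule factor[OF assms])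
 fix P s f assume s: "qs P (D.dm F) s" and f: "mor P (D.cd F) f" and F: "F = q P (D.cd F) f ** D.iv (q P (D.dm F) s)"
 note S = qs_mor[OF s]
 let ?s = "q P (D.dm F) s"
 have i: "D.iso ?s" "D.dm ?s = P" "D.cd ?s = D.dm F" using s S by simp_all
 have b: "DG (D.cd F)" "DG P" using assms D.arr_obj[OF assms] morD(1)[OF S] by simp_all
 note m = mor_cin[OF f] mor_cpr[OF f]
 have "tri (D.cd ?s) (D.cd (Idn Der (D.cd F))) (D.cd (Idn Der (cn P (D.cd F) f))) F (ci P (D.cd F) f) (sus ?s ** cp P (D.cd F) f)"
 proof (rule tri_iso[OF tri_cn[OF f] i(1) D.iso_idn D.iso_idn])
  show "F ** ?s = Idn Der (D.cd F) ** q P (D.cd F) f"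
   by (subst F) (use i f b in "simp")
 qed (use i m f b assms in "simp_all")
 thus ?thesis using i b f by auto
qed

lemma tri_id:
 assumes M: "DG M" shows "EX Z v w. D.null Z & tri M M Z (Idn Der M) v w"
proof (intro exI conjI)
 note f = mor_id[OF M]
 \<comment> \<open>The contraction of the cone of the identity moves the component in M to the
   component in the shifted copy of M.\<close>
 let ?C = "cn M M hid" and ?h = "%p u. pr (zr M (p - 1), fst (un u))"
 have "gh (-1) ?C ?C ?h"
  by (rule ghI) (use M DG_cn[OF f] in "auto simp: DG_act_zero diff_add_eq")
 hence "hq ?C ?C hid (hzero ?C)"
  by (rule hqI[OF mor_id[OF DG_cn[OF f]] mor_zero[OF DG_cn[OF f] DG_cn[OF f]]])
   (use M in "auto simp: koszul_cases DG_ac")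
 thus "D.null ?C" by (rule contractible_null)
 show "tri M M ?C (Idn Der M) (ci M M hid) (cp M M hid)" using tri_cn[OF f] by (simp add: Der_idn)
qed

text \<open>In the cone of N -> cn M N f the two copies of N cancel, leaving the suspension of M.
  The equivalence \<open>?sg\<close> must carry the term - f m to commute with differentials, and
  this term is the source of the sign in the rotated triangle.\<close>

lemma tri_rot:
 assumes t: "tri X Y Z u v w" shows "tri Y Z (\<Sigma> X) v w (D.ng (sus u))"
proof (rule triE[OF t])
 fix M N f a b c assume f: "mor M N f"
  and u: "D.arr u" "D.arr v" "D.arr w" "D.dm u = X" "D.cd u = Y" "D.dm v = Y" "D.cd v = Z" "D.dm w = Z" "D.cd w = \<Sigma> X"
  and j: "D.iso a" "D.iso b" "D.iso c" "D.dm a = X" "D.dm b = Y" "D.dm c = Z" "D.cd a = M" "D.cd b = N" "D.cd c = cn M N f"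
  and e: "b ** u = q M N f ** a" "c ** v = ci M N f ** b" "sus a ** w = cp M N f ** c"
 note F = morD[OF f]
 let ?C = "cn M N f" and ?i = "cin M N f"
 note i = mor_cin[OF f]
 let ?C2 = "cn N ?C ?i"
 note T = tws_cn[OF f] and T2 = tws_cn[OF i]
 let ?sg = "%p m. pr (pr (zr N p, m), ngt N (p+1) (f (p+1) m))"
 let ?ka = "%p u. snd (un (fst (un u)))"
 have s: "mor (\<Sigma> M) ?C2 ?sg"
 proof (rule morI)
  fix p m assume "m : cel (\<Sigma> M) p"
  hence m: "m : cel M (p+1)" by simp
  have fm: "f (p+1) m : cel N (p+1)" "cdiff N (p+1) (f (p+1) m) : cel N (p+2)"
   "cdiff M (p+1) m : cel M (p+2)" using m F by simp_all
  show "?sg (p+1) (cdiff (\<Sigma> M) p m) = cdiff ?C2 p (?sg p m)"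
   using m F(1,2) fm F(7)[OF m, of "p+2"] F(9)[OF fm(3)] by (simp add: koszul_cases idx DG_d_neg)
  show "?sg (p + r) (gact (\<Sigma> M) p r m x) = gact ?C2 p r (?sg p m) x" if "x : cel A r" for r x
   using m that F(1,2) fm F(10)[OF m that] DG_act_neg[OF F(2) fm(1) that] by (simp add: DG_act_zero add_ac)
 qed (use F(1,2) DG_cn[OF i] in "auto simp: F DG_ac")
 have k: "mor ?C2 (\<Sigma> M) ?ka"
  by (rule morI) (use F(1,2) DG_cn[OF i] in "auto simp: koszul_cases")
 \<comment> \<open>The homotopy contracts the two copies of N against each other.\<close>
 let ?H = "%p u. pr (pr (zr N (p - 1), zr M p), fst (un (fst (un u))))"
 have H: "gh (-1) ?C2 ?C2 ?H"
  by (rule ghI) (use F(1,2) DG_cn[OF i] in "auto simp: DG_act_zero diff_add_eq")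
 have sk: "hq ?C2 ?C2 hid (?sg oo ?ka)"
 proof (rule hqI[OF mor_id[OF DG_cn[OF i]] mor_comp[OF k s] H])
  fix p x assume "x : cel ?C2 p"
  then obtain n m n' where x: "x = pr (pr (n, m), n')" and n: "n : cel N p" "n' : cel N (p+1)" and m: "m : cel M (p+1)"
   by auto
  have fm: "f (p+1) m : cel N (p+1)" "cdiff N p n : cel N (p+1)" using m n F by simp_all
  show "x = pls ?C2 p ((?sg oo ?ka) p x) (pls ?C2 p (cdiff ?C2 (p - 1) (?H p x)) (?H (p+1) (cdiff ?C2 p x)))"
   using n m fm F(1,2,8) by (simp add: x koszul_cases idx DG_ac)
 qed
 have ks: "hq (\<Sigma> M) (\<Sigma> M) (?ka oo ?sg) hid"
  by (rule hq_ext[OF mor_comp[OF s k] mor_id]) (use F(1) in simp_all)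
 have qs: "qs (\<Sigma> M) ?C2 ?sg" by (rule qs_hequiv[OF s k ks hq_sym[OF sk]])
 let ?s = "q (\<Sigma> M) ?C2 ?sg"
 have S: "D.iso ?s" "D.arr ?s" "D.dm ?s = \<Sigma> M" "D.cd ?s = ?C2" using qs s by simp_all
 note i2 = mor_cin[OF i] and p2 = mor_cpr[OF i] and p1 = mor_cpr[OF f]
 have 1: "?s ** cp M N f = ci N ?C ?i"
 proof -
  have ext: "hq ?C ?C2 (?sg oo cpr) ((?sg oo ?ka) oo cin N ?C ?i)"
   by (rule hq_ext[OF mor_comp[OF p1 s] mor_comp[OF i2 mor_comp[OF k s]]]) simp
  show ?thesis
   unfolding q_cmp[OF p1 s]
   by (rule q_eq[OF hq_trans[OF ext]]) (use hq_sym[OF hq_comp_right[OF i2 sk]] in simp)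
 qed
 have 2: "cp N ?C ?i ** ?s = D.ng (sus (q M N f))"
 proof -
  have sf: "mor (\<Sigma> M) (\<Sigma> N) (sh f)" by (rule mor_shift[OF f])
  show ?thesis
   unfolding q_cmp[OF s p2] sus_q[OF f] q_neg[OF sf, symmetric]
   by (rule q_eq[OF hq_ext[OF mor_comp[OF s p2] mor_neg[OF sf]]]) (use F(1,2) in simp)
 qed
 have 3: "(?s ** sus a) ** w = ci N ?C ?i ** c"
  unfolding 1[symmetric] using e(3) S u j p1 by simp
 have 4: "sus b ** D.ng (sus u) = cp N ?C ?i ** (?s ** sus a)"
 proof -
  have "cp N ?C ?i ** (?s ** sus a) = (cp N ?C ?i ** ?s) ** sus a" using S u j p2 by simp
  also have "... = D.ng (sus (q M N f ** a))" unfolding 2 using f j u by (simp add: sus_cmp)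
  also have "... = sus b ** D.ng (sus u)" unfolding e(1)[symmetric] using j u by (simp add: sus_cmp)
  finally show ?thesis ..
 qed
 show ?thesis
  using triI[OF i, of v w "D.ng (sus u)" b c "?s ** sus a"] 3 4 e(2) u j S by simp
qed

subsection \<open>Morphisms of cones\<close>

lemma idx3: "3 + p = p + (3 :: int)"
 by simp

text \<open>A homotopy commutative square induces a map of cones in three moves: change of target,
  replacement of the map by a homotopic one, and change of source. This is the first; its
  quasi-isomorphism part is the five lemma written with elements.\<close>

lemma cone_map_target:
 assumes f: "mor M N f" and b: "mor N N' b"
 defines "g \<equiv> (%p u. pr (b p (fst (un u)), snd (un u)))"
 shows "mor (cn M N f) (cn M N' (b oo f)) g" and "qs N N' b ==> qs (cn M N f) (cn M N' (b oo f)) g"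
proof -
 let ?C = "cn M N f" and ?D = "cn M N' (b oo f)"
 note F = morD[OF f] and B = morD[OF b]
 have bf: "mor M N' (b oo f)" by (rule mor_comp[OF f b])
 note DGs = DG_cn[OF f] DG_cn[OF bf]
 show g: "mor ?C ?D g"
  unfolding g_def by (rule morI) (use F(1,2,5) B(2) DGs in "auto simp: B koszul_cases")
 assume qb: "qs N N' b"
 show "qs ?C ?D g"
 proof (rule qsI[OF g])
  fix p x y assume a: "x : cel ?C (p+1)" "cdiff ?C (p+1) x = zr ?C (p+2)"
   "y : cel ?D p" "g (p+1) x = cdiff ?D p y"
  from a(1) obtain n m where x: "x = pr (n, m)" "n : cel N (p+1)" "m : cel M (p+1+1)" by auto
  from a(3) obtain n' m' where y: "y = pr (n', m')" "n' : cel N' p" "m' : cel M (p+1)" by auto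
  have m: "m = ngt M (p+2) (cdiff M (p+1) m')" and bn: "b (p+1) n = pls N' (p+1) (cdiff N' p n') (b (p+1) (f (p+1) m'))"
   using a(4) by (simp_all add: x y g_def koszul_cases idx)
  have fm: "f (p+1) m' : cel N (p+1)" "cdiff M (p+1) m' : cel M (p+2)" using y F by simp_all
  have dn: "pls N (p+2) (cdiff N (p+1) n) (f (p+2) m) = zr N (p+2)"
   using a(2) by (simp add: x koszul_cases idx)
  \<comment> \<open>Subtracting f m' leaves a cocycle of N whose image under b is the coboundary of
    n', so injectivity of b on cohomology applies.\<close>
  let ?z = "pls N (p+1) n (ngt N (p+1) (f (p+1) m'))"
  have z: "?z : cel N (p+1)" "cdiff N (p+1) ?z = zr N (p+2)"
   using x y fm dn F(2) F(7)[OF y(3), of "p+2"] F(9)[OF fm(2)] by (simp_all add: m DG_d_add DG_d_neg idx)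
  have "b (p+1) ?z = cdiff N' p n'"
   using x fm y B(1,2) B(5)[OF fm(1)] by (simp add: B(6) B(9) bn DG_ac)
  then obtain c where c: "c : cel N p" "?z = cdiff N p c" by (rule qs_injE[OF qb z y(2)])
  have "n = pls N (p+1) (cdiff N p c) (f (p+1) m')"
   unfolding c(2)[symmetric] using x fm F(2) by (simp add: DG_ac)
  thus "EX c:cel ?C p. x = cdiff ?C p c"
   using c(1) y by (intro bexI[of _ "pr (c, m')"]) (simp_all add: x m koszul_cases idx)
 next
  fix p y assume a: "y : cel ?D (p+1)" "cdiff ?D (p+1) y = zr ?D (p+2)"
  from a(1) obtain n' m where y: "y = pr (n', m)" "n' : cel N' (p+1)" "m : cel M (p+2)" by (auto simp: idx)
  have dn': "pls N' (p+2) (cdiff N' (p+1) n') (b (p+2) (f (p+2) m)) = zr N' (p+2)"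
   and "ngt M (p+3) (cdiff M (p+2) m) = zr M (p+3)"
   using a(2) by (simp_all add: y koszul_cases idx idx3)
  hence dm: "cdiff M (p+2) m = zr M (p+3)"
   using DG_group_simps(10)[OF F(1), of "cdiff M (p+2) m" "p+3"] DG_group_simps(11)[OF F(1), of "p+3"] y(3) F(1) by simp
  have fm: "f (p+1+1) m : cel N (p+1+1)" "cdiff N (p+1+1) (f (p+1+1) m) = zr N (p+1+2)"
   using y F(5)[of m "p+2"] F(7)[of m "p+2" "p+3"] F(8) dm by (simp_all add: idx idx3)
  have bfm: "b (p+2) (f (p+2) m) = cdiff N' (p+1) (ngt N' (p+1) n')"
   using DG_neg_unique(1)[OF B(2) _ _ dn'] y(2) B(2) B(5)[OF fm(1)] by (simp add: DG_d_neg idx)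
  obtain n1 where n1: "n1 : cel N (p+1)" "f (p+1+1) m = cdiff N (p+1) n1"
   by (rule qs_injE[OF qb fm, of "ngt N' (p+1) n'"]) (use bfm y(2) B(2) in "simp_all add: idx")
  let ?w = "pls N' (p+1) (b (p+1) n1) n'"
  have bn1: "b (p+1) n1 : cel N' (p+1)" "cdiff N' (p+1) (b (p+1) n1) = b (p+2) (f (p+2) m)"
   using n1 B(5) B(7)[of n1 "p+1" "p+2"] by (simp_all add: idx)
  have w: "?w : cel N' (p+1)" "cdiff N' (p+1) ?w = zr N' (p+2)"
   using bn1 y(2) dn' B(2) B(5)[OF fm(1)] by (simp_all add: DG_d_add DG_ac idx)
  obtain n2 n3 where n2: "n2 : cel N (p+1)" "cdiff N (p+1) n2 = zr N (p+2)" "n3 : cel N' p"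
    "?w = pls N' (p+1) (b (p+1) n2) (cdiff N' p n3)" by (rule qs_surjE[OF qb w])
  let ?n = "pls N (p+1) n2 (ngt N (p+1) n1)"
  have fm': "f (p+2) m : cel N (p+2)" "f (p+2) m = cdiff N (p+1) n1" using fm n1 by (simp_all add: idx idx3)
  have bn2: "b (p+1) n2 : cel N' (p+1)" using B(5) n2 by simp
  have "n' = pls N' (p+1) (ngt N' (p+1) (b (p+1) n1)) ?w" using bn1 y(2) B(2) by simp
  hence n': "n' = pls N' (p+1) (b (p+1) ?n) (cdiff N' p n3)"
   unfolding n2(4) using n1(1) n2(1,3) bn1 bn2 B(1,2) by (simp add: B(6) B(9) DG_ac)
  show "hits ?C ?D g p y"
  proof -
   have "cdiff ?C (p+1) (pr (?n, m)) = zr ?C (p+2)"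
    using n1(1) n2(1,2) fm' F(1,2) dm by (simp add: koszul_cases DG_d_add DG_d_neg idx idx3)
   moreover have "y = pls ?D (p+1) (g (p+1) (pr (?n, m))) (cdiff ?D p (pr (n3, zr M (p+1))))"
    using n' n2(3) y(1,3) F(1,8) B(2,8) by (simp add: g_def koszul_cases idx)
   moreover have "pr (?n, m) : cel ?C (p+1)" "pr (n3, zr M (p+1)) : cel ?D p"
    using n1(1) n2(1,3) y(3) F(1,2) by (simp_all add: idx)
   ultimately show ?thesis by blast
  qed
 qed
qed

text \<open>The third move. Again the five lemma is carried out by hand, with injectivity and
  surjectivity of a on cohomology both needed for injectivity on the cones.\<close>

lemma cone_map_source:
 assumes a: "mor M M' a" and f: "mor M' N f"
 defines "g \<equiv> (%p u. pr (fst (un u), a (p+1) (snd (un u))))"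
 shows "mor (cn M N (f oo a)) (cn M' N f) g" and "qs M M' a ==> qs (cn M N (f oo a)) (cn M' N f) g"
proof -
 let ?C = "cn M N (f oo a)" and ?D = "cn M' N f"
 note F = morD[OF f] and A' = morD[OF a]
 have fa: "mor M N (f oo a)" by (rule mor_comp[OF a f])
 note DGs = DG_cn[OF f] DG_cn[OF fa]
 have act: "a (p + r+1) (gact M (p+1) r x c) = gact M' (p+1) r (a (p+1) x) c"
  if "x : cel M (p+1)" "c : cel A r" for p r x c
 proof -
  have "p + r+1 = p+1 + r" by simp
  thus ?thesis by (simp only: A'(10)[OF that])
 qed
 show g: "mor ?C ?D g"
  unfolding g_def
  by (rule morI) (use F(1,2,5) A'(1,2,5) DGs in "auto simp: act A' koszul_cases")
 assume qa: "qs M M' a"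
 show "qs ?C ?D g"
 proof (rule qsI[OF g])
  fix p x y assume as: "x : cel ?C (p+1)" "cdiff ?C (p+1) x = zr ?C (p+2)"
   "y : cel ?D p" "g (p+1) x = cdiff ?D p y"
  from as(1) obtain n m where x: "x = pr (n, m)" "n : cel N (p+1)" "m : cel M (p+1+1)" by auto
  from as(3) obtain n' m' where y: "y = pr (n', m')" "n' : cel N p" "m' : cel M' (p+1)" by auto
  have am: "a (p+2) m = ngt M' (p+2) (cdiff M' (p+1) m')" and n: "n = pls N (p+1) (cdiff N p n') (f (p+1) m')"
   using as(4) by (simp_all add: x y g_def koszul_cases idx idx3)
  have "ngt M (p+3) (cdiff M (p+2) m) = zr M (p+3)"
   using as(2) by (simp add: x koszul_cases idx idx3)
  hence dm: "cdiff M (p+1+1) m = zr M (p+1+2)"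
   using DG_group_simps(10)[OF A'(1), of "cdiff M (p+2) m" "p+3"] DG_group_simps(11)[OF A'(1), of "p+3"] x(3) A'(1)
   by (simp add: idx idx3)
  obtain m1 where m1: "m1 : cel M (p+1)" "m = cdiff M (p+1) m1"
   by (rule qs_injE[OF qa x(3) dm, of "ngt M' (p+1) m'"]) (use am y A'(2) in "simp_all add: DG_d_neg idx")
  \<comment> \<open>Both summands have opposite differentials, so this is a cocycle; lifting its
    class along a gives \<open>m2\<close>, and m2 - m1 is the source component of the primitive
    sought.\<close>
  let ?z = "pls M' (p+1) m' (a (p+1) m1)"
  have am1: "a (p+1) m1 : cel M' (p+1)" "cdiff M' (p+1) (a (p+1) m1) = a (p+2) m"
   using A'(5) A'(7)[OF m1(1), of "p+2"] m1 by simp_all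
  have z: "?z : cel M' (p+1)" "cdiff M' (p+1) ?z = zr M' (p+2)"
   using y(3) am1 A'(2) am by (simp_all add: DG_d_add idx)
  obtain m2 m3 where m2: "m2 : cel M (p+1)" "cdiff M (p+1) m2 = zr M (p+2)" "m3 : cel M' p"
    "?z = pls M' (p+1) (a (p+1) m2) (cdiff M' p m3)" by (rule qs_surjE[OF qa z])
  have am2: "a (p+1) m2 : cel M' (p+1)" "cdiff M' p m3 : cel M' (p+1)" using m2 A' by simp_all
  have fs: "f (p+1) (a (p+1) m1) : cel N (p+1)" "f (p+1) (a (p+1) m2) : cel N (p+1)"
   "f (p+1) m' : cel N (p+1)" "f p m3 : cel N p" "cdiff N p (f p m3) : cel N (p+1)"
   using F(2) F(5)[OF am1(1)] F(5)[OF am2(1)] F(5)[OF y(3)] F(5)[OF m2(3)] by simp_all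
  have "m' = pls M' (p+1) ?z (ngt M' (p+1) (a (p+1) m1))" using y(3) am1(1) A'(2) by (simp add: DG_ac)
  hence "f (p+1) m' = f (p+1) (pls M' (p+1) (pls M' (p+1) (a (p+1) m2) (cdiff M' p m3)) (ngt M' (p+1) (a (p+1) m1)))"
   unfolding m2(4) by simp
  also have "... = pls N (p+1) (pls N (p+1) (f (p+1) (a (p+1) m2)) (cdiff N p (f p m3))) (ngt N (p+1) (f (p+1) (a (p+1) m1)))"
   using am1(1) am2 A'(2) by (simp add: F(6) F(9) F(7)[OF m2(3)])
  finally have fm': "f (p+1) m' = pls N (p+1) (pls N (p+1) (f (p+1) (a (p+1) m2)) (cdiff N p (f p m3))) (ngt N (p+1) (f (p+1) (a (p+1) m1)))" .
  show "EX c:cel ?C p. x = cdiff ?C p c"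
  proof (intro bexI[of _ "pr (pls N p n' (f p m3), pls M (p+1) m2 (ngt M (p+1) m1))"])
   show "x = cdiff ?C p (pr (pls N p n' (f p m3), pls M (p+1) m2 (ngt M (p+1) m1)))"
    using m1 m2(1-3) y(2) fs am1(1) am2(1) A'(1,2) F(2)
    by (simp add: x n fm' koszul_cases DG_d_add DG_d_neg A'(6) A'(9) F(6) F(9) idx DG_ac)
  qed (use y m1 m2 fs A'(1) F(2) in simp_all)
 next
  fix p y assume as: "y : cel ?D (p+1)" "cdiff ?D (p+1) y = zr ?D (p+2)"
  from as(1) obtain n m' where y: "y = pr (n, m')" "n : cel N (p+1)" "m' : cel M' (p+1+1)" by auto
  have dn: "pls N (p+2) (cdiff N (p+1) n) (f (p+2) m') = zr N (p+2)"
   and "ngt M' (p+3) (cdiff M' (p+2) m') = zr M' (p+3)"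
   using as(2) by (simp_all add: y koszul_cases idx idx3)
  hence dm: "cdiff M' (p+1+1) m' = zr M' (p+1+2)"
   using DG_group_simps(10)[OF A'(2), of "cdiff M' (p+2) m'" "p+3"] DG_group_simps(11)[OF A'(2), of "p+3"] y(3) A'(2)
   by (simp add: idx idx3)
  obtain m m3 where m: "m : cel M (p+1+1)" "cdiff M (p+1+1) m = zr M (p+1+2)" "m3 : cel M' (p+1)"
    "m' = pls M' (p+1+1) (a (p+1+1) m) (cdiff M' (p+1) m3)" by (rule qs_surjE[OF qa y(3) dm])
  have c: "a (p+2) m : cel M' (p+2)" "f (p+2) (a (p+2) m) : cel N (p+2)" "f (p+1) m3 : cel N (p+1)"
   "cdiff M' (p+1) m3 : cel M' (p+2)"
   using m A'(5)[of m "p+2"] F(5)[of "a (p+2) m" "p+2"] F(5)[of m3 "p+1"] A'(2) by (simp_all add: idx)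
  have m': "m' = pls M' (p+2) (a (p+2) m) (cdiff M' (p+1) m3)" using m(4) by (simp add: idx)
  have fm': "f (p+2) m' = pls N (p+2) (f (p+2) (a (p+2) m)) (cdiff N (p+1) (f (p+1) m3))"
   unfolding m' using c F(7)[OF m(3), of "p+2"] by (simp add: F(6))
  show "hits ?C ?D g p y"
  proof -
   have "cdiff ?C (p+1) (pr (pls N (p+1) n (f (p+1) m3), m)) = zr ?C (p+2)"
    using dn m(1,2) c y(2) F(2) A'(1) unfolding fm' by (simp add: koszul_cases DG_d_add DG_ac idx idx3)
   moreover have "y = pls ?D (p+1) (g (p+1) (pr (pls N (p+1) n (f (p+1) m3), m)))
     (cdiff ?D p (pr (zr N p, ngt M' (p+1) m3)))"
    using m(1,3) c y(2) F(1,2) A'(2) by (simp add: y m' g_def koszul_cases F(9) DG_d_neg idx DG_ac)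
   moreover have "pr (pls N (p+1) n (f (p+1) m3), m) : cel ?C (p+1)"
    "pr (zr N p, ngt M' (p+1) m3) : cel ?D p"
    using m(1,3) c y(2) F(1,2) A'(2) by simp_all
   ultimately show ?thesis by blast
  qed
 qed
qed

text \<open>The homotopy h gives the shear (n, m) -> (n + h m, m), which is bijective in each degree
  and compatible with the maps of the two cone triangles.\<close>

lemma cone_map_homotopic:
 assumes "hq M N f f'"
 obtains g where "qs (cn M N f) (cn M N f') g" "!!p y. y : cel N p ==> g p (cin M N f p y) = cin M N f' p y"
  "!!p u. u : cel (cn M N f) p ==> snd (un (g p u)) = snd (un u)"
proof (rule hqE[OF assms])
 fix h assume h: "gh (-1) M N h" and e: "!!p x. x : cel M p ==>
   f p x = bnd M N f' h p x"
 note f = hqD(1)[OF assms] and f' = hqD(2)[OF assms]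
 let ?D = "cn M N f'" and ?C = "cn M N f"
 note F = morD[OF f] and F' = morD[OF f'] and H = ghD[OF h]
 note DGs = DG_cn[OF f] DG_cn[OF f']
 let ?g = "%p u. pr (pls N p (fst (un u)) (h (p+1) (snd (un u))), snd (un u))"
 have h1: "m : cel M (p+1) ==> h (p+1) m : cel N p" for p m using H(1)[of m "p+1" p] by simp
 have hz: "h (p+1) (zr M (p+1)) = zr N p" for p using H(5)[OF F(1,2), of "p+1"] by simp
 have g: "mor ?C ?D ?g"
 proof (rule morI[OF DGs])
  fix p u assume "u : cel ?C p"
  then obtain n m where u: "u = pr (n, m)" "n : cel N p" "m : cel M (p+1)" by auto
  have dm: "cdiff M (p+1) m : cel M (p+1+1)" using u F(1) by simp
  have c: "h (p+1) m : cel N p" "h (p+1+1) (cdiff M (p+1) m) : cel N (p+1)" "f' (p+1) m : cel N (p+1)"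
   "cdiff N p (h (p+1) m) : cel N (p+1)" "cdiff N p n : cel N (p+1)"
   using u h1 h1[OF dm] F'(5) F(2) by simp_all
  have n: "h (p+1+1) (ngt M (p+1+1) (cdiff M (p+1) m)) = ngt N (p+1) (h (p+1+1) (cdiff M (p+1) m))"
   using H(6)[OF F(1,2) dm] by (simp add: idx)
  show "?g p u : cel ?D p" using u c F(2) by simp
  have "f (p+1) m = pls N (p+1) (f' (p+1) m) (pls N (p+1) (cdiff N p (h (p+1) m)) (h (p+1+1) (cdiff M (p+1) m)))"
   using e[OF u(3)] by simp
  thus "?g (p+1) (cdiff ?C p u) = cdiff ?D p (?g p u)"
   using u c n F(2) by (simp add: koszul_cases DG_d_add DG_ac)
  show "?g (p + r) (gact ?C p r u x) = gact ?D p r (?g p u) x" if "x : cel A r" for r x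
   using u c that F(2) H(3)[OF u(3) that] by (simp add: DG_act_add add_ac)
  fix v assume "v : cel ?C p"
  then obtain n' m' where v: "v = pr (n', m')" "n' : cel N p" "m' : cel M (p+1)" by auto
  show "?g p (pls ?C p u v) = pls ?D p (?g p u) (?g p v)"
   using u v c h1[OF v(3)] H(2)[OF u(3) v(3)] F(2) by (simp add: DG_ac)
 qed
 have "bij_betw (?g p) (cel ?C p) (cel ?D p)" for p
  by (rule bij_betw_byWitness[where f' = "%u. pr (pls N p (fst (un u)) (ngt N p (h (p+1) (snd (un u)))), snd (un u))"])
   (use F(1,2) h1 in "auto simp: DG_ac")
 hence "qs ?C ?D ?g" by (rule qs_bij[OF g])
 thus ?thesis by (rule that) (use F(2) hz in simp_all)
qed

lemma cone_map:
 assumes f: "mor M N f" and f': "mor M' N' f'" and a: "mor M M' a" and b: "mor N N' b"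
  and h: "hq M N' (b oo f) (f' oo a)"
 obtains gm where "D.arr gm" "D.dm gm = cn M N f" "D.cd gm = cn M' N' f'"
  "gm ** ci M N f = ci M' N' f' ** q N N' b" "cp M' N' f' ** gm = sus (q M M' a) ** cp M N f"
  "qs M M' a ==> qs N N' b ==> D.iso gm"
proof -
 have bf: "mor M N' (b oo f)" and fa: "mor M N' (f' oo a)" using mor_comp f f' a b by blast+
 let ?g1 = "%p u. pr (b p (fst (un u)), snd (un u))" and ?g3 = "%p u. pr (fst (un u), a (p+1) (snd (un u)))"
 note g1 = cone_map_target[OF f b] and g3 = cone_map_source[OF a f']
 obtain g where g: "qs (cn M N' (b oo f)) (cn M N' (f' oo a)) g"
  "!!p y. y : cel N' p ==> g p (cin M N' (b oo f) p y) = cin M N' (f' oo a) p y"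
  "!!p u. u : cel (cn M N' (b oo f)) p ==> snd (un (g p u)) = snd (un u)"
  by (rule cone_map_homotopic[OF h]) blast
 let ?G = "?g3 oo g oo ?g1"
 have G: "mor (cn M N f) (cn M' N' f') ?G"
  by (rule mor_comp[OF mor_comp[OF g1(1) qs_mor[OF g(1)]] g3(1)])
 have "q (cn M N f) (cn M' N' f') ?G ** ci M N f = ci M' N' f' ** q N N' b"
  unfolding q_cmp[OF mor_cin[OF f] G] q_cmp[OF b mor_cin[OF f']]
  by (rule q_eq[OF hq_ext[OF mor_comp[OF mor_cin[OF f] G] mor_comp[OF b mor_cin[OF f']]]])
   (use morD(5)[OF b] g(2) morD(8)[OF a] in simp)
 moreover have "cp M' N' f' ** q (cn M N f) (cn M' N' f') ?G = sus (q M M' a) ** cp M N f"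
  unfolding q_cmp[OF G mor_cpr[OF f']] sus_q[OF a] q_cmp[OF mor_cpr[OF f] mor_shift[OF a]]
  by (rule q_eq[OF hq_ext[OF mor_comp[OF G mor_cpr[OF f']] mor_comp[OF mor_cpr[OF f] mor_shift[OF a]]]])
   (use g(3)[OF morD(5)[OF g1(1)]] in simp)
 moreover have "D.iso (q (cn M N f) (cn M' N' f') ?G)" if "qs M M' a" "qs N N' b"
  by (rule q_iso'(1)[OF qs_comp[OF qs_comp[OF g1(2)[OF that(2)] g(1)] g3(2)[OF that(1)]]])
 ultimately show ?thesis using that q_arr[OF G] by blast
qed

end

context dgc begin

text \<open>Denominators of al and be are refined until the square commutes up to homotopy between
  honest dg maps. The cone of the common refinement then maps to both given cones; the first of
  these maps is invertible, and the desired arrow runs back along it.\<close>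

lemma TR3_cn:
 assumes f: "mor M N f" and f': "mor M' N' f'"
  and al: "D.arr al" "D.dm al = M" "D.cd al = M'" and be: "D.arr be" "D.dm be = N" "D.cd be = N'"
  and e: "be ** q M N f = q M' N' f' ** al"
 obtains gm where "D.arr gm" "D.dm gm = cn M N f" "D.cd gm = cn M' N' f'"
  "gm ** ci M N f = ci M' N' f' ** be" "cp M' N' f' ** gm = sus al ** cp M N f"
proof -
 obtain P s a where s: "qs P M s" and a: "mor P M' a" and al': "al = q P M' a ** D.iv (q P M s)"
  using factor[OF al(1)] al(2,3) by metis
 obtain R t b where t: "qs R N t" and b: "mor R N' b" and be': "be = q R N' b ** D.iv (q R N t)"
  using factor[OF be(1)] be(2,3) by metis
 obtain Q u v where Q: "qs Q P u" "mor Q R v" "hq Q N ((f oo s) oo u) (t oo v)"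
  by (rule ore[OF mor_comp[OF qs_mor[OF s] f] t])
 have su: "qs Q M (s oo u)" by (rule qs_comp[OF Q(1) s])
 note m = qs_mor[OF s] qs_mor[OF t] qs_mor[OF Q(1)] qs_mor[OF su]
 have au: "mor Q M' (a oo u)" by (rule mor_comp[OF m(3) a])
 have bet: "be ** q R N t = q R N' b" unfolding be' using t b m(2) by simp
 have als: "al ** q P M s = q P M' a" unfolding al' using s a m(1) by simp
 have "q Q N' (b oo v) = q Q N' (f' oo a oo u)"
 proof -
  have "q Q N' (b oo v) = (be ** q R N t) ** q Q R v" unfolding bet by (rule q_cmp[OF Q(2) b, symmetric])
  also have "... = be ** q Q N (t oo v)" using be Q(2) m(2) by (simp add: q_cmp)
  also have "q Q N (t oo v) = q Q N (f oo s oo u)" using q_eq[OF hq_sym[OF Q(3)]] by (simp add: gcomp_assoc)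
  also have "... = q M N f ** q P M s ** q Q P u"
   using f m by (simp add: q_cmp mor_comp gcomp_assoc)
  also have "be ** (q M N f ** q P M s ** q Q P u) = (be ** q M N f) ** q P M s ** q Q P u"
   using be f m by simp
  also have "... = q M' N' f' ** (al ** q P M s) ** q Q P u" unfolding e using al f' m by simp
  also have "... = q Q N' (f' oo a oo u)" unfolding als using a f' m by (simp add: q_cmp mor_comp)
  finally show ?thesis .
 qed
 \<comment> \<open>Equality of images under \<open>q\<close> is homotopy only after precomposition
   with a quasi-isomorphism; \<open>Q'\<close> absorbs this refinement.\<close>
 then obtain Q' w where w: "qs Q' Q w" "hq Q' N' ((b oo v) oo w) ((f' oo a oo u) oo w)"
  by (rule q_eqD[OF mor_comp[OF Q(2) b]])
 note mw = qs_mor[OF w(1)]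
 let ?g = "v oo w" and ?s = "s oo u oo w" and ?a = "a oo u oo w"
 have g: "mor Q' R ?g" and a': "mor Q' M' ?a" and s': "qs Q' M ?s"
  using mor_comp[OF mw Q(2)] mor_comp[OF mw au] qs_comp[OF w(1) su] by (simp_all add: gcomp_assoc)
 have h1: "hq Q' N (t oo ?g) (f oo ?s)" using hq_sym[OF hq_comp_right[OF mw Q(3)]] by (simp add: gcomp_assoc)
 have h2: "hq Q' N' (b oo ?g) (f' oo ?a)" using w(2) by (simp add: gcomp_assoc)
 obtain gm1 where g1: "D.arr gm1" "D.dm gm1 = cn Q' R ?g" "D.cd gm1 = cn M N f"
  "gm1 ** ci Q' R ?g = ci M N f ** q R N t" "cp M N f ** gm1 = sus (q Q' M ?s) ** cp Q' R ?g" "D.iso gm1"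
  by (rule cone_map[OF g f qs_mor[OF s'] m(2) h1]) (use s' t in blast)
 obtain gm2 where g2: "D.arr gm2" "D.dm gm2 = cn Q' R ?g" "D.cd gm2 = cn M' N' f'"
  "gm2 ** ci Q' R ?g = ci M' N' f' ** q R N' b" "cp M' N' f' ** gm2 = sus (q Q' M' ?a) ** cp Q' R ?g"
  by (rule cone_map[OF g f' a' b h2]) blast
 have ala: "q Q' M' ?a = al ** q Q' M ?s"
 proof -
  have "al ** q Q' M ?s = (al ** q P M s) ** q Q' P (u oo w)"
   using al m(1) mor_comp[OF mw m(3)] by (simp add: q_cmp)
  thus ?thesis unfolding als using q_cmp[OF mor_comp[OF mw m(3)] a] by simp
 qed
 note arrs = mor_cin[OF f] mor_cin[OF f'] mor_cin[OF g] mor_cpr[OF f] mor_cpr[OF f'] mor_cpr[OF g]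
 show ?thesis
 proof (rule that[of "gm2 ** D.iv gm1"])
  have "D.iv gm1 ** ci M N f ** q R N t = ci Q' R ?g"
   unfolding g1(4)[symmetric] using g1(1-3,6) arrs m by simp
  hence "((gm2 ** D.iv gm1) ** ci M N f) ** q R N t = (ci M' N' f' ** be) ** q R N t"
   using g1(1-3,6) g2(1-4) arrs m be bet f f' by simp
  thus "(gm2 ** D.iv gm1) ** ci M N f = ci M' N' f' ** be"
   by (rule D.iso_epi[OF q_iso'(1)[OF t], rotated -1]) (use g1(1-3,6) g2(1-3) arrs m be in simp_all)
  have "(cp M' N' f' ** gm2 ** D.iv gm1) ** gm1 = (sus al ** cp M N f) ** gm1"
   using g1 g2(1-3,5) arrs al qs_mor[OF s'] a' by (simp add: ala sus_cmp)
  thus "cp M' N' f' ** gm2 ** D.iv gm1 = sus al ** cp M N f"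
   by (rule D.iso_epi[OF g1(6), rotated -1]) (use g1(1-3,6) g2(1-3) arrs al in simp_all)
 qed (use g1 g2 in simp_all)
qed

lemma tri_TR3:
 assumes t: "tri X Y Z u v w" and t': "tri X' Y' Z' u' v' w'"
  and al: "D.arr al" "D.dm al = X" "D.cd al = X'" and be: "D.arr be" "D.dm be = Y" "D.cd be = Y'"
  and e: "be ** u = u' ** al"
 shows "EX gm. D.arr gm & D.dm gm = Z & D.cd gm = Z' & gm ** v = v' ** be & w' ** gm = sus al ** w"
proof (rule triE[OF t], rule triE[OF t'])
 fix M N f a b c M' N' f' a' b' c'
 assume f: "mor M N f"
  and u: "D.arr u" "D.arr v" "D.arr w" "D.dm u = X" "D.cd u = Y" "D.dm v = Y" "D.cd v = Z" "D.dm w = Z" "D.cd w = \<Sigma> X"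
  and j: "D.iso a" "D.iso b" "D.iso c" "D.dm a = X" "D.dm b = Y" "D.dm c = Z" "D.cd a = M" "D.cd b = N" "D.cd c = cn M N f"
  and e1: "b ** u = q M N f ** a" "c ** v = ci M N f ** b" "sus a ** w = cp M N f ** c"
  and f': "mor M' N' f'"
  and u': "D.arr u'" "D.arr v'" "D.arr w'" "D.dm u' = X'" "D.cd u' = Y'" "D.dm v' = Y'" "D.cd v' = Z'" "D.dm w' = Z'"
   "D.cd w' = \<Sigma> X'"
  and j': "D.iso a'" "D.iso b'" "D.iso c'" "D.dm a' = X'" "D.dm b' = Y'" "D.dm c' = Z'" "D.cd a' = M'" "D.cd b' = N'"
   "D.cd c' = cn M' N' f'"
  and e1': "b' ** u' = q M' N' f' ** a'" "c' ** v' = ci M' N' f' ** b'" "sus a' ** w' = cp M' N' f' ** c'"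
 note arrs = mor_cin[OF f] mor_cin[OF f'] mor_cpr[OF f] mor_cpr[OF f'] f f'
 let ?al = "a' ** al ** D.iv a" and ?be = "b' ** be ** D.iv b"
 have A: "D.arr ?al" "D.dm ?al = M" "D.cd ?al = M'" "D.arr ?be" "D.dm ?be = N" "D.cd ?be = N'"
  using al be j j' by simp_all
 have r: "q M' N' f' ** (a' ** al) = b' ** (u' ** al)"
  using D.assoc[of al a' "q M' N' f'"] D.assoc[of al u' b'] e1'(1) u' j' arrs al by (simp del: D.assoc)
 have "(?be ** q M N f) ** a = (q M' N' f' ** ?al) ** a"
  using al be j j' u u' arrs by (simp add: e1(1)[symmetric] e r)
 hence "?be ** q M N f = q M' N' f' ** ?al"
  by (rule D.iso_epi[OF j(1), rotated -1]) (use A arrs j in simp_all)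
 then obtain gm where g: "D.arr gm" "D.dm gm = cn M N f" "D.cd gm = cn M' N' f'"
  "gm ** ci M N f = ci M' N' f' ** ?be" "cp M' N' f' ** gm = sus ?al ** cp M N f"
  by (rule TR3_cn[OF f f' A])
 let ?g = "D.iv c' ** gm ** c"
 have G: "D.arr ?g" "D.dm ?g = Z" "D.cd ?g = Z'" using g(1-3) j j' by simp_all
 have "?g ** v = D.iv c' ** (gm ** ci M N f) ** b" using g(1-3) j j' u arrs by (simp add: e1(2))
 also have "... = D.iv c' ** (ci M' N' f' ** b') ** be" unfolding g(4) using be j j' arrs by simp
 also have "... = v' ** be" unfolding e1'(2)[symmetric] using be j' u' by simp
 finally have 1: "?g ** v = v' ** be" .
 have "sus a' ** w' ** ?g = (sus a' ** w') ** ?g" using j' u' G by simp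
 also have "... = (cp M' N' f' ** gm) ** c" unfolding e1'(3) using j j' arrs g(1-3) by simp
 also have "... = sus ?al ** (sus a ** w)" unfolding g(5) e1(3) using j arrs A by simp
 also have "... = (sus ?al ** sus a) ** w" using A j u by simp
 also have "sus ?al ** sus a = sus (a' ** al)" using al j j' by (simp add: sus_cmp[symmetric])
 also have "sus (a' ** al) ** w = sus a' ** (sus al ** w)" using al j' u by (simp add: sus_cmp)
 finally have "w' ** ?g = sus al ** w"
  by (rule D.iso_mono[OF sus_iso[OF j'(1)], rotated -1]) (use G u u' al j' in simp_all)
 thus ?thesis using G 1 by blast
qed

subsection \<open>The octahedral axiom\<close>

text \<open>The cone of the map f between the cones of u and v u has graded parts Z, X, Y, X, up to
  shifts. The two copies of X cancel and leave the cone of v: \<open>?s\<close> and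
  \<open>?k\<close> are the equivalence and \<open>?H\<close> contracts the copies of X.\<close>

lemma oct_cn:
 assumes u: "mor X Y u" and v: "mor Y Z v"
 obtains f g where "tri (cn X Y u) (cn X Z (v oo u)) (cn Y Z v) f g (sus (ci X Y u) ** cp Y Z v)"
  "f ** ci X Y u = ci X Z (v oo u) ** q Y Z v" "cp X Z (v oo u) ** f = cp X Y u"
  "g ** ci X Z (v oo u) = ci Y Z v" "cp Y Z v ** g = sus (q X Y u) ** cp X Z (v oo u)"
proof -
 note U = morD[OF u] and V = morD[OF v]
 have vu: "mor X Z (v oo u)" by (rule mor_comp[OF u v])
 let ?C1 = "cn X Y u" and ?C2 = "cn X Z (v oo u)" and ?C3 = "cn Y Z v"
 let ?f = "%p c. pr (v p (fst (un c)), snd (un c))" and ?g = "%p c. pr (fst (un c), u (p+1) (snd (un c)))"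
 note f = cone_map_target(1)[OF u v] and g = cone_map_source(1)[OF u v]
 note ci = mor_cin[OF u] mor_cin[OF vu] mor_cin[OF v] mor_cin[OF f] and cp = mor_cpr[OF u] mor_cpr[OF vu] mor_cpr[OF v] mor_cpr[OF f]
 let ?C4 = "cn ?C1 ?C2 ?f"
 note DGs = DG_cn[OF u] DG_cn[OF vu] DG_cn[OF v] DG_cn[OF f]
 let ?s = "%p c. pr (pr (fst (un c), zr X (p+1)), pr (snd (un c), zr X (p+2)))"
 let ?k = "%p c. pr (fst (un (fst (un c))), pls Y (p+1) (fst (un (snd (un c)))) (u (p+1) (snd (un (fst (un c))))))"
 let ?H = "%p c. pr (pr (zr Z (p - 1), zr X p), pr (zr Y p, snd (un (fst (un c)))))"
 have s: "mor ?C3 ?C4 ?s"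
 proof (rule morI[OF DGs(3,4)])
  fix p c assume "c : cel ?C3 p"
  then obtain z y where c: "c = pr (z, y)" "z : cel Z p" "y : cel Y (p+1)" by auto
  have vy: "v (p+1) y : cel Z (p+1)" "cdiff Y (p+1) y : cel Y (p+2)" using c V by simp_all
  have ng1: "ngt ?C1 (p+1+1) (pr (cdiff Y (p+1) y, zr X (p+3))) = pr (ngt Y (p+2) (cdiff Y (p+1) y), zr X (p+3))"
   using tw_ngt[OF tws_cn[OF u], of "cdiff Y (p+1) y" "p+2" "zr X (p+3)"] vy U(1) by (simp add: idx idx3)
  show "?s p c : cel ?C4 p" using c U(1) by (simp add: idx)
  show "?s (p+1) (cdiff ?C3 p c) = cdiff ?C4 p (?s p c)"
   using c vy ng1 U(1,2) V(2) U(8) V(8) by (simp add: koszul_cases idx idx3)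
  show "?s (p + r) (gact ?C3 p r c x) = gact ?C4 p r (?s p c) x" if "x : cel A r" for r x
  proof -
   have i: "p + r+1 = p+1 + r" "p + r+2 = p+2 + r" by simp_all
   have "gact X (p+1) r (zr X (p+1)) x = zr X (p + r+1)" "gact X (p+2) r (zr X (p+2)) x = zr X (p + r+2)"
    unfolding i by (rule DG_act_zero[OF U(1) that])+
   thus ?thesis using c by (simp add: idx)
  qed
  fix c' assume "c' : cel ?C3 p"
  then obtain z' y' where c': "c' = pr (z', y')" "z' : cel Z p" "y' : cel Y (p+1)" by auto
  show "?s p (pls ?C3 p c c') = pls ?C4 p (?s p c) (?s p c')" using c c' U(1) by (simp add: idx)
 qed
 have k: "mor ?C4 ?C3 ?k"
 proof (rule morI[OF DGs(4,3)])
  fix p c assume "c : cel ?C4 p"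
  then obtain z x' y x where c: "c = pr (pr (z, x'), pr (y, x))" "z : cel Z p" "x' : cel X (p+1)" "y : cel Y (p+1)" "x : cel X (p+2)"
   by (auto simp: idx)
  have d: "u (p+1) x' : cel Y (p+1)" "v (p+1) y : cel Z (p+1)" "v (p+1) (u (p+1) x') : cel Z (p+1)"
   "cdiff Y (p+1) y : cel Y (p+2)" "u (p+2) x : cel Y (p+2)" "cdiff X (p+1) x' : cel X (p+2)"
   "cdiff Y (p+1) (u (p+1) x') : cel Y (p+2)" "cdiff X (p+2) x : cel X (p+3)"
   using c U V V(5)[OF U(5)] by simp_all
  have ng1: "ngt ?C1 (p+1+1) (pr (pls Y (p+2) (cdiff Y (p+1) y) (u (p+2) x), ngt X (p+3) (cdiff X (p+2) x))) =
    pr (pls Y (p+2) (ngt Y (p+2) (cdiff Y (p+1) y)) (ngt Y (p+2) (u (p+2) x)), cdiff X (p+2) x)"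
   using tw_ngt[OF tws_cn[OF u], of "pls Y (p+2) (cdiff Y (p+1) y) (u (p+2) x)" "p+2" "ngt X (p+3) (cdiff X (p+2) x)"] d U(1,2)
   by (simp add: idx idx3)
  have un: "u (p+2) (ngt X (p+2) (cdiff X (p+1) x')) = ngt Y (p+2) (cdiff Y (p+1) (u (p+1) x'))"
   using U(9)[OF d(6)] U(7)[OF c(3), of "p+2"] by simp
  show "?k p c : cel ?C3 p" using c d U by simp
  show "?k (p+1) (cdiff ?C4 p c) = cdiff ?C3 p (?k p c)"
   using c d ng1 un U(1,2) V(2) by (simp add: koszul_cases idx idx3 DG_d_add U(6) V(6) DG_ac)
  show "?k (p + r) (gact ?C4 p r c e) = gact ?C3 p r (?k p c) e" if "e : cel A r" for r e
  proof -
   have i: "p + r+1 = p+1 + r" by simp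
   have "u (p + r+1) (gact X (p+1) r x' e) = gact Y (p+1) r (u (p+1) x') e"
    unfolding i by (rule U(10)[OF c(3) that])
   moreover have "gact Y (p+1) r (pls Y (p+1) y (u (p+1) x')) e =
     pls Y (p + r+1) (gact Y (p+1) r y e) (gact Y (p+1) r (u (p+1) x') e)"
    unfolding i by (rule DG_act_add[OF U(2) c(4) d(1) that])
   ultimately show ?thesis using c by simp
  qed
  fix c' assume "c' : cel ?C4 p"
  then obtain z1 x1' y1 x1 where c': "c' = pr (pr (z1, x1'), pr (y1, x1))" "z1 : cel Z p" "x1' : cel X (p+1)" "y1 : cel Y (p+1)" "x1 : cel X (p+2)"
   by (auto simp: idx)
  show "?k p (pls ?C4 p c c') = pls ?C3 p (?k p c) (?k p c')"
   using c c' d U(1,2) U(5)[OF c'(3)] by (simp add: U(6) DG_ac)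
 qed
 have H: "gh (-1) ?C4 ?C4 ?H"
  by (rule ghI) (use U(1,2) V(2) DGs in "auto simp: DG_act_zero diff_add_eq")
 have sk: "hq ?C4 ?C4 hid (?s oo ?k)"
 proof (rule hqI[OF mor_id[OF DGs(4)] mor_comp[OF k s] H])
  fix p c assume "c : cel ?C4 p"
  then obtain z x' y x where c: "c = pr (pr (z, x'), pr (y, x))" "z : cel Z p" "x' : cel X (p+1)" "y : cel Y (p+1)" "x : cel X (p+2)"
   by (auto simp: idx)
  have d: "u (p+1) x' : cel Y (p+1)" "cdiff X (p+1) x' : cel X (p+2)" using c U by simp_all
  have ng1: "ngt ?C1 (p+1) (pr (u (p+1) x', ngt X (p+2) (cdiff X (p+1) x'))) = pr (ngt Y (p+1) (u (p+1) x'), cdiff X (p+1) x')"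
   using tw_ngt[OF tws_cn[OF u], of "u (p+1) x'" "p+1" "ngt X (p+2) (cdiff X (p+1) x')"] d U(1) by (simp add: idx)
  show "c = pls ?C4 p ((?s oo ?k) p c) (pls ?C4 p (cdiff ?C4 (p - 1) (?H p c)) (?H (p+1) (cdiff ?C4 p c)))"
   using c d ng1 U(1,2,8) V(2,8) by (simp add: koszul_cases idx DG_ac)
 qed
 have ks: "hq ?C3 ?C3 (?k oo ?s) hid"
  by (rule hq_ext[OF mor_comp[OF s k] mor_id[OF DGs(3)]]) (use U(2,8) in auto)
 have qs: "qs ?C3 ?C4 ?s" by (rule qs_hequiv[OF s k ks hq_sym[OF sk]])
 let ?F = "q ?C1 ?C2 ?f" and ?G = "q ?C2 ?C3 ?g" and ?S = "q ?C3 ?C4 ?s"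
 have S: "D.iso ?S" "D.arr ?S" "D.dm ?S = ?C3" "D.cd ?S = ?C4" using qs s by simp_all
 have 1: "?S ** ?G = ci ?C1 ?C2 ?f ** Idn Der ?C2"
 proof -
  have ext: "hq ?C2 ?C4 (?s oo ?g) ((?s oo ?k) oo cin ?C1 ?C2 ?f)"
   by (rule hq_ext[OF mor_comp[OF g s] mor_comp[OF ci(4) mor_comp[OF k s]]]) (use U(2,5) in auto)
  have "?S ** ?G = ci ?C1 ?C2 ?f"
   unfolding q_cmp[OF g s]
   by (rule q_eq[OF hq_trans[OF ext]]) (use hq_sym[OF hq_comp_right[OF ci(4) sk]] in simp)
  thus ?thesis using ci(4) by simp
 qed
 have 2: "sus (Idn Der ?C1) ** (sus (ci X Y u) ** cp Y Z v) = cp ?C1 ?C2 ?f ** ?S"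
 proof -
  have c: "mor (\<Sigma> Y) (\<Sigma> ?C1) (sh (cin X Y u))" by (rule mor_shift[OF ci(1)])
  have "sus (ci X Y u) ** cp Y Z v = cp ?C1 ?C2 ?f ** ?S"
   unfolding sus_q[OF ci(1)] q_cmp[OF cp(3) c] q_cmp[OF s cp(4)]
   by (rule q_eq[OF hq_ext[OF mor_comp[OF cp(3) c] mor_comp[OF s cp(4)]]]) (simp add: idx)
  thus ?thesis using S cp(4) DGs(1) by (simp add: sus_idn)
 qed
 show ?thesis
 proof (rule that[of ?F ?G])
  show "tri ?C1 ?C2 ?C3 ?F ?G (sus (ci X Y u) ** cp Y Z v)"
   using triI[OF f, of ?F ?G "sus (ci X Y u) ** cp Y Z v" "Idn Der ?C1" "Idn Der ?C2" ?S] f g DGs S ci cp 1 2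
   by simp
  show "?F ** ci X Y u = ci X Z (v oo u) ** q Y Z v"
   unfolding q_cmp[OF ci(1) f] q_cmp[OF v ci(2)]
   by (rule q_eq[OF hq_ext[OF mor_comp[OF ci(1) f] mor_comp[OF v ci(2)]]]) simp
  show "cp X Z (v oo u) ** ?F = cp X Y u"
   unfolding q_cmp[OF f cp(2)] by (rule q_eq[OF hq_ext[OF mor_comp[OF f cp(2)] cp(1)]]) simp
  show "?G ** ci X Z (v oo u) = ci Y Z v"
   unfolding q_cmp[OF ci(2) g] by (rule q_eq[OF hq_ext[OF mor_comp[OF ci(2) g] ci(3)]]) (use U(8) in simp)
  show "cp Y Z v ** ?G = sus (q X Y u) ** cp X Z (v oo u)"
   unfolding sus_q[OF u] q_cmp[OF g cp(3)] q_cmp[OF cp(2) mor_shift[OF u]]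
   by (rule q_eq[OF hq_ext[OF mor_comp[OF g cp(3)] mor_comp[OF cp(2) mor_shift[OF u]]]]) simp
 qed
qed

text \<open>To replace both arrows by dg maps at once, be is written as v s^-1 first and only then
  s^-1 al as u t^-1. The pair (u, v) is then isomorphic to (al, be) and \<open>oct_cn\<close> is
  transported.\<close>

lemma tri_oct:
 assumes al: "D.arr al" and be: "D.arr be" "D.dm be = D.cd al"
 shows "EX C1 C2 C3 i1 p1 i2 p2 i3 p3 f g.
  tri (D.dm al) (D.cd al) C1 al i1 p1 & tri (D.dm al) (D.cd be) C2 (be ** al) i2 p2 & tri (D.cd al) (D.cd be) C3 be i3 p3 &
  tri C1 C2 C3 f g (sus i1 ** p3) & f ** i1 = i2 ** be & p2 ** f = p1 & g ** i2 = i3 & p3 ** g = sus al ** p2"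
proof -
 define X Y Z where "X = D.dm al" and "Y = D.cd al" and "Z = D.cd be"
 have al': "D.dm al = X" "D.cd al = Y" and be': "D.dm be = Y" "D.cd be = Z"
  using be by (simp_all add: X_def Y_def Z_def)
 have DGs: "DG X" "DG Y" "DG Z" using D.arr_obj[OF al] D.arr_obj[OF be(1)] al' be' by auto
 obtain Y' s v where s: "qs Y' Y s" and v: "mor Y' Z v" and bv: "be = q Y' Z v ** D.iv (q Y' Y s)"
  using factor[OF be(1)] be' by metis
 let ?s = "q Y' Y s"
 have S: "D.iso ?s" "D.arr ?s" "D.dm ?s = Y'" "D.cd ?s = Y" using s qs_mor[OF s] by simp_all
 have a0: "D.arr (D.iv ?s ** al)" "D.dm (D.iv ?s ** al) = X" "D.cd (D.iv ?s ** al) = Y'" using S al al' by simp_all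
 obtain X' t u where t: "qs X' X t" and u: "mor X' Y' u" and au: "D.iv ?s ** al = q X' Y' u ** D.iv (q X' X t)"
  using factor[OF a0(1)] a0(2,3) by metis
 let ?t = "q X' X t"
 have T: "D.iso ?t" "D.arr ?t" "D.dm ?t = X'" "D.cd ?t = X" using t qs_mor[OF t] by simp_all
 have a1: "al ** ?t = ?s ** q X' Y' u"
 proof -
  have "al ** ?t = ?s ** (D.iv ?s ** al) ** ?t" using S T al al' by simp
  thus ?thesis unfolding au using S T u by simp
 qed
 have b1: "be ** ?s = q Y' Z v" unfolding bv using S v by simp
 obtain f g where o: "tri (cn X' Y' u) (cn X' Z (v oo u)) (cn Y' Z v) f g (sus (ci X' Y' u) ** cp Y' Z v)"
  "f ** ci X' Y' u = ci X' Z (v oo u) ** q Y' Z v" "cp X' Z (v oo u) ** f = cp X' Y' u"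
  "g ** ci X' Z (v oo u) = ci Y' Z v" "cp Y' Z v ** g = sus (q X' Y' u) ** cp X' Z (v oo u)"
  by (rule oct_cn[OF u v])
 note fg = tri_wf[OF o(1)]
 have vu: "mor X' Z (v oo u)" by (rule mor_comp[OF u v])
 note arrs = mor_cin[OF u] mor_cin[OF vu] mor_cin[OF v] mor_cpr[OF u] mor_cpr[OF vu] mor_cpr[OF v]
 let ?i1 = "ci X' Y' u ** D.iv ?s" and ?p1 = "sus ?t ** cp X' Y' u"
 let ?i2 = "ci X' Z (v oo u)" and ?p2 = "sus ?t ** cp X' Z (v oo u)"
 let ?i3 = "ci Y' Z v" and ?p3 = "sus ?s ** cp Y' Z v"
 have t1: "tri X Y (cn X' Y' u) al ?i1 ?p1"
  using tri_iso[OF tri_cn[OF u], of ?t ?s "Idn Der (cn X' Y' u)" al ?i1 ?p1] S T al al' a1 arrs u by simp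
 have t2: "tri X Z (cn X' Z (v oo u)) (be ** al) ?i2 ?p2"
 proof -
  have "(be ** al) ** ?t = (be ** ?s) ** q X' Y' u" using S T al al' be(1) be' u a1 by simp
  also have "... = q X' Z (v oo u)" unfolding b1 by (rule q_cmp[OF u v])
  finally have e: "(be ** al) ** ?t = q X' Z (v oo u)" .
  show ?thesis
   using tri_iso[OF tri_cn[OF vu], of ?t "Idn Der Z" "Idn Der (cn X' Z (v oo u))" "be ** al" ?i2 ?p2] e S T al al' be(1) be' arrs vu DGs
   by (simp del: D.assoc)
 qed
 have t3: "tri Y Z (cn Y' Z v) be ?i3 ?p3"
  using tri_iso[OF tri_cn[OF v], of ?s "Idn Der Z" "Idn Der (cn Y' Z v)" be ?i3 ?p3] b1 S be(1) be' arrs v DGs by simp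
 have ss: "sus (D.iv ?s) ** sus ?s = Idn Der (\<Sigma> Y')"
  using S DGs u morD[OF u] by (simp add: sus_cmp[symmetric] sus_idn)
 have "sus ?i1 ** ?p3 = sus (ci X' Y' u) ** (sus (D.iv ?s) ** sus ?s) ** cp Y' Z v"
  using S arrs by (simp add: sus_cmp)
 also have "... = sus (ci X' Y' u) ** cp Y' Z v" unfolding ss using arrs morD[OF u] by simp
 finally have t4: "tri (cn X' Y' u) (cn X' Z (v oo u)) (cn Y' Z v) f g (sus ?i1 ** ?p3)" using o(1) by simp
 have e1: "f ** ?i1 = ?i2 ** be"
 proof -
  have "f ** ?i1 = (f ** ci X' Y' u) ** D.iv ?s" using S fg arrs by simp
  also have "... = ?i2 ** (q Y' Z v ** D.iv ?s)" unfolding o(2) using S arrs v by simp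
  finally show ?thesis unfolding bv .
 qed
 have e2: "?p2 ** f = ?p1" using T fg arrs o(3) by simp
 have e4: "?p3 ** g = sus al ** ?p2"
 proof -
  have "?p3 ** g = (sus ?s ** sus (q X' Y' u)) ** cp X' Z (v oo u)" using S fg arrs o(5) u by simp
  also have "sus ?s ** sus (q X' Y' u) = sus al ** sus ?t" using a1 S T u al al' by (simp add: sus_cmp[symmetric])
  finally show ?thesis using T al al' arrs by (simp del: gcomp_apply)
 qed
 show ?thesis unfolding al' be' using t1 t2 t3 t4 e1 e2 o(4) e4 by blast
qed

end

subsection \<open>Triangulated categories\<close>

locale tcat = pcat T for T :: "('o, 'f) tricat"
begin

abbreviation cmpT (infixr "**" 70) where "g ** f \<equiv> Cmp T g f"
abbreviation plT (infixl "\<boxplus>" 65) where "f \<boxplus> g \<equiv> HAdd T f g"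
abbreviation "tri X Y Z u v w \<equiv> (X, Y, Z, u, v, w) : Tri T"
abbreviation "S X \<equiv> Shift T 1 X"

end

text \<open>The axioms of a triangulated category in the form the derived category provides them.
  Only the first shift acts on arrows, through \<open>sus\<close>; other shifts act on objects and
  compose merely up to isomorphism (\<open>sh_sh\<close>, \<open>sh_0\<close>).\<close>

locale tricat0 = tcat T for T :: "('o, 'f) tricat" +
 fixes sus :: "'f => 'f"
 assumes ob_ex: "EX X. ob X"
  and biprod_ex: "ob X ==> ob Y ==> EX P. is_biproduct T X Y P"
  and sh_ob [simp]: "ob X ==> ob (Shift T n X)"
  and sus_arr [simp]: "arr f ==> arr (sus f)" "arr f ==> dm (sus f) = Shift T 1 (dm f)"
   "arr f ==> cd (sus f) = Shift T 1 (cd f)"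
  and sus_idn [simp]: "ob X ==> sus (idn X) = idn (Shift T 1 X)"
  and sus_cmp: "[|arr f; arr g; dm g = cd f|] ==> sus (g ** f) = sus g ** sus f"
  and sus_add: "[|arr f; arr g; dm f = dm g; cd f = cd g|] ==> sus (f \<boxplus> g) = sus f \<boxplus> sus g"
  and sus_inj: "[|arr f; arr g; dm f = dm g; cd f = cd g; sus f = sus g|] ==> f = g"
  and sus_surj: "[|arr f; dm f = Shift T 1 X; cd f = Shift T 1 Y; ob X; ob Y|]
   ==> EX g. arr g & dm g = X & cd g = Y & sus g = f"
  and sh_sh: "ob X ==> isom (Shift T n (Shift T m X)) (Shift T (n + m) X)"
  and sh_0: "ob X ==> isom (Shift T 0 X) X"
  and tri_wf: "(X, Y, Z, u, v, w) : Tri T ==> arr u & arr v & arr w & dm u = X & cd u = Y & dm v = Y &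
   cd v = Z & dm w = Z & cd w = Shift T 1 X"
  and tri_iso: "[|(X, Y, Z, u, v, w) : Tri T; iso al; iso be; iso gm; dm al = X; dm be = Y; dm gm = Z;
   cd al = X'; cd be = Y'; cd gm = Z'; arr u'; arr v'; arr w'; dm u' = X'; cd u' = Y'; dm v' = Y'; cd v' = Z'; dm w' = Z';
   cd w' = Shift T 1 X'; u' ** al = be ** u; v' ** be = gm ** v; w' ** gm = sus al ** w|]
   ==> (X', Y', Z', u', v', w') : Tri T"
  and tri_complete: "arr u ==> EX Z v w. (dm u, cd u, Z, u, v, w) : Tri T"
  and tri_id: "ob X ==> EX Z v w. null Z & (X, X, Z, idn X, v, w) : Tri T"
  and tri_rot: "(X, Y, Z, u, v, w) : Tri T ==> (Y, Z, Shift T 1 X, v, w, ng (sus u)) : Tri T"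
  and tri_TR3: "[|(X, Y, Z, u, v, w) : Tri T; (X', Y', Z', u', v', w') : Tri T; arr al; dm al = X; cd al = X';
   arr be; dm be = Y; cd be = Y'; be ** u = u' ** al|]
   ==> EX gm. arr gm & dm gm = Z & cd gm = Z' & gm ** v = v' ** be & w' ** gm = sus al ** w"
  and tri_oct: "[|arr al; arr be; dm be = cd al|] ==> EX C1 C2 C3 i1 p1 i2 p2 i3 p3 f g.
   (dm al, cd al, C1, al, i1, p1) : Tri T & (dm al, cd be, C2, be ** al, i2, p2) : Tri T & (cd al, cd be, C3, be, i3, p3) : Tri T &
   (C1, C2, C3, f, g, sus i1 ** p3) : Tri T & f ** i1 = i2 ** be & p2 ** f = p1 & g ** i2 = i3 & p3 ** g = sus al ** p2"
begin

section \<open>Elementary consequences of the axioms of a triangulated category\<close>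

lemma triD:
 assumes "tri X Y Z u v w"
 shows "arr u" "arr v" "arr w" "dm u = X" "cd u = Y" "dm v = Y" "cd v = Z" "dm w = Z" "cd w = S X"
  "ob X" "ob Y" "ob Z"
 using tri_wf[OF assms] by auto

lemma sus_zz [simp]: "ob X ==> ob Y ==> sus (zz X Y) = zz (S X) (S Y)"
proof -
 assume o: "ob X" "ob Y"
 have "sus (zz X Y) \<boxplus> sus (zz X Y) = sus (zz X Y) \<boxplus> zz (S X) (S Y)"
  using o by (simp add: sus_add[symmetric])
 thus ?thesis by (subst (asm) pl_cancel(1)) (use o in simp_all)
qed

lemma sus_ng [simp]: "arr f ==> sus (ng f) = ng (sus f)"
proof (rule ng_unique)
 assume f: "arr f"
 have "sus (ng f) \<boxplus> sus f = sus (zz (dm f) (cd f))" using f by (simp add: sus_add[symmetric] del: sus_zz)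
 thus "sus (ng f) \<boxplus> sus f = zz (dm (sus f)) (cd (sus f))" using f by simp
qed simp_all

lemma sus_iso [simp]: "iso f ==> iso (sus f)"
 by (rule isoI[of _ "sus (iv f)"]) (simp_all add: sus_cmp[symmetric])

lemma sus_iso_iff: assumes f: "arr f" shows "iso (sus f) = iso f"
proof
 assume i: "iso (sus f)"
 obtain g where g: "arr g" "dm g = cd f" "cd g = dm f" "sus g = iv (sus f)"
  using sus_surj[of "iv (sus f)" "cd f" "dm f"] f i by auto
 have e: "sus (g ** f) = sus (idn (dm f))" "sus (f ** g) = sus (idn (cd f))" using g i f by (simp_all add: sus_cmp)
 show "iso f"
  by (rule isoI[of f g]) (use g f sus_inj[OF _ _ _ _ e(1)] sus_inj[OF _ _ _ _ e(2)] in simp_all)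
qed (rule sus_iso)

lemma ng_inj:
 assumes "arr f" "arr g" "ng f = ng g" shows "f = g"
 by (rule trans[OF _ ng_ng[OF assms(2)]], subst assms(3)[symmetric]) (rule ng_ng[OF assms(1), symmetric])

lemma sus_ng_cmp_inj:
 assumes "arr f" "arr g" "dm f = dm g" "cd f = cd g" "ng (sus f) = ng (sus g)" shows "f = g"
 by (rule sus_inj[OF assms(1-4)], rule ng_inj[OF _ _ assms(5)]) (simp_all add: assms(1,2))

lemma null_ex: obtains N where "null N"
 using ob_ex tri_id by blast

text \<open>The triangle is compared with the one on the identity of X, whose third object is
  null.\<close>

lemma tri_vu:
 assumes t: "tri X Y Z u v w" shows "v ** u = zz X Z"
proof -
 note D = triD[OF t]
 obtain N v0 w0 where n: "null N" "tri X X N (idn X) v0 w0" using tri_id[OF D(10)] by blast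
 note D0 = triD[OF n(2)]
 obtain gm where g: "arr gm" "dm gm = N" "cd gm = Z" "gm ** v0 = v ** u"
  using tri_TR3[OF n(2) t, of "idn X" u] D by auto
 have z: "gm = zz N Z" using null_arr(1)[OF n(1) g(1,2)] g(3) by simp
 have "v ** u = zz N Z ** v0" using g(4) z by simp
 thus ?thesis using D D0 by simp
qed

lemma tri_wv: "tri X Y Z u v w ==> w ** v = zz Y (S X)"
 using tri_vu[OF tri_rot] .

lemma tri_susu_w:
 assumes t: "tri X Y Z u v w" shows "sus u ** w = zz Z (S Y)"
proof -
 note D = triD[OF t]
 have "ng (sus u ** w) = zz Z (S Y)" using tri_vu[OF tri_rot[OF tri_rot[OF t]]] D by simp
 thus ?thesis using ng_eq_zz[of "sus u ** w" Z "S Y"] D by simp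
qed

text \<open>A filler between the rotated identity triangle on the source of f and the rotated given
  triangle is a suspended arrow; removing \<open>sus\<close> and the signs gives the lift.\<close>

lemma tri_exact:
 assumes t: "tri X Y Z u v w" and f: "arr f" "cd f = Y" "v ** f = zz (dm f) Z"
 obtains g where "arr g" "dm g = dm f" "cd g = X" "u ** g = f"
proof -
 note D = triD[OF t]
 let ?W = "dm f"
 have W: "ob ?W" using f by simp
 obtain N v0 w0 where n: "null N" "tri ?W ?W N (idn ?W) v0 w0" using tri_id[OF W] by blast
 note D0 = triD[OF n(2)]
 have "zz N Z ** v0 = v ** f" using f D D0 by simp
 then obtain gm where g: "arr gm" "dm gm = S ?W" "cd gm = S X" "ng (sus u) ** gm = sus f ** ng (sus (idn ?W))"
  using tri_TR3[OF tri_rot[OF n(2)] tri_rot[OF t] f(1) refl f(2), of "zz N Z"] D D0 by auto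
 obtain g' where g': "arr g'" "dm g' = ?W" "cd g' = X" "sus g' = gm"
  using sus_surj[OF g(1-3) W D(10)] by blast
 have "ng (sus (u ** g')) = ng (sus f)" using g(4)[unfolded g'(4)[symmetric]] g'(1-3) D f by (simp add: sus_cmp)
 hence "u ** g' = f" by (rule sus_ng_cmp_inj[rotated -1]) (use g' D f in simp_all)
 thus ?thesis using that g' by blast
qed

lemma tri_exact2:
 assumes t: "tri X Y Z u v w" and f: "arr f" "cd f = Z" "w ** f = zz (dm f) (S X)"
 obtains g where "arr g" "dm g = dm f" "cd g = Y" "v ** g = f"
 using tri_exact[OF tri_rot[OF t] f] .

lemma tri_exact3:
 assumes t: "tri X Y Z u v w" and f: "arr f" "cd f = S X" "sus u ** f = zz (dm f) (S Y)"
 obtains g where "arr g" "dm g = dm f" "cd g = Z" "w ** g = f"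
proof (rule tri_exact[OF tri_rot[OF tri_rot[OF t]] f(1,2)])
 note D = triD[OF t]
 show "ng (sus u) ** f = zz (dm f) (S Y)" using D f by simp
qed (rule that)

lemma tri_coexact:
 assumes t: "tri X Y Z u v w" and f: "arr f" "dm f = Y" "f ** u = zz X (cd f)"
 obtains g where "arr g" "dm g = Z" "cd g = cd f" "g ** v = f"
proof -
 note D = triD[OF t]
 let ?W = "cd f"
 have W: "ob ?W" using f by simp
 obtain N v0 w0 where n: "null N" "tri ?W ?W N (idn ?W) v0 w0" using tri_id[OF W] by blast
 note D0 = triD[OF n(2)]
 have e: "sus f ** ng (sus u) = w0 ** zz (S X) N" using f D D0 by (simp add: sus_cmp[symmetric])
 obtain gm where g: "arr gm" "dm gm = S Z" "cd gm = S ?W" "gm ** ng (sus v) = ng (sus (idn ?W)) ** sus f"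
  using tri_TR3[OF tri_rot[OF tri_rot[OF tri_rot[OF t]]] tri_rot[OF tri_rot[OF n(2)]], of "zz (S X) N" "sus f"] e D D0 f
  by auto
 obtain g' where g': "arr g'" "dm g' = Z" "cd g' = ?W" "sus g' = gm"
  using sus_surj[OF g(1-3) D(12) W] by blast
 have "ng (sus (g' ** v)) = ng (sus f)" using g(4)[unfolded g'(4)[symmetric]] g'(1-3) D f by (simp add: sus_cmp)
 hence "g' ** v = f" by (rule sus_ng_cmp_inj[rotated -1]) (use g' D f in simp_all)
 thus ?thesis using that g' by blast
qed

lemma tri_coexact2:
 assumes t: "tri X Y Z u v w" and f: "arr f" "dm f = Z" "f ** v = zz Y (cd f)"
 obtains g where "arr g" "dm g = S X" "cd g = cd f" "g ** w = f"
 using tri_coexact[OF tri_rot[OF t] f] .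

text \<open>The comparison map exists by \<open>tri_TR3\<close>. Instead of the five lemma for Hom
  functors, it is shown that every arrow into Z' lifts through gm and that gm annihilates no nonzero
  arrow; lifting the identity of Z' then gives the inverse.\<close>

lemma cone_unique:
 assumes t: "tri X Y Z u v w" and t': "tri X Y Z' u v' w'"
 obtains gm where "iso gm" "dm gm = Z" "cd gm = Z'" "gm ** v = v'" "w' ** gm = w"
proof -
 note D = triD[OF t] and D' = triD[OF t']
 obtain gm where gm: "arr gm" "dm gm = Z" "cd gm = Z'" and e: "gm ** v = v'" "w' ** gm = w"
  using tri_TR3[OF t t', of "idn X" "idn Y"] D D' by auto
 have gv: "gm ** (v ** h) = v' ** h" if "arr h" "cd h = Y" for h
  using assoc[of h v gm] that gm D by (simp add: e del: assoc)
 have gw: "w' ** (gm ** h) = w ** h" if "arr h" "cd h = Z" for h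
  using assoc[of h gm w'] that gm D' by (simp add: e del: assoc)
 have surj: "EX g. arr g & dm g = dm h & cd g = Z & gm ** g = h" if h: "arr h" "cd h = Z'" for h
 proof -
  have "sus u ** (w' ** h) = (sus u ** w') ** h" using h D' by simp
  hence "sus u ** (w' ** h) = zz (dm (w' ** h)) (S Y)" unfolding tri_susu_w[OF t'] using h D' by simp
  then obtain g0 where g0: "arr g0" "dm g0 = dm h" "cd g0 = Z" "w ** g0 = w' ** h"
   using tri_exact3[OF t, of "w' ** h"] h D' by auto
  have z: "w' ** (h \<boxplus> ng (gm ** g0)) = zz (dm h) (S X)" using h gm g0 D D' by (simp add: gw)
  then obtain m where m: "arr m" "dm m = dm h" "cd m = Y" "v' ** m = h \<boxplus> ng (gm ** g0)"
   using tri_exact2[OF t', of "h \<boxplus> ng (gm ** g0)"] h gm g0 by auto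
  have "gm ** (g0 \<boxplus> v ** m) = gm ** g0 \<boxplus> (h \<boxplus> ng (gm ** g0))" using g0 gm D m by (simp add: gv)
  also have "... = h" using h gm g0 pl_ac(3)[of "gm ** g0" h "ng (gm ** g0)"] by simp
  finally show ?thesis using g0 D m by (intro exI[of _ "g0 \<boxplus> v ** m"]) simp
 qed
 have inj: "h = zz (dm h) Z" if h: "arr h" "cd h = Z" "gm ** h = zz (dm h) Z'" for h
 proof -
  have "w ** h = zz (dm h) (S X)" using gw[of h] h D' by simp
  then obtain m where m: "arr m" "dm m = dm h" "cd m = Y" "v ** m = h" by (rule tri_exact2[OF t h(1,2)])
  have "v' ** m = zz (dm m) Z'" using gv[of m] m h by simp
  then obtain n where n: "arr n" "dm n = dm m" "cd n = X" "u ** n = m" by (rule tri_exact[OF t' m(1,3)])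
  have "h = (v ** u) ** n" using m(4) D n by simp
  thus ?thesis unfolding tri_vu[OF t] using n m D by simp
 qed
 obtain g where g: "arr g" "dm g = Z'" "cd g = Z" "gm ** g = idn Z'" using surj[of "idn Z'"] D' by auto
 have "gm ** (g ** gm \<boxplus> ng (idn Z)) = zz Z Z'"
  using g gm D assoc[of gm g gm] by (simp del: assoc)
 hence "g ** gm \<boxplus> ng (idn Z) = zz Z Z" using inj[of "g ** gm \<boxplus> ng (idn Z)"] g gm D by simp
 hence "g ** gm = idn Z" using diff_zero[of "g ** gm" "idn Z"] g gm D by simp
 hence "iso gm" using g gm by (intro isoI[of gm g]) simp_all
 thus ?thesis using that gm e by blast
qed

lemma tri_iso3:
 assumes t: "tri X Y Z u v w" and g: "iso gm" "dm gm = Z" "cd gm = Z'"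
 shows "tri X Y Z' u (gm ** v) (w ** iv gm)"
 by (rule tri_iso[OF t, of "idn X" "idn Y" gm]) (use triD[OF t] g in simp_all)

lemma tri_iso1:
 assumes t: "tri X Y Z u v w" and g: "iso gm" "dm gm = X" "cd gm = X'"
 shows "tri X' Y Z (u ** iv gm) v (sus gm ** w)"
 by (rule tri_iso[OF t, of gm "idn Y" "idn Z"]) (use triD[OF t] g in simp_all)

lemma tri_iso2:
 assumes t: "tri X Y Z u v w" and g: "iso gm" "dm gm = Y" "cd gm = Y'"
 shows "tri X Y' Z (gm ** u) (v ** iv gm) w"
 by (rule tri_iso[OF t, of "idn X" gm "idn Z"]) (use triD[OF t] g in simp_all)

text \<open>w is completed to a triangle of its own; rotated, that triangle and the given one share
  their first arrow, so their cones agree by \<open>cone_unique\<close>.\<close>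

lemma tri_unrot:
 assumes t: "tri X Y (S Z) u v (ng (sus w))" and w: "arr w" "dm w = Z" "cd w = X"
 shows "tri Z X Y w u v"
proof -
 note D = triD[OF t]
 obtain Y' u' v' where t': "tri Z X Y' w u' v'" using tri_complete[OF w(1)] w by auto
 note D' = triD[OF t']
 have Z: "ob Z" using w by auto
 note r = tri_rot[OF tri_rot[OF t]] and r' = tri_rot[OF tri_rot[OF tri_rot[OF t']]]
 obtain c where c: "iso c" "dm c = S Y" "cd c = S Y'" "c ** ng (sus u) = ng (sus u')" "ng (sus v') ** c = ng (sus v)"
  by (rule cone_unique[OF r r']) blast
 obtain d where d: "arr d" "dm d = Y" "cd d = Y'" "sus d = c" using sus_surj[of c Y Y'] c D D' by auto
 have iso: "iso d" using sus_iso_iff[OF d(1)] c(1) d(4) by simp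
 have 1: "d ** u = u'"
  by (rule sus_ng_cmp_inj) (use c(4)[unfolded d(4)[symmetric]] d(1-3) D D' in "simp_all add: sus_cmp")
 have 2: "v' ** d = v"
  by (rule sus_ng_cmp_inj) (use c(5)[unfolded d(4)[symmetric]] d(1-3) D D' Z in "simp_all add: sus_cmp")
 show ?thesis
  by (rule tri_iso[OF t', of "idn Z" "idn X" "iv d"])
   (use D D' d iso Z w in "simp_all add: 1[symmetric] 2[symmetric]")
qed

lemma tri_unrot':
 assumes t: "tri X Y Z u v w" and i: "isom Z (S Z')" "ob Z'"
 obtains e w' where "iso e" "dm e = Z" "cd e = S Z'" "tri Z' X Y w' u (e ** v)" "w = ng (sus w') ** e"
proof -
 note D = triD[OF t]
 obtain e where e: "iso e" "dm e = Z" "cd e = S Z'" using isomE[OF i(1)] .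
 obtain w' where w': "arr w'" "dm w' = Z'" "cd w' = X" "sus w' = ng (w ** iv e)"
  using sus_surj[of "ng (w ** iv e)" Z' X] e D i(2) by auto
 have n: "ng (sus w') = w ** iv e" using w'(4) e D by simp
 have "tri X Y (S Z') u (e ** v) (ng (sus w'))" unfolding n by (rule tri_iso3[OF t e])
 hence "tri Z' X Y w' u (e ** v)" by (rule tri_unrot[OF _ w'(1-3)])
 moreover have "w = ng (sus w') ** e" unfolding n using e D by simp
 ultimately show ?thesis using that e by blast
qed

lemma unS: assumes "ob X" obtains X' where "ob X'" "isom X (S X')"
proof
 show "ob (Shift T (-1) X)" using assms by simp
 have "isom (S (Shift T (-1) X)) (Shift T 0 X)" using sh_sh[OF assms, of 1 "-1"] by simp
 thus "isom X (S (Shift T (-1) X))" using isom_trans[OF _ sh_0[OF assms]] isom_sym by blast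
qed

text \<open>Three backward rotations leave signs on u and v; the automorphism -1 of Y absorbs
  both.\<close>

lemma tri_unsus:
 assumes t: "tri (S X) (S Y) (S Z) (sus u) (sus v) (ng (sus w))"
  and u: "arr u" "dm u = X" "cd u = Y" and v: "arr v" "dm v = Y" "cd v = Z" and w: "arr w" "dm w = Z" "cd w = S X"
 shows "tri X Y Z u v w"
proof -
 have o: "ob X" "ob Y" "ob Z" using u v by auto
 have t1: "tri Z (S X) (S Y) w (sus u) (sus v)" by (rule tri_unrot[OF t w])
 have "tri Z (S X) (S Y) w (sus u) (ng (sus (ng v)))" using t1 v by simp
 hence t2: "tri Y Z (S X) (ng v) w (sus u)" by (rule tri_unrot) (use v in simp_all)
 have "tri Y Z (S X) (ng v) w (ng (sus (ng u)))" using t2 u by simp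
 hence t3: "tri X Y Z (ng u) (ng v) w" by (rule tri_unrot) (use u in simp_all)
 show ?thesis
  by (rule tri_iso[OF t3, of "idn X" "ng (idn Y)" "idn Z"]) (use u v w o in simp_all)
qed

text \<open>The axiom only asserts that some choice of the three cones admits an octahedron;
  \<open>cone_unique\<close> carries it to cones given in advance.\<close>

lemma oct:
 assumes t1: "tri X Y C1 u i1 p1" and t2: "tri X Z C2 (v ** u) i2 p2" and t3: "tri Y Z C3 v i3 p3"
 obtains f g where "tri C1 C2 C3 f g (sus i1 ** p3)" "f ** i1 = i2 ** v" "p2 ** f = p1" "g ** i2 = i3" "p3 ** g = sus u ** p2"
proof -
 note D1 = triD[OF t1] and D2 = triD[OF t2] and D3 = triD[OF t3]
 obtain C1' C2' C3' i1' p1' i2' p2' i3' p3' f g where o: "tri X Y C1' u i1' p1'" "tri X Z C2' (v ** u) i2' p2'"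
  "tri Y Z C3' v i3' p3'" "tri C1' C2' C3' f g (sus i1' ** p3')" "f ** i1' = i2' ** v" "p2' ** f = p1'" "g ** i2' = i3'"
  "p3' ** g = sus u ** p2'"
  using tri_oct[OF D1(1) D3(1)] D1(4,5) D3(4,5) by auto
 note E1 = triD[OF o(1)] and E2 = triD[OF o(2)] and E3 = triD[OF o(3)] and E4 = triD[OF o(4)]
 obtain a where a: "iso a" "dm a = C1" "cd a = C1'" "a ** i1 = i1'" "p1' ** a = p1" by (rule cone_unique[OF t1 o(1)])
 obtain b where b: "iso b" "dm b = C2" "cd b = C2'" "b ** i2 = i2'" "p2' ** b = p2" by (rule cone_unique[OF t2 o(2)])
 obtain c where c: "iso c" "dm c = C3" "cd c = C3'" "c ** i3 = i3'" "p3' ** c = p3" by (rule cone_unique[OF t3 o(3)])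
 let ?f = "iv b ** f ** a" and ?g = "iv c ** g ** b"
 have ai: "iv a ** i1' = i1" using a D1 unfolding a(4)[symmetric] by simp
 have si: "sus (iv a) ** sus i1' = sus i1" using ai a E1 by (simp add: sus_cmp[symmetric])
 have si2: "sus (iv a) ** (sus i1' ** h) = sus i1 ** h" if "arr h" "cd h = S Y" for h
  using assoc[of h "sus i1'" "sus (iv a)"] si that a E1 by (simp del: assoc)
 have "tri C1 C2 C3 ?f ?g (sus i1 ** p3)"
  by (rule tri_iso[OF o(4), of "iv a" "iv b" "iv c"])
   (use a(1-3) b(1-3) c(1-3) D1 D3 E1 E3 E4 si2 in "simp_all add: c(5)[symmetric]")
 moreover have "?f ** i1 = i2 ** v"
 proof -
  have "?f ** i1 = iv b ** f ** i1'" using a b E4 D1 by simp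
  also have "... = iv b ** (b ** i2) ** v" unfolding o(5) b(4) ..
  also have "... = i2 ** v" using b(1-3) D2 D3 by simp
  finally show ?thesis .
 qed
 moreover have "p2 ** ?f = p1"
 proof -
  have "p2 ** ?f = (p2' ** f) ** a" unfolding b(5)[symmetric] using a(1-3) b(1-3) E4 E2 by simp
  thus ?thesis unfolding o(6) a(5) .
 qed
 moreover have "?g ** i2 = i3"
 proof -
  have "?g ** i2 = iv c ** g ** i2'" using b c(1-3) E4 D2 by simp
  also have "... = i3" unfolding o(7) c(4)[symmetric] using c(1-3) D3 by simp
  finally show ?thesis .
 qed
 moreover have "p3 ** ?g = sus u ** p2"
 proof -
  have "p3 ** ?g = (p3' ** g) ** b" unfolding c(5)[symmetric] using b(1-3) c(1-3) E4 E3 by simp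
  also have "... = sus u ** p2" unfolding o(8) b(5)[symmetric] using b(1-3) E2 D1 by simp
  finally show ?thesis .
 qed
 ultimately show ?thesis using that by blast
qed

text \<open>This reassociates extensions: if Y is an extension of Z by X and Z is an extension of Q
  by Z1, then the fibre Y1 of Y -> Q is an extension of Z1 by X. It is the octahedron on rotated
  triangles, desuspended.\<close>

lemma fib_oct:
 assumes t1: "tri X Y Z a b c" and t3: "tri Z1 Z Q a' b' c'"
 obtains Y1 f g s r where "tri X Y1 Z1 f g (c ** a')" "tri Y1 Y Q s (b' ** b) r" "s ** f = a" "b ** s = a' ** g"
proof -
 note D1 = triD[OF t1] and D3 = triD[OF t3]
 have m: "arr (b' ** b)" "dm (b' ** b) = Y" "cd (b' ** b) = Q" using D1 D3 by simp_all
 obtain C r0 s0 where t2: "tri Y Q C (b' ** b) r0 s0" using tri_complete[OF m(1)] m(2,3) by auto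
 obtain Y1 where Y1: "ob Y1" "isom C (S Y1)" using unS triD(12)[OF t2] by blast
 obtain e s where e: "iso e" "dm e = C" "cd e = S Y1" "tri Y1 Y Q s (b' ** b) (e ** r0)" "s0 = ng (sus s) ** e"
  using tri_unrot'[OF t2 Y1(2,1)] .
 note D2 = triD[OF e(4)]
 note t2' = tri_rot[OF e(4)]
 obtain f0 g0 where o: "tri (S X) (S Y1) (S Z1) f0 g0 (sus c ** ng (sus a'))" "f0 ** c = (e ** r0) ** b'"
  "ng (sus s) ** f0 = ng (sus a)" "g0 ** (e ** r0) = c'" "ng (sus a') ** g0 = sus b ** ng (sus s)"
  by (rule oct[OF tri_rot[OF t1] t2' tri_rot[OF t3]])
 note D4 = triD[OF o(1)]
 obtain f where f: "arr f" "dm f = X" "cd f = Y1" "sus f = f0" using sus_surj[of f0 X Y1] D4 D1 D2 by auto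
 obtain g where g: "arr g" "dm g = Y1" "cd g = Z1" "sus g = g0" using sus_surj[of g0 Y1 Z1] D4 D2 D3 by auto
 have "sus c ** ng (sus a') = ng (sus (c ** a'))" using D1 D3 by (simp add: sus_cmp)
 hence "tri (S X) (S Y1) (S Z1) (sus f) (sus g) (ng (sus (c ** a')))" using o(1) f(4) g(4) by simp
 hence "tri X Y1 Z1 f g (c ** a')"
  by (rule tri_unsus) (use f g D1 D3 in simp_all)
 moreover have "s ** f = a"
  by (rule sus_ng_cmp_inj) (use o(3)[unfolded f(4)[symmetric]] f(1-3) D1 D2 in "simp_all add: sus_cmp")
 moreover have "b ** s = a' ** g"
  by (rule sus_ng_cmp_inj) (use o(5)[unfolded g(4)[symmetric]] g(1-3) D1 D2 D3 in "simp_all add: sus_cmp")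
 ultimately show ?thesis using that e(4) by blast
qed

lemma tri_mono_of_w_zero:
 assumes t: "tri X Y Z u v w" and w: "w = zz Z (S X)" and f: "arr f" "cd f = X" "u ** f = zz (dm f) Y"
 shows "f = zz (dm f) X"
proof -
 note D = triD[OF t]
 have "sus u ** sus f = zz (dm (sus f)) (S Y)" using f D by (simp add: sus_cmp[symmetric])
 then obtain g where g: "arr g" "dm g = dm (sus f)" "cd g = Z" "w ** g = sus f"
  using tri_exact3[OF t, of "sus f"] f by auto
 have "sus f = sus (zz (dm f) X)" using g f D unfolding w by simp
 thus ?thesis by (rule sus_inj[rotated -1]) (use f D in simp_all)
qed

text \<open>A section s forces w = w v s = 0, so u annihilates no nonzero arrow; the retraction r is
  obtained by factoring 1 - s v through u.\<close>

lemma tri_split: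
 assumes t: "tri X Y Z u v w" and s: "arr s" "dm s = Z" "cd s = Y" "v ** s = idn Z"
 shows "is_biproduct T X Z Y"
proof -
 note D = triD[OF t]
 have "w = (w ** v) ** s" using s D by simp
 hence w: "w = zz Z (S X)" unfolding tri_wv[OF t] using s D by simp
 have vsv: "v ** (s ** v) = v" using assoc[of v s v] s D by (simp del: assoc)
 have sv: "arr (s ** v)" "dm (s ** v) = Y" "cd (s ** v) = Y" using s D by simp_all
 let ?e = "idn Y \<boxplus> ng (s ** v)"
 have e: "arr ?e" "dm ?e = Y" "cd ?e = Y" using D sv by simp_all
 have "v ** ?e = zz Y Z" using D sv vsv by simp
 then obtain r where r: "arr r" "dm r = Y" "cd r = X" "u ** r = ?e" using tri_exact[OF t e(1,3)] e(2) by auto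
 have svu: "(s ** v) ** u = zz X Y" using tri_vu[OF t] s D by simp
 have "u ** (r ** u \<boxplus> ng (idn X)) = zz X Y"
 proof -
  have "u ** (r ** u) = ?e ** u" using assoc[of u r u] r D by (simp del: assoc)
  also have "... = u" using D sv svu by simp
  finally show ?thesis using r D by simp
 qed
 hence "r ** u \<boxplus> ng (idn X) = zz X X"
  using tri_mono_of_w_zero[OF t w, of "r ** u \<boxplus> ng (idn X)"] r D by simp
 hence ru: "r ** u = idn X" using diff_zero[of "r ** u" "idn X"] r D by simp
 have "u ** (r ** s) = zz Z Y"
 proof -
  have "u ** (r ** s) = ?e ** s" using assoc[of s r u] r s D by (simp del: assoc)
  also have "(s ** v) ** s = s" using s D by simp
  hence "?e ** s = zz Z Y" using s sv D by simp
  finally show ?thesis .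
 qed
 hence rs: "r ** s = zz Z X" using tri_mono_of_w_zero[OF t w, of "r ** s"] r s D by simp
 have sum: "u ** r \<boxplus> s ** v = idn Y" unfolding r(4) using D sv pl_ac(2)[of "idn Y" "ng (s ** v)" "s ** v"] by simp
 show ?thesis
  by (rule biprodI[of u X Y s Z r v]) (use D s r ru rs sum tri_vu[OF t] in "simp_all add: ar_iff")
qed

end

section \<open>Vanishing of Hom, and triangles with their maps forgotten\<close>

context tricat0 begin

abbreviation "sh n X \<equiv> Shift T n X"

definition "hz X Y = (ALL f. arr f --> dm f = X --> cd f = Y --> f = zz X Y)"

lemma hzD: "hz X Y ==> arr f ==> dm f = X ==> cd f = Y ==> f = zz X Y"
 unfolding hz_def by blast

lemma hzI: "(!!f. arr f ==> dm f = X ==> cd f = Y ==> f = zz X Y) ==> hz X Y"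
 unfolding hz_def by blast

lemma hz_isom:
 assumes h: "hz X Y" and i: "isom X X'" "isom Y Y'" shows "hz X' Y'"
proof (rule hzI)
 fix f assume f: "arr f" "dm f = X'" "cd f = Y'"
 obtain a where a: "iso a" "dm a = X" "cd a = X'" using isomE[OF i(1)] .
 obtain b where b: "iso b" "dm b = Y" "cd b = Y'" using isomE[OF i(2)] .
 note o = isom_ob[OF i(1)] isom_ob[OF i(2)]
 have "iv b ** (f ** a) = zz X Y" by (rule hzD[OF h]) (use a b f in simp_all)
 hence "b ** (iv b ** (f ** a)) = b ** zz X Y" by simp
 hence e: "f ** a = zz X Y'" using a b f o by simp
 show "f = zz X' Y'" by (rule iso_epi[OF a(1)]) (use a b f o e in simp_all)
qed

lemma hz_null:
 "null X ==> hz X Y" "null Y ==> hz X Y"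
 by (rule hzI, use null_arr in blast)+

lemma null_iff_hz: "ob X ==> null X = hz X X"
 using hz_null(1)[of X X] hzD[of X X "idn X"] by (auto simp: null_def)

lemma hz_S: assumes "ob X" "ob Y" shows "hz (S X) (S Y) = hz X Y"
proof
 assume h: "hz (S X) (S Y)"
 show "hz X Y"
 proof (rule hzI)
  fix f assume f: "arr f" "dm f = X" "cd f = Y"
  have "sus f = sus (zz X Y)" using hzD[OF h, of "sus f"] f assms by simp
  thus "f = zz X Y" by (rule sus_inj[rotated -1]) (use f assms in simp_all)
 qed
next
 assume h: "hz X Y"
 show "hz (S X) (S Y)"
 proof (rule hzI)
  fix f assume f: "arr f" "dm f = S X" "cd f = S Y"
  obtain g where g: "arr g" "dm g = X" "cd g = Y" "sus g = f" using sus_surj[OF f assms] by blast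
  show "f = zz (S X) (S Y)" unfolding g(4)[symmetric] hzD[OF h g(1-3)] using assms by simp
 qed
qed

lemma isom_S: "isom X Y ==> isom (S X) (S Y)"
 by (erule isomE, rule isomI[OF sus_iso]) auto

lemma isom_S_iff: assumes o: "ob X" "ob Y" shows "isom (S X) (S Y) = isom X Y"
proof
 assume "isom (S X) (S Y)"
 then obtain f where f: "iso f" "dm f = S X" "cd f = S Y" by (rule isomE)
 obtain g where g: "arr g" "dm g = X" "cd g = Y" "sus g = f" using sus_surj[of f X Y] f o by auto
 have "iso g" using sus_iso_iff[OF g(1)] f(1) g(4) by simp
 thus "isom X Y" by (rule isomI) (use g in simp_all)
qed (rule isom_S)

lemma sh_Suc: "ob X ==> isom (S (sh n X)) (sh (n+1) X)"
 using sh_sh[of X 1 n] by (simp add: add.commute)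

text \<open>Passes from invariance under a single suspension to all integers. Negative shifts are
  reached this way although they do not act on arrows.\<close>

lemma int_iff_induct: 
 assumes "P 0 = Q" "!!n::int. P n = P (n+1)" shows "P n = Q"
proof (induction n rule: int_induct[where k = 0])
 case (step2 i) thus ?case using assms(2)[of "i - 1"] by simp
qed (use assms in auto)

lemma isom_cong: assumes "isom X X'" "isom Y Y'" shows "isom X Y = isom X' Y'"
 using isom_trans[OF isom_trans[OF isom_sym[OF assms(1)]] assms(2)]
  isom_trans[OF isom_trans[OF assms(1)] isom_sym[OF assms(2)]] by iprover

lemma hz_cong: assumes "isom X X'" "isom Y Y'" shows "hz X Y = hz X' Y'"
 using hz_isom[OF _ assms] hz_isom[OF _ assms[THEN isom_sym]] by iprover

lemma isom_sh_iff: assumes o: "ob X" "ob Y" shows "isom (sh n X) (sh n Y) = isom X Y"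
proof (rule int_iff_induct)
 show "isom (sh 0 X) (sh 0 Y) = isom X Y" by (rule isom_cong[OF o[THEN sh_0]])
 show "isom (sh n X) (sh n Y) = isom (sh (n+1) X) (sh (n+1) Y)" for n
  unfolding isom_S_iff[OF sh_ob[OF o(1), of n] sh_ob[OF o(2), of n], symmetric]
  by (rule isom_cong[OF o[THEN sh_Suc]])
qed

lemma isom_sh: "isom X Y ==> isom (sh n X) (sh n Y)"
 using isom_sh_iff isom_ob by blast

lemma hz_sh: assumes o: "ob X" "ob Y" shows "hz (sh n X) (sh n Y) = hz X Y"
proof (rule int_iff_induct)
 show "hz (sh 0 X) (sh 0 Y) = hz X Y" by (rule hz_cong[OF o[THEN sh_0]])
 show "hz (sh n X) (sh n Y) = hz (sh (n+1) X) (sh (n+1) Y)" for n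
  unfolding hz_S[OF sh_ob[OF o(1), of n] sh_ob[OF o(2), of n], symmetric]
  by (rule hz_cong[OF o[THEN sh_Suc]])
qed

lemma hz_sh2: assumes o: "ob X" "ob Y" shows "hz (sh i X) (sh j Y) = hz X (sh (j - i) Y)"
proof -
 have i: "isom (sh i (sh (j - i) Y)) (sh j Y)" using sh_sh[OF o(2), of i "j - i"] by simp
 have "hz (sh i X) (sh j Y) = hz (sh i X) (sh i (sh (j - i) Y))"
  by (rule hz_cong[OF isom_refl[OF sh_ob[OF o(1)]] isom_sym[OF i]])
 also have "... = hz X (sh (j - i) Y)" by (rule hz_sh[OF o(1) sh_ob[OF o(2)]])
 finally show ?thesis .
qed

lemma null_sh: assumes "ob X" shows "null (sh n X) = null X"
 using null_iff_hz hz_sh[OF assms assms] assms by simp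

text \<open>With the maps forgotten, triangles are invariant under isomorphism in each object
  separately, which is all that filtrations use.\<close>

definition "trio X Y Z = (EX u v w. tri X Y Z u v w)"

lemma trioI: "tri X Y Z u v w ==> trio X Y Z"
 unfolding trio_def by blast

lemma trioE: assumes "trio X Y Z" obtains u v w where "tri X Y Z u v w"
 using assms unfolding trio_def by blast

lemma trio_ob: "trio X Y Z ==> ob X & ob Y & ob Z"
 using triD(10-12) unfolding trio_def by blast

lemma trio_isom:
 assumes "trio X Y Z" "isom X X'" "isom Y Y'" "isom Z Z'" shows "trio X' Y' Z'"
proof -
 obtain u v w where t: "tri X Y Z u v w" using assms(1) by (rule trioE)
 obtain a where a: "iso a" "dm a = X" "cd a = X'" using isomE[OF assms(2)] .
 obtain b where b: "iso b" "dm b = Y" "cd b = Y'" using isomE[OF assms(3)] .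
 obtain c where c: "iso c" "dm c = Z" "cd c = Z'" using isomE[OF assms(4)] .
 show ?thesis by (rule trioI, rule tri_iso3[OF tri_iso2[OF tri_iso1[OF t a] b] c])
qed

lemma trio_rot: "trio X Y Z ==> trio Y Z (S X)"
 using tri_rot unfolding trio_def by blast

lemma trio_unrot: assumes "trio X Y (S Z)" "ob Z" shows "trio Z X Y"
proof -
 obtain u v w where t: "tri X Y (S Z) u v w" using assms(1) by (rule trioE)
 show ?thesis
  by (rule tri_unrot'[OF t isom_refl[OF sh_ob[OF assms(2)]] assms(2)]) (rule trioI)
qed

lemma trio_S: assumes o: "ob X" "ob Y" "ob Z" shows "trio (S X) (S Y) (S Z) = trio X Y Z"
proof
 assume "trio X Y Z" from trio_rot[OF trio_rot[OF trio_rot[OF this]]] show "trio (S X) (S Y) (S Z)" .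
next
 assume "trio (S X) (S Y) (S Z)"
 from trio_unrot[OF trio_unrot[OF trio_unrot[OF this o(3)] o(2)] o(1)] show "trio X Y Z" .
qed

lemma trio_cong:
 assumes "isom X X'" "isom Y Y'" "isom Z Z'" shows "trio X Y Z = trio X' Y' Z'"
 using trio_isom[OF _ assms] trio_isom[OF _ assms[THEN isom_sym]] by iprover

lemma trio_sh: assumes o: "ob X" "ob Y" "ob Z" shows "trio (sh n X) (sh n Y) (sh n Z) = trio X Y Z"
proof (rule int_iff_induct)
 show "trio (sh 0 X) (sh 0 Y) (sh 0 Z) = trio X Y Z" by (rule trio_cong[OF o[THEN sh_0]])
 show "trio (sh n X) (sh n Y) (sh n Z) = trio (sh (n+1) X) (sh (n+1) Y) (sh (n+1) Z)" for n
  unfolding trio_S[OF o[THEN sh_ob[of _ n]], symmetric]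
  by (rule trio_cong[OF o[THEN sh_Suc]])
qed

lemma tri_isom_u: assumes t: "tri X Y Z u v w" and n: "null Z" shows "iso u"
proof -
 note D = triD[OF t]
 have v: "v = zz Y Z" and w: "w = zz Z (S X)"
  using null_arr(2)[OF n D(2)] null_arr(1)[OF n D(3)] D by simp_all
 obtain g where g: "arr g" "dm g = dm (idn Y)" "cd g = X" "u ** g = idn Y"
  by (rule tri_exact[OF t, of "idn Y"]) (use D v in simp_all)
 have "u ** (g ** u \<boxplus> ng (idn X)) = zz X Y"
  using g D assoc[of u g u] by (simp del: assoc)
 hence "g ** u \<boxplus> ng (idn X) = zz X X"
  using tri_mono_of_w_zero[OF t w, of "g ** u \<boxplus> ng (idn X)"] g D by simp
 hence "g ** u = idn X" using diff_zero[of "g ** u" "idn X"] g D by simp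
 thus ?thesis using g D by (intro isoI[of u g]) simp_all
qed

lemma trio_null3: assumes "trio X Y Z" "null Z" shows "isom X Y"
proof -
 obtain u v w where t: "tri X Y Z u v w" using assms(1) by (rule trioE)
 show ?thesis using tri_isom_u[OF t assms(2)] triD[OF t] isomI by blast
qed

lemma trio_null1: assumes "trio X Y Z" "null X" shows "isom Y Z"
 using trio_null3[OF trio_rot[OF assms(1)]] null_sh[of X 1] assms trio_ob by blast

lemma hz_trio_right:
 assumes "trio X Y Z" "hz W X" "hz W Z" shows "hz W Y"
proof (rule hzI)
 obtain u v w where t: "tri X Y Z u v w" using assms(1) by (rule trioE)
 note D = triD[OF t]
 fix f assume f: "arr f" "dm f = W" "cd f = Y"
 have "v ** f = zz W Z" by (rule hzD[OF assms(3)]) (use f D in simp_all)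
 then obtain g where g: "arr g" "dm g = W" "cd g = X" "u ** g = f" using tri_exact[OF t f(1,3)] f(2) by auto
 have "g = zz W X" using hzD[OF assms(2)] g by blast
 thus "f = zz W Y" using g(4)[symmetric] g(2) D f by (metis cmp_zz(1) arr_obj(1))
qed

lemma hz_trio_left:
 assumes "trio X Y Z" "hz X W" "hz Z W" shows "hz Y W"
proof (rule hzI)
 obtain u v w where t: "tri X Y Z u v w" using assms(1) by (rule trioE)
 note D = triD[OF t]
 fix f assume f: "arr f" "dm f = Y" "cd f = W"
 have "f ** u = zz X W" by (rule hzD[OF assms(2)]) (use f D in simp_all)
 then obtain g where g: "arr g" "dm g = Z" "cd g = W" "g ** v = f" using tri_coexact[OF t f(1,2)] f(3) by auto
 have "g = zz Z W" using hzD[OF assms(3)] g by blast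
 thus "f = zz Y W" using g(4)[symmetric] g(3) D f by (metis cmp_zz(2) arr_obj(2))
qed

text \<open>If u = 0, then the identity of S X factors through w as w g, and g: S X -> Z
  vanishes.\<close>

lemma null_of_u_zero:
 assumes t: "trio X Y Z" and h: "hz X Y" "hz (S X) Z" shows "null X"
proof -
 obtain u v w where t: "tri X Y Z u v w" using t by (rule trioE)
 note D = triD[OF t]
 have u: "u = zz X Y" by (rule hzD[OF h(1)]) (use D in simp_all)
 obtain g where g: "arr g" "dm g = dm (idn (S X))" "cd g = Z" "w ** g = idn (S X)"
  by (rule tri_exact3[OF t, of "idn (S X)"]) (use D u in simp_all)
 have "g = zz (S X) Z" by (rule hzD[OF h(2)]) (use g D in simp_all)
 hence "null (S X)" using g(4) D by (simp add: null_def)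
 thus ?thesis using null_sh[of X 1] D by blast
qed

lemma null_of_iso:
 assumes t: "tri X Y Z u v w" and u: "iso u" shows "null Z"
proof -
 note D = triD[OF t]
 have v: "v = zz Y Z"
  by (rule iso_epi[OF u]) (use D tri_vu[OF t] in simp_all)
 have w: "w = zz Z (S X)"
  by (rule iso_mono[OF sus_iso[OF u]]) (use D tri_susu_w[OF t] in simp_all)
 obtain g where g: "arr g" "dm g = S X" "cd g = cd (idn Z)" "g ** w = idn Z"
  by (rule tri_coexact2[OF t, of "idn Z"]) (use D v in simp_all)
 thus ?thesis using w D by (simp add: null_def)
qed

text \<open>If v = 0, then the identity of Z factors as g w through S X, and g: S X -> Z
  vanishes.\<close>

lemma null_of_v_zero:
 assumes t: "trio X Y Z" and h: "hz Y Z" "hz (S X) Z" shows "null Z"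
proof -
 obtain u v w where t: "tri X Y Z u v w" using t by (rule trioE)
 note D = triD[OF t]
 have v: "v = zz Y Z" by (rule hzD[OF h(1)]) (use D in simp_all)
 obtain g where g: "arr g" "dm g = S X" "cd g = cd (idn Z)" "g ** w = idn Z"
  by (rule tri_coexact2[OF t, of "idn Z"]) (use D v in simp_all)
 have "g = zz (S X) Z" by (rule hzD[OF h(2)]) (use g D in simp_all)
 thus ?thesis using g(4) D by (simp add: null_def)
qed

lemma is_biproduct_sym: "is_biproduct T X Y P ==> is_biproduct T Y X P"
proof -
 assume "is_biproduct T X Y P"
 then obtain i1 i2 p1 p2 where *: "ar i1 X P" "ar i2 Y P" "ar p1 P X" "ar p2 P Y"
   "p1 ** i1 = idn X" "p2 ** i2 = idn Y" "p2 ** i1 = zz X Y" "p1 ** i2 = zz Y X"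
   "i1 ** p1 \<boxplus> i2 ** p2 = idn P"
  unfolding biprod_iff by (elim conjE exE) rule
 have "i2 ** p2 \<boxplus> i1 ** p1 = idn P" using pl_ac(1)[of "i1 ** p1" "i2 ** p2"] * by (simp add: ar_iff)
 thus ?thesis by (intro biprodI[of i2 Y P i1 X p2 p1] *)
qed

text \<open>Besides the four maps it delivers the split triangle: since p1 retracts i1 the third map
  of a triangle on i1 is zero, and p2 identifies its third object with Y.\<close>

lemma biprodE:
 assumes "is_biproduct T X Y P"
 obtains i1 i2 p1 p2 where "arr i1" "dm i1 = X" "cd i1 = P" "arr i2" "dm i2 = Y" "cd i2 = P"
  "arr p1" "dm p1 = P" "cd p1 = X" "arr p2" "dm p2 = P" "cd p2 = Y"
  "p1 ** i1 = idn X" "p2 ** i2 = idn Y" "p2 ** i1 = zz X Y" "p1 ** i2 = zz Y X"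
  "i1 ** p1 \<boxplus> i2 ** p2 = idn P" "tri X P Y i1 p2 (zz Y (S X))"
proof -
 obtain i1 i2 p1 p2 where *: "ar i1 X P" "ar i2 Y P" "ar p1 P X" "ar p2 P Y"
   "p1 ** i1 = idn X" "p2 ** i2 = idn Y" "p2 ** i1 = zz X Y" "p1 ** i2 = zz Y X"
   "i1 ** p1 \<boxplus> i2 ** p2 = idn P"
  using assms unfolding biprod_iff by (elim conjE exE) rule
 note a = *(1-4)[unfolded ar_iff]
 have o: "ob X" "ob Y" "ob P" using *(1,2) by (auto simp: ar_def)
 obtain Z v w where t: "tri X P Z i1 v w" using tri_complete[of i1] a by auto
 note D = triD[OF t]
 have "sus i1 ** w = zz Z (S P)" by (rule tri_susu_w[OF t])
 hence "sus p1 ** (sus i1 ** w) = zz Z (S X)" using a D by simp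
 hence w: "w = zz Z (S X)"
  using assoc[of w "sus i1" "sus p1"] a D *(5) by (simp del: assoc add: sus_cmp[symmetric])
 obtain h where h: "arr h" "dm h = Z" "cd h = Y" "h ** v = p2"
  using tri_coexact[OF t, of p2] a *(7) by auto
 let ?k = "v ** i2"
 have k: "arr ?k" "dm ?k = Y" "cd ?k = Z" using a D by simp_all
 have hk: "h ** ?k = idn Y" using assoc[of i2 v h] h a D *(6) by (simp del: assoc)
 have vi: "v ** (i1 ** p1) = zz P Z" using assoc[of p1 i1 v] tri_vu[OF t] a D by (simp del: assoc)
 have "v ** (i1 ** p1 \<boxplus> i2 ** p2) = v" unfolding *(9) using D by simp
 hence vv: "v ** i2 ** p2 = v" using a D vi by simp
 have "(?k ** h \<boxplus> ng (idn Z)) ** v = zz P Z" using h a D vv by simp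
 then obtain g where g: "arr g" "dm g = S X" "cd g = Z" "g ** w = ?k ** h \<boxplus> ng (idn Z)"
  using tri_coexact2[OF t, of "?k ** h \<boxplus> ng (idn Z)"] h k D by auto
 have "?k ** h = idn Z" by (rule diff_zero) (use g w h a D in simp_all)
 hence ih: "iso h" using hk h k by (intro isoI[of h ?k]) simp_all
 have "tri X P Y i1 (h ** v) (w ** iv h)" by (rule tri_iso3[OF t ih h(2,3)])
 hence "tri X P Y i1 p2 (zz Y (S X))" using h(4) w ih h D by simp
 thus ?thesis using that * a by blast
qed

lemma biprod_trio: "is_biproduct T X Y P ==> trio X P Y"
 by (erule biprodE) (rule trioI)

lemma biprod_isom: assumes i: "isom X Y" and n: "null N" shows "is_biproduct T X N Y"
proof -
 have o: "ob N" "idn N = zz N N" using n by (auto simp: null_def)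
 obtain a where a: "iso a" "dm a = X" "cd a = Y" using isomE[OF i] .
 have x: "ob X" "ob Y" using isom_ob[OF i] .
 show ?thesis
  by (rule biprodI[of a X Y "zz N Y" N "iv a" "zz Y N"]) (use a o x in "simp_all add: ar_iff")
qed

lemma biprod_null: "ob X ==> null N ==> is_biproduct T X N X"
 by (rule biprod_isom[OF isom_refl])

subsection \<open>Filtrations by shifts of a set of objects\<close>

text \<open>Each step adds one layer on top, in no prescribed order of degrees. The number of layers
  is part of the predicate because it is the induction measure in the proof of closure under
  summands.\<close>

inductive filt :: "'o set => int set => nat => 'o => bool" for SS I where
 zero: "null X ==> filt SS I 0 X"
| app: "[|filt SS I n X; trio X Y Q; isom (sh i s) Q; i : I; s : SS|] ==> filt SS I (Suc n) Y"

lemma filt_ob: "filt SS I n X ==> ob X"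
 by (induction rule: filt.induct) (auto simp: null_def dest: trio_ob)

lemma filt_isom: assumes "filt SS I n X" "isom X X'" shows "filt SS I n X'"
 using assms
proof cases
 case zero
 thus ?thesis using null_isom[OF _ assms(2)] filt.zero by simp
next
 case (app n X0 Q i s)
 have "trio X0 X' Q" by (rule trio_isom[OF app(3) isom_refl assms(2) isom_refl]) (use trio_ob[OF app(3)] in auto)
 thus ?thesis using app filt.app by blast
qed

lemma filt_mono: "filt SS I n X ==> I \<subseteq> J ==> filt SS J n X"
 by (induction rule: filt.induct) (auto intro: filt.intros)

lemma filt_one: assumes "s : SS" "i : I" "isom (sh i s) X" shows "filt SS I 1 X"
proof -
 obtain N where N: "null N" by (rule null_ex)
 have X: "ob X" using isom_ob[OF assms(3)] by simp
 have b: "is_biproduct T X N X" by (rule biprod_null[OF X N])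
 show ?thesis
  using filt.app[OF filt.zero[OF N] biprod_trio[OF is_biproduct_sym[OF b]] assms(3,2,1)] by simp
qed

text \<open>The top layer of Z is peeled off Y by \<open>fib_oct\<close>, which leaves an extension
  of the rest of Z by X.\<close>

lemma filt_ext:
 assumes "filt SS I n Z" "filt SS I m X" "trio X Y Z" shows "filt SS I (m + n) Y"
 using assms
proof (induction arbitrary: Y rule: filt.induct)
 case (zero Z)
 thus ?case using trio_null3 filt_isom by force
next
 case (app n Z1 Z Q i s)
 obtain u v w where t: "tri X Y Z u v w" using app.prems(2) by (rule trioE)
 obtain u' v' w' where t': "tri Z1 Z Q u' v' w'" using app.hyps(2) by (rule trioE)
 obtain Y1 where y: "trio X Y1 Z1" "trio Y1 Y Q"
  by (rule fib_oct[OF t t']) (blast intro: trioI)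
 from filt.app[OF app.IH[OF app.prems(1) y(1)] y(2) app.hyps(3-5)] show ?case by simp
qed

lemma filt_shift: "filt SS I n X ==> filt SS ((+) k ` I) n (sh k X)" if SSo: "!!s. s : SS ==> ob s"
proof (induction rule: filt.induct)
 case (zero X)
 thus ?case using null_sh[of X k] by (intro filt.zero) (auto simp: null_def)
next
 case (app n X Y Q i s)
 have t: "trio (sh k X) (sh k Y) (sh k Q)" using trio_sh trio_ob[OF app.hyps(2)] app.hyps(2) by blast
 have "isom (sh (k + i) s) (sh k (sh i s))" by (rule isom_sym[OF sh_sh]) (use SSo app in blast)
 hence i: "isom (sh (k + i) s) (sh k Q)" using isom_trans isom_sh[OF app.hyps(3)] by blast
 show ?case by (rule filt.app[OF app.IH t i _ app.hyps(5)]) (use app.hyps(4) in blast)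
qed

lemma filt_hz_right:
 assumes "filt SS I n X" "!!i s. i : I ==> s : SS ==> hz W (sh i s)" "ob W" shows "hz W X"
 using assms(1)
proof induction
 case (app n X Y Q i s)
 have "hz W Q" by (rule hz_isom[OF assms(2)[OF app.hyps(4,5)] isom_refl[OF assms(3)] app.hyps(3)])
 thus ?case using hz_trio_right app by blast
qed (rule hz_null)

lemma filt_hz_left:
 assumes "filt SS I n X" "!!i s. i : I ==> s : SS ==> hz (sh i s) W" "ob W" shows "hz X W"
 using assms(1)
proof induction
 case (app n X Y Q i s)
 have "hz Q W" by (rule hz_isom[OF assms(2)[OF app.hyps(4,5)] app.hyps(3) isom_refl[OF assms(3)]])
 thus ?case using hz_trio_left app by blast
qed (rule hz_null)

end

section \<open>Schur's property for pairs of objects\<close>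

context tricat0 begin

lemma hz_biprod:
 assumes b: "is_biproduct T X Y M"
 shows "hz M W ==> hz X W" "hz W M ==> hz W X"
proof -
 obtain i1 i2 p1 p2 where B: "arr i1" "dm i1 = X" "cd i1 = M" "arr i2" "dm i2 = Y" "cd i2 = M"
  "arr p1" "dm p1 = M" "cd p1 = X" "arr p2" "dm p2 = M" "cd p2 = Y" "p1 ** i1 = idn X"
  using b by (rule biprodE)
 show "hz X W" if h: "hz M W"
 proof (rule hzI)
  fix f assume f: "arr f" "dm f = X" "cd f = W"
  have "f ** p1 = zz M W" by (rule hzD[OF h]) (use f B in simp_all)
  hence "(f ** p1) ** i1 = zz X W" using f B arr_obj[OF f(1)] by simp
  thus "f = zz X W" using f B by simp
 qed
 show "hz W X" if h: "hz W M"
 proof (rule hzI)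
  fix f assume f: "arr f" "dm f = W" "cd f = X"
  have "i1 ** f = zz W M" by (rule hzD[OF h]) (use f B in simp_all)
  hence "p1 ** (i1 ** f) = zz W X" using f B arr_obj[OF f(1)] by simp
  thus "f = zz W X" using f B assoc[of f i1 p1] by (simp del: assoc)
 qed
qed

definition "nzi X Y = (ALL f. arr f --> dm f = X --> cd f = Y --> f ~= zz X Y --> iso f)"

lemma nziI: "(!!f. arr f ==> dm f = X ==> cd f = Y ==> f ~= zz X Y ==> iso f) ==> nzi X Y"
 unfolding nzi_def by blast

lemma nziD: "nzi X Y ==> arr f ==> dm f = X ==> cd f = Y ==> f ~= zz X Y ==> iso f"
 unfolding nzi_def by blast

lemma nzi_isom:
 assumes h: "nzi X Y" and i: "isom X X'" "isom Y Y'" shows "nzi X' Y'"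
proof (rule nziI)
 fix f assume f: "arr f" "dm f = X'" "cd f = Y'" and nz: "f ~= zz X' Y'"
 obtain a where a: "iso a" "dm a = X" "cd a = X'" using isomE[OF i(1)] .
 obtain b where b: "iso b" "dm b = Y" "cd b = Y'" using isomE[OF i(2)] .
 note o = isom_ob[OF i(1)] isom_ob[OF i(2)]
 have e: "f = b ** (iv b ** f ** a) ** iv a" using f a b by simp
 have "iv b ** f ** a ~= zz X Y"
 proof
  assume z: "iv b ** f ** a = zz X Y"
  show False using nz e a b o unfolding z by simp
 qed
 hence "iso (iv b ** f ** a)" using nziD[OF h, of "iv b ** f ** a"] a b f by simp
 hence "iso (b ** (iv b ** f ** a) ** iv a)" 
  by (rule iso_cmp[OF iso_cmp[OF iso_iv[OF a(1)]] b(1)]) (use a b f in simp_all)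
 from ssubst[OF e, of iso, OF this] show "iso f" .
qed

lemma nzi_cong: assumes "isom X X'" "isom Y Y'" shows "nzi X Y = nzi X' Y'"
 using nzi_isom[OF _ assms] nzi_isom[OF _ assms[THEN isom_sym]] by iprover

lemma nzi_S: assumes o: "ob X" "ob Y" shows "nzi (S X) (S Y) = nzi X Y"
proof
 assume h: "nzi (S X) (S Y)"
 show "nzi X Y"
 proof (rule nziI)
  fix f assume f: "arr f" "dm f = X" "cd f = Y" "f ~= zz X Y"
  have "sus f ~= zz (S X) (S Y)" using sus_inj[of f "zz X Y"] f o by auto
  hence "iso (sus f)" using nziD[OF h, of "sus f"] f by simp
  thus "iso f" using sus_iso_iff f by simp
 qed
next
 assume h: "nzi X Y"
 show "nzi (S X) (S Y)"
 proof (rule nziI)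
  fix f assume f: "arr f" "dm f = S X" "cd f = S Y" "f ~= zz (S X) (S Y)"
  obtain g where g: "arr g" "dm g = X" "cd g = Y" "sus g = f" using sus_surj[OF f(1-3) o] by blast
  have "g ~= zz X Y"
  proof
   assume z: "g = zz X Y"
   show False using f(4) g(4) sus_zz[OF o] unfolding z by simp
  qed
  hence "iso g" using nziD[OF h, of g] g by simp
  thus "iso f" using g by auto
 qed
qed

lemma nzi_sh: assumes o: "ob X" "ob Y" shows "nzi (sh n X) (sh n Y) = nzi X Y"
proof (rule int_iff_induct)
 show "nzi (sh 0 X) (sh 0 Y) = nzi X Y" by (rule nzi_cong[OF o[THEN sh_0]])
 show "nzi (sh n X) (sh n Y) = nzi (sh (n+1) X) (sh (n+1) Y)" for n
  unfolding nzi_S[OF sh_ob[OF o(1), of n] sh_ob[OF o(2), of n], symmetric]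
  by (rule nzi_cong[OF o[THEN sh_Suc]])
qed

end

text \<open>A simple-minded collection SS with a generator G built from it. \<open>G_dom\<close> and
  \<open>G_cod\<close> record, without reference to a chosen decomposition, that maps out of and
  into G are detected on objects of SS.\<close>

locale smc = tricat0 T sus for T :: "('o, 'f) tricat" and sus :: "'f => 'f" +
 fixes SS :: "'o set" and G :: 'o
 assumes SS_ob: "s : SS ==> ob s"
  and SS_nn: "s : SS ==> \<not> null s"
  and SS_nzi: "s : SS ==> s' : SS ==> nzi s s'"
  and SS_hz: "s : SS ==> s' : SS ==> n < 0 ==> hz s (sh n s')"
  and SS_G: "s : SS ==> EX Z. is_biproduct T s Z G"
  and G_filt: "EX n. filt SS {0} n G"
  and G_dom: "arr p ==> dm p = G ==> p ~= zz G (cd p) ==>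
   EX s a. s : SS & arr a & dm a = s & cd a = G & p ** a ~= zz s (cd p)"
  and G_cod: "arr p ==> cd p = G ==> p ~= zz (dm p) G ==>
   EX s a. s : SS & arr a & dm a = G & cd a = s & a ** p ~= zz (dm p) s"
begin

abbreviation "flt \<equiv> filt SS"
definition "F I X = (EX n. flt I n X)"

lemma FI: "flt I n X ==> F I X"
 unfolding F_def by blast

lemma SS_hz_sh: "s : SS ==> s' : SS ==> j < i ==> hz (sh i s) (sh j s')"
 using hz_sh2[OF SS_ob SS_ob, of s s' i j] SS_hz[of s s' "j - i"] by simp

lemma flt_hz:
 assumes X: "flt I m X" and Y: "flt J n Y" and ij: "!!i j. i : I ==> j : J ==> j < i"
 shows "hz X Y"
proof (rule filt_hz_right[OF Y _ filt_ob[OF X]])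
 fix j s' assume j: "j : J" "s' : SS"
 show "hz X (sh j s')"
  by (rule filt_hz_left[OF X]) (use SS_hz_sh j ij SS_ob in auto)
qed

text \<open>The mechanism of all cancellations. W sits in the highest degree that R can have. Either
  f vanishes on the top layer Q and factors through the rest, where induction applies; or Q must lie
  in degree c as well, W -> Q is an isomorphism by Schur, and W cancels Q, leaving C isomorphic to
  the rest of R.\<close>

lemma flt_cone:
 assumes "flt I n R" "I \<subseteq> {..c}" "s : SS" "isom (sh c s) W"
  "tri W R C f v w" "f ~= zz W R"
 shows "EX m. n = Suc m & flt I m C"
 using assms(1,5,6)
proof (induction arbitrary: C f v w rule: filt.induct)
 case (zero R)
 have "f = zz W R" by (rule hzD[OF hz_null(2)[OF zero(1)]]) (use triD[OF zero(2)] in simp_all)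
 thus ?case using zero(3) by blast
next
 case (app n R1 R Q j s')
 note D = triD[OF app.prems(1)]
 obtain a b d where t3: "tri R1 R Q a b d" using app.hyps(2) by (rule trioE)
 note D3 = triD[OF t3]
 show ?case
 proof (cases "b ** f = zz W Q")
  case True
  obtain f1 where f1: "arr f1" "dm f1 = dm f" "cd f1 = R1" "a ** f1 = f"
   by (rule tri_exact[OF t3 D(1,5)]) (use True D in simp)
  have "f1 ~= zz W R1"
  proof
   assume z: "f1 = zz W R1"
   show False using f1(4) app.prems(2) D(10) D3(1,4,5,10) unfolding z by simp
  qed
  obtain C1 v1 w1 where t1: "tri W R1 C1 f1 v1 w1" using tri_complete[OF f1(1)] f1 D by auto
  from app.IH[OF t1 \<open>f1 ~= zz W R1\<close>] obtain m where m: "n = Suc m" "flt I m C1" by blast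
  have t2: "tri W R C (a ** f1) v w" using app.prems(1) f1(4) by simp
  have "trio C1 C Q" by (rule oct[OF t1 t2 t3]) (rule trioI)
  from filt.app[OF m(2) this app.hyps(3-5)] m(1) show ?thesis by simp
 next
  case False
  have bf: "arr (b ** f)" "dm (b ** f) = W" "cd (b ** f) = Q" using D D3 by simp_all
  have jc: "j = c"
  proof (rule ccontr)
   assume "j ~= c"
   hence "j < c" using app.hyps(4) assms(2) by auto
   from hz_isom[OF SS_hz_sh[OF assms(3) app.hyps(5) this] assms(4) app.hyps(3)]
   show False using hzD[of W Q "b ** f"] bf False by blast
  qed
  have "nzi (sh c s) (sh c s')" using nzi_sh[OF SS_ob[OF assms(3)] SS_ob[OF app.hyps(5)]]
    SS_nzi[OF assms(3) app.hyps(5)] by blast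
  hence "nzi W Q" by (rule nzi_isom[OF _ assms(4) app.hyps(3)[unfolded jc]])
  hence i: "iso (b ** f)" using nziD[OF _ bf False] by blast
  obtain C2 v2 w2 where t2: "tri W Q C2 (b ** f) v2 w2" using tri_complete[OF bf(1)] bf by auto
  have n: "null C2" by (rule null_of_iso[OF t2 i])
  have "trio C C2 (S R1)" by (rule oct[OF app.prems(1) t2 tri_rot[OF t3]]) (rule trioI)
  from trio_null1[OF trio_rot[OF this] n] have "isom (S R1) (S C)" .
  hence "isom R1 C" using isom_S_iff[of R1 C] D D3 by blast
  from filt_isom[OF app.hyps(1) this] show ?thesis by blast
 qed
qed

text \<open>Layers are sorted one at a time. A new layer of degree below c joins R. Otherwise its
  attaching map to R decides: if that map is zero the layer joins L, and if not it cancels a layer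
  of R by \<open>flt_cone\<close>. Hence the bound l + r \<le> n instead of an equality.\<close>

lemma truncate:
 assumes "flt I n M"
 shows "EX L R l r. flt (I \<inter> {c..}) l L & flt (I \<inter> {..c - 1}) r R & l + r \<le> n & trio L M R"
 using assms
proof (induction rule: filt.induct)
 case (zero M)
 have "ob M" using zero by (simp add: null_def)
 then obtain N v w where N: "null N" "tri M M N (idn M) v w" using tri_id by blast
 show ?case using filt.zero[OF zero] filt.zero[OF N(1)] trioI[OF N(2)] by blast
next
 case (app n M1 M Q i s)
 obtain L1 R1 l r where L1: "flt (I \<inter> {c..}) l L1" and R1: "flt (I \<inter> {..c - 1}) r R1" and n: "l + r \<le> n"
  and "trio L1 M1 R1" using app.IH by blast
 then obtain a1 b1 c1 where t1: "tri L1 M1 R1 a1 b1 c1" by (elim trioE)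
 note D1 = triD[OF t1]
 obtain a b d where t: "tri M1 M Q a b d" using app.hyps(2) by (rule trioE)
 note D = triD[OF t]
 show ?case
 proof (cases "i < c")
  case True
  obtain C v w where t2: "tri L1 M C (a ** a1) v w"
   using tri_complete[of "a ** a1"] D D1 by auto
  have "trio R1 C Q" by (rule oct[OF t1 t2 t]) (rule trioI)
  hence "flt (I \<inter> {..c - 1}) (Suc r) C"
   using filt.app[OF R1 _ app.hyps(3) _ app.hyps(5)] app.hyps(4) True by auto
  moreover have "l + Suc r \<le> Suc n" using n by simp
  ultimately show ?thesis using L1 trioI[OF t2] by blast
 next
  case False
  \<comment> \<open>The desuspended new layer, so that M becomes the cone of the attaching map g: ?W
    -> M1.\<close>
  let ?W = "sh (i - 1) s"
  have W: "ob ?W" "isom (sh i s) (S ?W)"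
   using SS_ob[OF app.hyps(5)] isom_sym[OF sh_Suc[of s "i - 1"]] by simp_all
  have "isom Q (S ?W)" using isom_trans[OF isom_sym[OF app.hyps(3)] W(2)] .
  then obtain e g where g: "tri ?W M1 M g a (e ** b)" using tri_unrot'[OF t _ W(1)] by metis
  note D2 = triD[OF g]
  let ?h = "b1 ** g"
  have h: "arr ?h" "dm ?h = ?W" "cd ?h = R1" using D1 D2 by simp_all
  obtain C v w where t2: "tri ?W R1 C ?h v w" using tri_complete[OF h(1)] h by auto
  note D3 = triD[OF t2]
  have "trio M C (S L1)" by (rule oct[OF g t2 tri_rot[OF t1]]) (rule trioI)
  hence LMC: "trio L1 M C" using trio_unrot D1 by blast
  show ?thesis
  proof (cases "?h = zz ?W R1")
   case False
   \<comment> \<open>The layers of R1 have degree at most c - 1, so a nonzero map from degree i - 1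
     \<ge> c - 1 exists only in the boundary case, which is the one \<open>flt_cone\<close>
     covers.\<close>
   have ic: "i - 1 = c - 1"
   proof (rule ccontr)
    assume "i - 1 ~= c - 1"
    hence "c \<le> i - 1" using \<open>\<not> i < c\<close> by simp
    hence "hz ?W R1"
     by (intro filt_hz_right[OF R1]) (use SS_hz_sh app.hyps(5) W in auto)
    thus False using False hzD h by blast
   qed
   obtain m where m: "r = Suc m" "flt (I \<inter> {..c - 1}) m C"
    using flt_cone[OF R1 Int_lower2 app.hyps(5) _ t2 False] isom_refl[OF W(1)] unfolding ic by blast
   moreover have "l + m \<le> Suc n" using n m by simp
   ultimately show ?thesis using L1 LMC by blast
  next
   case True
   \<comment> \<open>A zero attaching map makes C the direct sum of R1 and the new layer. Reading
     this sum as an extension of R1 by the layer allows \<open>fib_oct\<close> to move the layer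
     over to L.\<close>
   have "ng (sus ?h) ** idn (S ?W) = zz (S ?W) (S R1)" unfolding True using W D1 by simp
   then obtain sg where sg: "arr sg" "dm sg = dm (idn (S ?W))" "cd sg = C" "w ** sg = idn (S ?W)"
    using tri_exact2[OF tri_rot[OF t2], of "idn (S ?W)"] W by auto
   have "is_biproduct T R1 (S ?W) C" by (rule tri_split[OF tri_rot[OF t2] sg(1)]) (use sg W in simp_all)
   hence "trio (S ?W) C R1" by (rule biprod_trio[OF is_biproduct_sym])
   then obtain x1 y1 z1 where u: "tri (S ?W) C R1 x1 y1 z1" by (rule trioE)
   obtain x2 y2 z2 where u2: "tri L1 M C x2 y2 z2" using LMC by (rule trioE)
   obtain L where L: "trio L1 L (S ?W)" "trio L M R1" by (rule fib_oct[OF u2 u]) (blast intro: trioI)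
   have "flt (I \<inter> {c..}) (Suc l) L"
    using filt.app[OF L1 L(1) W(2) _ app.hyps(5)] app.hyps(4) \<open>\<not> i < c\<close> by auto
   moreover have "Suc l + r \<le> Suc n" using n by simp
   ultimately show ?thesis using R1 L(2) by blast
  qed
 qed
qed

lemma flt_S: "flt I n X ==> flt ((+) 1 ` I) n (S X)"
 using filt_shift[OF SS_ob] by blast

lemma hz_truncate: "flt (I \<inter> {c..}) l L ==> flt (J \<inter> {..c - 1}) r R ==> hz (S L) R"
 by (rule flt_hz[OF flt_S]) auto

text \<open>In the truncation triangle the map M -> R is zero by assumption and S L -> R is zero by
  degrees, so R is null and M is isomorphic to L.\<close>

lemma flt_upper:
 assumes "flt I n M" and h: "!!R r. flt (I \<inter> {..c - 1}) r R ==> hz M R"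
 shows "\<exists>m\<le>n. flt (I \<inter> {c..}) m M"
proof -
 obtain L R l r where t: "flt (I \<inter> {c..}) l L" "flt (I \<inter> {..c - 1}) r R" "l + r \<le> n" "trio L M R"
  using truncate[OF assms(1), of c] by blast
 have "null R" by (rule null_of_v_zero[OF t(4) h[OF t(2)] hz_truncate[OF t(1,2)]])
 from filt_isom[OF t(1) trio_null3[OF t(4) this]] t(3) show ?thesis by (intro exI[of _ l]) simp
qed

lemma flt_lower:
 assumes "flt I n M" and h: "!!L l. flt (I \<inter> {c..}) l L ==> hz L M"
 shows "\<exists>m\<le>n. flt (I \<inter> {..c - 1}) m M"
proof -
 obtain L R l r where t: "flt (I \<inter> {c..}) l L" "flt (I \<inter> {..c - 1}) r R" "l + r \<le> n" "trio L M R"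
  using truncate[OF assms(1), of c] by blast
 have "null L" by (rule null_of_u_zero[OF t(4) h[OF t(1)] hz_truncate[OF t(1,2)]])
 from filt_isom[OF t(2) isom_sym[OF trio_null1[OF t(4) this]]] t(3) show ?thesis by (intro exI[of _ r]) simp
qed

text \<open>Absence of maps from the single top degree c already allows that degree to be removed.
  This is the step of \<open>summand_aux\<close> that narrows the range of degrees.\<close>

lemma flt_top:
 assumes M: "flt I n M" "I \<subseteq> {..c}" and h: "!!s. s : SS ==> hz (sh c s) M"
 shows "\<exists>m\<le>n. flt (I \<inter> {..c - 1}) m M"
proof (rule flt_lower[OF M(1)])
 fix L l assume L: "flt (I \<inter> {c..}) l L"
 show "hz L M"
 proof (rule filt_hz_left[OF L _ filt_ob[OF M(1)]])
  fix i s assume "i : I \<inter> {c..}" "s : SS"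
  hence "i = c" using M(2) by auto
  thus "hz (sh i s) M" using h \<open>s \<in> SS\<close> by simp
 qed
qed

lemma flt_empty: "flt {} n M ==> null M"
 by (erule filt.cases) auto

lemma flt_bounds: assumes "flt I n M" shows "EX a d. flt (I \<inter> {a..<a + int d}) n M"
 using assms
proof induction
 case (app n X Y Q i s)
 then obtain a d where a: "flt (I \<inter> {a..<a + int d}) n X" by blast
 let ?a = "min a i" let ?d = "nat (max (a + int d) (i+1) - ?a)"
 have s: "I \<inter> {a..<a + int d} \<subseteq> I \<inter> {?a..<?a + int ?d}" "i : I \<inter> {?a..<?a + int ?d}" using app.hyps(4) by auto
 have "flt (I \<inter> {?a..<?a + int ?d}) (Suc n) Y"
  by (rule filt.app[OF filt_mono[OF a s(1)] app.hyps(2,3) s(2) app.hyps(5)])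
 thus ?case by blast
qed (use filt.zero in blast)

text \<open>Since i1 is split, i1 g is still nonzero, so its cone C loses a layer by
  \<open>flt_cone\<close>. The octahedron for i1 g displays C as an extension of Y by the cone of g,
  and this extension splits through i2.\<close>

lemma cone_biprod:
 assumes b: "is_biproduct T X Y M" and M: "flt I n M" "I \<subseteq> {..c}" and s: "s : SS"
  and g: "arr g" "dm g = sh c s" "cd g = X" and nz: "g ~= zz (sh c s) X"
 obtains m CX C where "n = Suc m" "is_biproduct T CX Y C" "flt I m C" "trio (sh c s) X CX"
proof -
 let ?W = "sh c s"
 have W: "ob ?W" using SS_ob[OF s] by simp
 obtain i1 i2 p1 p2 where B: "arr i1" "dm i1 = X" "cd i1 = M" "arr i2" "dm i2 = Y" "cd i2 = M"
  "arr p1" "dm p1 = M" "cd p1 = X" "arr p2" "dm p2 = M" "cd p2 = Y" "p1 ** i1 = idn X" "p2 ** i2 = idn Y"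
  "tri X M Y i1 p2 (zz Y (S X))"
  using b by (rule biprodE)
 have e: "p1 ** (i1 ** g) = g" using assoc[of g i1 p1] B g by (simp del: assoc)
 have ig: "arr (i1 ** g)" "dm (i1 ** g) = ?W" "cd (i1 ** g) = M" using B g by simp_all
 have nz': "i1 ** g ~= zz ?W M"
 proof
  assume "i1 ** g = zz ?W M"
  hence "g = p1 ** zz ?W M" using e by simp
  thus False using nz B W by simp
 qed
 obtain CX v1 w1 where t1: "tri ?W X CX g v1 w1" using tri_complete[OF g(1)] g by auto
 obtain C v2 w2 where t2: "tri ?W M C (i1 ** g) v2 w2" using tri_complete[OF ig(1)] ig by auto
 note D2 = triD[OF t2]
 obtain m where m: "n = Suc m" "flt I m C"
  using flt_cone[OF M s isom_refl[OF W] t2 nz'] by blast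
 obtain f h where o: "tri CX C Y f h (sus v1 ** zz Y (S X))" "h ** v2 = p2" by (rule oct[OF t1 t2 B(15)])
 note D = triD[OF o(1)]
 have "h ** (v2 ** i2) = p2 ** i2" unfolding o(2)[symmetric] using D D2 B by simp
 hence "is_biproduct T CX Y C" by (intro tri_split[OF o(1), of "v2 ** i2"]) (use B D D2 in simp_all)
 thus ?thesis using that m trioI[OF t1] by blast
qed

lemma biprod_null_both: assumes "is_biproduct T X Y M" "null M" shows "null X" "null Y"
proof -
 have o: "ob X" "ob Y" using assms(1) by (auto simp: is_biproduct_def)
 show "null X" using hz_biprod(1)[OF assms(1) hz_null(1)[OF assms(2)]] null_iff_hz[OF o(1)] by blast
 show "null Y" using hz_biprod(1)[OF is_biproduct_sym[OF assms(1)] hz_null(1)[OF assms(2)]] null_iff_hz[OF o(2)] by blast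
qed

lemma F_ext: "F I X ==> F I Z ==> trio X Y Z ==> F I Y"
 unfolding F_def using filt_ext by blast

lemma F_one: "s : SS ==> i : I ==> F I (sh i s)"
 using FI[OF filt_one[OF _ _ isom_refl[OF sh_ob[OF SS_ob]]]] by blast

lemma F_null: "null X ==> F I X"
 using FI[OF filt.zero] .

lemma F_mono: "F I X ==> I \<subseteq> J ==> F J X"
 unfolding F_def using filt_mono by blast

text \<open>If nothing in the top degree maps to M, the range of degrees shrinks. Otherwise a
  nonzero map from the top degree has a nonzero component in X or in Y, and
  \<open>cone_biprod\<close> replaces that summand by a cone while the total loses a layer. The
  measure n + d falls in both cases.\<close>

lemma summand_aux:
 assumes "flt {a..<a + int d} n M" "is_biproduct T X Y M"
 shows "F UNIV X & F UNIV Y"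
 using assms
proof (induction "n + d" arbitrary: n d M X Y rule: less_induct)
 case less
 note b = less.prems(2)
 show ?case
 proof (cases d)
  case 0
  hence "null M" using less.prems(1) flt_empty by simp
  from biprod_null_both[OF b this] F_null show ?thesis by blast
 next
  case (Suc d')
  let ?c = "a + int d'" let ?I = "{a..<a + int d}"
  have I: "?I \<subseteq> {..?c}" "?I \<inter> {..?c - 1} = {a..<a + int d'}" using Suc by auto
  show ?thesis
  proof (cases "ALL s:SS. hz (sh ?c s) M")
   case True
   then obtain m where "m \<le> n" "flt {a..<a + int d'} m M"
    using flt_top[OF less.prems(1) I(1)] I(2) by auto
   with less.hyps[of m d' M X Y] b Suc show ?thesis by auto
  next
   case False
   then obtain s f where s: "s : SS" and f: "arr f" "dm f = sh ?c s" "cd f = M" "f ~= zz (sh ?c s) M"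
    unfolding hz_def by blast
   have W: "ob (sh ?c s)" using SS_ob[OF s] by simp
   have step: "F UNIV X' & F UNIV Y'" if b': "is_biproduct T X' Y' M"
    and g: "arr g" "dm g = sh ?c s" "cd g = X'" "g ~= zz (sh ?c s) X'" for X' Y' g
   proof -
    obtain m CX C where m: "n = Suc m" "is_biproduct T CX Y' C" "flt ?I m C" "trio (sh ?c s) X' CX"
     by (rule cone_biprod[OF b' less.prems(1) I(1) s g])
    have "F UNIV CX & F UNIV Y'" using less.hyps[OF _ m(3,2)] m(1) by simp
    thus ?thesis using F_ext[OF F_one[OF s UNIV_I] _ m(4)] by blast
   qed
   obtain i1 i2 p1 p2 where B: "arr i1" "dm i1 = X" "cd i1 = M" "arr i2" "dm i2 = Y" "cd i2 = M"
    "arr p1" "dm p1 = M" "cd p1 = X" "arr p2" "dm p2 = M" "cd p2 = Y" "i1 ** p1 \<boxplus> i2 ** p2 = idn M"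
    using b by (rule biprodE)
   have "p1 ** f ~= zz (sh ?c s) X \<or> p2 ** f ~= zz (sh ?c s) Y"
   proof (rule ccontr)
    assume "\<not> ?thesis"
    hence z: "p1 ** f = zz (sh ?c s) X" "p2 ** f = zz (sh ?c s) Y" by auto
    have "f = (i1 ** p1 \<boxplus> i2 ** p2) ** f" unfolding B(13) using f by simp
    also have "... = i1 ** (p1 ** f) \<boxplus> i2 ** (p2 ** f)" using B(1-12) f by simp
    also have "... = zz (sh ?c s) M" unfolding z using B(1-6) W arr_obj[OF B(1)] by simp
    finally show False using f(4) by blast
   qed
   thus ?thesis
   proof
    assume "p1 ** f ~= zz (sh ?c s) X"
    from step[OF b _ _ _ this] B f show ?thesis by simp
   next
    assume "p2 ** f ~= zz (sh ?c s) Y"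
    from step[OF is_biproduct_sym[OF b] _ _ _ this] B f show ?thesis by simp
   qed
  qed
 qed
qed

lemma F_summand: assumes "F UNIV M" "is_biproduct T X Y M" shows "F UNIV X"
proof -
 obtain n where "flt UNIV n M" using assms(1) unfolding F_def by blast
 then obtain a d where "flt {a..<a + int d} n M" using flt_bounds by fastforce
 from summand_aux[OF this assms(2)] show ?thesis by blast
qed

text \<open>X is filtered in some degrees by \<open>F_summand\<close>; a summand of M inherits the
  vanishing of maps into lower degrees, so \<open>flt_upper\<close> confines the filtration.\<close>

lemma F_summand_upper: assumes M: "F {c..} M" and b: "is_biproduct T X Y M" shows "F {c..} X"
proof -
 obtain k where k: "flt {c..} k M" using M unfolding F_def by blast
 obtain n where n: "flt UNIV n X" using F_summand[OF F_mono[OF M] b] unfolding F_def by blast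
 have "hz X R" if "flt (UNIV \<inter> {..c - 1}) r R" for r R
  by (rule hz_biprod(1)[OF b flt_hz[OF k that]]) auto
 from flt_upper[OF n this] show ?thesis using FI by fastforce
qed

lemma F_summand_lower: assumes M: "F {..c} M" and b: "is_biproduct T X Y M" shows "F {..c} X"
proof -
 obtain k where k: "flt {..c} k M" using M unfolding F_def by blast
 obtain n where n: "flt UNIV n X" using F_summand[OF F_mono[OF M] b] unfolding F_def by blast
 have "hz L X" if "flt (UNIV \<inter> {c+1..}) l L" for l L
  by (rule hz_biprod(2)[OF b flt_hz[OF that k]]) auto
 from flt_lower[OF n this] show ?thesis using FI by fastforce
qed

lemma F_heart: "F {0..} X ==> F {..0} X ==> F {0} X"
proof -
 assume "F {0..} X" "F {..0} X"
 then obtain n m where n: "flt {0..} n X" and m: "flt {..0} m X" unfolding F_def by blast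
 have "hz L X" if "flt ({0..} \<inter> {1..}) l L" for l L
  by (rule flt_hz[OF that m]) auto
 hence "\<exists>k\<le>n. flt ({0..} \<inter> {..1 - 1}) k X" by (rule flt_lower[OF n])
 then obtain k where k: "flt ({0..} \<inter> {..1 - 1}) k X" by blast
 have "{0..} \<inter> {..1 - 1} = {0::int}" by auto
 thus ?thesis using k FI by simp
qed

end

subsection \<open>Idempotents of semisimple rings\<close>

text \<open>Non-zero orthogonal idempotents whose corners \<open>e j C e i\<close> consist of zero and isomorphisms.\<close>

definition idems :: "'a set => ('a => 'a => 'a) => 'a => nat => (nat => 'a) => bool" where
 "idems C m z n e = (ALL i<n. e i : C & e i ~= z & m (e i) (e i) = e i & (ALL j<n. (i ~= j --> m (e i) (e j) = z) &
  (ALL x:C. m (e j) x = x --> m x (e i) = x --> x ~= z --> (EX y:C. m x y = e j & m y x = e i))))"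

lemma idems_transfer:
 assumes "idems C m z n e" and ph: "bij_betw ph C C'" "!!x y. x : C ==> y : C ==> ph (m x y) = m' (ph x) (ph y)" "ph z = z'"
  and C: "!!x y. x : C ==> y : C ==> m x y : C" "z : C"
 shows "idems C' m' z' n (%i. ph (e i))"
proof -
 have eq: "(ph x = ph y) = (x = y)" if "x : C" "y : C" for x y
  using ph(1) that by (auto simp: bij_betw_def inj_on_eq_iff)
 have C': "C' = ph ` C" using ph(1) by (simp add: bij_betw_def)
 have e: "e i : C" if "i < n" for i using assms(1) that by (simp add: idems_def)
 show ?thesis using assms(1) unfolding idems_def C' ball_simps bex_simps
  by (simp add: ph(2,3)[symmetric] eq C e cong: conj_cong)
qed

text \<open>Write \<open>1 = \<Sum> e i\<close> along the decomposition into minimal right ideals; then \<open>I i = e i R\<close>, and a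
 non-zero \<open>x\<close> in \<open>e j R e i\<close> generates \<open>I j\<close>.\<close>

lemma semisimple_idempotents:
 fixes R (structure)
 assumes "semisimple_ring R"
 obtains n :: nat and e where "idems (carrier R) (monoid.mult R) \<zero> n e" "finsum R e {..<n} = \<one>"
proof -
 interpret ring R using assms by (simp add: semisimple_ring_def)
 obtain n :: nat and I where m: "!!i. i < n ==> minimal_right_ideal R (I i)"
  and bij: "bij_betw (%x. finsum R x {..<n}) (Pi\<^sub>E {..<n} I) (carrier R)"
  using assms unfolding semisimple_ring_def by blast
 have ri: "right_ideal R (I i)" and nz: "I i ~= {\<zero>}" if "i < n" for i
  using m[OF that] by (auto simp: minimal_right_ideal_def)
 have sub: "additive_subgroup (I i) R" and cl: "x : I i ==> r : carrier R ==> x \<otimes> r : I i"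
  if "i < n" for i x r
  using ri[OF that] by (auto simp: right_ideal_def)
 have Ic: "I i \<subseteq> carrier R" and I0: "\<zero> : I i" if "i < n" for i
  using additive_subgroup.a_subset[OF sub[OF that]] additive_subgroup.zero_closed[OF sub[OF that]] .
 have "\<one> : (%x. finsum R x {..<n}) ` Pi\<^sub>E {..<n} I" using bij by (auto simp: bij_betw_def)
 then obtain e where e: "e : Pi\<^sub>E {..<n} I" and one: "finsum R e {..<n} = \<one>" by auto
 have eI: "e i : I i" and ec: "e i : carrier R" if "i < n" for i
  using e that Ic[OF that] by (auto simp: PiE_iff)
 \<comment> \<open>x is both the sum of all e i x and the sum with x alone in place j; uniqueness of
   the decomposition compares the two families.\<close>
 have split: "e i \<otimes> x = (if i = j then x else \<zero>)" if ij: "i < n" "j < n" and x: "x : I j" for i j x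
 proof -
  let ?f = "\<lambda>i\<in>{..<n}. e i \<otimes> x" and ?g = "\<lambda>i\<in>{..<n}. if i = j then x else \<zero>"
  have xc: "x : carrier R" using Ic[OF ij(2)] x by blast
  have f: "?f : Pi\<^sub>E {..<n} I" using cl eI xc by auto
  have g: "?g : Pi\<^sub>E {..<n} I" using I0 x by auto
  have "finsum R ?f {..<n} = (\<Oplus>i\<in>{..<n}. e i \<otimes> x)"
   by (rule finsum_cong') (use ec xc in auto)
  also have "... = finsum R e {..<n} \<otimes> x" by (rule finsum_ldistr[symmetric]) (use ec xc in auto)
  also have "... = x" using one xc by simp
  finally have fx: "finsum R ?f {..<n} = x" .
  have "finsum R ?g {..<n} = (\<Oplus>i\<in>{..<n}. if j = i then x else \<zero>)"
   by (rule finsum_cong') (use xc in auto)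
  also have "... = x" by (rule finsum_singleton) (use ij xc in auto)
  finally have "finsum R ?f {..<n} = finsum R ?g {..<n}" using fx by simp
  hence "?f = ?g" by (rule inj_onD[OF bij_betw_imp_inj_on[OF bij] _ f g])
  from fun_cong[OF this, of i] show ?thesis using ij by simp
 qed
 have ne: "e i ~= \<zero>" if i: "i < n" for i
 proof
  assume z: "e i = \<zero>"
  have "x = \<zero>" if "x : I i" for x using split[OF i i that] Ic[OF i] that unfolding z by auto
  thus False using nz[OF i] I0[OF i] by blast
 qed
 have gen: "EX y:carrier R. x \<otimes> y = e j" if j: "j < n" and x: "x : carrier R" "e j \<otimes> x = x" "x ~= \<zero>" for j x
 proof -
  let ?J = "(%y. x \<otimes> y) ` carrier R"
  have xI: "x : I j" using cl[OF j eI[OF j] x(1)] x(2) by simp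
  have "right_ideal R ?J"
   unfolding right_ideal_def
  proof (intro conjI ballI)
   show "additive_subgroup ?J R"
   proof (intro additive_subgroup.intro add.subgroupI)
    fix a assume "a : ?J"
    then obtain y where y: "y : carrier R" "a = x \<otimes> y" by blast
    have "\<ominus> a = x \<otimes> (\<ominus> y)" using x y by (simp add: r_minus)
    thus "\<ominus> a : ?J" using y by blast
   next
    fix a b assume "a : ?J" "b : ?J"
    then obtain y z where y: "y : carrier R" "a = x \<otimes> y" "z : carrier R" "b = x \<otimes> z" by blast
    have "a \<oplus> b = x \<otimes> (y \<oplus> z)" using x y by (simp add: r_distr)
    thus "a \<oplus> b : ?J" using y by blast
   qed (use x in auto)
   fix a r assume "a : ?J" and r: "r : carrier R"
   then obtain y where y: "y : carrier R" "a = x \<otimes> y" by blast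
   have "a \<otimes> r = x \<otimes> (y \<otimes> r)" using x y r by (simp add: m_assoc)
   thus "a \<otimes> r : ?J" using y r by blast
  qed
  moreover have "?J \<subseteq> I j" using cl[OF j xI] by blast
  ultimately have "?J = {\<zero>} \<or> ?J = I j" using m[OF j] unfolding minimal_right_ideal_def by blast
  moreover have "x : ?J" using x by (intro image_eqI[of _ _ "\<one>"]) auto
  ultimately have "e j : ?J" using eI[OF j] x(3) by auto
  thus ?thesis by auto
 qed
 have co: "EX y:carrier R. x \<otimes> y = e j & y \<otimes> x = e i"
  if ij: "i < n" "j < n" and x: "x : carrier R" "e j \<otimes> x = x" "x \<otimes> e i = x" "x ~= \<zero>" for i j x
 proof -
  note c = ec[OF ij(1)] ec[OF ij(2)]
  have ee: "e i \<otimes> e i = e i" "e j \<otimes> e j = e j" using split[OF _ _ eI] ij by simp_all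
  obtain y0 where y0: "y0 : carrier R" "x \<otimes> y0 = e j" using gen[OF ij(2) x(1,2,4)] by blast
  \<comment> \<open>A right inverse y0 of x relative to e j is compressed into the opposite corner.
    Its compression has a right inverse z of its own, and x = e j z then shows that the one-sided
    inverse is two-sided.\<close>
  let ?y = "e i \<otimes> (y0 \<otimes> e j)"
  have y: "?y : carrier R" using c y0 by simp
  have "x \<otimes> ?y = ((x \<otimes> e i) \<otimes> y0) \<otimes> e j" using x(1) c y0(1) by (simp add: m_assoc)
  hence xy: "x \<otimes> ?y = e j" unfolding x(3) y0(2) ee(2) .
  have ey: "e i \<otimes> ?y = ?y" using c y0 ee by (simp add: m_assoc[symmetric])
  have "?y ~= \<zero>" using xy ne[OF ij(2)] x(1) by auto
  then obtain z where z: "z : carrier R" "?y \<otimes> z = e i" using gen[OF ij(1) y ey] by blast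
  have "x = e j \<otimes> z"
   using m_assoc[OF x(1) y z(1)] unfolding xy z(2) x(3) by simp
  hence "?y \<otimes> x = (?y \<otimes> e j) \<otimes> z" using m_assoc[OF y c(2) z(1)] by simp
  moreover have "?y \<otimes> e j = ?y" using c y0 ee by (simp add: m_assoc)
  ultimately show ?thesis using xy y z(2) by auto
 qed
 have "idems (carrier R) (monoid.mult R) \<zero> n e"
  unfolding idems_def using ec ne split[OF _ _ eI] by (simp add: co)
 thus ?thesis using that one by blast
qed

section \<open>Full subcategories: their zero objects, biproducts, monics, kernels and
  cokernels\<close>

context tricat0 begin

lemma full_sub_simps [simp]:
 "Obj (full_sub T P) = P" "Hom (full_sub T P) = Hom T" "Cmp (full_sub T P) = Cmp T" "Idn (full_sub T P) = Idn T"
 "HAdd (full_sub T P) = HAdd T" "HZero (full_sub T P) = HZero T" "Shift (full_sub T P) = Shift T"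
 by (simp_all add: full_sub_def)

lemma full_sub_tri: "((X, Y, Z, u, v, w) : Tri (full_sub T P)) = (tri X Y Z u v w & X : P & Y : P & Z : P)"
 by (auto simp: full_sub_def)

lemma full_sub_all: "full_sub T (Obj T) = T"
proof -
 have "{(X, Y, Z, u, v, w) : Tri T. X : Obj T & Y : Obj T & Z : Obj T} = Tri T"
  using triD(10-12) by auto
 thus ?thesis by (simp add: full_sub_def)
qed

lemma full_sub_twice: "H \<subseteq> P ==> full_sub (full_sub T P) H = full_sub T H"
proof -
 assume "H \<subseteq> P"
 hence "{(X, Y, Z, u, v, w). tri X Y Z u v w & X : P & Y : P & Z : P & X : H & Y : H & Z : H} =
   {(X, Y, Z, u, v, w). tri X Y Z u v w & X : H & Y : H & Z : H}" by blast
 thus ?thesis by (simp add: full_sub_def)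
qed

lemma Hom_iff: "ob X ==> ob Y ==> (f : Hom T X Y) = (arr f & dm f = X & cd f = Y)"
 using homD[of f X Y] arr_hom[of f X Y] by blast

lemma preadditive_full_sub:
 assumes P: "P \<subseteq> Obj T" shows "preadditive (full_sub T P)"
proof -
 have "category (full_sub T P)"
  unfolding category_def full_sub_simps
  by (intro conjI ballI) (auto dest!: subsetD[OF P] simp: Hom_iff)
 moreover have "comm_group \<lparr>carrier = Hom T X Y, monoid.mult = HAdd T, one = zz X Y\<rparr>" if "X : P" "Y : P" for X Y
  by (rule grp) (use that P in auto)
 ultimately show ?thesis
  unfolding preadditive_def full_sub_simps
  by (intro conjI ballI) (auto dest!: subsetD[OF P] simp: Hom_iff)
qed

lemma full_sub_pcat:
 assumes P: "P \<subseteq> Obj T" shows "pcat (full_sub T P)"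
proof
 show "preadditive (full_sub T P)" by (rule preadditive_full_sub[OF P])
 fix f X Y X' Y'
 assume a: "f : Hom (full_sub T P) X Y" "f : Hom (full_sub T P) X' Y'" "X : Obj (full_sub T P)"
  "Y : Obj (full_sub T P)" "X' : Obj (full_sub T P)" "Y' : Obj (full_sub T P)"
 show "X = X' & Y = Y'" by (rule hom_disj[of f]) (use a P in auto)
qed

lemma full_sub_zero: "P \<subseteq> Obj T ==> zero_object (full_sub T P) X = (X : P & null X)"
 using pcat.zero_object_iff[OF full_sub_pcat, of P X] pcat.null_def[OF full_sub_pcat, of P X]
 by (auto simp: null_def)

lemma full_sub_biprod:
 "P \<subseteq> Obj T ==> is_biproduct (full_sub T P) X Y Q = (X : P & Y : P & Q : P & is_biproduct T X Y Q)"
 unfolding is_biproduct_def full_sub_simps by auto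

lemma full_sub_is_iso:
 "P \<subseteq> Obj T ==> X : P ==> Y : P ==> is_iso (full_sub T P) X Y f = (iso f & dm f = X & cd f = Y)"
 using is_iso_iff[of X Y f] unfolding is_iso_def full_sub_simps by auto

lemma full_sub_isomorphic:
 "P \<subseteq> Obj T ==> isomorphic (full_sub T P) X Y = (X : P & Y : P & isom X Y)"
 unfolding isomorphic_def isom_def using full_sub_is_iso[of P X Y] by auto

lemma hz_Hom: assumes "ob X" "ob Y" "hz X Y" shows "Hom T X Y = {zz X Y}"
 using Hom_iff[OF assms(1,2)] hzD[OF assms(3)] zz_simps[OF assms(1,2)] by blast

text \<open>Passing to the difference of two arrows reduces cancellation to arrows annihilated by f,
  which is the form in which exactness of triangles can be applied.\<close>

lemma full_sub_monic:
 assumes P: "P \<subseteq> Obj T" "X : P" "Y : P"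
 shows "monic (full_sub T P) X Y f = (arr f & dm f = X & cd f = Y &
  (ALL g. arr g --> dm g : P --> cd g = X --> f ** g = zz (dm g) Y --> g = zz (dm g) X))"
  (is "?l = ?r")
proof
 have o: "ob X" "ob Y" using P by auto
 assume m: ?l
 hence f: "arr f" "dm f = X" "cd f = Y" using Hom_iff[OF o] by (auto simp: monic_def)
 have "g = zz (dm g) X" if g: "arr g" "dm g : P" "cd g = X" "f ** g = zz (dm g) Y" for g
 proof -
  have h: "!!g h W. W : P ==> g : Hom T W X ==> h : Hom T W X ==> f ** g = f ** h ==> g = h"
   using m unfolding monic_def full_sub_simps by blast
  show ?thesis by (rule h[OF g(2)]) (use g f o in simp_all)
 qed
 thus ?r using f by blast
next
 have o: "ob X" "ob Y" using P by auto
 assume r: ?r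
 show ?l unfolding monic_def full_sub_simps
 proof (intro conjI ballI impI)
  show "f : Hom T X Y" using r Hom_iff[OF o] by blast
  fix W g h assume W: "W : P" and "g : Hom T W X" "h : Hom T W X" and e: "f ** g = f ** h"
  hence g: "arr g" "dm g = W" "cd g = X" and h: "arr h" "dm h = W" "cd h = X"
   using Hom_iff[of W X] o P by auto
  have "f ** (g \<boxplus> ng h) = zz W Y" using r g h e by simp
  hence "g \<boxplus> ng h = zz W X" using r[THEN conjunct2, THEN conjunct2, THEN conjunct2, rule_format, of "g \<boxplus> ng h"] W g h by simp
  thus "g = h" using diff_zero[of g h] g h by simp
 qed
qed

lemma full_sub_epic:
 assumes P: "P \<subseteq> Obj T" "X : P" "Y : P"
 shows "epic (full_sub T P) X Y f = (arr f & dm f = X & cd f = Y &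
  (ALL g. arr g --> cd g : P --> dm g = Y --> g ** f = zz X (cd g) --> g = zz Y (cd g)))"
  (is "?l = ?r")
proof
 have o: "ob X" "ob Y" using P by auto
 assume m: ?l
 hence f: "arr f" "dm f = X" "cd f = Y" using Hom_iff[OF o] by (auto simp: epic_def)
 have "g = zz Y (cd g)" if g: "arr g" "cd g : P" "dm g = Y" "g ** f = zz X (cd g)" for g
 proof -
  have h: "!!g h W. W : P ==> g : Hom T Y W ==> h : Hom T Y W ==> g ** f = h ** f ==> g = h"
   using m unfolding epic_def full_sub_simps by blast
  show ?thesis by (rule h[OF g(2)]) (use g f o in simp_all)
 qed
 thus ?r using f by blast
next
 have o: "ob X" "ob Y" using P by auto
 assume r: ?r
 show ?l unfolding epic_def full_sub_simps
 proof (intro conjI ballI impI)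
  show "f : Hom T X Y" using r Hom_iff[OF o] by blast
  fix W g h assume W: "W : P" and "g : Hom T Y W" "h : Hom T Y W" and e: "g ** f = h ** f"
  hence g: "arr g" "dm g = Y" "cd g = W" and h: "arr h" "dm h = Y" "cd h = W"
   using Hom_iff[of Y W] o P by auto
  have "(g \<boxplus> ng h) ** f = zz X W" using r g h e by simp
  hence "g \<boxplus> ng h = zz Y W" using r[THEN conjunct2, THEN conjunct2, THEN conjunct2, rule_format, of "g \<boxplus> ng h"] W g h by simp
  thus "g = h" using diff_zero[of g h] g h by simp
 qed
qed

lemma full_sub_kernel:
 assumes P: "P \<subseteq> Obj T" "X : P" "Y : P" "K : P" and f: "arr f" "dm f = X" "cd f = Y" and m: "monic (full_sub T P) K X i"
  and fi: "f ** i = zz K Y"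
  and lift: "!!g. arr g ==> dm g : P ==> cd g = X ==> f ** g = zz (dm g) Y ==> EX h. arr h & dm h = dm g & cd h = K & i ** h = g"
 shows "is_kernel (full_sub T P) X Y f K i"
 unfolding is_kernel_def full_sub_simps
proof (intro conjI ballI impI)
 have i: "arr i" "dm i = K" "cd i = X" using m full_sub_monic[OF P(1,4,2)] by auto
 show "i : Hom T K X" using i by simp
 fix W g assume W: "W : P" and g: "g : Hom T W X" "f ** g = zz W Y"
 have g': "arr g" "dm g = W" "cd g = X" using Hom_iff[of W X] g P W by auto
 obtain h where h: "arr h" "dm h = W" "cd h = K" "i ** h = g" using lift[OF g'(1)] g' g W by auto
 show "EX! h. h : Hom T W K & i ** h = g"
 proof (rule ex1I)
  show "h : Hom T W K & i ** h = g" using h by simp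
  fix h' assume h': "h' : Hom T W K & i ** h' = g"
  have "!!g h W. W : P ==> g : Hom T W K ==> h : Hom T W K ==> i ** g = i ** h ==> g = h"
   using m unfolding monic_def full_sub_simps by blast
  from this[OF W, of h' h] show "h' = h" using h h' by simp
 qed
qed (use P fi in auto)

lemma full_sub_cokernel:
 assumes P: "P \<subseteq> Obj T" "X : P" "Y : P" "K : P" and f: "arr f" "dm f = X" "cd f = Y" and m: "epic (full_sub T P) Y K i"
  and fi: "i ** f = zz X K"
  and lift: "!!g. arr g ==> cd g : P ==> dm g = Y ==> g ** f = zz X (cd g) ==> EX h. arr h & dm h = K & cd h = cd g & h ** i = g"
 shows "is_cokernel (full_sub T P) X Y f K i"
 unfolding is_cokernel_def full_sub_simps
proof (intro conjI ballI impI)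
 have i: "arr i" "dm i = Y" "cd i = K" using m full_sub_epic[OF P(1,3,4)] by auto
 show "i : Hom T Y K" using i by simp
 fix W g assume W: "W : P" and g: "g : Hom T Y W" "g ** f = zz X W"
 have g': "arr g" "dm g = Y" "cd g = W" using Hom_iff[of Y W] g P W by auto
 obtain h where h: "arr h" "dm h = K" "cd h = W" "h ** i = g" using lift[OF g'(1)] g' g W by auto
 show "EX! h. h : Hom T K W & h ** i = g"
 proof (rule ex1I)
  show "h : Hom T K W & h ** i = g" using h by simp
  fix h' assume h': "h' : Hom T K W & h' ** i = g"
  have "!!g h W. W : P ==> g : Hom T K W ==> h : Hom T K W ==> g ** i = h ** i ==> g = h"
   using m unfolding epic_def full_sub_simps by blast
  from this[OF W, of h' h] show "h' = h" using h h' by simp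
 qed
qed (use P fi in auto)

lemma biprod_isom_left:
 assumes b: "is_biproduct T X Y M" and i: "isom X X'" shows "is_biproduct T X' Y M"
proof -
 obtain a where a: "iso a" "dm a = X" "cd a = X'" using isomE[OF i] .
 obtain i1 i2 p1 p2 where B: "arr i1" "dm i1 = X" "cd i1 = M" "arr i2" "dm i2 = Y" "cd i2 = M"
  "arr p1" "dm p1 = M" "cd p1 = X" "arr p2" "dm p2 = M" "cd p2 = Y"
  "p1 ** i1 = idn X" "p2 ** i2 = idn Y" "p2 ** i1 = zz X Y" "p1 ** i2 = zz Y X"
  "i1 ** p1 \<boxplus> i2 ** p2 = idn M"
  using b by (rule biprodE)
 have o: "ob X" "ob X'" "ob Y" using a arr_obj[OF B(4)] B(5) arr_obj[OF iso_arr[OF a(1)]] by auto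
 have c: "p1 ** (i1 ** iv a) = iv a" "p2 ** (i1 ** iv a) = zz X' Y"
  using assoc[of "iv a" i1 p1] assoc[of "iv a" i1 p2] a B o by (simp_all del: assoc)
 show ?thesis
  by (rule biprodI[of "i1 ** iv a" X' M i2 Y "a ** p1" p2]) (use a B c o in "simp_all add: ar_iff")
qed

end

subsection \<open>The t-structure and its heart\<close>

context smc begin

lemma F_ob: "F I X ==> ob X"
 unfolding F_def using filt_ob by blast

lemma F_isom: "F I X ==> isom X Y ==> F I Y"
 unfolding F_def using filt_isom by blast

lemma F_shift: "F I X ==> (+) n ` I \<subseteq> J ==> F J (sh n X)"
 unfolding F_def by (elim exE, rule exI, rule filt_mono[OF filt_shift[OF SS_ob]])

lemma F_S: "F {i} X ==> F {i+1} (S X)"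
 by (rule F_shift) auto

lemma F_hz: "F I X ==> F J Y ==> (!!i j. i : I ==> j : J ==> j < i) ==> hz X Y"
 unfolding F_def using flt_hz by blast

lemma F_SS: "s : SS ==> 0 : I ==> F I s"
 using F_isom[OF F_one sh_0[OF SS_ob]] by blast

lemma G_F: "0 : I ==> F I G"
 using F_mono[of "{0}" G I] G_filt unfolding F_def by blast

lemma G_ob: "ob G"
 using F_ob[OF G_F[of UNIV]] by simp

lemma F_biprod: "F I X ==> F I Y ==> is_biproduct T X Y P ==> F I P"
 using F_ext biprod_trio by blast

text \<open>One statement for the perfect category and both aisles. J may exceed N only by 0, since
  G itself lies in degree 0 while the aisles allow strictly positive or negative shifts only.
  Conversely each layer is a shift of a summand of G.\<close>

lemma generated_eq:
 assumes P: "P \<subseteq> Obj T" "!!X. F UNIV X ==> X : P"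
  and J: "0 : J" "J \<subseteq> insert 0 N" "!!n. n : N ==> (+) n ` J \<subseteq> J"
  and summand: "!!X Y Z. is_biproduct T X Z Y ==> F J Y ==> F J X"
 shows "generated (full_sub T P) N G = {X. F J X}"
proof (intro equalityI subsetI CollectI)
 fix X assume "X : generated (full_sub T P) N G"
 thus "F J X"
 proof induction
  case base
  show ?case by (rule G_F[OF J(1)])
 next
  case (ext X Y Z u v w)
  hence "tri X Y Z u v w" by (simp add: full_sub_tri)
  from F_ext[OF ext.IH trioI[OF this]] show ?case .
 next
  case (shift X n)
  thus ?case using F_shift[OF shift.IH J(3)] by simp
 next
  case (summand Y X)
  then obtain Z where "is_biproduct T X Z Y" unfolding direct_summand_def full_sub_biprod[OF P(1)] by blast
  from assms(6)[OF this summand.IH] show ?case .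
 qed
next
 let ?gen = "generated (full_sub T P) N G"
 fix X assume "X : {X. F J X}"
 then obtain n where "flt J n X" unfolding F_def by blast
 have PJ: "F I X ==> X : P" for I X using P(2) F_mono by blast
 have s: "X : ?gen" if "Y : ?gen" "is_biproduct T X Z Y" "X : P" "Y : P" "Z : P" for X Y Z
  by (rule generated.summand[OF that(1)], unfold direct_summand_def full_sub_biprod[OF P(1)])
   (intro exI[of _ Z] conjI that)
 obtain N0 where N0: "null N0" by (rule null_ex)
 have i: "X : ?gen" if "Y : ?gen" "isom X Y" "Y : P" "X : P" for X Y
  by (rule s[OF that(1) biprod_isom[OF that(2) N0] that(4,3)]) (rule PJ[OF F_null[OF N0]])
 show "X : ?gen" using \<open>flt J n X\<close>
 proof induction
  case (zero X)
  have o: "ob X" using zero by (simp add: null_def)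
  show ?case
   by (rule s[OF generated.base is_biproduct_sym[OF biprod_null[OF G_ob zero]]])
    (use PJ[OF F_null[OF zero]] PJ[OF G_F[of UNIV]] in auto)
 next
  case (app n X Y Q j t)
  obtain Z where Z: "is_biproduct T t Z G" using SS_G[OF app.hyps(5)] by blast
  have t: "t : P" by (rule PJ[OF F_SS[OF app.hyps(5) UNIV_I]])
  have "Z : P" by (rule PJ[OF F_summand[OF G_F[OF UNIV_I] is_biproduct_sym[OF Z]]])
  hence g: "t : ?gen" by (rule s[OF generated.base Z t PJ[OF G_F[OF UNIV_I]]])
  have sp: "sh j t : P" by (rule PJ[OF F_one[OF app.hyps(5) UNIV_I]])
  have "sh j t : ?gen"
  proof (cases "j = 0")
   case True
   thus ?thesis using i[OF g sh_0[OF SS_ob[OF app.hyps(5)]] t] sp by simp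
  next
   case False
   hence "j : N" using app.hyps(4) J(2) by auto
   from generated.shift[OF g this] show ?thesis by simp
  qed
  have F: "F J X" "F J Q" "F J Y"
   by (rule FI[OF app.hyps(1)], rule F_isom[OF F_one[OF app.hyps(5,4)] app.hyps(3)], rule FI[OF filt.app[OF app.hyps]])
  have Q: "Q : ?gen" by (rule i[OF \<open>sh j t \<in> ?gen\<close> isom_sym[OF app.hyps(3)] sp PJ[OF F(2)]])
  obtain u v w where tr: "tri X Y Q u v w" using app.hyps(2) by (rule trioE)
  have "(X, Y, Q, u, v, w) : Tri (full_sub T P)"
   unfolding full_sub_tri by (intro conjI tr PJ[OF F(1)] PJ[OF F(2)] PJ[OF F(3)])
  from generated.ext[OF this app.IH Q] show ?case .
 qed
qed

text \<open>These definitions repeat \<open>per\<close>, \<open>left_aisle\<close>,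
  \<open>right_aisle\<close> and later \<open>per_heart\<close> over an abstract T and G, so that
  they unfold to the concrete ones literally.\<close>

definition "per0 = full_sub T (generated T UNIV G)"
definition "la = generated per0 {n. n > 0} G"
definition "ra = generated per0 {n. n < 0} G"

lemma F_Obj: "{X. F I X} \<subseteq> Obj T"
 using F_ob by blast

lemma per_eq: "per0 = full_sub T {X. F UNIV X}"
proof -
 have "generated (full_sub T (Obj T)) UNIV G = {X. F UNIV X}"
  by (rule generated_eq) (use F_ob F_summand in auto)
 thus ?thesis unfolding per0_def full_sub_all by simp
qed

lemma la_eq: "la = {X. F {0..} X}"
 unfolding la_def per_eq by (rule generated_eq[OF F_Obj]) (use F_summand_upper in auto)

lemma ra_eq: "ra = {X. F {..0} X}"
 unfolding ra_def per_eq by (rule generated_eq[OF F_Obj]) (use F_summand_lower in auto)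

lemma additive_F: "strictly_full_additive per0 {X. F I X}"
 unfolding strictly_full_additive_def
proof (intro conjI ballI allI impI)
 note o = F_Obj[of UNIV]
 have FU: "F UNIV X" if "F I X" for X by (rule F_mono[OF that]) simp
 show "{X. F I X} \<subseteq> Obj per0" unfolding per_eq using FU by auto
 show "Y : {X. F I X}" if X: "X : {X. F I X}" and i: "isomorphic per0 X Y" for X Y
 proof -
  have "isom X Y" using i unfolding per_eq full_sub_isomorphic[OF o] by simp
  from F_isom[OF _ this] X show ?thesis by simp
 qed
 obtain Z where Z: "null Z" by (rule null_ex)
 have "zero_object per0 Z" unfolding per_eq full_sub_zero[OF o] using Z F_null[OF Z] by simp
 thus "EX Z:{X. F I X}. zero_object per0 Z" using F_null[OF Z, of I] by blast
 fix X Y assume "X : {X. F I X}" "Y : {X. F I X}"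
 hence XY: "F I X" "F I Y" by auto
 obtain P where P: "is_biproduct T X Y P" using biprod_ex[OF F_ob[OF XY(1)] F_ob[OF XY(2)]] by blast
 have FP: "F I P" by (rule F_biprod[OF XY P])
 have "is_biproduct per0 X Y P" unfolding per_eq full_sub_biprod[OF o] using FU XY FP P by simp
 thus "EX P:{X. F I X}. is_biproduct per0 X Y P" using FP by blast
qed

lemma bounded: "bounded_t_structure per0 la ra"
proof -
 note o = F_Obj[of UNIV]
 have FU: "F UNIV X" if "F I X" for I X by (rule F_mono[OF that]) simp
 have "t_structure per0 la ra"
  unfolding t_structure_def
 proof (intro conjI ballI)
  show "strictly_full_additive per0 la" "strictly_full_additive per0 ra"
   unfolding la_eq ra_eq by (rule additive_F)+
  show "Shift per0 1 X : la" if "X : la" for X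
   using that F_shift[of "{0..}" X 1 "{0..}"] unfolding la_eq per_eq by auto
  show "Shift per0 (-1) X : ra" if "X : ra" for X
  proof -
   have "F {..0} (sh (-1) X)" by (rule F_shift[of "{..0}"]) (use that in "auto simp: ra_eq")
   thus ?thesis unfolding ra_eq per_eq by simp
  qed
  show "Hom per0 M (Shift per0 (-1) N) = {HZero per0 M (Shift per0 (-1) N)}" if "M : la" "N : ra" for M N
  proof -
   have M: "F {0..} M" and N: "F {..0} N" using that unfolding la_eq ra_eq by auto
   have "F {..-1} (sh (-1) N)" by (rule F_shift[OF N]) auto
   hence "hz M (sh (-1) N)" by (rule F_hz[OF M]) auto
   thus ?thesis using hz_Hom[OF F_ob[OF M] sh_ob[OF F_ob[OF N]]] unfolding per_eq by simp
  qed
  fix M assume "M : Obj per0"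
  then obtain n where n: "flt UNIV n M" unfolding per_eq F_def by auto
  obtain L R l r where t: "flt (UNIV \<inter> {0..}) l L" "flt (UNIV \<inter> {..0 - 1}) r R" "trio L M R"
   using truncate[OF n, of 0] by blast
  obtain u v w where tr: "tri L M R u v w" using t(3) by (rule trioE)
  have "(L, M, R, u, v, w) : Tri per0"
   unfolding per_eq full_sub_tri using tr FU[OF FI[OF t(1)]] FU[OF FI[OF t(2)]] FI[OF n] by simp
  moreover have "L : la" using FI[OF t(1)] unfolding la_eq by simp
  moreover have "F {..0} (S R)" by (rule F_shift[OF FI[OF t(2)]]) auto
  hence "Shift per0 1 R : ra" unfolding ra_eq per_eq by simp
  ultimately show "EX L R u v w. (L, M, R, u, v, w) : Tri per0 & L : la & Shift per0 1 R : ra" by blast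
 qed
 \<comment> \<open>Finitely many layers occupy a finite interval of degrees, which some shift moves
   into I; this serves both halves of boundedness.\<close>
 moreover have "(\<Union>n. shifted per0 n {X. F I X}) = Obj per0"
  if I: "!!a b. EX c. (+) c ` {a..<b} \<subseteq> I" for I
 proof (intro equalityI subsetI)
  fix X assume "X : (\<Union>n. shifted per0 n {X. F I X})"
  thus "X : Obj per0" unfolding shifted_def per_eq full_sub_isomorphic[OF o] by auto
 next
  fix X assume "X : Obj per0"
  then obtain n where n: "flt UNIV n X" unfolding per_eq F_def by auto
  obtain a d where "flt (UNIV \<inter> {a..<a + int d}) n X" using flt_bounds[OF n] by blast
  hence "F {a..<a + int d} X" using FI by simp
  moreover obtain c where "(+) c ` {a..<a + int d} \<subseteq> I" using I by blast
  ultimately have Y: "F I (sh c X)" by (rule F_shift)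
  have X: "ob X" using filt_ob[OF n] .
  have "isom (sh (- c) (sh c X)) (sh 0 X)" using sh_sh[OF X, of "- c" c] by simp
  hence i: "isom X (sh (- c) (sh c X))" by (rule isom_sym[OF isom_trans[OF _ sh_0[OF X]]])
  have "isomorphic per0 X (Shift per0 (- c) (sh c X))"
   unfolding per_eq full_sub_isomorphic[OF o] using i FI[OF n] F_isom[OF FI[OF n] i] by simp
  thus "X : (\<Union>n. shifted per0 n {X. F I X})" unfolding shifted_def using Y by blast
 qed
 note sft = this
 have "(\<Union>n. shifted per0 n la) = Obj per0"
  unfolding la_eq
 proof (rule sft)
  show "EX c. (+) c ` {a..<b} \<subseteq> {0..}" for a b :: int by (rule exI[of _ "- a"]) auto
 qed
 moreover have "(\<Union>n. shifted per0 n ra) = Obj per0"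
  unfolding ra_eq
 proof (rule sft)
  show "EX c. (+) c ` {a..<b} \<subseteq> {..0}" for a b :: int by (rule exI[of _ "- b"]) auto
 qed
 ultimately show ?thesis unfolding bounded_t_structure_def by blast
qed

definition "ht = full_sub per0 (la \<inter> ra)"
abbreviation "HH \<equiv> {X. F {0} X}"

lemma ht_eq: "ht = full_sub T HH"
proof -
 have "la \<inter> ra = HH" (is "?A = _")
 proof (intro equalityI subsetI)
  fix X assume "X : ?A"
  thus "X : HH" using F_heart[of X] unfolding la_eq ra_eq by simp
 next
  fix X assume "X : HH"
  hence X: "F {0} X" by simp
  show "X : ?A" unfolding la_eq ra_eq using F_mono[OF X, of "{0..}"] F_mono[OF X, of "{..0}"] by simp
 qed
 moreover have "HH \<subseteq> {X. F UNIV X}"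
 proof
  fix X assume "X : HH"
  thus "X : {X. F UNIV X}" using F_mono[of "{0}" X UNIV] by simp
 qed
 ultimately show ?thesis unfolding ht_def per_eq using full_sub_twice[of HH "{X. F UNIV X}"] by simp
qed

lemmas HO = F_Obj[of "{0}"]

text \<open>The suspension of f factors through w by an arrow from S (dm f) to Z, and the last
  hypothesis annihilates that arrow.\<close>

lemma S_mono:
 assumes t: "tri X Y Z u v w" and f: "arr f" "cd f = X" "u ** f = zz (dm f) Y" and h: "hz (S (dm f)) Z"
 shows "f = zz (dm f) X"
proof -
 note D = triD[OF t]
 have "sus u ** sus f = sus (zz (dm f) Y)" unfolding f(3)[symmetric] using f(1,2) D by (simp add: sus_cmp)
 hence s: "sus u ** sus f = zz (dm (sus f)) (S Y)" using f D by simp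
 obtain g where g: "arr g" "dm g = dm (sus f)" "cd g = Z" "w ** g = sus f"
  by (rule tri_exact3[OF t _ _ s]) (use f D in simp_all)
 have "g = zz (S (dm f)) Z" by (rule hzD[OF h]) (use g f in simp_all)
 hence "sus f = sus (zz (dm f) X)" using g(4) f D by auto
 thus ?thesis by (rule sus_inj[rotated -1]) (use f D in simp_all)
qed

lemma S_epi:
 assumes t: "tri X Y Z u v w" and f: "arr f" "dm f = Z" "f ** v = zz Y (cd f)" and h: "hz (S X) (cd f)"
 shows "f = zz Z (cd f)"
proof -
 note D = triD[OF t]
 obtain g where g: "arr g" "dm g = S X" "cd g = cd f" "g ** w = f" by (rule tri_coexact2[OF t f])
 have "g = zz (S X) (cd f)" by (rule hzD[OF h]) (use g in simp_all)
 thus ?thesis using g(4) f D by (metis cmp_zz(2) arr_obj(2))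
qed

text \<open>A triangle whose three objects lie in degree 0 is short exact: the obstructions to u
  being monic and v being epic are maps S W -> W' between degrees 1 and 0, and these vanish.\<close>

lemma exact_seq:
 assumes t: "tri X Y Z u v w" and H: "F {0} X" "F {0} Y" "F {0} Z"
 shows "monic ht X Y u" "epic ht Y Z v" "is_kernel ht Y Z v X u" "is_cokernel ht X Y u Z v"
proof -
 note D = triD[OF t]
 have S: "F {0} W ==> F {0} W' ==> hz (S W) W'" for W W' by (rule F_hz[OF F_S]) auto
 have H': "X : HH" "Y : HH" "Z : HH" using H by simp_all
 show m: "monic ht X Y u" unfolding ht_eq full_sub_monic[OF HO H'(1,2)]
 proof (intro conjI allI impI)
  fix g assume g: "arr g" "dm g : HH" "cd g = X" "u ** g = zz (dm g) Y"
  show "g = zz (dm g) X" by (rule S_mono[OF t g(1,3,4) S[OF _ H(3)]]) (use g in simp)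
 qed (rule D)+
 show e: "epic ht Y Z v" unfolding ht_eq full_sub_epic[OF HO H'(2,3)]
 proof (intro conjI allI impI)
  fix g assume g: "arr g" "cd g : HH" "dm g = Z" "g ** v = zz Y (cd g)"
  show "g = zz Z (cd g)" by (rule S_epi[OF t g(1,3,4) S[OF H(1)]]) (use g in simp)
 qed (rule D)+
 show "is_kernel ht Y Z v X u" unfolding ht_eq
 proof (rule full_sub_kernel[OF HO H'(2,3,1) D(2,6,7) m[unfolded ht_eq] tri_vu[OF t]])
  fix g assume g: "arr g" "dm g : HH" "cd g = Y" "v ** g = zz (dm g) Z"
  show "EX h. arr h & dm h = dm g & cd h = X & u ** h = g" by (rule tri_exact[OF t g(1,3,4)]) blast
 qed
 show "is_cokernel ht X Y u Z v" unfolding ht_eq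
 proof (rule full_sub_cokernel[OF HO H' D(1,4,5) e[unfolded ht_eq] tri_vu[OF t]])
  fix g assume g: "arr g" "cd g : HH" "dm g = Y" "g ** u = zz X (cd g)"
  show "EX h. arr h & dm h = Z & cd h = cd g & h ** v = g" by (rule tri_coexact[OF t g(1,3,4)]) blast
 qed
qed

text \<open>The cone C of f has layers in degrees 0 and 1 only. Truncating it gives S K -> C -> R;
  the composite of S K -> C with w desuspends to the kernel, and the composite of v with C -> R is
  the cokernel.\<close>

lemma ker_coker:
 assumes f: "arr f" "F {0} (dm f)" "F {0} (cd f)"
 obtains C v w K a R b c k where "tri (dm f) (cd f) C f v w" "tri (S K) C R a b c" "F {0} K" "F {0} R"
  "arr k" "dm k = K" "cd k = dm f" "sus k = w ** a"
  "is_kernel ht (dm f) (cd f) f K k" "is_cokernel ht (dm f) (cd f) f R (b ** v)"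
  "monic ht K (dm f) k" "epic ht (cd f) R (b ** v)"
proof -
 let ?X = "dm f" and ?Y = "cd f"
 have S0: "F {0} W ==> F {0} W' ==> hz (S W) W'" for W W' by (rule F_hz[OF F_S]) auto
 have SS0: "F {0} W ==> F {0} W' ==> hz (S (S W)) W'" for W W' by (rule F_hz[OF F_S[OF F_S]]) auto
 obtain C v w where t: "tri ?X ?Y C f v w" using tri_complete[OF f(1)] by blast
 note D = triD[OF t]
 have "F {0,1} C"
  by (rule F_ext[OF F_mono[OF f(3)] F_mono[OF F_S[OF f(2)]] trioI[OF tri_rot[OF t]]]) auto
 then obtain n where n: "flt {0,1} n C" unfolding F_def by blast
 obtain L R l r where LR: "flt ({0,1} \<inter> {1..}) l L" "flt ({0,1} \<inter> {..1 - 1}) r R" "trio L C R"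
  using truncate[OF n, of 1] by blast
 have L: "F {1} L" using F_mono[OF FI[OF LR(1)], of "{1}"] by auto
 have R: "F {0} R" using F_mono[OF FI[OF LR(2)], of "{0}"] by auto
 let ?K = "sh (-1) L"
 have K: "F {0} ?K" by (rule F_shift[OF L]) simp
 have "isom (S ?K) (sh 0 L)" using sh_sh[OF F_ob[OF L], of 1 "-1"] by simp
 from isom_sym[OF isom_trans[OF this sh_0[OF F_ob[OF L]]]]
 have "trio (S ?K) C R" by (rule trio_isom[OF LR(3) _ isom_refl[OF D(12)] isom_refl[OF F_ob[OF R]]])
 then obtain a b c where t2: "tri (S ?K) C R a b c" by (rule trioE)
 note D2 = triD[OF t2]
 have oK: "ob ?K" using F_ob[OF K] .
 have wa: "arr (w ** a)" "dm (w ** a) = S ?K" "cd (w ** a) = S ?X" using D D2 by simp_all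
 obtain k where k: "arr k" "dm k = ?K" "cd k = ?X" "sus k = w ** a"
  using sus_surj[OF wa oK D(10)] by blast
 have mono: "h = zz (dm h) ?K" if h: "arr h" "F {0} (dm h)" "cd h = ?K" "k ** h = zz (dm h) ?X" for h
 proof -
  \<comment> \<open>Hence a (sus h) factors through v from an object in degree 1 to one in degree 0,
    so it vanishes; then \<open>S_mono\<close> for the truncation triangle gives sus h = 0.\<close>
  have "w ** (a ** sus h) = sus (k ** h)" using k h(1-3) D D2 by (simp add: sus_cmp)
  hence z: "w ** (a ** sus h) = zz (dm (a ** sus h)) (S ?X)" using h D D2 by simp
  obtain m where m: "arr m" "dm m = dm (a ** sus h)" "cd m = ?Y" "v ** m = a ** sus h"
   by (rule tri_exact2[OF t _ _ z]) (use h D2 in simp_all)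
  have "m = zz (S (dm h)) ?Y" by (rule hzD[OF S0[OF h(2) f(3)]]) (use m h D2 in simp_all)
  hence "a ** sus h = zz (dm (sus h)) C" using m(4) h D by simp
  hence "sus h = zz (dm (sus h)) (S ?K)"
   by (intro S_mono[OF t2]) (use h SS0[OF h(2) R] in simp_all)
  hence "sus h = sus (zz (dm h) ?K)" using h oK by simp
  thus ?thesis by (rule sus_inj[rotated -1]) (use h oK in simp_all)
 qed
 have H': "?X : HH" "?Y : HH" "?K : HH" "R : HH" using f K R by simp_all
 have m: "monic ht ?K ?X k" unfolding ht_eq full_sub_monic[OF HO H'(3,1)]
 proof (intro conjI allI impI)
  fix g assume g: "arr g" "dm g : HH" "cd g = ?K" "k ** g = zz (dm g) ?X"
  show "g = zz (dm g) ?K" by (rule mono[OF g(1) _ g(3,4)]) (use g in simp)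
 qed (rule k)+
 have "sus (f ** k) = (sus f ** w) ** a" using k D D2 by (simp add: sus_cmp)
 hence "sus (f ** k) = sus (zz ?K ?Y)" using tri_susu_w[OF t] D D2 oK by simp
 hence fk: "f ** k = zz ?K ?Y" by (rule sus_inj[rotated -1]) (use k D oK in simp_all)
 have ker: "is_kernel ht ?X ?Y f ?K k" unfolding ht_eq
 proof (rule full_sub_kernel[OF HO H'(1,2,3) f(1) refl refl m[unfolded ht_eq] fk])
  fix g assume g: "arr g" "dm g : HH" "cd g = ?X" "f ** g = zz (dm g) ?Y"
  have "sus f ** sus g = sus (f ** g)" using g(1-3) f by (simp add: sus_cmp)
  hence z: "sus f ** sus g = zz (dm (sus g)) (S ?Y)" using g D by simp
  obtain m where m: "arr m" "dm m = dm (sus g)" "cd m = C" "w ** m = sus g"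
   by (rule tri_exact3[OF t _ _ z]) (use g in simp_all)
  have "hz (S (dm g)) R" by (rule S0[OF _ R]) (use g(2) in simp)
  hence "b ** m = zz (S (dm g)) R" by (rule hzD) (use m g D2 in simp_all)
  hence z2: "b ** m = zz (dm m) R" using m g by simp
  obtain n where n: "arr n" "dm n = dm m" "cd n = S ?K" "a ** n = m" by (rule tri_exact[OF t2 m(1,3) z2])
  obtain h where h: "arr h" "dm h = dm g" "cd h = ?K" "sus h = n"
   using sus_surj[OF n(1), of "dm g" ?K] n m g oK by auto
  have "sus (k ** h) = w ** (a ** n)" unfolding h(4)[symmetric] using k h(1-3) D D2 by (simp add: sus_cmp)
  hence "sus (k ** h) = sus g" using n m by simp
  hence "k ** h = g" by (rule sus_inj[rotated -1]) (use k h g in simp_all)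
  thus "EX h. arr h & dm h = dm g & cd h = ?K & k ** h = g" using h by blast
 qed
 have bv: "arr (b ** v)" "dm (b ** v) = ?Y" "cd (b ** v) = R" using D D2 by simp_all
 have epi: "h = zz R (cd h)" if h: "arr h" "F {0} (cd h)" "dm h = R" "h ** (b ** v) = zz ?Y (cd h)" for h
 proof -
  have "h ** b = zz C (cd (h ** b))"
   by (rule S_epi[OF t]) (use h D D2 S0[OF f(2) h(2)] in simp_all)
  hence "h ** b = zz C (cd h)" using h D2 by simp
  thus ?thesis by (intro S_epi[OF t2 h(1,3)]) (use SS0[OF K h(2)] in simp_all)
 qed
 have e: "epic ht ?Y R (b ** v)" unfolding ht_eq full_sub_epic[OF HO H'(2,4)]
 proof (intro conjI allI impI)
  fix g assume g: "arr g" "cd g : HH" "dm g = R" "g ** (b ** v) = zz ?Y (cd g)"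
  show "g = zz R (cd g)" by (rule epi[OF g(1) _ g(3,4)]) (use g in simp)
 qed (rule bv)+
 have "(b ** v) ** f = b ** zz ?X C" using tri_vu[OF t] D D2 by simp
 hence bvf: "(b ** v) ** f = zz ?X R" using D D2 by simp
 have coker: "is_cokernel ht ?X ?Y f R (b ** v)" unfolding ht_eq
 proof (rule full_sub_cokernel[OF HO H'(1,2,4) f(1) refl refl e[unfolded ht_eq] bvf])
  fix g assume g: "arr g" "cd g : HH" "dm g = ?Y" "g ** f = zz ?X (cd g)"
  obtain h0 where h0: "arr h0" "dm h0 = C" "cd h0 = cd g" "h0 ** v = g"
   by (rule tri_coexact[OF t g(1,3,4)])
  have "hz (S ?K) (cd g)" by (rule S0[OF K]) (use g(2) in simp)
  hence "h0 ** a = zz (S ?K) (cd g)" by (rule hzD) (use h0 D2 in simp_all)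
  hence z: "h0 ** a = zz (S ?K) (cd h0)" using h0 by simp
  obtain h where h: "arr h" "dm h = R" "cd h = cd h0" "h ** b = h0" by (rule tri_coexact[OF t2 h0(1,2) z])
  have "h ** (b ** v) = g" using h h0 D D2 assoc[of v b h] by (simp del: assoc)
  hence "arr h & dm h = R & cd h = cd g & h ** (b ** v) = g" using h(1-3) h0(3) by simp
  thus "EX h. arr h & dm h = R & cd h = cd g & h ** (b ** v) = g" by blast
 qed
 show ?thesis using that[OF t t2 K R k ker coker m e] .
qed

text \<open>A monic has kernel k = 0, and k is itself monic, so K is null; then the cone C is
  isomorphic to R and lies in the heart.\<close>

lemma monic_cone:
 assumes f: "arr f" "F {0} (dm f)" "F {0} (cd f)" and m: "monic ht (dm f) (cd f) f"
 obtains C v w where "tri (dm f) (cd f) C f v w" "F {0} C"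
proof -
 obtain C v w K a R b c k where *: "tri (dm f) (cd f) C f v w" "tri (S K) C R a b c" "F {0} K" "F {0} R"
  "arr k" "dm k = K" "cd k = dm f" "is_kernel ht (dm f) (cd f) f K k" "monic ht K (dm f) k"
  by (rule ker_coker[OF f])
 have k0: "f ** k = zz K (cd f)" using *(8) unfolding is_kernel_def ht_eq by simp
 have H: "dm f : HH" "cd f : HH" "K : HH" using f *(3) by auto
 have "k = zz K (dm f)"
  using m k0 *(3,5-7) unfolding ht_eq full_sub_monic[OF HO H(1,2)] by auto
 hence "k ** idn K = zz K (dm f)" using F_ob[OF *(3)] F_ob[OF f(2)] by simp
 hence "idn K = zz K K"
  using *(9) F_ob[OF *(3)] *(3) unfolding ht_eq full_sub_monic[OF HO H(3,1)] by (metis H(3) idn_simps)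
 hence "null K" using F_ob[OF *(3)] by (simp add: null_def)
 hence "null (S K)" using null_sh F_ob[OF *(3)] by blast
 from trio_null1[OF trioI[OF *(2)] this] have "isom R C" by (rule isom_sym)
 from that[OF *(1) F_isom[OF *(4) this]] show ?thesis .
qed

text \<open>Dually the cokernel R is null, so the cone is isomorphic to S K, and rotating back
  exhibits K as the fibre of f.\<close>

lemma epic_cone:
 assumes f: "arr f" "F {0} (dm f)" "F {0} (cd f)" and m: "epic ht (dm f) (cd f) f"
 obtains K u w where "tri K (dm f) (cd f) u f w" "F {0} K"
proof -
 obtain C v w K a R b c k where *: "tri (dm f) (cd f) C f v w" "tri (S K) C R a b c" "F {0} K" "F {0} R"
  "is_cokernel ht (dm f) (cd f) f R (b ** v)" "epic ht (cd f) R (b ** v)"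
  by (rule ker_coker[OF f])
 note D = triD[OF *(1)] and D2 = triD[OF *(2)]
 let ?q = "b ** v"
 have q: "arr ?q" "dm ?q = cd f" "cd ?q = R" using D D2 by simp_all
 have k0: "?q ** f = zz (dm f) R" using *(5) unfolding is_cokernel_def ht_eq by simp
 have H: "dm f : HH" "cd f : HH" "R : HH" using f *(4) by auto
 have "?q = zz (cd f) (cd ?q)"
  using m k0 *(4) q unfolding ht_eq full_sub_epic[OF HO H(1,2)] by auto
 hence "idn R ** ?q = zz (cd f) R" using q F_ob[OF *(4)] F_ob[OF f(2)] by simp
 hence "idn R = zz R R"
  using *(6) F_ob[OF *(4)] *(4) unfolding ht_eq full_sub_epic[OF HO H(2,3)] by (metis H(3) idn_simps)
 hence "null R" using F_ob[OF *(4)] by (simp add: null_def)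
 from trio_null3[OF trioI[OF *(2)] this] have "isom C (S K)" by (rule isom_sym)
 from tri_unrot'[OF *(1) this F_ob[OF *(3)]] that *(3) show ?thesis by metis
qed

end

section \<open>The heart is abelian and of finite length; its simple objects\<close>

context smc begin

lemma abelian: "abelian_category ht"
 unfolding abelian_category_def
proof (intro conjI ballI allI impI)
 show "preadditive ht" unfolding ht_eq by (rule preadditive_full_sub[OF HO])
 show "EX Z. zero_object ht Z" unfolding ht_eq full_sub_zero[OF HO] using null_ex F_null by blast
 have ha: "arr f & dm f = X & cd f = Y" if "X : Obj ht" "Y : Obj ht" "f : Hom ht X Y" for X Y f
  using that Hom_iff[of X Y f] F_ob unfolding ht_eq by simp
 fix X Y assume XY: "X : Obj ht" "Y : Obj ht"
 hence F: "F {0} X" "F {0} Y" unfolding ht_eq by auto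
 show "EX P. is_biproduct ht X Y P"
 proof -
  obtain P where P: "is_biproduct T X Y P" using biprod_ex F_ob F by blast
  from F_biprod[OF F P] show ?thesis unfolding ht_eq full_sub_biprod[OF HO] using P F by blast
 qed
 show "EX K i. is_kernel ht X Y f K i" "EX Q q. is_cokernel ht X Y f Q q" if "f : Hom ht X Y" for f
 proof -
  have f: "arr f" "F {0} (dm f)" "F {0} (cd f)" "dm f = X" "cd f = Y" using ha[OF XY that] F by auto
  show "EX K i. is_kernel ht X Y f K i" by (rule ker_coker[OF f(1-3)]) (use f(4,5) in blast)
  show "EX Q q. is_cokernel ht X Y f Q q" by (rule ker_coker[OF f(1-3)]) (use f(4,5) in blast)
 qed
 show "EX Z:Obj ht. EX g:Hom ht Y Z. is_kernel ht Y Z g X f" if m: "monic ht X Y f" for f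
 proof -
  have f: "arr f" "F {0} (dm f)" "F {0} (cd f)" "dm f = X" "cd f = Y"
   using ha[OF XY, of f] m F unfolding monic_def by auto
  obtain C v w where t: "tri X Y C f v w" "F {0} C" using monic_cone[OF f(1-3)] m f(4,5) by blast
  note D = triD[OF t(1)]
  have "v : Hom ht Y C" unfolding ht_eq using D by simp
  moreover have "C : Obj ht" unfolding ht_eq using t(2) by simp
  ultimately show ?thesis using exact_seq(3)[OF t(1) F t(2)] by blast
 qed
 show "EX W:Obj ht. EX g:Hom ht W X. is_cokernel ht W X g Y f" if m: "epic ht X Y f" for f
 proof -
  have f: "arr f" "F {0} (dm f)" "F {0} (cd f)" "dm f = X" "cd f = Y"
   using ha[OF XY, of f] m F unfolding epic_def by auto
  obtain K u w where t: "tri K X Y u f w" "F {0} K" using epic_cone[OF f(1-3)] m f(4,5) by blast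
  note D = triD[OF t(1)]
  have "u : Hom ht K X" unfolding ht_eq using D by simp
  moreover have "K : Obj ht" unfolding ht_eq using t(2) by simp
  ultimately show ?thesis using exact_seq(4)[OF t(1) t(2) F] by blast
 qed
qed

text \<open>If all maps from objects of SS to Y vanished, then so would all maps from Y, which is
  filtered by such objects, to Y; the identity would be zero.\<close>

lemma nz_from:
 assumes Y: "F {0} Y" "\<not> null Y"
 obtains s j where "s : SS" "arr j" "dm j = s" "cd j = Y" "j ~= zz s Y"
proof (rule ccontr)
 note that0 = that
 assume n: "\<not> thesis"
 have h: "hz s Y" if "s : SS" for s
  by (rule hzI, rule ccontr) (use n that that0 in blast)
 obtain n where "flt {0} n Y" using Y(1) unfolding F_def by blast
 hence "hz Y Y"
 proof (rule filt_hz_left)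
  fix i s assume i: "i : {0::int}" "s : SS"
  show "hz (sh i s) Y"
   using hz_isom[OF h[OF i(2)] isom_sym[OF sh_0[OF SS_ob[OF i(2)]]] isom_refl[OF F_ob[OF Y(1)]]] i by simp
 qed (rule F_ob[OF Y(1)])
 thus False using null_iff_hz[OF F_ob[OF Y(1)]] Y(2) by blast
qed

text \<open>If X is simple, a nonzero map s -> X has its cone in the heart by
  \<open>flt_cone\<close>, so it is monic and hence invertible. Conversely, for a monic f: Y -> X
  with Y nonzero and X isomorphic to s, some s' -> Y -> X is nonzero, hence invertible by Schur; so
  f has a section, and being monic it is invertible.\<close>

lemma simple_iff: "simple_object ht X = (EX s:SS. isom s X)"
proof
 assume X: "simple_object ht X"
 hence F: "F {0} X" and nn: "\<not> null X"
  unfolding simple_object_def ht_eq full_sub_zero[OF HO] by auto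
 obtain s j where s: "s : SS" and j: "arr j" "dm j = s" "cd j = X" "j ~= zz s X" by (rule nz_from[OF F nn])
 have Fs: "F {0} s" by (rule F_SS[OF s]) simp
 obtain n where n: "flt {0} n X" using F unfolding F_def by blast
 obtain C v w where t: "tri s X C j v w" using tri_complete[OF j(1)] j by auto
 have "F {0} C" using flt_cone[OF n _ s sh_0[OF SS_ob[OF s]] t j(4)] FI by auto
 hence "monic ht s X j" by (rule exact_seq(1)[OF t Fs F])
 moreover have "\<not> zero_object ht s" using SS_nn[OF s] unfolding ht_eq full_sub_zero[OF HO] by blast
 moreover have "s : Obj ht" using Fs unfolding ht_eq by simp
 ultimately have "is_iso ht s X j" using X unfolding simple_object_def by blast
 hence "iso j" using full_sub_is_iso[OF HO, of s X j] Fs F unfolding ht_eq by simp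
 thus "EX s:SS. isom s X" using s isomI[OF _ j(2,3)] by blast
next
 assume "EX s:SS. isom s X"
 then obtain s where s: "s : SS" "isom s X" by blast
 have F: "F {0} X" by (rule F_isom[OF F_SS[OF s(1)] s(2)]) simp
 have nn: "\<not> null X" using SS_nn[OF s(1)] null_isom[OF _ isom_sym[OF s(2)]] by blast
 show "simple_object ht X"
  unfolding simple_object_def
 proof (intro conjI ballI allI impI)
  show "X : Obj ht" unfolding ht_eq using F by simp
  show "\<not> zero_object ht X" unfolding ht_eq full_sub_zero[OF HO] using nn by blast
  fix Y f assume Y: "Y : Obj ht" and m: "monic ht Y X f"
  have FY: "F {0} Y" using Y unfolding ht_eq by simp
  have f: "arr f" "dm f = Y" "cd f = X"
   and mono: "!!g. arr g ==> F {0} (dm g) ==> cd g = Y ==> f ** g = zz (dm g) X ==> g = zz (dm g) Y"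
   using m full_sub_monic[OF HO, of Y X f] FY F unfolding ht_eq by auto
  show "zero_object ht Y \<or> is_iso ht Y X f"
  proof (rule disjCI)
   assume "\<not> is_iso ht Y X f"
   hence ni: "\<not> iso f" using full_sub_is_iso[OF HO, of Y X f] FY F f unfolding ht_eq by simp
   have "null Y"
   proof (rule ccontr)
    assume "\<not> null Y"
    then obtain s' j where s': "s' : SS" and j: "arr j" "dm j = s'" "cd j = Y" "j ~= zz s' Y"
     by (rule nz_from[OF FY])
    have Fs: "F {0} s'" by (rule F_SS[OF s']) simp
    have "f ** j ~= zz s' X" using mono[OF j(1)] j Fs by auto
    moreover have "nzi s' X" by (rule nzi_isom[OF SS_nzi[OF s' s(1)] isom_refl[OF SS_ob[OF s']] s(2)])
    ultimately have i: "iso (f ** j)" using nziD[of s' X "f ** j"] f j by simp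
    let ?r = "j ** iv (f ** j)"
    have r: "arr ?r" "dm ?r = X" "cd ?r = Y" using i f j by simp_all
    have fr: "f ** ?r = idn X" using iv_simps(5)[OF i] assoc[of "iv (f ** j)" j f] i f j by simp
    have "f ** (?r ** f \<boxplus> ng (idn Y)) = zz Y X"
     using assoc[of f ?r f] r f fr F_ob[OF FY] by (simp del: assoc)
    hence "?r ** f \<boxplus> ng (idn Y) = zz Y Y"
     using mono[of "?r ** f \<boxplus> ng (idn Y)"] r f FY F_ob[OF FY] by (simp del: assoc)
    hence "?r ** f = idn Y" using diff_zero[of "?r ** f" "idn Y"] r f F_ob[OF FY] by (simp del: assoc)
    hence "iso f" using fr r f by (intro isoI[of f ?r]) (simp_all del: assoc)
    thus False using ni by blast
   qed
   thus "zero_object ht Y" unfolding ht_eq full_sub_zero[OF HO] using FY by blast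
  qed
 qed
qed

text \<open>A filtration in the single degree 0 is a composition series, since each of its triangles
  is a short exact sequence with a simple cokernel.\<close>

lemma flt_length:
 assumes "flt {0} n X"
 shows "EX Y m. (\<forall>i\<le>n. F {0} (Y i)) & null (Y 0) & Y n = X &
  (\<forall>i<n. monic ht (Y i) (Y (Suc i)) (m i) &
   (EX S q. simple_object ht S & is_cokernel ht (Y i) (Y (Suc i)) (m i) S q))"
 using assms
proof (induction rule: filt.induct)
 case (zero X)
 thus ?case using F_null[OF zero] by (intro exI[of _ "%_. X"]) auto
next
 case (app n X X' Q j s)
 then obtain Y m where Y: "!!i. i \<le> n ==> F {0} (Y i)" "null (Y 0)" "Y n = X"
  and m: "!!i. i < n ==> monic ht (Y i) (Y (Suc i)) (m i) &
   (EX S q. simple_object ht S & is_cokernel ht (Y i) (Y (Suc i)) (m i) S q)" by blast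
 obtain u v w where t: "tri X X' Q u v w" using app.hyps(2) by (rule trioE)
 have FX: "F {0} X" "F {0} X'" using FI[OF app.hyps(1)] FI[OF filt.app[OF app.hyps]] .
 have iQ: "isom s Q" using isom_trans[OF isom_sym[OF sh_0[OF SS_ob[OF app.hyps(5)]]]] app.hyps(3,4) by simp
 have FQ: "F {0} Q" by (rule F_isom[OF F_SS[OF app.hyps(5)] iQ]) simp
 note e = exact_seq(1,4)[OF t FX FQ]
 have sQ: "simple_object ht Q" using simple_iff app.hyps(5) iQ by blast
 let ?Y = "%i. if i \<le> n then Y i else X'" and ?m = "%i. if i < n then m i else u"
 have "monic ht (?Y i) (?Y (Suc i)) (?m i) &
   (EX S q. simple_object ht S & is_cokernel ht (?Y i) (?Y (Suc i)) (?m i) S q)" if "i < Suc n" for i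
 proof (cases "i < n")
  case True
  thus ?thesis using m[OF True] by simp
 next
  case False
  hence "i = n" using that by simp
  thus ?thesis using e sQ Y(3) by auto
 qed
 moreover have "\<forall>i\<le>Suc n. F {0} (?Y i)" using Y(1) FX by simp
 ultimately show ?case using Y(2) by (intro exI[of _ ?Y] exI[of _ ?m]) simp
qed

lemma length_cat: "length_category ht"
 unfolding length_category_def
proof (intro conjI ballI abelian)
 fix X assume "X : Obj ht"
 then obtain n where "flt {0} n X" unfolding ht_eq F_def by auto
 from flt_length[OF this] obtain Y m where "\<forall>i\<le>n. F {0} (Y i)" "null (Y 0)" "Y n = X"
  "\<forall>i<n. monic ht (Y i) (Y (Suc i)) (m i) &
   (EX S q. simple_object ht S & is_cokernel ht (Y i) (Y (Suc i)) (m i) S q)" by blast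
 moreover have "zero_object ht (Y 0)" "\<forall>i\<le>n. Y i : Obj ht"
  using calculation(1,2) unfolding ht_eq full_sub_zero[OF HO] by auto
 ultimately show "finite_length ht X" unfolding finite_length_def by blast
qed

text \<open>For a nonzero summand X of G, the projection from G is detected by some s -> G, and the
  resulting s -> X -> G is detected by some G -> s'. The composite s -> s' is invertible by Schur,
  so s splits off X and is all of it. Conversely Schur makes each projector of such an X zero or
  invertible, so one of two complementary summands is null.\<close>

lemma indecomposable_iff:
 "(indecomposable per0 X & direct_summand per0 X G) = (EX s:SS. isom s X)"
proof -
 note O = F_Obj[of UNIV]
 have GU: "F UNIV G" by (rule G_F) simp
 have sm: "F UNIV Y & F UNIV Z" if "is_biproduct T Y Z M" "F UNIV M" for Y Z M
  using F_summand[OF that(2,1)] F_summand[OF that(2) is_biproduct_sym[OF that(1)]] by simp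
 have ds: "direct_summand per0 X G = (EX Z. is_biproduct T X Z G)" for X
  unfolding direct_summand_def per_eq full_sub_biprod[OF O]
 proof (intro iffI; elim exE conjE)
  fix Z assume Z: "is_biproduct T X Z G"
  from sm[OF Z GU] Z GU show "EX Z. X : {X. F UNIV X} & Z : {X. F UNIV X} & G : {X. F UNIV X} & is_biproduct T X Z G"
   by (intro exI[of _ Z]) simp
 qed blast
 have ind: "indecomposable per0 X = (F UNIV X & \<not> null X & (ALL Y Z. is_biproduct T Y Z X --> null Y \<or> null Z))" for X
 proof (cases "F UNIV X")
  case True
  have "is_biproduct per0 Y Z X = is_biproduct T Y Z X" for Y Z
   unfolding per_eq full_sub_biprod[OF O] using sm[OF _ True, of Y Z] True by auto
  moreover have "is_biproduct T Y Z X ==> (zero_object per0 Y \<or> zero_object per0 Z) = (null Y \<or> null Z)" for Y Z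
   unfolding per_eq full_sub_zero[OF O] using sm[OF _ True, of Y Z] by simp
  moreover have "zero_object per0 X = null X" "X : Obj per0"
   unfolding per_eq full_sub_zero[OF O] using True by simp_all
  ultimately show ?thesis unfolding indecomposable_def using True by (simp cong: imp_cong)
 next
  case False
  thus ?thesis unfolding indecomposable_def per_eq by simp
 qed
 show ?thesis
 proof
  assume "indecomposable per0 X & direct_summand per0 X G"
  then obtain Z where X: "F UNIV X" "\<not> null X" "!!Y Z. is_biproduct T Y Z X ==> null Y \<or> null Z"
   and Z: "is_biproduct T X Z G" unfolding ds ind by blast
  obtain i1 p1 where B: "arr i1" "dm i1 = X" "cd i1 = G" "arr p1" "dm p1 = G" "cd p1 = X" "p1 ** i1 = idn X"
   using Z by (rule biprodE)
  have oX: "ob X" using F_ob[OF X(1)] .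
  have "p1 ~= zz G (cd p1)"
  proof
   assume z: "p1 = zz G (cd p1)"
   have "idn X = zz G X ** i1" using z B by simp
   thus False using X(2) B oX by (simp add: null_def)
  qed
  then obtain s a where s: "s : SS" and a: "arr a" "dm a = s" "cd a = G" "p1 ** a ~= zz s (cd p1)"
   using G_dom[OF B(4,5)] by blast
  let ?t = "p1 ** a"
  have t: "arr ?t" "dm ?t = s" "cd ?t = X" "?t ~= zz s X" using a B by simp_all
  have pit: "p1 ** (i1 ** ?t) = ?t" using assoc[of ?t i1 p1] t B by (simp del: assoc)
  have "i1 ** ?t ~= zz (dm (i1 ** ?t)) G"
  proof
   assume z: "i1 ** ?t = zz (dm (i1 ** ?t)) G"
   have "?t = p1 ** zz s G" using pit z t B by simp
   thus False using t(4) B SS_ob[OF s] by simp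
  qed
  then obtain s' b where s': "s' : SS" and b: "arr b" "dm b = G" "cd b = s'" "b ** (i1 ** ?t) ~= zz (dm (i1 ** ?t)) s'"
   using G_cod[of "i1 ** ?t"] t B by auto
  have i: "iso (b ** (i1 ** ?t))" using nziD[OF SS_nzi[OF s s'], of "b ** (i1 ** ?t)"] b t B by simp
  \<comment> \<open>A retraction of \<open>?t\<close>; its fibre is the complement of s in X, null
    by indecomposability.\<close>
  let ?sg = "iv (b ** (i1 ** ?t)) ** (b ** i1)"
  have sg: "arr ?sg" "dm ?sg = X" "cd ?sg = s" using i b t B by simp_all
  have st: "?sg ** ?t = idn s" using iv_simps(4)[OF i] i b t B by simp
  obtain C v w where tr: "tri X s C ?sg v w" using tri_complete[OF sg(1)] unfolding sg(2,3) by blast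
  obtain C' where C': "ob C'" "isom C (S C')" using unS triD(12)[OF tr] by blast
  obtain e w' where tr': "tri C' X s w' ?sg (e ** v)" using tri_unrot'[OF tr C'(2,1)] by metis
  have "is_biproduct T C' s X" by (rule tri_split[OF tr' t(1-3) st])
  hence "null C'" using X(3) SS_nn[OF s] by blast
  from trio_null1[OF trioI[OF tr'] this] have "isom s X" by (rule isom_sym)
  thus "EX s:SS. isom s X" using s by blast
 next
  assume "EX s:SS. isom s X"
  then obtain s where s: "s : SS" "isom s X" by blast
  obtain Z where "is_biproduct T s Z G" using SS_G[OF s(1)] by blast
  from biprod_isom_left[OF this s(2)] have d: "direct_summand per0 X G" unfolding ds by (rule exI)
  have nn: "\<not> null X"
   by (rule notI, drule null_isom[OF _ isom_sym[OF s(2)]]) (rule notE[OF SS_nn[OF s(1)]])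
  have FX: "F UNIV X" by (rule F_isom[OF F_SS[OF s(1)] s(2)]) simp
  have "null Y \<or> null Z" if b: "is_biproduct T Y Z X" for Y Z
  proof -
   obtain i1 i2 p1 p2 where B: "arr i1" "dm i1 = Y" "cd i1 = X" "arr i2" "dm i2 = Z" "cd i2 = X"
    "arr p1" "dm p1 = X" "cd p1 = Y" "arr p2" "dm p2 = X" "cd p2 = Z"
    "p1 ** i1 = idn Y" "p2 ** i2 = idn Z" "p2 ** i1 = zz Y Z"
    using b by (rule biprodE)
   have o: "ob X" "ob Y" "ob Z" using b by (auto simp: is_biproduct_def)
   have nz: "nzi X X" by (rule nzi_isom[OF SS_nzi[OF s(1,1)] s(2,2)])
   show ?thesis
   proof (cases "i1 ** p1 = zz X X")
    case True
    have "idn Y = p1 ** ((i1 ** p1) ** i1)" using B by simp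
    hence "idn Y = zz Y Y" unfolding True using B o by simp
    thus ?thesis using o by (simp add: null_def)
   next
    case False
    hence i: "iso (i1 ** p1)" using nziD[OF nz, of "i1 ** p1"] B by simp
    have "p2 ** (i1 ** p1) = (p2 ** i1) ** p1" using B(1-12) by simp
    also have "... = zz X Z ** (i1 ** p1)" unfolding B(15) using B(1-12) o by simp
    finally have "p2 ** (i1 ** p1) = zz X Z ** (i1 ** p1)" .
    from iso_epi[OF i _ _ _ _ this] have "p2 = zz X Z" using B o by simp
    hence "p2 ** i2 = zz Z Z" using B(1-6) o by simp
    hence "idn Z = zz Z Z" unfolding B(14) .
    thus ?thesis using o by (simp add: null_def)
   qed
  qed
  hence "indecomposable per0 X" unfolding ind using nn FX by (intro conjI allI impI)
  thus "indecomposable per0 X & direct_summand per0 X G" using d by (rule conjI)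
 qed
qed

theorem main:
 "bounded_t_structure per0 la ra & length_category ht &
 {X. simple_object ht X} = {X. indecomposable per0 X & direct_summand per0 X G}"
proof (rule conjI[OF bounded conjI[OF length_cat]])
 show "{X. simple_object ht X} = {X. indecomposable per0 X & direct_summand per0 X G}"
  by (simp only: simple_iff indecomposable_iff)
qed

end

section \<open>Decomposing an object along split orthogonal idempotents\<close>

primrec (in pcat) psum where
 "psum X Y f 0 = zz X Y"
| "psum X Y f (Suc n) = psum X Y f n \<boxplus> f n"

lemma (in pcat) psum_simps [simp]:
 assumes "ob X" "ob Y" "!!i. i < n ==> ar (f i) X Y"
 shows "arr (psum X Y f n)" "dm (psum X Y f n) = X" "cd (psum X Y f n) = Y"
proof -
 have "arr (psum X Y f n) & dm (psum X Y f n) = X & cd (psum X Y f n) = Y"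
  using assms(3)
 proof (induction n)
  case (Suc n)
  hence "arr (psum X Y f n)" "dm (psum X Y f n) = X" "cd (psum X Y f n) = Y" by auto
  moreover have "arr (f n)" "dm (f n) = X" "cd (f n) = Y" using Suc.prems[of n] by (auto simp: ar_iff)
  ultimately show ?case by simp
 qed (use assms in simp)
 thus "arr (psum X Y f n)" "dm (psum X Y f n) = X" "cd (psum X Y f n) = Y" by auto
qed

lemma (in pcat) psum_cmp_left:
 assumes "ob X" "ob Y" "!!i. i < n ==> ar (f i) X Y" "arr g" "dm g = Y"
 shows "g ** psum X Y f n = psum X (cd g) (%i. g ** f i) n"
 using assms(3)
proof (induction n)
 case (Suc n)
 have f: "arr (f n)" "dm (f n) = X" "cd (f n) = Y" using Suc.prems[of n] by (auto simp: ar_iff)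
 have "arr (psum X Y f n)" "dm (psum X Y f n) = X" "cd (psum X Y f n) = Y"
  using psum_simps[OF assms(1,2), of n f] Suc.prems by auto
 thus ?case using Suc f assms by simp
qed (use assms in simp)

lemma (in pcat) psum_cmp_right:
 assumes "ob X" "ob Y" "!!i. i < n ==> ar (f i) X Y" "arr g" "cd g = X"
 shows "psum X Y f n ** g = psum (dm g) Y (%i. f i ** g) n"
 using assms(3)
proof (induction n)
 case (Suc n)
 have f: "arr (f n)" "dm (f n) = X" "cd (f n) = Y" using Suc.prems[of n] by (auto simp: ar_iff)
 have "arr (psum X Y f n)" "dm (psum X Y f n) = X" "cd (psum X Y f n) = Y"
  using psum_simps[OF assms(1,2), of n f] Suc.prems by auto
 thus ?case using Suc f assms by simp
qed (use assms in simp)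

lemma (in pcat) psum_zz:
 assumes "ob X" "ob Y" "!!i. i < n ==> f i = zz X Y" shows "psum X Y f n = zz X Y"
 using assms(3) by (induction n) (use assms(1,2) in simp_all)

lemma (in pcat) psum_cong:
 assumes "!!i. i < n ==> f i = g i" shows "psum X Y f n = psum X Y g n"
 using assms by (induction n) simp_all

context tricat0 begin

lemma section_fiber:
 assumes p: "arr p" "dm p = X" "cd p = Z" and i: "arr i" "dm i = Z" "cd i = X" and pi: "p ** i = idn Z"
 shows "EX Y a. tri Y X Z a p (zz Z (S Y)) & is_biproduct T Y Z X"
proof -
 obtain C v w where t: "tri X Z C p v w" using tri_complete[OF p(1)] p(2,3) by blast
 obtain Y where Y: "ob Y" "isom C (S Y)" using unS triD(12)[OF t] by blast
 obtain e a where a: "tri Y X Z a p (e ** v)" using tri_unrot'[OF t Y(2,1)] by metis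
 note D = triD[OF a]
 have "((e ** v) ** p) ** i = (e ** v) ** (p ** i)" by (rule assoc) (use D i in simp_all)
 hence "e ** v = zz X (S Y) ** i" unfolding pi tri_wv[OF a] using D by simp
 hence "e ** v = zz Z (S Y)" using i D by simp
 hence t': "tri Y X Z a p (zz Z (S Y))" using a by simp
 show ?thesis by (rule exI, rule exI, rule conjI[OF t' tri_split[OF a i pi]])
qed

text \<open>The last summand is split off as the top layer. The remaining inclusions lift to the
  fibre Y of the last projection, and the lifted data again decompose the identity of Y because a,
  the inclusion of Y, annihilates no nonzero arrow.\<close>

lemma filt_of_sum:
 assumes "ob X" and io: "!!i. i < n ==> ar (jo i) (s i) X" and pi: "!!i. i < n ==> ar (pi i) X (s i)"
  and on: "!!i. i < n ==> pi i ** jo i = idn (s i)"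
  and off: "!!i j. i < n ==> j < n ==> i ~= j ==> pi i ** jo j = zz (s j) (s i)"
  and sum: "psum X X (%i. jo i ** pi i) n = idn X"
  and SS: "!!i. i < n ==> s i : SS" "0 : I"
 shows "filt SS I n X"
 using assms(1-7)
proof (induction n arbitrary: X jo pi)
 case 0
 hence "null X" by (simp add: null_def)
 thus ?case by (rule filt.zero)
next
 case (Suc n)
 note sum = Suc.prems(6)
 have io: "arr (jo i)" "dm (jo i) = s i" "cd (jo i) = X" if "i < Suc n" for i
  using Suc.prems(2)[OF that] by (simp_all add: ar_iff)
 have pi: "arr (pi i)" "dm (pi i) = X" "cd (pi i) = s i" if "i < Suc n" for i
  using Suc.prems(3)[OF that] by (simp_all add: ar_iff)
 have on: "pi i ** jo i = idn (s i)" if "i < Suc n" for i by (rule Suc.prems(4)[OF that])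
 obtain Y a where t: "tri Y X (s n) a (pi n) (zz (s n) (S Y))"
  using section_fiber[OF pi[of n] io[of n] on[of n]] by blast
 note D = triD[OF t]
 have ex: "EX g. arr g & dm g = s i & cd g = Y & a ** g = jo i" if "i < n" for i
 proof -
  have i: "i < Suc n" "n ~= i" using that by auto
  have "pi n ** jo i = zz (dm (jo i)) (s n)" using Suc.prems(5)[OF _ i] io[OF i(1)] by simp
  from tri_exact[OF t io(1,3)[OF i(1)] this] io(2)[OF i(1)] show ?thesis by metis
 qed
 then obtain g where g: "!!i. i < n ==> arr (g i) & dm (g i) = s i & cd (g i) = Y & a ** g i = jo i"
  by metis
 have ps: "psum X X (%i. jo i ** pi i) n ** a = a"
 proof -
  let ?P = "psum X X (%i. jo i ** pi i) n"
  have P: "arr ?P" "dm ?P = X" "cd ?P = X"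
   using psum_simps[OF \<open>ob X\<close> \<open>ob X\<close>, of n "%i. jo i ** pi i"] io pi by (auto simp: ar_iff)
  have "(jo n ** pi n) ** a = jo n ** (pi n ** a)" by (rule assoc) (use D io[of n] in simp_all)
  hence z: "(jo n ** pi n) ** a = zz Y X" unfolding tri_vu[OF t] using io[of n] D by simp
  have "(?P \<boxplus> jo n ** pi n) ** a = ?P ** a \<boxplus> (jo n ** pi n) ** a"
   by (rule dist2) (use P io[of n] pi[of n] D in simp_all)
  thus ?thesis using sum z P D by simp
 qed
 have "filt SS I n Y"
 proof (rule Suc.IH[of Y g "%i. pi i ** a"])
  show "ob Y" using D by simp
  show "ar (g i) (s i) Y" if "i < n" for i using g[OF that] by (simp add: ar_iff)
  show "ar (pi i ** a) Y (s i)" if "i < n" for i using pi[of i] that D by (simp add: ar_iff)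
  show "(pi i ** a) ** g i = idn (s i)" if "i < n" for i
   using g[OF that] pi[of i] on[of i] that D by simp
  show "(pi i ** a) ** g j = zz (s j) (s i)" if "i < n" "j < n" "i ~= j" for i j
   using g[OF that(2)] pi[of i] Suc.prems(5)[of i j] that D by simp
  show "psum Y Y (%i. g i ** (pi i ** a)) n = idn Y"
  proof -
   let ?Q = "psum Y Y (%i. g i ** (pi i ** a)) n"
   have ga: "ar (g i ** (pi i ** a)) Y Y" if "i < n" for i
    using g[OF that] pi[of i] that D by (simp add: ar_iff)
   have Q: "arr ?Q" "dm ?Q = Y" "cd ?Q = Y"
    using psum_simps[OF \<open>ob Y\<close> \<open>ob Y\<close>, of n "%i. g i ** (pi i ** a)"] ga by auto
   have "a ** ?Q = psum Y X (%i. a ** (g i ** (pi i ** a))) n"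
    using psum_cmp_left[OF \<open>ob Y\<close> \<open>ob Y\<close> ga D(1,4)] D by simp
   also have "... = psum Y X (%i. (jo i ** pi i) ** a) n"
   proof (rule psum_cong)
    fix i assume i: "i < n"
    have gi: "arr (g i)" "dm (g i) = s i" "cd (g i) = Y" and ag: "a ** g i = jo i" using g[OF i] by auto
    have "a ** (g i ** (pi i ** a)) = (a ** g i) ** (pi i ** a)" using gi pi[of i] i D by simp
    also have "... = (jo i ** pi i) ** a" unfolding ag using pi[of i] io[of i] i D by simp
    finally show "a ** (g i ** (pi i ** a)) = (jo i ** pi i) ** a" .
   qed
   also have "... = psum X X (%i. jo i ** pi i) n ** a"
    using psum_cmp_right[OF \<open>ob X\<close> \<open>ob X\<close> _ D(1,5), of n "%i. jo i ** pi i"] io pi D by (simp add: ar_iff)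
   finally have e: "a ** ?Q = a" using ps by simp
   have "a ** (?Q \<boxplus> ng (idn Y)) = zz Y X" using e Q D by simp
   hence "?Q \<boxplus> ng (idn Y) = zz Y Y"
    using tri_mono_of_w_zero[OF t refl, of "?Q \<boxplus> ng (idn Y)"] Q D by simp
   thus ?thesis using diff_zero[of ?Q "idn Y"] Q D by simp
  qed
  show "s i : SS" if "i < n" for i using Suc.prems(7)[of i] that by simp
 qed
 moreover have "isom (sh 0 (s n)) (s n)" using sh_0 D by blast
 ultimately show ?case by (rule filt.app[OF _ trioI[OF t] _ SS(2) Suc.prems(7)]) simp
qed

text \<open>Splittings of the idempotents E i form a simple-minded collection: an arrow s i -> s j
  corresponds to an element of the corner E j End(G) E i, where \<open>idems\<close> provides
  inverses.\<close>

lemma smcI: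
 assumes G: "ob G" and io: "!!i. i < n ==> ar (jo i) (s i) G" and pi: "!!i. i < n ==> ar (pi i) G (s i)"
  and on: "!!i. i < n ==> pi i ** jo i = idn (s i)"
  and E: "!!i. i < n ==> jo i ** pi i = E i"
  and id: "idems {x. ar x G G} (Cmp T) (zz G G) n E"
  and sum: "psum G G E n = idn G"
  and neg: "!!m. m < 0 ==> hz G (sh m G)"
 shows "smc T sus (s ` {..<n}) G"
proof -
 have EE: "!!i j. i < n ==> j < n ==> i ~= j ==> E i ** E j = zz G G"
  and nz: "!!i. i < n ==> E i ~= zz G G"
  and corner: "!!i j x. i < n ==> j < n ==> ar x G G ==> E j ** x = x ==> x ** E i = x ==> x ~= zz G G ==>
   EX y. ar y G G & x ** y = E j & y ** x = E i"
  using id unfolding idems_def by auto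
 have io: "arr (jo i)" "dm (jo i) = s i" "cd (jo i) = G" if "i < n" for i
  using io[OF that] by (simp_all add: ar_iff)
 have pi: "arr (pi i)" "dm (pi i) = G" "cd (pi i) = s i" if "i < n" for i
  using pi[OF that] by (simp_all add: ar_iff)
 have so: "ob (s i)" if "i < n" for i using arr_obj(1)[OF io(1)[OF that]] io(2)[OF that] by simp
 have sG: "EX Z. is_biproduct T (s i) Z G" if "i < n" for i
 proof -
  from section_fiber[OF pi[OF that] io[OF that] on[OF that]] obtain Y where "is_biproduct T Y (s i) G" by blast
  thus ?thesis using is_biproduct_sym by blast
 qed
 have pj: "pi i ** (jo i ** h) = h" if "i < n" "arr h" "cd h = s i" for i h
  using assoc[of h "jo i" "pi i"] on io pi that by (simp del: assoc)
 have off: "pi i ** jo j = zz (s j) (s i)" if ij: "i < n" "j < n" "i ~= j" for i j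
 proof -
  have "pi i ** jo j = pi i ** ((E i ** E j) ** jo j)"
   using io pi ij so by (simp add: E[symmetric] pj on)
  thus ?thesis unfolding EE[OF ij] using io pi ij G so by simp
 qed
 have sumx: "psum G G (%i. jo i ** pi i) n = idn G" unfolding sum[symmetric] by (rule psum_cong) (rule E)
 have nzi: "nzi (s i) (s j)" if ij: "i < n" "j < n" for i j
 proof (rule nziI)
  fix f assume f: "arr f" "dm f = s i" "cd f = s j" "f ~= zz (s i) (s j)"
  let ?x = "jo j ** (f ** pi i)"
  note s = f(1-3) io pi ij so G
  have x: "arr ?x" "dm ?x = G" "cd ?x = G" using s by simp_all
  have fx: "pi j ** (?x ** jo i) = f" using s by (simp add: pj on)
  have "?x ~= zz G G"
  proof
   assume "?x = zz G G"
   from fx[unfolded this] show False using f(4) s by simp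
  qed
  moreover have "E j ** ?x = ?x" "?x ** E i = ?x" using s by (simp_all add: E[symmetric] pj)
  ultimately obtain y where "ar y G G" and y: "?x ** y = E j" "y ** ?x = E i"
   using corner[OF ij, of ?x] x by (auto simp: ar_iff)
  hence y': "arr y" "dm y = G" "cd y = G" by (simp_all add: ar_iff)
  let ?g = "pi i ** (y ** jo j)"
  show "iso f"
  proof (rule isoI[of f ?g])
   have "f ** ?g = pi j ** ((?x ** y) ** jo j)" using s y' by (simp add: pj)
   thus "f ** ?g = idn (cd f)" unfolding y using s by (simp add: E[symmetric] pj on)
   have "?g ** f = pi i ** ((y ** ?x) ** jo i)" using s y' by (simp add: on)
   thus "?g ** f = idn (dm f)" unfolding y using s by (simp add: E[symmetric] pj on)
  qed (use s y' in simp_all)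
 qed
 show ?thesis
 proof (intro smc.intro smc_axioms.intro)
  show "tricat0 T sus" by (rule tricat0_axioms)
  show "ob x" if "x : s ` {..<n}" for x using that so by auto
  show "\<not> null x" if x: "x : s ` {..<n}" for x
  proof
   assume N: "null x"
   obtain i where i: "i < n" "x = s i" using x by auto
   have "pi i = zz G (s i)" using null_arr(2)[OF N pi(1)[OF i(1)]] pi[OF i(1)] i(2) by simp
   hence "E i = zz G G" unfolding E[OF i(1), symmetric] using io[OF i(1)] G so[OF i(1)] by simp
   thus False using nz[OF i(1)] by blast
  qed
  show "nzi x y" if "x : s ` {..<n}" "y : s ` {..<n}" for x y using that nzi by auto
  show "hz x (sh m y)" if xy: "x : s ` {..<n}" "y : s ` {..<n}" "m < 0" for x y m
  proof -
   obtain i j where i: "i < n" "x = s i" and j: "j < n" "y = s j" using xy by auto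
   obtain Z where Z: "is_biproduct T x Z G" using sG[OF i(1)] i(2) by blast
   obtain Z' where Z': "is_biproduct T y Z' G" using sG[OF j(1)] j(2) by blast
   have o: "ob x" "ob y" using so i j by auto
   \<comment> \<open>The shift is then moved from the target to the source, since y is known to be a
     summand of G itself and not yet its shift of a shift of G; afterwards it is moved back.\<close>
   have "hz x (sh m G)" by (rule hz_biprod(1)[OF Z neg[OF xy(3)]])
   hence "hz (sh (- m) x) (sh 0 G)" using hz_sh2[OF o(1) G, of "- m" 0] by simp
   hence "hz (sh (- m) x) G" by (rule hz_isom[OF _ isom_refl[OF sh_ob[OF o(1)]] sh_0[OF G]])
   hence "hz (sh (- m) x) y" by (rule hz_biprod(2)[OF Z'])
   hence "hz (sh (- m) x) (sh 0 y)" by (rule hz_isom[OF _ isom_refl[OF sh_ob[OF o(1)]] isom_sym[OF sh_0[OF o(2)]]])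
   thus ?thesis using hz_sh2[OF o, of "- m" 0] by simp
  qed
  show "EX Z. is_biproduct T x Z G" if "x : s ` {..<n}" for x using that sG by auto
  show "EX n'. filt (s ` {..<n}) {0} n' G"
   by (rule exI, rule filt_of_sum[OF G _ _ on off sumx]) (use io pi in "auto simp: ar_iff")
  show "EX x a. x : s ` {..<n} & arr a & dm a = x & cd a = G & p ** a ~= zz x (cd p)"
   if p: "arr p" "dm p = G" "p ~= zz G (cd p)" for p
  proof (rule ccontr)
   assume "\<not> ?thesis"
   hence z: "p ** jo i = zz (s i) (cd p)" if "i < n" for i using io[OF that] that by auto
   have "p = p ** psum G G (%i. jo i ** pi i) n" unfolding sumx using p by simp
   also have "... = psum G (cd p) (%i. p ** (jo i ** pi i)) n"
    by (rule psum_cmp_left[OF G G _ p(1,2)]) (use io pi in "simp add: ar_iff")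
   also have "... = zz G (cd p)"
   proof (rule psum_zz[OF G arr_obj(2)[OF p(1)]])
    fix i assume i: "i < n"
    have "p ** (jo i ** pi i) = (p ** jo i) ** pi i" using p io pi i by simp
    thus "p ** (jo i ** pi i) = zz G (cd p)" unfolding z[OF i] using pi[OF i] p by simp
   qed
   finally show False using p(3) by blast
  qed
  show "EX x a. x : s ` {..<n} & arr a & dm a = G & cd a = x & a ** p ~= zz (dm p) x"
   if p: "arr p" "cd p = G" "p ~= zz (dm p) G" for p
  proof (rule ccontr)
   assume "\<not> ?thesis"
   hence z: "pi i ** p = zz (dm p) (s i)" if "i < n" for i using pi[OF that] that by auto
   have "p = psum G G (%i. jo i ** pi i) n ** p" unfolding sumx using p by simp
   also have "... = psum (dm p) G (%i. (jo i ** pi i) ** p) n"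
    by (rule psum_cmp_right[OF G G _ p(1,2)]) (use io pi in "simp add: ar_iff")
   also have "... = zz (dm p) G"
   proof (rule psum_zz[OF arr_obj(1)[OF p(1)] G])
    fix i assume i: "i < n"
    have "(jo i ** pi i) ** p = jo i ** (pi i ** p)" using p io pi i by simp
    thus "(jo i ** pi i) ** p = zz (dm p) G" unfolding z[OF i] using io[OF i] p by simp
   qed
   finally show False using p(3) by blast
  qed
 qed
qed

end

text \<open>\<open>e\<close> places the free module in \<open>'m\<close>, and \<open>en\<close>
  codes the stages of a sequential colimit.\<close>

locale dgi = dgc k A pr
 for k :: "'k ring" and A :: "('k, 'a) dga" and pr :: "'m \<times> 'm => 'm" +
 fixes e :: "'a => 'm" and en :: "nat => 'm"
 assumes inj_e: "inj e" and inj_en: "inj en"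
begin

abbreviation R :: "('k, 'a, 'm) dgm" where "R \<equiv> regular_dgm e A"
definition ei :: "'m => 'a" where "ei = the_inv e"

lemma ei_e [simp]: "ei (e a) = a"
 by (simp add: ei_def the_inv_f_f inj_e)

lemma e_eq [simp]: "(e a = e b) = (a = b)"
 using inj_e by (simp add: inj_eq)

lemma R_sel [simp]:
 "carrier (cgr R p) = e ` cel A p"
 "zr R p = e \<zero>\<^bsub>cgr A p\<^esub>"
 "pls R p x y = e (ei x \<oplus>\<^bsub>cgr A p\<^esub> ei y)"
 "sml R p c x = e (sml A p c (ei x))"
 "cdiff R p x = e (cdiff A p (ei x))"
 "gact R p r x a = e (gmul A p r (ei x) a)"
 by (simp_all add: regular_dgm_def ei_def)

lemma A_ab: "abelian_group (cgr A p)"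
 using A_module by (rule module.axioms(2))

lemma A_linear:
 "linear_map k (cgr A p) (cgr A (p+1)) (cdiff A p)"
 "x : cel A p ==> linear_map k (cgr A r) (cgr A (p + r)) (gmul A p r x)"
 "y : cel A r ==> linear_map k (cgr A p) (cgr A (p + r)) (%x. gmul A p r x y)"
 using A_dga by (simp_all add: dg_algebra_def cochain_complex_def)

lemma A_mul_assoc: "x : cel A p ==> y : cel A r ==> z : cel A t ==>
  gmul A (p + r) t (gmul A p r x y) z = gmul A p (r + t) x (gmul A r t y z)"
 using A_dga by (simp add: dg_algebra_def)

lemma A_one [simp]: "x : cel A p ==> gmul A 0 p (gone A) x = x" "x : cel A p ==> gmul A p 0 x (gone A) = x"
 using A_dga by (simp_all add: dg_algebra_def)

lemma A_leibniz: "x : cel A p ==> y : cel A r ==> cdiff A (p + r) (gmul A p r x y) =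
  gmul A (p+1) r (cdiff A p x) y \<oplus>\<^bsub>cgr A (p + r+1)\<^esub>
   koszul_sign p (cgr A (p + r+1)) (gmul A p (r+1) x (cdiff A r y))"
 using A_dga by (simp add: dg_algebra_def)

lemma A_dd: "x : cel A p ==> cdiff A (p+1) (cdiff A p x) = \<zero>\<^bsub>cgr A (p+2)\<^esub>"
 using A_dga by (simp add: dg_algebra_def cochain_complex_def)

lemma A_closed [simp]:
 "\<zero>\<^bsub>cgr A p\<^esub> : cel A p"
 "x : cel A p ==> y : cel A p ==> apl p x y : cel A p"
 "x : cel A p ==> \<ominus>\<^bsub>cgr A p\<^esub> x : cel A p"
proof -
 interpret abelian_group "cgr A p" by (rule A_ab)
 show "\<zero>\<^bsub>cgr A p\<^esub> : cel A p"
 "x : cel A p ==> y : cel A p ==> apl p x y : cel A p"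
 "x : cel A p ==> \<ominus>\<^bsub>cgr A p\<^esub> x : cel A p" by simp_all
qed

lemma R_module: "module k (cgr R p)"
proof -
 have ab: "abelian_group (cgr R p)"
 proof -
  interpret G: abelian_group "cgr A p" by (rule A_ab)
  show ?thesis
  proof (rule abelian_groupI)
   fix x y z assume "x : cel R p" "y : cel R p" "z : cel R p"
   then obtain a b c where "a : cel A p" "b : cel A p" "c : cel A p" "x = e a" "y = e b" "z = e c" by auto
   thus "pls R p (pls R p x y) z = pls R p x (pls R p y z)" by (simp add: G.a_assoc)
  next
   fix x y assume "x : cel R p" "y : cel R p"
   then obtain a b where "a : cel A p" "b : cel A p" "x = e a" "y = e b" by auto
   thus "pls R p x y = pls R p y x" by (simp add: G.a_comm)
  next
   fix x assume "x : cel R p"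
   then obtain a where "a : cel A p" "x = e a" by auto
   thus "EX y:cel R p. pls R p y x = zr R p" by (intro bexI[of _ "e (\<ominus>\<^bsub>cgr A p\<^esub> a)"]) (simp_all add: G.l_neg)
  qed auto
 qed
 interpret M: module k "cgr A p" by (rule A_module)
 show ?thesis
  by (rule moduleI[OF k_cring ab]) (auto simp: M.smult_l_distr M.smult_r_distr M.smult_assoc1)
qed

lemma koszul_e: "x : cel A p ==> koszul_sign n (cgr R p) (e x) = e (koszul_sign n (cgr A p) x)"
proof -
 assume x: "x : cel A p"
 interpret M: abelian_group "cgr A p" by (rule A_ab)
 interpret N: module k "cgr R p" by (rule R_module)
 have "ngt R p (e x) = e (\<ominus>\<^bsub>cgr A p\<^esub> x)"
  by (rule N.minus_equality) (use x in "simp_all add: M.l_neg")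
 thus ?thesis by (simp add: koszul_sign_def)
qed

lemma DG_R [simp]: "DG R"
proof (rule DGI, goal_cases)
 case (1 p)
 show ?case by (rule R_module)
next
 case (3 p x y)
 thus ?case using linear_mapD(2)[OF A_linear(1)] by auto
next
 case (4 p c x)
 thus ?case using linear_mapD(3)[OF A_linear(1)] by auto
next
 case (5 p x)
 thus ?case by (auto simp: A_dd)
next
 case (7 p q x y a)
 thus ?case using linear_mapD(2)[OF A_linear(3)] by auto
next
 case (8 p q x a b)
 thus ?case using linear_mapD(2)[OF A_linear(2)] by auto
next
 case (9 p q c x a)
 thus ?case using linear_mapD(3)[OF A_linear(3)] by auto
next
 case (10 p q c x a)
 thus ?case using linear_mapD(3)[OF A_linear(2)] by auto
next
 case (11 p q r x a b)
 thus ?case by (auto simp: A_mul_assoc)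
next
 case (13 p q x a)
 then obtain b where b: "b : cel A p" "x = e b" by auto
 have "gmul A p (q+1) b (cdiff A q a) : cel A (p + q+1)" using b 13 by simp
 from koszul_e[OF this] show ?case using b 13 by (simp add: A_leibniz)
qed auto

lemma d_one: "cdiff A 0 (gone A) = \<zero>\<^bsub>cgr A 1\<^esub>"
proof -
 interpret M: abelian_group "cgr A 1" by (rule A_ab)
 have d: "cdiff A 0 (gone A) : cel A 1" by simp
 have "cdiff A 0 (gone A) = cdiff A 0 (gone A) \<oplus>\<^bsub>cgr A 1\<^esub> cdiff A 0 (gone A)"
  using A_leibniz[of "gone A" 0 "gone A" 0] d by (simp add: koszul_sign_def)
 thus ?thesis using d M.add.l_cancel_one by metis
qed

subsection \<open>Maps out of the free module\<close>

definition ev :: "('k, 'a, 'm) dgm => 'm => int => 'm => 'm" where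
 "ev N z p x = gact N 0 p z (ei x)"

lemma mor_ev:
 assumes N: "DG N" and z: "z : cel N 0" "cdiff N 0 z = zr N 1" shows "mor R N (ev N z)"
proof (rule morI)
 fix p q x y a
 assume x: "x : cel R p"
 then obtain b where b: "b : cel A p" "x = e b" by auto
 show "ev N z p x : cel N p" using N z b by (simp add: ev_def)
 show "ev N z p (pls R p x y) = pls N p (ev N z p x) (ev N z p y)" if "y : cel R p"
  using that N z b DG_act_add2[OF N z(1), of b p] by (auto simp: ev_def)
 show "ev N z (p + q) (gact R p q x a) = gact N p q (ev N z p x) a" if "a : cel A q"
  using that N z b DG_act_assoc[OF N z(1), of b p a q] by (simp add: ev_def)
 show "ev N z (p+1) (cdiff R p x) = cdiff N p (ev N z p x)"
  using N z b DG_leibniz[OF N z(1), of b p] by (simp add: ev_def koszul_sign_def DG_act_zero[of N b p 1, simplified] idx)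
qed (use N in simp_all)

lemma ev_one [simp]: "DG N ==> z : cel N 0 ==> ev N z 0 (e (gone A)) = z"
 by (simp add: ev_def DG_act_one)

lemma mor_R_value:
 assumes f: "mor R N f" and b: "b : cel A p" shows "f p (e b) = gact N 0 p (f 0 (e (gone A))) b"
 using ghD(3)[OF morD(4)[OF f], of "e (gone A)" 0 b p] b by simp

lemma mor_R_cocycle:
 assumes f: "mor R N f" shows "f 0 (e (gone A)) : cel N 0" "cdiff N 0 (f 0 (e (gone A))) = zr N 1"
proof -
 show "f 0 (e (gone A)) : cel N 0" using morD(5)[OF f] by simp
 show "cdiff N 0 (f 0 (e (gone A))) = zr N 1"
  using morD(7)[OF f, of "e (gone A)" 0 1] morD(8)[OF f, of 1] by (simp add: d_one)
qed

text \<open>Dg maps out of the free module are determined by the image of the cocycle 1, and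
  homotopies likewise by an element y of degree -1; so maps up to homotopy are the classes in H^0
  N.\<close>

lemma hq_R_iff:
 assumes f: "mor R N f" and g: "mor R N g"
 shows "hq R N f g = (EX y:cel N (-1). f 0 (e (gone A)) = pls N 0 (g 0 (e (gone A))) (cdiff N (-1) y))"
proof
 have N: "DG N" using morD(2)[OF f] .
 assume "hq R N f g"
 then obtain h where h: "gh (-1) R N h" and eq: "!!p x. x : cel R p ==>
   f p x = bnd R N g h p x" by (rule hqE) blast
 let ?y = "h 0 (e (gone A))"
 have y: "?y : cel N (-1)" using ghD(1)[OF h, of "e (gone A)" 0 "-1"] by simp
 have "h 1 (zr R 1) = zr N 0" using ghD(5)[OF h DG_R N, of 1] by simp
 hence "f 0 (e (gone A)) = pls N 0 (g 0 (e (gone A))) (cdiff N (-1) ?y)"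
  using eq[of "e (gone A)" 0] y N by (simp add: d_one)
 thus "EX y:cel N (-1). f 0 (e (gone A)) = pls N 0 (g 0 (e (gone A))) (cdiff N (-1) y)" using y by blast
next
 have N: "DG N" using morD(2)[OF f] .
 assume "EX y:cel N (-1). f 0 (e (gone A)) = pls N 0 (g 0 (e (gone A))) (cdiff N (-1) y)"
 then obtain y where y: "y : cel N (-1)" and eq: "f 0 (e (gone A)) = pls N 0 (g 0 (e (gone A))) (cdiff N (-1) y)" by blast
 let ?h = "%p x. gact N (-1) p y (ei x)"
 have gh: "gh (-1) R N ?h"
 proof (rule ghI[OF DG_R N])
  fix p q x x' a assume "x : cel R p"
  then obtain b where b: "b : cel A p" "x = e b" by auto
  show "?h p x : cel N (p + -1)" using N y b by simp
  show "?h p (pls R p x x') = pls N (p + -1) (?h p x) (?h p x')" if "x' : cel R p"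
   using that N y b DG_act_add2[OF N y, of b p] by auto
  show "?h (p + q) (gact R p q x a) = gact N (p + -1) q (?h p x) a" if "a : cel A q"
   using that N y b DG_act_assoc[OF N y, of b p a q] by simp
 qed
 show "hq R N f g"
 proof (rule hqI[OF f g gh])
  fix p x assume "x : cel R p"
  then obtain b where b: "b : cel A p" "x = e b" by auto
  have g0: "g 0 (e (gone A)) : cel N 0" using mor_R_cocycle[OF g] by blast
  have dy: "cdiff N (-1) y : cel N 0" using N y by simp
  have db: "cdiff A p b : cel A (p+1)" using b by simp
  have 1: "gact N 0 p (cdiff N (-1) y) b : cel N p" "gact N (-1) (p+1) y (cdiff A p b) : cel N p"
   using N y b dy by simp_all
  have "cdiff N (p - 1) (gact N (-1) p y b) = pls N p (gact N 0 p (cdiff N (-1) y) b) (ngt N p (gact N (-1) (p+1) y (cdiff A p b)))"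
   using DG_leibniz[OF N y b(1)] by (simp add: koszul_sign_def)
  hence "pls N p (cdiff N (p - 1) (gact N (-1) p y b)) (gact N (-1) (p+1) y (cdiff A p b)) = gact N 0 p (cdiff N (-1) y) b"
   using N 1 DG_ac(2)[OF N 1(1), of "ngt N p (gact N (-1) (p+1) y (cdiff A p b))" "gact N (-1) (p+1) y (cdiff A p b)"] by simp
  thus "f p x = pls N p (g p x) (pls N p (cdiff N (p - 1) (?h p x)) (?h (p+1) (cdiff R p x)))"
   unfolding b(2) mor_R_value[OF f b(1)] mor_R_value[OF g b(1)] eq
   using DG_act_add[OF N g0 dy b(1)] by simp
 qed
qed

text \<open>The cocycle 1 lifts along s up to a coboundary, and the lift defines u. Thus fractions
  with source R can be rewritten without a denominator (\<open>arr_R\<close>).\<close>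

lemma qs_section:
 assumes s: "qs P R s" obtains u where "mor R P u" "hq R R (s oo u) hid" "qs R P u"
proof -
 have sm: "mor P R s" by (rule qs_mor[OF s])
 have P: "DG P" using morD(1)[OF sm] .
 have c: "e (gone A) : cel R (-1+1)" "cdiff R (-1+1) (e (gone A)) = zr R (-1+2)" by (simp_all add: d_one)
 obtain x b where x: "x : cel P (-1+1)" "cdiff P (-1+1) x = zr P (-1+2)" "b : cel R (-1)"
  "e (gone A) = pls R (-1+1) (s (-1+1) x) (cdiff R (-1) b)" by (rule qs_surjE[OF s c]) blast
 have i: "-1+1 = (0 :: int)" "-1+2 = (1 :: int)" by simp_all
 have x: "x : cel P 0" "cdiff P 0 x = zr P 1" and b: "b : cel R (-1)"
  and eq: "e (gone A) = pls R 0 (s 0 x) (cdiff R (-1) b)"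
  using x[unfolded i] by this+
 have u: "mor R P (ev P x)" by (rule mor_ev[OF P x])
 have su: "mor R R (s oo ev P x)" by (rule mor_comp[OF u sm])
 have "hq R R hid (s oo ev P x)"
  unfolding hq_R_iff[OF mor_id[OF DG_R] su] by (rule bexI[OF _ b]) (simp only: gcomp_apply ev_one[OF P x(1)] eq[symmetric])
 hence h: "hq R R (s oo ev P x) hid" by (rule hq_sym)
 have "qs R P (ev P x)" by (rule qs_cancel[OF u s qs_hq[OF hq_sym[OF h] qs_id[OF DG_R]]])
 from that[OF u h this] show ?thesis .
qed

lemma arr_R:
 assumes "D.arr F" "D.dm F = R" obtains f where "mor R (D.cd F) f" "F = q R (D.cd F) f"
proof -
 obtain P s f where r: "rf R P (D.cd F) s f" and F: "F = cl R P (D.cd F) s f"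
  using arr_cl[OF assms(1,2) refl] .
 obtain u where u: "mor R P u" "hq R R (s oo u) hid" "qs R P u" using qs_section[OF rfD(1)[OF r]] .
 note c = cl_refine[OF r u(3)]
 have m: "mor R (D.cd F) (f oo u)" by (rule mor_comp[OF u(1) rfD(2)[OF r]])
 have "F = cl R R (D.cd F) (s oo u) (f oo u)" using F c(1) by simp
 also have "... = q R (D.cd F) (f oo u)" unfolding q_def by (rule cl_hq[OF c(2) u(2) hq_refl[OF m]])
 finally show ?thesis by (rule that[OF m])
qed

lemma q_R_eq_iff:
 assumes f: "mor R N f" and g: "mor R N g" shows "(q R N f = q R N g) = hq R N f g"
proof
 assume "q R N f = q R N g"
 then obtain Q t where t: "qs Q R t" "hq Q N (f oo t) (g oo t)" by (rule q_eqD[OF f])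
 obtain u where u: "mor R Q u" "hq R R (t oo u) hid" using qs_section[OF t(1)] .
 have "hq R N (f oo (t oo u)) (g oo (t oo u))" using hq_comp_right[OF u(1) t(2)] by (simp add: gcomp_assoc)
 moreover have "hq R N (f oo (t oo u)) f" "hq R N (g oo (t oo u)) g"
  using hq_comp_left[OF u(2) f] hq_comp_left[OF u(2) g] by simp_all
 ultimately show "hq R N f g" using hq_trans hq_sym by blast
qed (rule q_eq)

lemma coboundary_of_trivial:
 assumes "trivial_group (cohomology A m)" "x : cel A m" "cdiff A m x = \<zero>\<^bsub>cgr A (m+1)\<^esub>"
 obtains c where "c : cel A (m - 1)" "x = cdiff A (m - 1) c"
proof -
 let ?B = "coboundaries A m"
 interpret M: abelian_group "cgr A m" by (rule A_ab)
 have x: "x : cocycles A m" using assms by (simp add: cocycles_def)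
 have "?B +>\<^bsub>cgr A m\<^esub> x : carrier (cohomology A m)" using x unfolding carrier_cohomology by blast
 hence "?B +>\<^bsub>cgr A m\<^esub> x = \<one>\<^bsub>cohomology A m\<^esub>" using assms(1) by (simp add: trivial_group_def)
 also have "... = ?B" by (simp add: cohomology_def A_FactGroup_def FactGroup_def)
 finally have "?B +>\<^bsub>cgr A m\<^esub> x = ?B" .
 moreover have "x : ?B +>\<^bsub>cgr A m\<^esub> x"
 proof -
  have "cdiff A (m - 1) \<zero>\<^bsub>cgr A (m - 1)\<^esub> = \<zero>\<^bsub>cgr A m\<^esub>"
   using additive_zero_neg(1)[OF A_ab A_ab, of "m - 1" "cdiff A (m - 1)" m]
    linear_mapD(2)[OF A_linear(1)[of "m - 1"]] by simp
  hence "\<zero>\<^bsub>cgr A m\<^esub> : ?B" unfolding coboundaries_def by (metis A_closed(1) imageI)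
  thus ?thesis using assms(2) unfolding a_r_coset_def' by (force intro: bexI[of _ "\<zero>\<^bsub>cgr A m\<^esub>"])
 qed
 ultimately show ?thesis using that unfolding coboundaries_def by auto
qed

text \<open>A map from R to its m-th shift is a class in H^m A, which is trivial here.\<close>

lemma hz_shift_R:
 assumes t: "trivial_group (cohomology A m)" and F: "D.arr F" "D.dm F = R" "D.cd F = dg_shift m R"
 shows "F = HZero Der R (dg_shift m R)"
proof -
 let ?N = "dg_shift m R"
 have N: "DG ?N" by simp
 obtain f where f: "mor R ?N f" and Ff: "F = q R ?N f" using arr_R[OF F(1,2)] F(3) by metis
 obtain x where x: "x : cel A m" "f 0 (e (gone A)) = e x" using mor_R_cocycle(1)[OF f] by auto
 have "koszul_sign m (cgr R (m+1)) (e (cdiff A m x)) = zr R (m+1)"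
  using mor_R_cocycle(2)[OF f] x by (simp add: idx)
 hence k0: "koszul_sign m (cgr A (m+1)) (cdiff A m x) = \<zero>\<^bsub>cgr A (m+1)\<^esub>"
  using koszul_e[of "cdiff A m x" "m+1" m] x by simp
 have "cdiff A m x = \<zero>\<^bsub>cgr A (m+1)\<^esub>"
 proof -
  interpret G: abelian_group "cgr A (m+1)" by (rule A_ab)
  have "cdiff A m x : cel A (m+1)" using x by simp
  thus ?thesis using k0 G.minus_minus[of "cdiff A m x"] by (simp add: koszul_sign_def split: if_splits)
 qed
 then obtain c where c: "c : cel A (m - 1)" "x = cdiff A (m - 1) c" by (rule coboundary_of_trivial[OF t x(1)])
 \<comment> \<open>The sign compensates for the one in the differential of the shifted
   module.\<close>
 define y where "y = koszul_sign m (cgr R (m - 1)) (e c)"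
 have y: "y : cel ?N (-1)" unfolding y_def using c koszul_in[OF DG_R, of "e c" "m - 1" m] by simp
 have dy: "cdiff ?N (-1) y = e x"
 proof -
  have "cdiff R (m - 1) (ngt R (m - 1) (e c)) = ngt R m (cdiff R (m - 1) (e c))"
   using DG_d_neg[OF DG_R, of "e c" "m - 1"] c by simp
  moreover have "cdiff R (m - 1) (e c) : cel R m" using c by simp
  ultimately show ?thesis
   using c(2) unfolding y_def by (simp add: koszul_cases del: R_sel(2,3))
 qed
 have z: "mor R ?N (hzero ?N)" by (rule mor_zero[OF DG_R N])
 have "hq R ?N f (hzero ?N)"
  unfolding hq_R_iff[OF f z] using y dy x(2) DG_group_simps(4)[OF N, of "e x" 0] x(1)
  by (intro bexI[of _ y]) (simp_all del: R_sel(2,3))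
 thus ?thesis unfolding Ff using q_zero[OF DG_R N] q_eq by metis
qed

end

context dgi begin

lemma A_d_add: "x : cel A p ==> y : cel A p ==> cdiff A p (apl p x y) = cdiff A p x \<oplus>\<^bsub>cgr A (p+1)\<^esub> cdiff A p y"
 by (rule linear_mapD(2)[OF A_linear(1)])

lemma A_d_zero [simp]: "cdiff A p \<zero>\<^bsub>cgr A p\<^esub> = \<zero>\<^bsub>cgr A (p+1)\<^esub>"
 by (rule additive_zero_neg(1)[OF A_ab A_ab]) (simp_all add: A_d_add)

lemma A_d_neg: "x : cel A p ==> cdiff A p (\<ominus>\<^bsub>cgr A p\<^esub> x) = \<ominus>\<^bsub>cgr A (p+1)\<^esub> cdiff A p x"
 by (rule additive_zero_neg(2)[OF A_ab A_ab]) (simp_all add: A_d_add)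

lemma A_neg_zero [simp]: "\<ominus>\<^bsub>cgr A p\<^esub> \<zero>\<^bsub>cgr A p\<^esub> = \<zero>\<^bsub>cgr A p\<^esub>"
proof -
 interpret G: abelian_group "cgr A p" by (rule A_ab)
 show ?thesis by (rule G.minus_equality) simp_all
qed

lemma A_mul_zero:
 "x : cel A p ==> gmul A p r x \<zero>\<^bsub>cgr A r\<^esub> = \<zero>\<^bsub>cgr A (p + r)\<^esub>"
 "x : cel A p ==> gmul A r p \<zero>\<^bsub>cgr A r\<^esub> x = \<zero>\<^bsub>cgr A (r + p)\<^esub>"
 by (rule additive_zero_neg(1)[OF A_ab A_ab]; simp add: linear_mapD(2)[OF A_linear(2)])
  (rule additive_zero_neg(1)[OF A_ab A_ab, of r "%y. gmul A r p y x"]; simp add: linear_mapD(2)[OF A_linear(3)])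

subsection \<open>Endomorphisms of the free module\<close>

abbreviation "Z0 \<equiv> cocycles A 0"
abbreviation "B0 \<equiv> coboundaries A 0"
text \<open>The ring of 0-cocycles is named so that \<open>H0_ring A\<close> becomes literally its
  quotient by the ideal \<open>B0\<close>.\<close>

definition "ZR = \<lparr>carrier = Z0, monoid.mult = gmul A 0 0, one = gone A, zero = \<zero>\<^bsub>cgr A 0\<^esub>, add = add (cgr A 0)\<rparr>"

lemma ZR_sel [simp]: "carrier ZR = Z0" "x \<otimes>\<^bsub>ZR\<^esub> y = gmul A 0 0 x y" "\<one>\<^bsub>ZR\<^esub> = gone A" "\<zero>\<^bsub>ZR\<^esub> = \<zero>\<^bsub>cgr A 0\<^esub>"
 "x \<oplus>\<^bsub>ZR\<^esub> y = apl 0 x y"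
 by (simp_all add: ZR_def)

lemma Z0_iff: "(x : Z0) = (x : cel A 0 & cdiff A 0 x = \<zero>\<^bsub>cgr A 1\<^esub>)"
 by (simp add: cocycles_def)

lemma B0_iff: "(x : B0) = (EX c:cel A (-1). x = cdiff A (-1) c)"
 by (auto simp: coboundaries_def)

lemma B0_Z0: "x : B0 ==> x : Z0"
 using A_dd[of _ "-1"] by (auto simp: B0_iff Z0_iff)

lemma mul_Z0: "x : Z0 ==> y : Z0 ==> gmul A 0 0 x y : Z0"
 using A_leibniz[of x 0 y 0] A_mul_zero[of x 0 1] A_mul_zero[of y 0 1] by (simp add: Z0_iff koszul_sign_def abelian_monoid.l_zero[OF abelian_group.axioms(1)[OF A_ab]])

lemma add_Z0: "x : Z0 ==> y : Z0 ==> apl 0 x y : Z0"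
 using A_d_add[of x 0 y] by (simp add: Z0_iff abelian_monoid.l_zero[OF abelian_group.axioms(1)[OF A_ab]])

lemma neg_Z0: "x : Z0 ==> \<ominus>\<^bsub>cgr A 0\<^esub> x : Z0"
 using A_d_neg[of x 0] by (simp add: Z0_iff)

lemma gone_Z0: "gone A : Z0"
 by (simp add: Z0_iff d_one)

lemma zero_Z0: "\<zero>\<^bsub>cgr A 0\<^esub> : Z0"
 by (simp add: Z0_iff)

lemma ZR_ring: "ring ZR"
proof (rule ringI)
 interpret G: abelian_group "cgr A 0" by (rule A_ab)
 show "abelian_group ZR"
 proof (rule abelian_groupI)
  show "EX y:carrier ZR. y \<oplus>\<^bsub>ZR\<^esub> x = \<zero>\<^bsub>ZR\<^esub>" if "x : carrier ZR" for x
   using that neg_Z0[of x] by (intro bexI[of _ "\<ominus>\<^bsub>cgr A 0\<^esub> x"]) (simp_all add: Z0_iff G.l_neg)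
  show "x \<oplus>\<^bsub>ZR\<^esub> y : carrier ZR" if "x : carrier ZR" "y : carrier ZR" for x y
   using that add_Z0 by simp
  show "x \<oplus>\<^bsub>ZR\<^esub> y \<oplus>\<^bsub>ZR\<^esub> z = x \<oplus>\<^bsub>ZR\<^esub> (y \<oplus>\<^bsub>ZR\<^esub> z)"
   if "x : carrier ZR" "y : carrier ZR" "z : carrier ZR" for x y z
   using that by (simp add: Z0_iff G.a_assoc)
  show "x \<oplus>\<^bsub>ZR\<^esub> y = y \<oplus>\<^bsub>ZR\<^esub> x" if "x : carrier ZR" "y : carrier ZR" for x y
   using that G.a_comm[of x y] by (simp add: Z0_iff)
  show "\<zero>\<^bsub>ZR\<^esub> \<oplus>\<^bsub>ZR\<^esub> x = x" if "x : carrier ZR" for x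
   using that by (simp add: Z0_iff)
 qed (simp add: zero_Z0)
 show "monoid ZR"
  by (rule monoidI) (use mul_Z0 gone_Z0 A_mul_assoc[of _ 0 _ 0 _ 0] in "auto simp: Z0_iff")
 fix x y z assume "x : carrier ZR" "y : carrier ZR" "z : carrier ZR"
 hence c: "x : cel A 0" "y : cel A 0" "z : cel A 0" by (simp_all add: Z0_iff)
 show "(x \<oplus>\<^bsub>ZR\<^esub> y) \<otimes>\<^bsub>ZR\<^esub> z = x \<otimes>\<^bsub>ZR\<^esub> z \<oplus>\<^bsub>ZR\<^esub> y \<otimes>\<^bsub>ZR\<^esub> z"
  using linear_mapD(2)[OF A_linear(3)[OF c(3), of 0] c(1,2)] by simp
 show "z \<otimes>\<^bsub>ZR\<^esub> (x \<oplus>\<^bsub>ZR\<^esub> y) = z \<otimes>\<^bsub>ZR\<^esub> x \<oplus>\<^bsub>ZR\<^esub> z \<otimes>\<^bsub>ZR\<^esub> y"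
  using linear_mapD(2)[OF A_linear(2)[OF c(3), of 0] c(1,2)] by simp
qed

lemma B0_ideal: "ideal B0 ZR"
proof (rule idealI[OF ZR_ring])
 interpret ring ZR by (rule ZR_ring)
 interpret G: abelian_group "cgr A 0" by (rule A_ab)
 show "subgroup B0 (add_monoid ZR)"
 proof (rule add.subgroupI)
  show "B0 \<subseteq> carrier ZR" using B0_Z0 by auto
  show "B0 ~= {}" by (auto simp: coboundaries_def intro: A_closed(1))
  fix x assume x: "x : B0"
  then obtain c where c: "c : cel A (-1)" "x = cdiff A (-1) c" unfolding B0_iff by blast
  have "\<ominus>\<^bsub>ZR\<^esub> x = \<ominus>\<^bsub>cgr A 0\<^esub> x"
   by (rule minus_equality) (use B0_Z0[OF x] in "auto simp: Z0_iff G.l_neg A_d_neg")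
  thus "\<ominus>\<^bsub>ZR\<^esub> x : B0" unfolding B0_iff using c A_d_neg[of c "-1"] by (auto intro: bexI[of _ "\<ominus>\<^bsub>cgr A (-1)\<^esub> c"])
  fix y assume "y : B0"
  then obtain c' where c': "c' : cel A (-1)" "y = cdiff A (-1) c'" unfolding B0_iff by blast
  show "x \<oplus>\<^bsub>ZR\<^esub> y : B0" unfolding B0_iff
   using c c' A_d_add[of c "-1" c'] by (intro bexI[of _ "apl (-1) c c'"]) simp_all
 qed
 fix b x assume "b : B0" and "x : carrier ZR"
 then obtain c where c: "c : cel A (-1)" "b = cdiff A (-1) c" and x: "x : cel A 0" "cdiff A 0 x = \<zero>\<^bsub>cgr A 1\<^esub>"
  unfolding B0_iff by (auto simp: Z0_iff)
 have "cdiff A (-1) (gmul A 0 (-1) x c) = gmul A 0 0 x b"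
  using A_leibniz[OF x(1) c(1)] x c A_mul_zero(2)[OF c(1), of 1] by (simp add: koszul_sign_def)
 thus "x \<otimes>\<^bsub>ZR\<^esub> b : B0" unfolding B0_iff using x c by (intro bexI[of _ "gmul A 0 (-1) x c"]) simp_all
 have "cdiff A (-1) (gmul A (-1) 0 c x) = gmul A 0 0 b x"
  using A_leibniz[OF c(1) x(1)] x c A_mul_zero(1)[OF c(1), of 1] by (simp add: koszul_sign_def)
 thus "b \<otimes>\<^bsub>ZR\<^esub> x : B0" unfolding B0_iff using x c by (intro bexI[of _ "gmul A (-1) 0 c x"]) simp_all
qed

lemma H0_eq: "H0_ring A = ZR Quot B0"
 by (simp add: H0_ring_def ZR_def)

definition "hcl a = B0 +>\<^bsub>ZR\<^esub> a"

lemma H0_sel: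
 "carrier (H0_ring A) = hcl ` Z0"
 "a : Z0 ==> b : Z0 ==> hcl a \<otimes>\<^bsub>H0_ring A\<^esub> hcl b = hcl (gmul A 0 0 a b)"
 "a : Z0 ==> b : Z0 ==> hcl a \<oplus>\<^bsub>H0_ring A\<^esub> hcl b = hcl (apl 0 a b)"
 "\<one>\<^bsub>H0_ring A\<^esub> = hcl (gone A)" "\<zero>\<^bsub>H0_ring A\<^esub> = hcl \<zero>\<^bsub>cgr A 0\<^esub>"
proof -
 interpret I: ideal B0 ZR by (rule B0_ideal)
 show "carrier (H0_ring A) = hcl ` Z0"
  unfolding H0_eq FactRing_def by (auto simp: A_RCOSETS_def' hcl_def)
 show "a : Z0 ==> b : Z0 ==> hcl a \<otimes>\<^bsub>H0_ring A\<^esub> hcl b = hcl (gmul A 0 0 a b)"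
  unfolding H0_eq FactRing_def hcl_def using I.rcoset_mult_add[of a b] by simp
 show "a : Z0 ==> b : Z0 ==> hcl a \<oplus>\<^bsub>H0_ring A\<^esub> hcl b = hcl (apl 0 a b)"
  unfolding H0_eq FactRing_def hcl_def using I.a_rcos_sum[of a b] by simp
 show "\<one>\<^bsub>H0_ring A\<^esub> = hcl (gone A)" by (simp add: H0_eq FactRing_def hcl_def)
 have "hcl \<zero>\<^bsub>cgr A 0\<^esub> = B0" unfolding hcl_def using I.a_coset_add_zero[OF I.a_subset] by simp
 thus "\<zero>\<^bsub>H0_ring A\<^esub> = hcl \<zero>\<^bsub>cgr A 0\<^esub>" by (simp add: H0_eq FactRing_def)
qed

lemma hcl_eq_iff:
 assumes "a : Z0" "b : Z0" shows "(hcl a = hcl b) = (EX c:cel A (-1). a = apl 0 b (cdiff A (-1) c))"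
proof -
 interpret ring ZR by (rule ZR_ring)
 have "(hcl a = hcl b) = (a \<ominus>\<^bsub>ZR\<^esub> b : B0)"
  unfolding hcl_def using quotient_eq_iff_same_a_r_cos[OF B0_ideal, of a b] assms by simp
 also have "... = (EX x:B0. a = b \<oplus>\<^bsub>ZR\<^esub> x)"
 proof
  assume m: "a \<ominus>\<^bsub>ZR\<^esub> b : B0"
  have ab: "a : carrier ZR" "b : carrier ZR" using assms by simp_all
  have "a = b \<oplus>\<^bsub>ZR\<^esub> (a \<ominus>\<^bsub>ZR\<^esub> b)"
   using ab a_lcomm[OF ab(2,1), of "\<ominus>\<^bsub>ZR\<^esub> b"] r_neg[OF ab(2)] by (simp add: minus_eq del: ZR_sel)
  thus "EX x:B0. a = b \<oplus>\<^bsub>ZR\<^esub> x" using m by blast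
 next
  assume "EX x:B0. a = b \<oplus>\<^bsub>ZR\<^esub> x"
  then obtain x where x: "x : B0" "a = b \<oplus>\<^bsub>ZR\<^esub> x" by blast
  have bx: "b : carrier ZR" "x : carrier ZR" using assms(2) B0_Z0[OF x(1)] by simp_all
  have "a \<ominus>\<^bsub>ZR\<^esub> b = x"
   unfolding x(2) a_comm[OF bx] using bx by (simp add: minus_eq a_assoc r_neg del: ZR_sel)
  thus "a \<ominus>\<^bsub>ZR\<^esub> b : B0" using x by simp
 qed
 also have "... = (EX c:cel A (-1). a = apl 0 b (cdiff A (-1) c))"
  unfolding coboundaries_def by simp
 finally show ?thesis .
qed

text \<open>Left multiplication by a. As the modules are right modules, it respects products in the
  given order, so End(R) is H^0 A and not its opposite.\<close>

definition "el a = q R R (ev R (e a))"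

lemma el_mor: "a : Z0 ==> mor R R (ev R (e a))"
 by (rule mor_ev) (simp_all add: Z0_iff)

lemma el_ar: "a : Z0 ==> D.ar (el a) R R"
 using el_mor[of a] by (simp add: el_def D.ar_iff)

lemma ev_e: "ev R (e a) p (e b) = e (gmul A 0 p a b)"
 by (simp add: ev_def)

lemma el_mult: assumes "a : Z0" "b : Z0" shows "Cmp Der (el a) (el b) = el (gmul A 0 0 a b)"
 unfolding el_def q_cmp[OF el_mor[OF assms(2)] el_mor[OF assms(1)]]
proof (rule q_eq[OF hq_ext[OF mor_comp[OF el_mor el_mor] el_mor[OF mul_Z0]]])
 fix p x assume "x : cel R p"
 then obtain c where c: "c : cel A p" "x = e c" by auto
 show "(ev R (e a) oo ev R (e b)) p x = ev R (e (gmul A 0 0 a b)) p x"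
  using A_mul_assoc[of a 0 b 0 c p] assms c by (simp add: ev_e Z0_iff)
qed (use assms in simp_all)

lemma el_idem:
 assumes "D.ar F R R" "Cmp Der F F = F" obtains f where "mor R R f" "hq R R (f oo f) f" "F = q R R f"
proof -
 obtain f where f: "mor R R f" "F = q R R f" using arr_R[of F] assms(1) unfolding D.ar_iff by metis
 have "hq R R (f oo f) f"
  using assms(2) unfolding f(2) q_cmp[OF f(1) f(1)] q_R_eq_iff[OF mor_comp[OF f(1) f(1)] f(1)] .
 thus ?thesis using that f by blast
qed

lemma el_add: assumes "a : Z0" "b : Z0" shows "HAdd Der (el a) (el b) = el (apl 0 a b)"
 unfolding el_def q_add'[OF el_mor[OF assms(1)] el_mor[OF assms(2)]]
proof (rule q_eq[OF hq_ext[OF mor_add[OF el_mor el_mor] el_mor]])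
 fix p x assume "x : cel R p"
 then obtain c where c: "c : cel A p" "x = e c" by auto
 show "hadd R (ev R (e a)) (ev R (e b)) p x = ev R (e (apl 0 a b)) p x"
  using linear_mapD(2)[OF A_linear(3)[of c p 0], of a b] assms c by (simp add: ev_e Z0_iff)
qed (use assms add_Z0 in simp_all)

lemma el_one: "el (gone A) = Idn Der R"
 unfolding el_def Der_idn by (rule q_eq[OF hq_ext[OF el_mor[OF gone_Z0] mor_id[OF DG_R]]]) (auto simp: ev_e)

lemma el_zero: "el \<zero>\<^bsub>cgr A 0\<^esub> = HZero Der R R"
 unfolding el_def q_zero[OF DG_R DG_R]
 by (rule q_eq[OF hq_ext[OF el_mor[OF zero_Z0] mor_zero[OF DG_R DG_R]]]) (auto simp: ev_e A_mul_zero)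

lemma el_eq_iff:
 assumes "a : Z0" "b : Z0" shows "(el a = el b) = (hcl a = hcl b)"
proof -
 have v: "ev R (e c) 0 (e (gone A)) = e c" if "c : Z0" for c using that by (simp add: ev_e Z0_iff)
 have "(el a = el b) = (EX y:cel R (-1). e a = pls R 0 (e b) (cdiff R (-1) y))"
  unfolding el_def q_R_eq_iff[OF el_mor[OF assms(1)] el_mor[OF assms(2)]] hq_R_iff[OF el_mor[OF assms(1)] el_mor[OF assms(2)]]
   v[OF assms(1)] v[OF assms(2)] ..
 also have "... = (hcl a = hcl b)" unfolding hcl_eq_iff[OF assms] by auto
 finally show ?thesis .
qed

lemma el_surj: assumes "D.ar F R R" obtains a where "a : Z0" "F = el a"
proof -
 obtain f where f: "mor R R f" "F = q R R f" using arr_R[of F] assms unfolding D.ar_iff by metis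
 obtain a where a: "a : cel A 0" "f 0 (e (gone A)) = e a" using mor_R_cocycle(1)[OF f(1)] by auto
 have z: "a : Z0" using mor_R_cocycle(2)[OF f(1)] a by (simp add: Z0_iff)
 have "F = el a" unfolding f(2) el_def
 proof (rule q_eq[OF hq_ext[OF f(1) el_mor[OF z]]])
  fix p x assume "x : cel R p"
  then obtain c where c: "c : cel A p" "x = e c" by auto
  show "f p x = ev R (e a) p x" unfolding c(2) mor_R_value[OF f(1) c(1)] a(2) by (simp add: ev_e)
 qed
 thus ?thesis using that z by blast
qed

text \<open>\<open>el\<close> factors through cohomology classes and is bijective onto the
  endomorphisms of R, so the idempotents of H^0 A and their sum are carried over.\<close>

lemma End_idempotents:
 assumes "semisimple_ring (H0_ring A)"
 obtains n :: nat and E where "idems {x. D.ar x R R} (Cmp Der) (HZero Der R R) n E" "D.psum R R E n = Idn Der R"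
proof -
 let ?H = "H0_ring A"
 interpret H: ring ?H using assms by (simp add: semisimple_ring_def)
 obtain n :: nat and et where h: "idems (carrier ?H) (monoid.mult ?H) \<zero>\<^bsub>?H\<^esub> n et" "finsum ?H et {..<n} = \<one>\<^bsub>?H\<^esub>"
  by (rule semisimple_idempotents[OF assms])
 \<comment> \<open>The chosen cocycle does not matter, by \<open>el_eq_iff\<close>.\<close>
 define ph where "ph x = el (SOME a. a : Z0 & hcl a = x)" for x
 have ph: "ph (hcl a) = el a" if "a : Z0" for a
 proof -
  have "(SOME b. b : Z0 & hcl b = hcl a) : Z0 & hcl (SOME b. b : Z0 & hcl b = hcl a) = hcl a"
   by (rule someI[of _ a]) (use that in simp)
  thus ?thesis unfolding ph_def using el_eq_iff that by blast
 qed
 have bij: "bij_betw ph (carrier ?H) {x. D.ar x R R}" unfolding bij_betw_def inj_on_def H0_sel(1)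
 proof (intro conjI equalityI subsetI ballI impI)
  show "x : ph ` hcl ` Z0" if "x : {x. D.ar x R R}" for x
  proof -
   have "D.ar x R R" using that by simp
   then obtain a where "a : Z0" "x = el a" by (rule el_surj)
   thus ?thesis using ph by (metis imageI)
  qed
 qed (auto simp: ph el_eq_iff el_ar)
 have "idems {x. D.ar x R R} (Cmp Der) (HZero Der R R) n (%i. ph (et i))"
 proof (rule idems_transfer[OF h(1) bij])
  show "ph (x \<otimes>\<^bsub>?H\<^esub> y) = Cmp Der (ph x) (ph y)" if "x : carrier ?H" "y : carrier ?H" for x y
   using that by (auto simp: H0_sel ph el_mult mul_Z0)
  show "ph \<zero>\<^bsub>?H\<^esub> = HZero Der R R" by (simp add: H0_sel ph zero_Z0 el_zero)
 qed simp_all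
 moreover have "D.psum R R (%i. ph (et i)) m = ph (finsum ?H et {..<m}) & finsum ?H et {..<m} : carrier ?H" if "m \<le> n" for m
  using that
 proof (induction m)
  case 0
  show ?case by (simp add: H0_sel(5) ph zero_Z0 el_zero) (simp add: H0_sel zero_Z0)
 next
  case (Suc m)
  have c: "et i : carrier ?H" if "i \<le> m" for i using h(1) Suc.prems that by (simp add: idems_def)
  have "finsum ?H et {..<Suc m} = et m \<oplus>\<^bsub>?H\<^esub> finsum ?H et {..<m}"
   unfolding lessThan_Suc by (rule H.finsum_insert) (use c in auto)
  also have "... = finsum ?H et {..<m} \<oplus>\<^bsub>?H\<^esub> et m" by (rule H.a_comm) (use c Suc in auto)
  finally have f: "finsum ?H et {..<Suc m} = finsum ?H et {..<m} \<oplus>\<^bsub>?H\<^esub> et m" .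
  obtain a b where "a : Z0" "finsum ?H et {..<m} = hcl a" "b : Z0" "et m = hcl b"
   using Suc c[of m] unfolding H0_sel(1) by auto
  thus ?case using Suc unfolding f by (simp add: H0_sel ph el_add add_Z0)
 qed
 from this[of n] have "D.psum R R (%i. ph (et i)) n = Idn Der R" by (simp add: h(2) H0_sel(4) ph gone_Z0 el_one)
 ultimately show ?thesis by (rule that)
qed

end

context dgi begin

context
 fixes M :: "('k, 'a, 'm) dgm" and f :: "int => 'm => 'm"
begin

subsection \<open>Splitting homotopy idempotents\<close>

text \<open>\<open>ce p n a\<close> encodes the image in the colimit of \<open>M \<rightarrow> M \<rightarrow> \<dots>\<close> (all maps \<open>f\<close>) of the
 element \<open>a\<close> of the \<open>n\<close>-th copy of \<open>M\<^sup>p\<close>.\<close>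

definition sm where
 "sm p n a m b = (EX K. \<forall>L\<ge>K. n \<le> L & m \<le> L & (f p ^^ (L - n)) a = (f p ^^ (L - m)) b)"

text \<open>An equivalence class is a set and not an element of \<open>'m\<close>, so it is coded by
  a chosen member. The predicate under \<open>SOME\<close> depends on the class only, hence
  equivalent pairs receive the same code.\<close>

definition ce where
 "ce p n a = (case (SOME (m, b). b : cel M p & sm p n a m b) of (m, b) => pr (en m, b))"

definition de where
 "de p u = (SOME (n, a). a : cel M p & u = ce p n a)"

lemma sm_refl: "sm p n a n a"
 unfolding sm_def by auto

lemma sm_sym: "sm p n a m b ==> sm p m b n a"
 unfolding sm_def by metis

lemma sm_trans: assumes "sm p n a m b" "sm p m b l c" shows "sm p n a l c"
proof -
 obtain K1 where 1: "\<forall>L\<ge>K1. n \<le> L & m \<le> L & (f p ^^ (L - n)) a = (f p ^^ (L - m)) b" using assms(1) unfolding sm_def by blast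
 obtain K2 where 2: "\<forall>L\<ge>K2. m \<le> L & l \<le> L & (f p ^^ (L - m)) b = (f p ^^ (L - l)) c" using assms(2) unfolding sm_def by blast
 show ?thesis unfolding sm_def by (rule exI[of _ "max K1 K2"]) (use 1 2 in auto)
qed

lemma sm_shift: "sm p (n + i) ((f p ^^ i) a) n a"
 unfolding sm_def
proof (intro exI allI impI)
 fix L assume L: "n + i \<le> L"
 have "(f p ^^ (L - (n + i) + i)) a = (f p ^^ (L - (n + i))) ((f p ^^ i) a)" by (simp add: funpow_add)
 thus "n + i \<le> L & n \<le> L & (f p ^^ (L - (n + i))) ((f p ^^ i) a) = (f p ^^ (L - n)) a" using L by simp
qed

lemma ce_rep:
 assumes "a : cel M p"
 obtains m b where "b : cel M p" "sm p n a m b" "ce p n a = pr (en m, b)"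
proof -
 have "EX z. case z of (m, b) => b : cel M p & sm p n a m b" using assms sm_refl by blast
 from someI_ex[OF this] show ?thesis using that unfolding ce_def by (auto split: prod.splits)
qed

lemma ce_eq_iff:
 assumes "a : cel M p" "b : cel M p" shows "(ce p n a = ce p m b) = sm p n a m b"
proof
 assume e: "ce p n a = ce p m b"
 obtain n1 a1 where 1: "sm p n a n1 a1" "ce p n a = pr (en n1, a1)" by (rule ce_rep[OF assms(1)])
 obtain m1 b1 where 2: "sm p m b m1 b1" "ce p m b = pr (en m1, b1)" by (rule ce_rep[OF assms(2)])
 have "n1 = m1" "a1 = b1" using e 1(2) 2(2) inj_en by (auto simp: inj_eq)
 thus "sm p n a m b" using sm_trans[OF 1(1) sm_sym] 2(1) by blast
next
 assume s: "sm p n a m b"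
 have "sm p n a l c = sm p m b l c" for l c using s sm_trans sm_sym by blast
 thus "ce p n a = ce p m b" unfolding ce_def by simp
qed

abbreviation "cec p \<equiv> {ce p n a |n a. a : cel M p}"

lemma de_ce:
 assumes "u : cec p" obtains n a where "de p u = (n, a)" "a : cel M p" "u = ce p n a"
proof -
 have "EX z. case z of (n, a) => a : cel M p & u = ce p n a" using assms by auto
 from someI_ex[OF this] show ?thesis using that unfolding de_def by (auto split: prod.splits)
qed

text \<open>The colimit as a dg module. Operations act on whatever representative \<open>de\<close>
  returns; for a sum, both representatives are first pushed to the common stage n + m.\<close>

definition CL where
 "CL = \<lparr>cgr = (%p. \<lparr>carrier = cec p, monoid.mult = undefined, one = undefined,
   zero = ce p 0 (zr M p),
   add = (%u v. case de p u of (n, a) => case de p v of (m, b) =>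
    ce p (n + m) (pls M p ((f p ^^ m) a) ((f p ^^ n) b))),
   smult = (%c u. case de p u of (n, a) => ce p n (sml M p c a))\<rparr>),
  cdiff = (%p u. case de p u of (n, a) => ce (p+1) n (cdiff M p a)),
  gact = (%p r u x. case de p u of (n, a) => ce (p + r) n (gact M p r a x))\<rparr>"

lemma CL_carrier [simp]: "cel CL p = cec p"
 by (simp add: CL_def)

lemma CL_zr: "zr CL p = ce p 0 (zr M p)"
 by (simp add: CL_def)

text \<open>The inverse of the automorphism that \<open>f\<close> induces on the colimit.\<close>

definition gn where
 "gn p u = (case de p u of (n, a) => ce p (Suc n) a)"

context
 assumes f: "mor M M f"
begin

lemma it_mor: "mor M M (%p. f p ^^ i)"
proof (induction i)
 case 0
 have "(%p. f p ^^ 0) = hid" by (simp add: fun_eq_iff)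
 thus ?case using mor_id[OF morD(1)[OF f]] by simp
next
 case (Suc i)
 have e: "f oo (%p. f p ^^ i) = (%p. f p ^^ Suc i)" by (simp add: fun_eq_iff)
 show ?case using mor_comp[OF Suc f] unfolding e .
qed

lemma it_closed [simp]: "a : cel M p ==> (f p ^^ i) a : cel M p"
 using morD(5)[OF it_mor] .

lemma ce_shift:
 assumes "a : cel M p" shows "ce p (n + i) ((f p ^^ i) a) = ce p n a"
 unfolding ce_eq_iff[OF it_closed[OF assms] assms] by (rule sm_shift)

lemma ce_eq_iff2:
 assumes a: "a : cel M p" "b : cel M p"
 shows "(ce p n a = ce p n b) = (EX i. (f p ^^ i) a = (f p ^^ i) b)"
proof
 assume "ce p n a = ce p n b"
 thus "EX i. (f p ^^ i) a = (f p ^^ i) b" unfolding ce_eq_iff[OF a] sm_def by blast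
next
 assume "EX i. (f p ^^ i) a = (f p ^^ i) b"
 then obtain i where "(f p ^^ i) a = (f p ^^ i) b" by blast
 thus "ce p n a = ce p n b" using ce_shift[OF a(1), of n i] ce_shift[OF a(2), of n i] by simp
qed

text \<open>An operation that commutes with f respects \<open>sm\<close>, so the representative
  returned by \<open>de\<close> is irrelevant. The differential, the action and the scalars are all
  instances.\<close>

lemma ce_lift:
 assumes a: "a : cel M p"
  and ph: "!!x. x : cel M p ==> ph x : cel M p'" "!!x. x : cel M p ==> f p' (ph x) = ph (f p x)"
 shows "(case de p (ce p n a) of (n, a) => ce p' n (ph a)) = ce p' n (ph a)"
proof -
 have "ce p n a : cec p" using a by blast
 then obtain m b where b: "de p (ce p n a) = (m, b)" "b : cel M p" "ce p n a = ce p m b" by (rule de_ce)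
 have it: "(f p' ^^ i) (ph x) = ph ((f p ^^ i) x)" if "x : cel M p" for x i
  by (induction i) (simp_all add: ph(2) it_closed[OF that])
 have "sm p n a m b" using b(3) unfolding ce_eq_iff[OF a b(2)] .
 hence "sm p' n (ph a) m (ph b)" unfolding sm_def it[OF a] it[OF b(2)] by metis
 hence "ce p' n (ph a) = ce p' m (ph b)" unfolding ce_eq_iff[OF ph(1)[OF a] ph(1)[OF b(2)]] .
 thus ?thesis by (simp add: b(1))
qed

lemma CL_d: "a : cel M p ==> cdiff CL p (ce p n a) = ce (p+1) n (cdiff M p a)"
 using ce_lift[of a p "cdiff M p" "p+1" n] morD(1)[OF f] morD(7)[OF f] by (simp add: CL_def)

lemma CL_act: "a : cel M p ==> x : cel A r ==>
  gact CL p r (ce p n a) x = ce (p + r) n (gact M p r a x)"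
 using ce_lift[of a p "%a. gact M p r a x" "p + r" n] morD(1)[OF f] ghD(3)[OF morD(4)[OF f]] by (simp add: CL_def)

lemma CL_smult: "a : cel M p ==> c : carrier k ==>
  sml CL p c (ce p n a) = ce p n (sml M p c a)"
 using ce_lift[of a p "%a. c \<odot>\<^bsub>cgr M p\<^esub> a" p n] morD(1)[OF f] ghD(4)[OF morD(4)[OF f], of c] by (simp add: CL_def)

lemma CL_pls:
 assumes a: "a : cel M p" "b : cel M p"
 shows "pls CL p (ce p n a) (ce p n b) = ce p n (pls M p a b)"
proof -
 have M: "DG M" using morD(1)[OF f] .
 have "ce p n a : cec p" "ce p n b : cec p" using a by blast+
 note m = this
 obtain n1 a1 where 1: "de p (ce p n a) = (n1, a1)" "a1 : cel M p" "ce p n a = ce p n1 a1"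
  using m(1) by (rule de_ce)
 obtain n2 b1 where 2: "de p (ce p n b) = (n2, b1)" "b1 : cel M p" "ce p n b = ce p n2 b1"
  using m(2) by (rule de_ce)
 note ad = morD(6)[OF it_mor]
 obtain K1 where K1: "!!L. L \<ge> K1 ==> n \<le> L & n1 \<le> L & (f p ^^ (L - n)) a = (f p ^^ (L - n1)) a1"
  using 1(3) unfolding ce_eq_iff[OF a(1) 1(2)] sm_def by blast
 obtain K2 where K2: "!!L. L \<ge> K2 ==> n \<le> L & n2 \<le> L & (f p ^^ (L - n)) b = (f p ^^ (L - n2)) b1"
  using 2(3) unfolding ce_eq_iff[OF a(2) 2(2)] sm_def by blast
 let ?c = "pls M p ((f p ^^ n2) a1) ((f p ^^ n1) b1)"
 have c: "?c : cel M p" "pls M p a b : cel M p" using M f a 1(2) 2(2) by simp_all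
 have "sm p (n1 + n2) ?c n (pls M p a b)"
  unfolding sm_def
 proof (intro exI allI impI)
  fix L assume L: "K1 + K2 + n1 + n2 \<le> L"
  have i: "(f p ^^ (L - (n1 + n2))) ((f p ^^ n2) a1) = (f p ^^ (L - n1)) a1"
   "(f p ^^ (L - (n1 + n2))) ((f p ^^ n1) b1) = (f p ^^ (L - n2)) b1"
   using L funpow_add[of "L - (n1 + n2)" n2 "f p"] funpow_add[of "L - (n1 + n2)" n1 "f p"] by (simp_all add: fun_eq_iff)
  show "n1 + n2 \<le> L & n \<le> L & (f p ^^ (L - (n1 + n2))) ?c = (f p ^^ (L - n)) (pls M p a b)"
   using L K1[of L] K2[of L] ad[OF it_closed[OF 1(2)] it_closed[OF 2(2)]] ad[OF a] i by simp
 qed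
 hence "ce p (n1 + n2) ?c = ce p n (pls M p a b)" unfolding ce_eq_iff[OF c] .
 thus ?thesis by (simp add: CL_def 1(1) 2(1))
qed

lemma ce_common:
 assumes u: "u : cec p" "v : cec p" "w : cec p"
 obtains n a b c where "a : cel M p" "b : cel M p" "c : cel M p" "u = ce p n a" "v = ce p n b" "w = ce p n c"
proof -
 obtain n1 a n2 b n3 c where *: "a : cel M p" "b : cel M p" "c : cel M p"
  "u = ce p n1 a" "v = ce p n2 b" "w = ce p n3 c" using u by blast
 have "u = ce p (n1 + (n2 + n3)) ((f p ^^ (n2 + n3)) a)"
  "v = ce p (n1 + (n2 + n3)) ((f p ^^ (n1 + n3)) b)"
  "w = ce p (n1 + (n2 + n3)) ((f p ^^ (n1 + n2)) c)"
  using ce_shift[OF *(1), of n1 "n2 + n3"] ce_shift[OF *(2), of n2 "n1 + n3"] ce_shift[OF *(3), of n3 "n1 + n2"] *(4-6)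
  by (simp_all add: add.left_commute add.commute)
 from that[OF it_closed[OF *(1)] it_closed[OF *(2)] it_closed[OF *(3)] this] show ?thesis .
qed

lemma ce_common2:
 assumes u: "u : cel CL p" "v : cel CL p"
 obtains n a b where "a : cel M p" "b : cel M p" "u = ce p n a" "v = ce p n b"
proof -
 from u(1,2,2)[unfolded CL_carrier] obtain n a b c where "a : cel M p" "b : cel M p" "u = ce p n a" "v = ce p n b"
  by (rule ce_common)
 thus ?thesis by (rule that)
qed

lemma ce_zr: "ce p n (zr M p) = zr CL p"
 using ce_shift[of "zr M p" p 0 n] morD(8)[OF it_mor, of n p] morD(1)[OF f] by (simp add: CL_zr)

lemma CL_module: "module k (cgr CL p)"
proof (rule moduleI[OF k_cring])
 have M: "DG M" using morD(1)[OF f] .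
 interpret N: module k "cgr M p" by (rule DG_module[OF M])
 show ab: "abelian_group (cgr CL p)"
 proof (rule abelian_groupI)
  fix u v w assume "u : cel CL p" "v : cel CL p" "w : cel CL p"
  then obtain n a b c where *: "a : cel M p" "b : cel M p" "c : cel M p"
   "u = ce p n a" "v = ce p n b" "w = ce p n c" unfolding CL_carrier by (rule ce_common)
  show "pls CL p (pls CL p u v) w = pls CL p u (pls CL p v w)"
   unfolding *(4-6) using *(1-3) M by (simp add: CL_pls DG_ac(2))
 next
  fix u v assume "u : cel CL p" "v : cel CL p"
  then obtain n a b where *: "a : cel M p" "b : cel M p"
   "u = ce p n a" "v = ce p n b" by (rule ce_common2)
  show "pls CL p u v = pls CL p v u"
   unfolding *(3-4) using *(1-2) M DG_ac(1)[OF M *(1,2)] by (simp add: CL_pls)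
  have "pls M p a b : cel M p" using * M by simp
  thus "pls CL p u v : cel CL p"
   unfolding *(3-4) CL_pls[OF *(1,2)] CL_carrier by blast
 next
  show "zr CL p : cel CL p" unfolding CL_zr CL_carrier using M DG_group_simps(1) by blast
 next
  fix u assume "u : cel CL p"
  then obtain n a where *: "a : cel M p" "u = ce p n a" by auto
  show "pls CL p (zr CL p) u = u"
   unfolding *(2) ce_zr[of p n, symmetric] using CL_pls[of "zr M p" p a n] * M by simp
  have n: "ngt M p a : cel M p" using * M by simp
  have "pls CL p (ce p n (ngt M p a)) u = zr CL p"
   unfolding *(2) CL_pls[OF n *(1)] using * M by (simp add: ce_zr)
  thus "EX v:cel CL p. pls CL p v u = zr CL p"
   using n unfolding CL_carrier by blast
 qed
 fix c u assume c: "c : carrier k" and "u : cel CL p"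
 then obtain n a where a: "a : cel M p" "u = ce p n a" by auto
 have ca: "sml M p c a : cel M p" using a c M by simp
 show "sml CL p c u : cel CL p" unfolding a(2) CL_smult[OF a(1) c] CL_carrier using ca by blast
 fix d assume d: "d : carrier k"
 show "(c \<oplus>\<^bsub>k\<^esub> d) \<odot>\<^bsub>cgr CL p\<^esub> u = pls CL p (sml CL p c u) (sml CL p d u)"
  using a c d M by (simp add: CL_smult CL_pls N.smult_l_distr)
 show "(c \<otimes>\<^bsub>k\<^esub> d) \<odot>\<^bsub>cgr CL p\<^esub> u = sml CL p c (sml CL p d u)"
  using a c d M by (simp add: CL_smult N.smult_assoc1)
next
 have M: "DG M" using morD(1)[OF f] .
 interpret N: module k "cgr M p" by (rule DG_module[OF M])
 show "\<one>\<^bsub>k\<^esub> \<odot>\<^bsub>cgr CL p\<^esub> u = u" if "u : cel CL p" for u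
 proof -
  obtain n a where a: "a : cel M p" "u = ce p n a" using \<open>u \<in> _\<close> by auto
  show ?thesis using a by (simp add: CL_smult)
 qed
 fix c u v assume c: "c : carrier k" and uv: "u : cel CL p" "v : cel CL p"
 obtain n a b where *: "a : cel M p" "b : cel M p"
   "u = ce p n a" "v = ce p n b" by (rule ce_common2[OF uv])
 show "sml CL p c (pls CL p u v) = pls CL p (sml CL p c u) (sml CL p c v)"
  using * c M by (simp add: CL_smult CL_pls N.smult_r_distr)
qed

lemma CL_ngt: assumes a: "a : cel M p"
 shows "ngt CL p (ce p n a) = ce p n (ngt M p a)"
proof -
 have M: "DG M" using morD(1)[OF f] .
 interpret N: module k "cgr CL p" by (rule CL_module)
 have n: "ngt M p a : cel M p" using a M by simp
 show ?thesis
 proof (rule N.M.minus_equality)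
  show "pls CL p (ce p n (ngt M p a)) (ce p n a) = zr CL p"
   using a n M by (simp add: CL_pls ce_zr)
  show "ce p n a : cel CL p" "ce p n (ngt M p a) : cel CL p" using a n unfolding CL_carrier by blast+
 qed
qed

lemma CL_koszul: assumes a: "a : cel M p"
 shows "koszul_sign i (cgr CL p) (ce p n a) = ce p n (koszul_sign i (cgr M p) a)"
 using CL_ngt[OF a] by (simp add: koszul_sign_def)

lemma DG_CL: "DG CL"
proof (rule DGI)
 have M: "DG M" using morD(1)[OF f] .
 show "module k (cgr CL p)" for p by (rule CL_module)
 fix p r t u v c x y assume u: "u : cel CL p"
 then obtain n a where a: "a : cel M p" "u = ce p n a" by auto
 have da: "cdiff M p a : cel M (p+1)" using a M by simp
 show "cdiff CL p u : cel CL (p+1)" unfolding a(2) CL_d[OF a(1)] CL_carrier using da by blast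
 show "cdiff CL p (pls CL p u v) = pls CL (p+1) (cdiff CL p u) (cdiff CL p v)"
  if v: "v : cel CL p"
 proof -
  obtain n a b where *: "a : cel M p" "b : cel M p" "u = ce p n a" "v = ce p n b"
   by (rule ce_common2[OF u v])
  show ?thesis unfolding *(3,4) using *(1,2) M by (simp add: CL_d CL_pls DG_d_add)
 qed
 show "cdiff CL p (sml CL p c u) = sml CL (p+1) c (cdiff CL p u)" if "c : carrier k"
  using a that M by (simp add: CL_d CL_smult DG_d_smult)
 show "cdiff CL (p+1) (cdiff CL p u) = zr CL (p+2)"
  using a M CL_d[OF da] by (simp add: CL_d ce_zr idx)
 show "gact CL p 0 u (gone A) = u" using a M by (simp add: CL_act DG_act_one)
 assume x: "x : cel A r"
 have ax: "gact M p r a x : cel M (p + r)" using a x M by simp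
 show "gact CL p r u x : cel CL (p + r)" unfolding a(2) CL_act[OF a(1) x] CL_carrier using ax by blast
 show "gact CL p r (pls CL p u v) x = pls CL (p + r) (gact CL p r u x) (gact CL p r v x)"
  if v: "v : cel CL p"
 proof -
  obtain n a b where *: "a : cel M p" "b : cel M p" "u = ce p n a" "v = ce p n b"
   by (rule ce_common2[OF u v])
  show ?thesis unfolding *(3,4) using *(1,2) x M by (simp add: CL_act CL_pls DG_act_add)
 qed
 show "gact CL p r u (apl r x y) = pls CL (p + r) (gact CL p r u x) (gact CL p r u y)"
  if "y : cel A r"
  using a x that M by (simp add: CL_act CL_pls DG_act_add2)
 show "gact CL p r (sml CL p c u) x = sml CL (p + r) c (gact CL p r u x)"
  "gact CL p r u (sml A r c x) = sml CL (p + r) c (gact CL p r u x)" if "c : carrier k"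
  using a x that M by (simp_all add: CL_act CL_smult DG_act_smult DG_act_smult2)
 show "gact CL (p + r) t (gact CL p r u x) y = gact CL p (r + t) u (gmul A r t x y)" if "y : cel A t"
  using a x that M CL_act[OF ax that] by (simp add: CL_act DG_act_assoc add.assoc)
 have dx: "cdiff A r x : cel A (r+1)" using x by simp
 have k: "gact M (p+1) r (cdiff M p a) x : cel M (p + r+1)" "gact M p (r+1) a (cdiff A r x) : cel M (p + r+1)"
  using a x da dx M by simp_all
 have i: "p + (r+1) = p + r+1" "p+1 + r = p + r+1" by simp_all
 have 1: "gact CL (p+1) r (cdiff CL p u) x = ce (p + r+1) n (gact M (p+1) r (cdiff M p a) x)"
  using CL_act[OF da x] a by (simp add: CL_d i)
 have 2: "gact CL p (r+1) u (cdiff A r x) = ce (p + r+1) n (gact M p (r+1) a (cdiff A r x))"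
  using CL_act[OF a(1) dx] a by (simp add: i)
 show "cdiff CL (p + r) (gact CL p r u x) =
   pls CL (p + r+1) (gact CL (p+1) r (cdiff CL p u) x)
    (koszul_sign p (cgr CL (p + r+1)) (gact CL p (r+1) u (cdiff A r x)))"
  unfolding 1 2 CL_koszul[OF k(2)] CL_pls[OF k(1) koszul_in[OF M k(2)]]
  unfolding a(2) CL_act[OF a(1) x] CL_d[OF ax] DG_leibniz[OF M a(1) x] ..
qed

abbreviation "jn \<equiv> (%p a. ce p 0 a)"

lemma mor_jn: "mor M CL jn"
proof (rule morI[OF morD(1)[OF f] DG_CL])
 show "ce p 0 x : cel CL p" if "x : cel M p" for p x using that by auto
qed (use CL_pls CL_act CL_d in simp_all)

lemma gn_ce:
 assumes a: "a : cel M p" shows "gn p (ce p n a) = ce p (Suc n) a"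
proof -
 have "ce p n a : cec p" using a by blast
 then obtain m b where b: "de p (ce p n a) = (m, b)" "b : cel M p" "ce p n a = ce p m b" by (rule de_ce)
 obtain K where K: "!!L. L \<ge> K ==> n \<le> L & m \<le> L & (f p ^^ (L - n)) a = (f p ^^ (L - m)) b"
  using b(3) unfolding ce_eq_iff[OF a b(2)] sm_def by blast
 have "sm p (Suc n) a (Suc m) b"
  unfolding sm_def
 proof (intro exI allI impI)
  fix L assume "Suc K \<le> L"
  then obtain L' where L: "L = Suc L'" "K \<le> L'" by (cases L) auto
  show "Suc n \<le> L & Suc m \<le> L & (f p ^^ (L - Suc n)) a = (f p ^^ (L - Suc m)) b" using K[OF L(2)] by (simp add: L(1))
 qed
 hence "ce p (Suc n) a = ce p (Suc m) b" unfolding ce_eq_iff[OF a b(2)] .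
 thus ?thesis by (simp add: gn_def b(1))
qed

lemma mor_gn: "mor CL CL gn"
proof (rule morI[OF DG_CL DG_CL])
 have M: "DG M" using morD(1)[OF f] .
 fix p r u v x assume u: "u : cel CL p"
 then obtain n a where a: "a : cel M p" "u = ce p n a" by auto
 show "gn p u : cel CL p" unfolding a(2) gn_ce[OF a(1)] CL_carrier using a(1) by blast
 show "gn p (pls CL p u v) = pls CL p (gn p u) (gn p v)" if v: "v : cel CL p"
 proof -
  obtain n a b where *: "a : cel M p" "b : cel M p" "u = ce p n a" "v = ce p n b"
   by (rule ce_common2[OF u v])
  show ?thesis unfolding *(3,4) using *(1,2) M by (simp add: gn_ce CL_pls)
 qed
 show "gn (p + r) (gact CL p r u x) = gact CL p r (gn p u) x" if "x : cel A r"
  using a that M by (simp add: gn_ce CL_act)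
 show "gn (p+1) (cdiff CL p u) = cdiff CL p (gn p u)"
  using a M by (simp add: gn_ce CL_d)
qed

text \<open>\<open>gn\<close> strictly undoes one step: gn jn f = jn on carriers. Applying gn jn to
  the homotopy from f f to f therefore turns it into one from jn f to jn.\<close>

lemma jn_absorb:
 assumes ff: "hq M M (f oo f) f" shows "hq M CL (jn oo f) jn"
proof -
 note j = mor_jn and g = mor_gn
 have h: "hq M CL (gn oo (jn oo (f oo f))) (gn oo (jn oo f))"
  by (rule hq_comp_left[OF hq_comp_left[OF ff j] g])
 have s: "ce p (Suc 0) (f p x) = ce p 0 x" if "x : cel M p" for p x
  using ce_shift[OF that, of 0 1] by simp
 have 1: "hq M CL (jn oo f) (gn oo (jn oo (f oo f)))"
  by (rule hq_ext[OF mor_comp[OF f j] mor_comp[OF mor_comp[OF mor_comp[OF f f] j] g]])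
   (use morD(5)[OF f] in "simp add: gn_ce s")
 have 2: "hq M CL (gn oo (jn oo f)) jn"
  by (rule hq_ext[OF mor_comp[OF mor_comp[OF f j] g] j]) (use morD(5)[OF f] in "simp add: gn_ce s")
 show ?thesis by (rule hq_trans[OF 1 hq_trans[OF h 2]])
qed

end

end

section \<open>A homotopy idempotent and its complement; M as the sum of the two colimits\<close>

definition compl :: "('k, 'a, 'm) dgm => (int => 'm => 'm) => (int => 'm => 'm) => bool" where
 "compl M f g = (mor M M f & mor M M g & hq M M (f oo f) f & hq M M (g oo g) g &
  (ALL p. ALL x:cel M p. pls M p (f p x) (g p x) = x))"

lemma complD:
 assumes "compl M f g"
 shows "mor M M f" "mor M M g" "hq M M (f oo f) f" "hq M M (g oo g) g"
  "x : cel M p ==> pls M p (f p x) (g p x) = x" "DG M"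
 using assms morD(1)[of M M f] by (auto simp: compl_def)

lemma compl_sym: "compl M f g ==> compl M g f"
 unfolding compl_def using DG_ac(1) morD(1,5) by metis

lemma mor_ngt: assumes f: "mor M N f" and x: "x : cel M p" shows "f p (ngt M p x) = ngt N p (f p x)"
proof (rule DG_neg_unique(1)[OF morD(2)[OF f] morD(5)[OF f x]])
 have n: "ngt M p x : cel M p" using morD(1)[OF f] x by simp
 show "f p (ngt M p x) : cel N p" by (rule morD(5)[OF f n])
 show "pls N p (f p x) (f p (ngt M p x)) = zr N p"
  unfolding morD(6)[OF f x n, symmetric] using morD(1)[OF f] x morD(8)[OF f] by simp
qed

text \<open>(1 - f)(1 - f) = (1 - f) + (f f - f), and the last bracket is null homotopic. The sum of
  the two idempotents is the identity strictly, not only up to homotopy, which keeps the later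
  arguments on elements simple.\<close>

lemma compl_of_idem:
 assumes f: "mor M M f" and ff: "hq M M (f oo f) f"
 shows "compl M f (hadd M hid (hneg M f))"
proof -
 have M: "DG M" using morD(1)[OF f] .
 let ?g = "hadd M hid (hneg M f)"
 have g: "mor M M ?g" by (rule mor_add[OF mor_id[OF M] mor_neg[OF f]])
 note fc = morD(5)[OF f]
 note fn = mor_ngt[OF f]
 have fg: "f p (?g p x) = pls M p (f p x) (ngt M p (f p (f p x)))" if x: "x : cel M p" for p x
  using morD(6)[OF f, of x p "ngt M p (f p x)"] fn[of "f p x" p] x M fc by simp
 have h: "hq M M (hadd M ?g (hadd M (f oo f) (hneg M f))) (hadd M ?g (hadd M f (hneg M f)))"
  by (intro hq_add hq_refl g ff mor_neg f)
 have ff': "mor M M (f oo f)" by (rule mor_comp[OF f f])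
 have 1: "hq M M (?g oo ?g) (hadd M ?g (hadd M (f oo f) (hneg M f)))"
 proof (rule hq_ext[OF mor_comp[OF g g] mor_add[OF g mor_add[OF ff' mor_neg[OF f]]]])
  fix p x assume x: "x : cel M p"
  have c: "f p x : cel M p" "f p (f p x) : cel M p" using fc x by simp_all
  have "(?g oo ?g) p x = pls M p (?g p x) (ngt M p (pls M p (f p x) (ngt M p (f p (f p x)))))"
   using fg[OF x] by simp
  also have "ngt M p (pls M p (f p x) (ngt M p (f p (f p x)))) = pls M p (f p (f p x)) (ngt M p (f p x))"
  proof (rule DG_neg_unique(1)[OF M, symmetric])
   show "pls M p (pls M p (f p x) (ngt M p (f p (f p x)))) (pls M p (f p (f p x)) (ngt M p (f p x))) = zr M p"
    using c M by (simp add: DG_ac(2))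
  qed (use c M in simp_all)
  finally show "(?g oo ?g) p x = hadd M ?g (hadd M (f oo f) (hneg M f)) p x" by simp
 qed
 have 2: "hq M M (hadd M ?g (hadd M f (hneg M f))) ?g"
  by (rule hq_ext[OF mor_add[OF g mor_add[OF f mor_neg[OF f]]] g]) (use M fc in simp)
 have "pls M p (f p x) (?g p x) = x" if "x : cel M p" for p x
  using that M fc by simp
 thus ?thesis unfolding compl_def using f g ff hq_trans[OF 1 hq_trans[OF h 2]] by blast
qed

text \<open>The index is the degree of the primitive, so x itself lies in degree p+1.\<close>

definition cb :: "('k, 'a, 'm) dgm => int => 'm => bool" where
 "cb M p x = (EX c:cel M p. x = cdiff M p c)"

lemma cb_mor: "mor M N f ==> cb M p x ==> cb N p (f (p+1) x)"
 unfolding cb_def using morD(5,7)[of M N f] by fastforce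

lemma cb_add: assumes "DG M" "cb M p x" "cb M p y" shows "cb M p (pls M (p+1) x y)"
proof -
 obtain a b where "a : cel M p" "b : cel M p" "x = cdiff M p a" "y = cdiff M p b" using assms(2,3) by (auto simp: cb_def)
 thus ?thesis unfolding cb_def using assms(1) by (intro bexI[of _ "pls M p a b"]) (simp_all add: DG_d_add)
qed

lemma cb_neg: assumes "DG M" "cb M p x" shows "cb M p (ngt M (p+1) x)"
proof -
 obtain a where "a : cel M p" "x = cdiff M p a" using assms(2) by (auto simp: cb_def)
 thus ?thesis unfolding cb_def using assms(1) by (intro bexI[of _ "ngt M p a"]) (simp_all add: DG_d_neg)
qed

abbreviation mi where "mi M p x y \<equiv> pls M p x (ngt M p y)"

lemma hq_cb:
 assumes h: "hq M N f g" and x: "x : cel M (p+1)" "cdiff M (p+1) x = zr M (p+2)"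
 shows "cb N p (mi N (p+1) (f (p+1) x) (g (p+1) x))"
proof -
 obtain h where h': "gh (-1) M N h" and e: "!!p x. x : cel M p ==>
   f p x = bnd M N g h p x"
  using h by (rule hqE) blast
 note M = hqD(3)[OF h] and N = hqD(4)[OF h]
 have hx: "h (p+1) x : cel N p" using ghD(1)[OF h' x(1), of p] by simp
 have gx: "g (p+1) x : cel N (p+1)" using morD(5)[OF hqD(2)[OF h] x(1)] .
 have "h (p+1+1) (cdiff M (p+1) x) = zr N (p+1)"
  using x(2) ghD(5)[OF h' M N, of "p+2"] by (simp add: add.assoc) (simp add: add.commute)
 hence "f (p+1) x = pls N (p+1) (g (p+1) x) (cdiff N p (h (p+1) x))" using e[OF x(1)] N hx by simp
 hence "mi N (p+1) (f (p+1) x) (g (p+1) x) = cdiff N p (h (p+1) x)" using N gx hx by (simp add: DG_ac(2))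
 thus ?thesis unfolding cb_def using hx by blast
qed

context
 fixes M f g assumes c: "compl M f g"
begin

text \<open>Induction on i: apply f to the previous coboundary and add the coboundary f f x - f x
  given by idempotency up to homotopy.\<close>

lemma it_cb:
 assumes x: "x : cel M (p+1)" "cdiff M (p+1) x = zr M (p+2)"
 shows "cb M p (mi M (p+1) ((f (p+1) ^^ Suc i) x) (f (p+1) x))"
proof (induction i)
 note f = complD(1)[OF c] and M = complD(6)[OF c]
 have fx: "f (p+1) x : cel M (p+1)" using morD(5)[OF f x(1)] .
 case 0
 have "zr M (p+1) = cdiff M p (zr M p)" using M by simp
 thus ?case unfolding cb_def using M fx DG_group_simps(1)[OF M, of p] by (intro bexI[of _ "zr M p"]) simp_all
next
 note f = complD(1)[OF c] and M = complD(6)[OF c]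
 have fx: "f (p+1) x : cel M (p+1)" using morD(5)[OF f x(1)] .
 case (Suc i)
 let ?y = "(f (p+1) ^^ Suc i) x"
 have y: "?y : cel M (p+1)" by (rule it_closed[OF f x(1)])
 have ffx: "f (p+1) (f (p+1) x) : cel M (p+1)" "f (p+1) ?y : cel M (p+1)" using morD(5)[OF f] fx y by simp_all
 note fn = mor_ngt[OF f]
 have 1: "cb M p (mi M (p+1) (f (p+1) ?y) (f (p+1) (f (p+1) x)))"
  using cb_mor[OF f Suc.IH] morD(6)[OF f y, of "ngt M (p+1) (f (p+1) x)"] M fx fn[OF fx] by simp
 have 2: "cb M p (mi M (p+1) (f (p+1) (f (p+1) x)) (f (p+1) x))"
  using hq_cb[OF complD(3)[OF c] x] by simp
 have "pls M (p+1) (mi M (p+1) (f (p+1) ?y) (f (p+1) (f (p+1) x))) (mi M (p+1) (f (p+1) (f (p+1) x)) (f (p+1) x))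
  = mi M (p+1) (f (p+1) ?y) (f (p+1) x)" using M ffx fx by (simp add: DG_ac(2))
 thus ?case using cb_add[OF M 1 2] by simp
qed

lemma cb_of_it:
 assumes x: "x : cel M (p+1)" "cdiff M (p+1) x = zr M (p+2)" and z: "cb M p ((f (p+1) ^^ i) x)"
 shows "cb M p (f (p+1) x)"
proof -
 note f = complD(1)[OF c] and M = complD(6)[OF c]
 let ?y = "(f (p+1) ^^ Suc i) x" and ?w = "mi M (p+1) ((f (p+1) ^^ Suc i) x) (f (p+1) x)"
 have k: "?y : cel M (p+1)" "f (p+1) x : cel M (p+1)" using it_closed[OF f x(1)] morD(5)[OF f x(1)] by blast+
 have "cb M p ?y" using cb_mor[OF f z] by simp
 from cb_add[OF M this cb_neg[OF M it_cb[OF x, of i]]]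
 have "cb M p (pls M (p+1) ?y (ngt M (p+1) ?w))" .
 moreover have "ngt M (p+1) ?w = pls M (p+1) (f (p+1) x) (ngt M (p+1) ?y)"
  by (rule DG_neg_unique(1)[OF M, symmetric]) (use M k in "simp_all add: DG_ac(2) del: funpow.simps")
 ultimately show ?thesis using M k DG_ac(3)[OF M k] by (simp del: funpow.simps)
qed

text \<open>A class that dies in the colimit is killed by some iterate of f, and on cohomology all
  positive iterates agree with f.\<close>

lemma jn_inj:
 assumes x: "x : cel M (p+1)" "cdiff M (p+1) x = zr M (p+2)" and z: "cb (CL M f) p (jn M f (p+1) x)"
 shows "cb M p (f (p+1) x)"
proof -
 note f = complD(1)[OF c] and M = complD(6)[OF c]
 obtain n a where a: "a : cel M p" "ce M f (p+1) 0 x = ce M f (p+1) n (cdiff M p a)"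
  using z CL_d[OF f] unfolding cb_def CL_carrier by auto
 have da: "cdiff M p a : cel M (p+1)" using M a by simp
 obtain K where K: "(f (p+1) ^^ (K - 0)) x = (f (p+1) ^^ (K - n)) (cdiff M p a)"
  using a(2) unfolding ce_eq_iff[OF x(1) da] sm_def by blast
 have "cb M p ((f (p+1) ^^ (K - 0)) x)" unfolding K
  by (rule cb_mor[OF it_mor[OF f]]) (use a in "auto simp: cb_def")
 thus ?thesis by (rule cb_of_it[OF x])
qed

text \<open>A representative a has d a equal to zero only in the colimit; a sufficiently late image
  of a is an honest cocycle.\<close>

lemma CL_cocycle:
 assumes u: "u : cel (CL M f) p" "cdiff (CL M f) p u = zr (CL M f) (p+1)"
 obtains n a where "a : cel M p" "cdiff M p a = zr M (p+1)" "u = ce M f p n a"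
proof -
 note f = complD(1)[OF c] and M = complD(6)[OF c]
 obtain n a where a: "a : cel M p" "u = ce M f p n a" using u(1) by auto
 have da: "cdiff M p a : cel M (p+1)" using M a by simp
 have "ce M f (p+1) n (cdiff M p a) = ce M f (p+1) n (zr M (p+1))"
  using u(2) unfolding a(2) CL_d[OF f a(1)] ce_zr[OF f, symmetric, of "p+1" n] .
 then obtain i where i: "(f (p+1) ^^ i) (cdiff M p a) = (f (p+1) ^^ i) (zr M (p+1))"
  unfolding ce_eq_iff2[OF f da DG_group_simps(1)[OF M]] by blast
 have "cdiff M p ((f p ^^ i) a) = zr M (p+1)"
  using i morD(7)[OF it_mor[OF f, of i] a(1) refl] morD(8)[OF it_mor[OF f, of i], of "p+1"] by simp
 moreover have "u = ce M f p (n + i) ((f p ^^ i) a)" using a(2) ce_shift[OF f a(1)] by simp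
 ultimately show ?thesis using that it_closed[OF f a(1)] by blast
qed

text \<open>On the cohomology of the colimit f acts as the identity and g as zero, so
  \<open>jn\<close> of f a + g b represents a at any stage n. The cocycle b is left free so that one
  element of M can serve the colimit of f and that of g at the same time.\<close>

lemma jn_surj:
 assumes a: "a : cel M (p+1)" "cdiff M (p+1) a = zr M (p+2)"
  and b: "b : cel M (p+1)" "cdiff M (p+1) b = zr M (p+2)"
 shows "EX v:cel (CL M f) p. ce M f (p+1) n a =
  pls (CL M f) (p+1) (jn M f (p+1) (pls M (p+1) (f (p+1) a) (g (p+1) b))) (cdiff (CL M f) p v)"
proof -
 note f = complD(1)[OF c] and g = complD(2)[OF c] and M = complD(6)[OF c]
 let ?F = "f (p+1)" and ?p = "p+1"
 let ?z = "pls M ?p (?F a) (g ?p b)"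
 have k: "?F a : cel M ?p" "g ?p b : cel M ?p" "?F b : cel M ?p" using morD(5)[OF f a(1)] morD(5)[OF g b(1)] morD(5)[OF f b(1)] .
 have z: "?z : cel M ?p" using M k by simp
 have cg: "cdiff M ?p (g ?p b) = zr M (p+2)" "cdiff M ?p (?F a) = zr M (p+2)"
  using morD(7)[OF g b(1), of "p+2"] morD(7)[OF f a(1), of "p+2"] morD(8)[OF g, of "p+2"] morD(8)[OF f, of "p+2"] a(2) b(2)
  by simp_all
 have 1: "cb M p (mi M ?p ((?F ^^ Suc n) (?F a)) (?F (?F a)))" by (rule it_cb[OF k(1) cg(2)])
 have 2: "cb M p (mi M ?p (?F (?F a)) (?F a))" using hq_cb[OF complD(3)[OF c] a] by simp
 \<comment> \<open>From f b + g b = b one gets f g b = f b - f f b, a coboundary.\<close>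
 have 3: "cb M p (?F (g ?p b))"
 proof -
  have "cb M p (mi M ?p (?F (?F b)) (?F b))" using hq_cb[OF complD(3)[OF c] b] by simp
  hence "cb M p (ngt M ?p (mi M ?p (?F (?F b)) (?F b)))" by (rule cb_neg[OF M])
  moreover have "?F (g ?p b) = ngt M ?p (mi M ?p (?F (?F b)) (?F b))"
  proof (rule DG_neg_unique(1)[OF M])
   have fk: "?F (?F b) : cel M ?p" "?F (g ?p b) : cel M ?p" using morD(5)[OF f] k by blast+
   have "pls M ?p (?F (?F b)) (?F (g ?p b)) = ?F b"
    using morD(6)[OF f k(3,2)] complD(5)[OF c b(1)] by simp
   thus "pls M ?p (mi M ?p (?F (?F b)) (?F b)) (?F (g ?p b)) = zr M ?p"
    using M fk k DG_ac(3)[OF M fk(1), of "ngt M ?p (?F b)" "?F (g ?p b)"] DG_ac(1)[OF M k(3), of "ngt M ?p (?F b)"]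
     DG_ac(2)[OF M fk(1), of "ngt M ?p (?F b)" "?F (g ?p b)"] by simp
   show "mi M ?p (?F (?F b)) (?F b) : cel M ?p" "?F (g ?p b) : cel M ?p" using M fk k by simp_all
  qed
  ultimately show ?thesis by simp
 qed
 have 4: "cb M p ((?F ^^ Suc n) (g ?p b))"
  using cb_mor[OF it_mor[OF f, of n] 3] by (simp add: funpow_swap1)
 let ?A = "(?F ^^ Suc n) (?F a)" and ?B = "(?F ^^ Suc n) (g ?p b)"
 have kk: "?A : cel M ?p" "?B : cel M ?p" "?F (?F a) : cel M ?p"
  using it_closed[OF f k(1)] it_closed[OF f k(2)] morD(5)[OF f k(1)] by blast+
 have "cb M p (pls M ?p (pls M ?p (mi M ?p ?A (?F (?F a))) (mi M ?p (?F (?F a)) (?F a))) ?B)"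
  by (rule cb_add[OF M cb_add[OF M 1 2] 4])
 moreover have "pls M ?p (pls M ?p (mi M ?p ?A (?F (?F a))) (mi M ?p (?F (?F a)) (?F a))) ?B = mi M ?p (pls M ?p ?A ?B) (?F a)"
  using M kk k DG_ac(1)[OF M kk(2), of "ngt M ?p (?F a)"] by (simp add: DG_ac(2) del: funpow.simps)
 moreover have "pls M ?p ?A ?B = (?F ^^ Suc n) ?z" using morD(6)[OF it_mor[OF f] k(1,2), of "Suc n"] by simp
 ultimately have "cb M p (mi M ?p ((?F ^^ Suc n) ?z) (?F a))" by simp
 from cb_neg[OF M this] obtain d where d: "d : cel M p" "ngt M ?p (mi M ?p ((?F ^^ Suc n) ?z) (?F a)) = cdiff M p d"
  unfolding cb_def by blast
 have iz: "(?F ^^ Suc n) ?z : cel M ?p" by (rule it_closed[OF f z])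
 have "ngt M ?p (mi M ?p ((?F ^^ Suc n) ?z) (?F a)) = pls M ?p (?F a) (ngt M ?p ((?F ^^ Suc n) ?z))"
  by (rule DG_neg_unique(1)[OF M, symmetric]) (use M iz k in "simp_all add: DG_ac(2) del: funpow.simps")
 hence "?F a = pls M ?p ((?F ^^ Suc n) ?z) (cdiff M p d)"
  using d(2)[symmetric] M iz k by (simp del: funpow.simps)
 \<comment> \<open>The comparison takes place at stage Suc n, where f a is the image of a from stage
   n and the iterate of z is the image of z from stage 0.\<close>
 hence "ce M f ?p (Suc n) (?F a) = pls (CL M f) ?p (ce M f ?p (Suc n) ((?F ^^ Suc n) ?z)) (cdiff (CL M f) p (ce M f p (Suc n) d))"
  using CL_pls[OF f iz, of "cdiff M p d" "Suc n"] CL_d[OF f d(1)] d(1) M by (simp del: funpow.simps)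
 moreover have "ce M f ?p (Suc n) (?F a) = ce M f ?p n a" using ce_shift[OF f a(1), of n 1] by simp
 moreover have "ce M f ?p (Suc n) ((?F ^^ Suc n) ?z) = ce M f ?p 0 ?z" using ce_shift[OF f z, of 0 "Suc n"] by (simp del: funpow.simps)
 ultimately show ?thesis using d(1) by (intro bexI[of _ "ce M f p (Suc n) d"]) auto
qed

end

text \<open>f = 1 - g, and the canonical map to the colimit of g absorbs g by
  \<open>jn_absorb\<close>.\<close>

lemma jn_kill:
 assumes c: "compl M f g" shows "hq M (CL M g) (jn M g oo f) (hzero (CL M g))"
proof -
 note f = complD(1)[OF c] and g = complD(2)[OF c] and M = complD(6)[OF c]
 note j = mor_jn[OF g]
 let ?N = "CL M g"
 have N: "DG ?N" by (rule DG_CL[OF g])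
 have jg: "mor M ?N (jn M g oo g)" by (rule mor_comp[OF g j])
 have 1: "hq M ?N (jn M g oo f) (hadd ?N (jn M g) (hneg ?N (jn M g oo g)))"
 proof (rule hq_ext[OF mor_comp[OF f j] mor_add[OF j mor_neg[OF jg]]])
  fix p x assume x: "x : cel M p"
  have k: "f p x : cel M p" "g p x : cel M p" using morD(5)[OF f x] morD(5)[OF g x] .
  note kj = morD(5)[OF j k(1)] morD(5)[OF j k(2)]
  have "jn M g p x = pls ?N p (jn M g p (f p x)) (jn M g p (g p x))"
   using morD(6)[OF j k] complD(5)[OF c x] by simp
  thus "(jn M g oo f) p x = hadd ?N (jn M g) (hneg ?N (jn M g oo g)) p x"
   using N kj by (simp add: DG_ac(2) del: CL_carrier)
 qed
 have h: "hq M ?N (jn M g oo g) (jn M g)" by (rule jn_absorb[OF g complD(4)[OF c]])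
 have 2: "hq M ?N (hadd ?N (jn M g) (hneg ?N (jn M g oo g))) (hadd ?N (jn M g) (hneg ?N (jn M g)))"
  by (rule hq_add[OF hq_refl[OF j] hq_neg[OF h]])
 have 3: "hq M ?N (hadd ?N (jn M g) (hneg ?N (jn M g))) (hzero ?N)"
  by (rule hq_ext[OF mor_add[OF j mor_neg[OF j]] mor_zero[OF M N]]) (use N morD(5)[OF j] in "simp del: CL_carrier")
 show ?thesis by (rule hq_trans[OF 1 hq_trans[OF 2 3]])
qed

text \<open>M maps by (jn, jn') to the direct sum of the colimits of f and of 1 - f. Once this is a
  quasi-isomorphism s, the colimit of f is a summand of M with projection jn and inclusion s^-1
  i1.\<close>

lemma split_idem:
 assumes f: "mor M M f" and ff: "hq M M (f oo f) f"
 obtains L jo pi where "D.ar jo L M" "D.ar pi M L" "Cmp Der pi jo = Idn Der L" "Cmp Der jo pi = q M M f"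
proof -
 let ?g = "hadd M hid (hneg M f)"
 have c: "compl M f ?g" by (rule compl_of_idem[OF f ff])
 note g = complD(2)[OF c] and M = complD(6)[OF c]
 let ?L = "CL M f" and ?L' = "CL M ?g"
 let ?j = "jn M f" and ?j' = "jn M ?g"
 have L: "DG ?L" "DG ?L'" using DG_CL f g by blast+
 note j = mor_jn[OF f] and j' = mor_jn[OF g]
 let ?P = "tw ?L' ?L (%p x. zr ?L (p+1))"
 note T = tws_zero[OF L(2,1)]
 note P = DG_tw[OF T]
 let ?i1 = "%p y. pr (y, zr ?L' p)" and ?i2 = "%p x. pr (zr ?L p, x)" and ?s = "%p x. pr (?j p x, ?j' p x)"
 have i1: "mor ?L ?P ?i1" by (rule mor_tw_in[OF T])
 have i2: "mor ?L' ?P ?i2"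
  by (rule morI) (use L P in "auto simp: DG_act_zero simp del: CL_carrier")
 have p1: "mor ?P ?L (%p u. fst (un u))"
  by (rule morI) (use L P in "auto simp del: CL_carrier")
 have s: "mor M ?P ?s"
  by (rule morI) (use L P M morD(5)[OF j] morD(5)[OF j'] morD(6)[OF j] morD(6)[OF j'] morD(7)[OF j] morD(7)[OF j']
    ghD(3)[OF morD(4)[OF j]] ghD(3)[OF morD(4)[OF j']] in "simp_all del: CL_carrier")
 have dP: "cdiff ?P p (pr (u, v)) = pr (cdiff ?L p u, cdiff ?L' p v)" if "u : cel ?L p" "v : cel ?L' p" for p u v
  using that L by (simp del: CL_carrier)
 have qs: "qs M ?P ?s"
 proof (rule qsI[OF s])
  fix p x b assume x: "x : cel M (p+1)" "cdiff M (p+1) x = zr M (p+2)" and "b : cel ?P p" and e: "?s (p+1) x = cdiff ?P p b"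
  then obtain u v where uv: "u : cel ?L p" "v : cel ?L' p" "b = pr (u, v)" by (auto simp del: CL_carrier)
  have e': "?j (p+1) x = cdiff ?L p u" "?j' (p+1) x = cdiff ?L' p v" using e unfolding uv(3) dP[OF uv(1,2)] by simp_all
  have 1: "cb M p (f (p+1) x)" by (rule jn_inj[OF c x]) (unfold cb_def, intro bexI, rule e'(1), rule uv(1))
  have 2: "cb M p (?g (p+1) x)" by (rule jn_inj[OF compl_sym[OF c] x]) (unfold cb_def, intro bexI, rule e'(2), rule uv(2))
  show "EX c:cel M p. x = cdiff M p c"
   using cb_add[OF M 1 2] unfolding complD(5)[OF c x(1)] cb_def .
 next
  fix p y assume "y : cel ?P (p+1)" and e: "cdiff ?P (p+1) y = zr ?P (p+2)"
  then obtain u v where uv: "u : cel ?L (p+1)" "v : cel ?L' (p+1)" "y = pr (u, v)" by (auto simp del: CL_carrier)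
  have i: "p+1+1 = p+2" by simp
  have e': "cdiff ?L (p+1) u = zr ?L (p+1+1)" "cdiff ?L' (p+1) v = zr ?L' (p+1+1)"
   using e unfolding uv(3) dP[OF uv(1,2)] i by simp_all
  obtain n a where a: "a : cel M (p+1)" "cdiff M (p+1) a = zr M (p+1+1)" "u = ce M f (p+1) n a"
   by (rule CL_cocycle[OF c uv(1) e'(1)])
  obtain m b where b: "b : cel M (p+1)" "cdiff M (p+1) b = zr M (p+1+1)" "v = ce M ?g (p+1) m b"
   by (rule CL_cocycle[OF compl_sym[OF c] uv(2) e'(2)])
  note a2 = a(2)[unfolded i] and b2 = b(2)[unfolded i]
  let ?x = "pls M (p+1) (f (p+1) a) (?g (p+1) b)"
  \<comment> \<open>The one element f a + g b has to hit both components; \<open>jn_surj\<close> is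
    applied to it twice with the two idempotents exchanged.\<close>
  have k: "f (p+1) a : cel M (p+1)" "?g (p+1) b : cel M (p+1)" using morD(5)[OF f a(1)] morD(5)[OF g b(1)] .
  have x: "?x : cel M (p+1)" using M k by simp
  have "cdiff M (p+1) (f (p+1) a) = zr M (p+2)" "cdiff M (p+1) (?g (p+1) b) = zr M (p+2)"
   using morD(7)[OF g b(1), of "p+2"] morD(7)[OF f a(1), of "p+2"] morD(8)[OF g, of "p+2"] morD(8)[OF f, of "p+2"] a2 b2
   by simp_all
  hence dx: "cdiff M (p+1) ?x = zr M (p+2)" using DG_d_add[OF M k] M by (simp add: i)
  obtain w where w: "w : cel ?L p" "u = pls ?L (p+1) (?j (p+1) ?x) (cdiff ?L p w)"
   using jn_surj[OF c a(1) a2 b(1) b2, of n] unfolding a(3)[symmetric] by blast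
  have sw: "pls M (p+1) (?g (p+1) b) (f (p+1) a) = ?x" by (rule DG_ac(1)[OF M k(2,1)])
  obtain w' where w': "w' : cel ?L' p" "v = pls ?L' (p+1) (?j' (p+1) ?x) (cdiff ?L' p w')"
   using jn_surj[OF compl_sym[OF c] b(1) b2 a(1) a2, of m] unfolding b(3)[symmetric] sw by blast
  have "y = pls ?P (p+1) (?s (p+1) ?x) (cdiff ?P p (pr (w, w')))"
   unfolding uv(3) dP[OF w(1) w'(1)] using w(2) w'(2) by simp
  moreover have "pr (w, w') : cel ?P p" using w(1) w'(1) by (simp del: CL_carrier)
  ultimately show "hits M ?P ?s p y"
   using x dx by blast
 qed
 note qi = D.iv_simps[OF q_iso'(1)[OF qs]]
 let ?v = "D.iv (q M ?P ?s)"
 note qa = q_arr[OF s] q_arr[OF i1] q_arr[OF j] q_arr[OF p1] q_arr[OF f]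
 let ?jo = "Cmp Der ?v (q ?L ?P ?i1)" and ?pi = "q M ?L ?j"
 have v: "D.arr ?v" "D.dm ?v = ?P" "D.cd ?v = M" using qi qa by simp_all
 have "Cmp Der (q ?P ?L (%p u. fst (un u))) (q M ?P ?s) = ?pi"
  unfolding q_cmp[OF s p1] by (simp add: gcomp_def comp_def)
 hence "Cmp Der ?pi ?jo = Cmp Der (Cmp Der (q ?P ?L (%p u. fst (un u))) (q M ?P ?s)) ?jo" by simp
 also have "... = Cmp Der (q ?P ?L (%p u. fst (un u))) (Cmp Der (Cmp Der (q M ?P ?s) ?v) (q ?L ?P ?i1))"
  using v qa by simp
 also have "... = Cmp Der (q ?P ?L (%p u. fst (un u))) (q ?L ?P ?i1)"
  unfolding qi(5) using qa by simp
 also have "... = Idn Der ?L" unfolding q_cmp[OF i1 p1] by (simp add: gcomp_def comp_def Der_idn)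
 finally have pi: "Cmp Der ?pi ?jo = Idn Der ?L" .
 \<comment> \<open>Componentwise this says that jn absorbs f and that jn' f is null homotopic; it
   identifies jo pi with f after the invertible s.\<close>
 have h: "hq M ?P (?i1 oo ?j) (?s oo f)"
 proof (rule hq_sym)
  note 1 = hq_comp_left[OF jn_absorb[OF f ff] i1] and 2 = hq_comp_left[OF jn_kill[OF c] i2]
  have e: "hq M ?P (?s oo f) (hadd ?P (?i1 oo (?j oo f)) (?i2 oo (?j' oo f)))"
   by (rule hq_ext[OF mor_comp[OF f s] mor_add[OF hqD(1)[OF 1] hqD(1)[OF 2]]])
    (use L morD(5)[OF f] morD(5)[OF j] morD(5)[OF j'] in "simp del: CL_carrier")
  have e': "hq M ?P (hadd ?P (?i1 oo ?j) (?i2 oo hzero ?L')) (?i1 oo ?j)"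
   by (rule hq_ext[OF mor_add[OF hqD(2)[OF 1] hqD(2)[OF 2]] hqD(2)[OF 1]])
    (use L morD(5)[OF j] in "simp del: CL_carrier")
  show "hq M ?P (?s oo f) (?i1 oo ?j)" by (rule hq_trans[OF e hq_trans[OF hq_add[OF 1 2] e']])
 qed
 have "Cmp Der (q M ?P ?s) (Cmp Der ?jo ?pi) = Cmp Der (Cmp Der (q M ?P ?s) ?v) (Cmp Der (q ?L ?P ?i1) ?pi)"
  using v qa by simp
 also have "... = Cmp Der (q ?L ?P ?i1) ?pi" unfolding qi(5) using qa by simp
 also have "... = q M ?P (?s oo f)" unfolding q_cmp[OF j i1] by (rule q_eq[OF h])
 also have "... = Cmp Der (q M ?P ?s) (q M M f)" by (rule q_cmp[OF f s, symmetric])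
 finally have "Cmp Der ?jo ?pi = q M M f"
  by (rule D.iso_mono[OF q_iso'(1)[OF qs], rotated -1]) (use v qa in "simp_all")
 moreover have "D.ar ?jo ?L M" "D.ar ?pi M ?L" unfolding D.ar_iff using v qa by simp_all
 ultimately show ?thesis using that pi by blast
qed

end

section \<open>The derived category as an instance of the abstract theory\<close>

context dgi begin

abbreviation TT :: "(('k, 'a, 'm) dgm, ('k, 'a, 'm) roof set) tricat" where "TT \<equiv> derived k A"

lemma TT_sel: "Obj TT = Obj Der" "Hom TT = Hom Der" "Cmp TT = Cmp Der" "Idn TT = Idn Der" "HAdd TT = HAdd Der"
 "HZero TT = HZero Der" "Shift TT = dg_shift" "Tri TT = der_triangles k A"
 unfolding derived_def precat.extend_def tricat.fields_def by simp_all

sublocale T: pcat TT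
proof
 show "preadditive TT" using D.preadd unfolding preadditive_def category_def TT_sel .
 show "X = X' & Y = Y'" if "f : Hom TT X Y" "f : Hom TT X' Y'" "X : Obj TT" "Y : Obj TT" "X' : Obj TT" "Y' : Obj TT" for f X Y X' Y'
  using that unfolding TT_sel by (rule D.hom_disj)
qed

text \<open>\<open>derived\<close> and \<open>der_cat\<close> are records of different types, so
  their interpretations of \<open>pcat\<close> introduce separate constants. Identifying these lets
  the facts proved for D serve as the axioms of \<open>tricat0\<close>.\<close>

lemma T_ar: "T.ar = D.ar"
 by ((rule HOL.ext)+, simp only: T.ar_def D.ar_def TT_sel)

lemma T_arr: "T.arr = D.arr" "T.dm = D.dm" "T.cd = D.cd"
 by ((rule HOL.ext)+; simp only: T.arr_def D.arr_def T.dm_def D.dm_def T.cd_def D.cd_def T_ar)+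

lemma T_iso: "T.iso = D.iso"
 by ((rule HOL.ext)+, simp only: T.iso_def D.iso_def T_arr TT_sel)

lemma T_isom: "T.isom = D.isom" "T.null = D.null" "T.ng = D.ng"
 by ((rule HOL.ext)+; simp only: T.isom_def D.isom_def T.null_def D.null_def T.ng_def D.ng_def T_arr T_iso TT_sel)+

lemma T_biprod: "is_biproduct TT = is_biproduct Der"
 by ((rule HOL.ext)+, simp only: is_biproduct_def TT_sel)

lemma T_psum: "T.psum X Y f n = D.psum X Y f n"
 by (induction n) (simp_all only: T.psum.simps D.psum.simps TT_sel)

lemmas T_eqs = T_ar T_arr T_iso T_isom T_biprod TT_sel

lemma tricat_TT: "tricat0 TT sus"
proof (intro tricat0.intro tcat.intro T.pcat_axioms tricat0_axioms.intro; unfold T_eqs)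
 show "EX X. X : Obj Der" by (rule exI[of _ R]) simp
 show "X : Obj Der ==> Y : Obj Der ==> EX P. is_biproduct Der X Y P" for X Y using Der_biprod by auto
 show "X : Obj Der ==> dg_shift n X : Obj Der" for X n by simp
 show "D.arr f ==> D.arr (sus f)" "D.arr f ==> D.dm (sus f) = dg_shift 1 (D.dm f)"
  "D.arr f ==> D.cd (sus f) = dg_shift 1 (D.cd f)" for f by simp_all
 show "X : Obj Der ==> sus (Idn Der X) = Idn Der (dg_shift 1 X)" for X by (rule sus_idn) simp
 show "D.arr f ==> D.arr g ==> D.dm g = D.cd f ==> sus (Cmp Der g f) = Cmp Der (sus g) (sus f)" for f g
  by (rule sus_cmp)
 show "D.arr f ==> D.arr g ==> D.dm f = D.dm g ==> D.cd f = D.cd g ==> sus (HAdd Der f g) = HAdd Der (sus f) (sus g)" for f g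
  by (rule sus_add)
 show "D.arr f ==> D.arr g ==> D.dm f = D.dm g ==> D.cd f = D.cd g ==> sus f = sus g ==> f = g" for f g
  by (rule sus_inj)
 show "EX g. D.arr g & D.dm g = X & D.cd g = Y & sus g = f"
  if "D.arr f" "D.dm f = dg_shift 1 X" "D.cd f = dg_shift 1 Y" "X : Obj Der" "Y : Obj Der" for f X Y
  using sus_surj[OF that(1-3)] that(4,5) by auto
 show "X : Obj Der ==> D.isom (dg_shift n (dg_shift m X)) (dg_shift (n + m) X)" for X n m
  by (rule shift_shift_isom) simp
 show "X : Obj Der ==> D.isom (dg_shift 0 X) X" for X by (rule shift_0_isom) simp
 show "D.arr u & D.arr v & D.arr w & D.dm u = X & D.cd u = Y & D.dm v = Y & D.cd v = Z & D.dm w = Z &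
   D.cd w = dg_shift 1 X" if "tri X Y Z u v w" for X Y Z :: "('k, 'a, 'm) dgm" and u v w
  by (intro conjI tri_wf[OF that])
 show "tri X' Y' Z' u' v' w'"
  if "tri X Y Z u v w" "D.iso al" "D.iso be" "D.iso gm" "D.dm al = X" "D.dm be = Y" "D.dm gm = Z"
   "D.cd al = X'" "D.cd be = Y'" "D.cd gm = Z'" "D.arr u'" "D.arr v'" "D.arr w'" "D.dm u' = X'" "D.cd u' = Y'"
   "D.dm v' = Y'" "D.cd v' = Z'" "D.dm w' = Z'" "D.cd w' = dg_shift 1 X'"
   "Cmp Der u' al = Cmp Der be u" "Cmp Der v' be = Cmp Der gm v" "Cmp Der w' gm = Cmp Der (sus al) w"
  for X Y Z :: "('k, 'a, 'm) dgm" and u v w al be gm X' Y' Z' u' v' w'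
  using tri_iso[OF that(1-7), of u' v' w'] that(8-22) by simp
 show "EX Z v w. tri (D.dm u) (D.cd u) Z u v w" if "D.arr u" for u :: "('k, 'a, 'm) roof set" by (rule tri_complete[OF that])
 show "EX Z v w. D.null Z & tri X X Z (Idn Der X) v w" if "X : Obj Der" for X :: "('k, 'a, 'm) dgm" by (rule tri_id) (use that in simp)
 show "tri Y Z (dg_shift 1 X) v w (D.ng (sus u))" if "tri X Y Z u v w" for X Y Z :: "('k, 'a, 'm) dgm" and u v w by (rule tri_rot[OF that])
 show "EX gm. D.arr gm & D.dm gm = Z & D.cd gm = Z' & Cmp Der gm v = Cmp Der v' be & Cmp Der w' gm = Cmp Der (sus al) w"
  if "tri X Y Z u v w" "tri X' Y' Z' u' v' w'" "D.arr al" "D.dm al = X" "D.cd al = X'" "D.arr be" "D.dm be = Y" "D.cd be = Y'"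
   "Cmp Der be u = Cmp Der u' al" for X Y Z :: "('k, 'a, 'm) dgm" and u v w X' Y' Z' u' v' w' al be
  by (rule tri_TR3[OF that])
 show "EX C1 C2 C3 i1 p1 i2 p2 i3 p3 f g.
   tri (D.dm al) (D.cd al) C1 al i1 p1 & tri (D.dm al) (D.cd be) C2 (Cmp Der be al) i2 p2 & tri (D.cd al) (D.cd be) C3 be i3 p3 &
   tri C1 C2 C3 f g (Cmp Der (sus i1) p3) & Cmp Der f i1 = Cmp Der i2 be & Cmp Der p2 f = p1 & Cmp Der g i2 = i3 &
   Cmp Der p3 g = Cmp Der (sus al) p2"
  if "D.arr al" "D.arr be" "D.dm be = D.cd al" for al be :: "('k, 'a, 'm) roof set"
  by (rule tri_oct[OF that])
qed

text \<open>The images of the split idempotents of End(R) are the objects s; triviality of the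
  negative cohomology of A is the vanishing of Hom from R to its negative shifts.\<close>

lemma smc_TT:
 assumes neg: "!!p. p < 0 ==> trivial_group (cohomology A p)" and ss: "semisimple_ring (H0_ring A)"
 obtains SS where "smc TT sus SS R"
proof (rule End_idempotents[OF ss])
fix n :: nat and E assume E: "idems {x. D.ar x R R} (Cmp Der) (HZero Der R R) n E" "D.psum R R E n = Idn Der R"
 have "EX L jo pi. D.ar jo L R & D.ar pi R L & Cmp Der pi jo = Idn Der L & Cmp Der jo pi = E i" if i: "i < n" for i
 proof -
  obtain f where f: "mor R R f" "hq R R (f oo f) f" "E i = q R R f"
   using el_idem[of "E i"] E(1) i unfolding idems_def by blast
  show ?thesis unfolding f(3) by (rule split_idem[OF f(1,2)]) blast
 qed
 then obtain L jo pi where s: "!!i. i < n ==> D.ar (jo i) (L i) R & D.ar (pi i) R (L i) &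
   Cmp Der (pi i) (jo i) = Idn Der (L i) & Cmp Der (jo i) (pi i) = E i" by metis
 have "smc TT sus (L ` {..<n}) R"
 proof (rule tricat0.smcI[OF tricat_TT, of R n jo L pi E]; unfold T_eqs T_psum)
  show "R : Obj Der" by simp
  show "tricat0.hz TT R (dg_shift m R)" if "m < 0" for m
   unfolding tricat0.hz_def[OF tricat_TT] T_eqs using hz_shift_R[OF neg[OF that]] by blast
 qed (use s E in blast)+
 thus thesis by (rule that)
qed

lemma main_dgi:
 assumes "!!p. p < 0 ==> trivial_group (cohomology A p)" "semisimple_ring (H0_ring A)"
 shows "bounded_t_structure (per k A e) (left_aisle k A e) (right_aisle k A e) &
  length_category (per_heart k A e) &
  {S. simple_object (per_heart k A e) S} =
   {S. indecomposable (per k A e) S & direct_summand (per k A e) S R}"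
proof -
 obtain SS where s: "smc TT sus SS R" using smc_TT[OF assms] .
 have "smc.per0 TT R = per k A e" unfolding smc.per0_def[OF s] per_def ..
 hence e: "smc.per0 TT R = per k A e" "smc.la TT R = left_aisle k A e" "smc.ra TT R = right_aisle k A e"
  "smc.ht TT R = per_heart k A e"
  by (simp_all only: smc.la_def[OF s] smc.ra_def[OF s] smc.ht_def[OF s] left_aisle_def right_aisle_def per_heart_def)
 show ?thesis using smc.main[OF s] unfolding e .
qed

end

theorem theorem8p1:
  fixes k :: "'k ring" and A :: "('k, 'a) dga" and e :: "'a \<Rightarrow> 'm"
  assumes universe: "infinite (UNIV :: 'm set)" "inj e"
    and "cring k"
    and "dg_algebra k A"
    and "\<And>p. p < 0 \<Longrightarrow> trivial_group (cohomology A p)"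
    and "semisimple_ring (H0_ring A)"
    and "\<And>p. fin_gen_right_module (H0_ring A) (cohomology A p) (H0_act A p)"
  shows "bounded_t_structure (per k A e) (left_aisle k A e) (right_aisle k A e) \<and>
    length_category (per_heart k A e) \<and>
    {S. simple_object (per_heart k A e) S} =
      {S. indecomposable (per k A e) S \<and> direct_summand (per k A e) S (regular_dgm e A)}"
proof -
 \<comment> \<open>An infinite set has the cardinality of its square, which yields the coding of
   pairs; a countable subset yields the coding of stages.\<close>
 have "(card_of ((UNIV :: 'm set) \<times> (UNIV :: 'm set)), card_of (UNIV :: 'm set)) : ordLeq"
  by (rule ordIso_imp_ordLeq[OF card_of_Times_same_infinite[OF universe(1)]])
 then obtain pr :: "'m \<times> 'm => 'm" where pr: "inj pr"
  unfolding card_of_ordLeq[symmetric] UNIV_Times_UNIV by blast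
 obtain en :: "nat => 'm" where en: "inj en"
  using infinite_countable_subset[OF universe(1)] by blast
 interpret dgi k A pr e en
  by (intro dgi.intro dgc.intro dgi_axioms.intro) (fact assms pr en)+
 show ?thesis by (rule main_dgi[OF assms(5,6)])
qed

end
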